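(* Let $B$ be an (acyclic) exchange matrix of finite type $D$, let $\tilde B^{\mathrm{prin}}$ be the principal-coefficient extension of $B$, $X^{\mathrm{prin}}=X(\tilde B^{\mathrm{prin}})$ and $T^{\mathrm{prin}}=T(\tilde B^{\mathrm{prin}})$. Then $\mathcal{M}_D\cong\mathring X^{\mathrm{prin}}/T^{\mathrm{prin}}$ is isomorphic to the locus $\mathring X^{\mathrm{prin}}(1)\subset\mathring X^{\mathrm{prin}}$ where all initial mutable cluster variables have been set to $1$. The coordinate ring $\mathbb{C}[\mathcal{M}_D]$ is isomorphic to the subring of $\mathbb{C}(y_1,\dots,y_n)$ generated by $F_\gamma(\mathbf{y})^{\pm1}$, $\gamma\in\Pi$, and $y_i^{\pm1}$, $i=1,\dots,n$.
   Context: Cluster set-up. $D$ is a connected finite type Dynkin diagram with vertex set $I=\{1,\dots,n\}$ and Cartan matrix $(a_{ij})$. Fix an orientation of the underlying tree of $D$, with edges written $i\to j$; the associated exchange matrix $B$ (of type $D$) has $B_{ij}=-a_{ij}$ if $i\to j$, $B_{ij}=a_{ij}$ if $j\to i$, and $B_{ij}=0$ otherwise. An extended exchange matrix $\tilde B$ is an $(n+m)\times n$ integer matrix with top $n\times n$ block $B$. The cluster algebra $\mathcal{A}(\tilde B)$ is the $\mathbb{C}$-algebra generated by all mutable cluster variables, the frozen variables and the inverses of the frozen variables; the exchange relation at a seed with matrix $(b_{ij})$ is $x_kx_k'=\prod_{b_{ik}>0}x_i^{b_{ik}}+\prod_{b_{ik}<0}x_i^{-b_{ik}}$. Indexing. Put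 $x_{(0,i)}=x_i$ (initial cluster) and, for $t\ge1$, let the cluster $\{x_{(t,i)}\mid i\in I\}$ be obtained from $\{x_{(t-1,i)}\mid i\in I\}$ by mutating exactly once at each $i\in I$, always at a source of the current orientation ($i\to j$ iff $b_{ij}>0$). Let $r_i+1$ be the least positive $t$ such that $x_{(t,i)}$ is an initial variable and write $x_{(r_i+1,i)}=x_{(0,i^* )}$; $i\mapsto i^*$ is an involution of $I$. Set $\Pi=\{(s,i)\mid i\in I,\ 0\le s\le r_i\}$; then $\gamma\mapsto x_\gamma$ is a bijection from $\Pi$ to the set of mutable cluster variables. Put $(-1,i):=(r_{i^*},i^* )$ and let $\tau:\Pi\to\Pi$ be the bijection $\tau(t,j)=(t-1,j)$. Compatibility degree. $(\omega\|\gamma)\in\mathbb{Z}_{\ge0}$, for $\omega,\gamma\in\Pi$, is the unique function with $(\tau\omega\|\tau\gamma)=(\omega\|\gamma)$ and such that $((0,i)\|\gamma)$ is $\max(0,d_i)$, where $d_i$ is the exponent of $x_i$ in the denominator of the Laurent expansion of $x_\gamma$ in the initial cluster (so $(\gamma\|\gamma)=0$). Cluster configuration space. $\mathcal{M}_D=\operatorname{Spec}(\mathbb{C}[u_\gamma^{\pm1}\mid\gamma\in\Pi]/I_D)$, where $I_D$ is generated by $R_\gamma=u_\gamma+\prod_{\omega\in\Pi}u_\omega^{(\omega\|\gamma)}-1$, $\gamma\in\Pi$. Quotient. $X(\tilde B)=\operatorname{Spec}\mathcal{A}(\tilde B)$; $\mathring X$ is the open locus where all mutable cluster variables are non-vanishing.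 $T(\tilde B)$ is the group of algebra automorphisms of $\mathcal{A}(\tilde B)$ that multiply each mutable and each frozen variable by a nonzero scalar; $\mathring X/T:=\operatorname{Spec}(\mathbb{C}[\mathring X]^T)$. Principal coefficients. $\tilde B^{\mathrm{prin}}$ is the $2n\times n$ matrix with top half $B$ and bottom half the identity; the initial mutable variables are $x_1,\dots,x_n$ and the frozen variables are $y_1,\dots,y_n$. For $\gamma\in\Pi$, $F_\gamma(\mathbf{y})$ is the polynomial obtained from the Laurent expansion of $x_\gamma\in\mathcal{A}(\tilde B^{\mathrm{prin}})$ in the initial cluster by setting $x_1=\dots=x_n=1$ (so $F_\gamma=1$ if $x_\gamma$ is initial). *)

theory Defs
  imports
    "HOL-Algebra.QuotRing"
    "HOL-Algebra.Module"
    "HOL-Analysis.Function_Topology"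
    "HOL-Library.Poly_Mapping"
    "HOL-Computational_Algebra.Fraction_Field"
begin

section \<open>Commutative complex algebras and their spectra\<close>

text \<open>
  A $\mathbb{C}$-algebra is a ring record together with a scalar multiplication by complex
  numbers, i.e. a value of the library's record type \<open>module\<close> over the type \<open>complex\<close>.
\<close>

type_synonym 'a calg = "(complex, 'a) module"

definition calg_iso :: "'a calg \<Rightarrow> 'b calg \<Rightarrow> ('a \<Rightarrow> 'b) set" where
  "calg_iso A B = {h \<in> ring_iso A B. \<forall>c. \<forall>a\<in>carrier A. h (c \<odot>\<^bsub>A\<^esub> a) = c \<odot>\<^bsub>B\<^esub> h a}"

definition calg_isomorphic :: "'a calg \<Rightarrow> 'b calg \<Rightarrow> bool" where
  "calg_isomorphic A B \<longleftrightarrow> calg_iso A B \<noteq> {}"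

text \<open>The carrier \<open>S\<close> inside a type of class \<open>comm_ring_1\<close>, with scalars acting through
  \<open>emb\<close>.\<close>

definition calg_on :: "(complex \<Rightarrow> 'a::comm_ring_1) \<Rightarrow> 'a set \<Rightarrow> 'a calg" where
  "calg_on emb S = \<lparr>carrier = S, mult = (*), one = 1, zero = 0, add = (+),
     smult = (\<lambda>c a. emb c * a)\<rparr>"

inductive_set subalg_gen :: "(complex \<Rightarrow> 'a::comm_ring_1) \<Rightarrow> 'a set \<Rightarrow> 'a set"
  for emb :: "complex \<Rightarrow> 'a" and G :: "'a set" where
  const: "emb c \<in> subalg_gen emb G"
| gen: "g \<in> G \<Longrightarrow> g \<in> subalg_gen emb G"
| add: "a \<in> subalg_gen emb G \<Longrightarrow> b \<in> subalg_gen emb G \<Longrightarrow> a + b \<in> subalg_gen emb G"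
| mult: "a \<in> subalg_gen emb G \<Longrightarrow> b \<in> subalg_gen emb G \<Longrightarrow> a * b \<in> subalg_gen emb G"

definition calg_quot :: "'a calg \<Rightarrow> 'a set \<Rightarrow> 'a set calg" where
  "calg_quot A J = \<lparr>carrier = carrier (A Quot J), mult = mult (A Quot J), one = one (A Quot J),
     zero = zero (A Quot J), add = add (A Quot J),
     smult = (\<lambda>c X. J +>\<^bsub>A\<^esub> (c \<odot>\<^bsub>A\<^esub> (SOME a. a \<in> X)))\<rparr>"

definition spec_points :: "'a calg \<Rightarrow> 'a set set" where
  "spec_points A = {p. primeideal p A}"

definition zariski :: "'a calg \<Rightarrow> 'a set topology" where
  "zariski A = topology_generated_by {{p \<in> spec_points A. f \<notin> p} |f. f \<in> carrier A}"

text \<open>\<open>loc_frac A p a b\<close> is the fraction $a/b$ in the localization $A_{\mathfrak p}$: the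
  equivalence class of the pair \<open>(a, b)\<close>.\<close>

definition loc_frac :: "'a calg \<Rightarrow> 'a set \<Rightarrow> 'a \<Rightarrow> 'a \<Rightarrow> ('a \<times> 'a) set" where
  "loc_frac A p a b = {(c, d). c \<in> carrier A \<and> d \<in> carrier A - p \<and>
     (\<exists>t \<in> carrier A - p. t \<otimes>\<^bsub>A\<^esub> (a \<otimes>\<^bsub>A\<^esub> d) = t \<otimes>\<^bsub>A\<^esub> (c \<otimes>\<^bsub>A\<^esub> b))}"

definition localization :: "'a calg \<Rightarrow> 'a set \<Rightarrow> ('a \<times> 'a) set calg" where
  "localization A p =
    \<lparr>carrier = {loc_frac A p a b |a b. a \<in> carrier A \<and> b \<in> carrier A - p},
     mult = (\<lambda>X Y. \<Union>(a, b)\<in>X. \<Union>(c, d)\<in>Y. loc_frac A p (a \<otimes>\<^bsub>A\<^esub> c) (b \<otimes>\<^bsub>A\<^esub> d)),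
     one = loc_frac A p \<one>\<^bsub>A\<^esub> \<one>\<^bsub>A\<^esub>,
     zero = loc_frac A p \<zero>\<^bsub>A\<^esub> \<one>\<^bsub>A\<^esub>,
     add = (\<lambda>X Y. \<Union>(a, b)\<in>X. \<Union>(c, d)\<in>Y.
              loc_frac A p (a \<otimes>\<^bsub>A\<^esub> d \<oplus>\<^bsub>A\<^esub> c \<otimes>\<^bsub>A\<^esub> b) (b \<otimes>\<^bsub>A\<^esub> d)),
     smult = (\<lambda>z X. \<Union>(a, b)\<in>X. loc_frac A p (z \<odot>\<^bsub>A\<^esub> a) b)\<rparr>"

text \<open>The structure sheaf: sections over \<open>U\<close> are the families of elements of the local rings
  $A_{\mathfrak p}$, $\mathfrak p \in U$, that are locally given by a single fraction.\<close>

definition spec_sections :: "'a calg \<Rightarrow> 'a set set \<Rightarrow> ('a set \<Rightarrow> ('a \<times> 'a) set) calg" where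
  "spec_sections A U =
    \<lparr>carrier = {s \<in> extensional U. \<forall>p\<in>U. \<exists>V. openin (zariski A) V \<and> p \<in> V \<and> V \<subseteq> U \<and>
        (\<exists>a\<in>carrier A. \<exists>b\<in>carrier A. \<forall>q\<in>V. b \<notin> q \<and> s q = loc_frac A q a b)},
     mult = (\<lambda>s t. \<lambda>p\<in>U. s p \<otimes>\<^bsub>localization A p\<^esub> t p),
     one = (\<lambda>p\<in>U. \<one>\<^bsub>localization A p\<^esub>),
     zero = (\<lambda>p\<in>U. \<zero>\<^bsub>localization A p\<^esub>),
     add = (\<lambda>s t. \<lambda>p\<in>U. s p \<oplus>\<^bsub>localization A p\<^esub> t p),
     smult = (\<lambda>z s. \<lambda>p\<in>U. z \<odot>\<^bsub>localization A p\<^esub> s p)\<rparr>"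

record ('p, 's) cspace =
  space_top :: "'p topology"
  sections :: "'p set \<Rightarrow> 's calg"
  restr :: "'p set \<Rightarrow> 'p set \<Rightarrow> 's \<Rightarrow> 's"

definition Spec :: "'a calg \<Rightarrow> ('a set, 'a set \<Rightarrow> ('a \<times> 'a) set) cspace" where
  "Spec A = \<lparr>space_top = zariski A, sections = spec_sections A,
     restr = (\<lambda>U V s. restrict s V)\<rparr>"

text \<open>Isomorphism of spaces with a sheaf of $\mathbb{C}$-algebras. For the spectra above this is
  isomorphism of schemes over $\mathbb{C}$: locality of the induced maps of stalks is automatic
  for an isomorphism.\<close>

definition cspace_isomorphic :: "('p, 's) cspace \<Rightarrow> ('q, 't) cspace \<Rightarrow> bool" where
  "cspace_isomorphic X Y \<longleftrightarrow>
    (\<exists>f \<phi>. homeomorphic_map (space_top X) (space_top Y) f \<and>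
      (\<forall>U. openin (space_top Y) U \<longrightarrow>
        \<phi> U \<in> calg_iso (sections Y U) (sections X {p \<in> topspace (space_top X). f p \<in> U})) \<and>
      (\<forall>U V. openin (space_top Y) U \<and> openin (space_top Y) V \<and> V \<subseteq> U \<longrightarrow>
        (\<forall>s \<in> carrier (sections Y U).
          \<phi> V (restr Y U V s) =
          restr X {p \<in> topspace (space_top X). f p \<in> U} {p \<in> topspace (space_top X). f p \<in> V}
            (\<phi> U s))))"

text \<open>The function on \<open>U\<close> defined by \<open>a\<close>, and the action of an automorphism \<open>g\<close> of \<open>A\<close> on
  functions on \<open>U\<close>: the fraction $a/b$ at $g^{-1}(\mathfrak p)$ is sent to $g(a)/g(b)$ at
  $\mathfrak p$.\<close>

definition to_section :: "'a calg \<Rightarrow> 'a set set \<Rightarrow> 'a \<Rightarrow> ('a set \<Rightarrow> ('a \<times> 'a) set)" where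
  "to_section A U a = (\<lambda>p\<in>U. loc_frac A p a \<one>\<^bsub>A\<^esub>)"

definition aut_act ::
  "'a calg \<Rightarrow> 'a set set \<Rightarrow> ('a \<Rightarrow> 'a) \<Rightarrow> ('a set \<Rightarrow> ('a \<times> 'a) set) \<Rightarrow> ('a set \<Rightarrow> ('a \<times> 'a) set)"
where
  "aut_act A U g s = (\<lambda>p\<in>U. map_prod g g ` s {a \<in> carrier A. g a \<in> p})"


section \<open>Laurent polynomials and rational functions\<close>

text \<open>
  A monomial is a finitely supported integer exponent vector. The field of rational functions in
  the variables \<open>rvar 0, rvar 1, \<dots>\<close> is obtained as the fraction field of the Laurent polynomial
  ring, which is the same as the fraction field of the polynomial ring.
\<close>

type_synonym 'v laurent = "('v \<Rightarrow>\<^sub>0 int) \<Rightarrow>\<^sub>0 complex"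
type_synonym ratfun = "nat laurent fract"

definition lconst :: "complex \<Rightarrow> 'v laurent" where
  "lconst c = Poly_Mapping.single 0 c"

definition lvar :: "'v \<Rightarrow> 'v laurent" where
  "lvar v = Poly_Mapping.single (Poly_Mapping.single v 1) 1"

definition laurent_on :: "'v set \<Rightarrow> 'v laurent set" where
  "laurent_on V = {p. \<forall>m \<in> Poly_Mapping.keys p. Poly_Mapping.keys m \<subseteq> V}"

definition to_ratfun :: "nat laurent \<Rightarrow> ratfun" where
  "to_ratfun p = Fraction_Field.Fract p 1"

definition rconst :: "complex \<Rightarrow> ratfun" where
  "rconst c = to_ratfun (lconst c)"

definition rvar :: "nat \<Rightarrow> ratfun" where
  "rvar v = to_ratfun (lvar v)"

definition laurent_expansion :: "ratfun \<Rightarrow> nat laurent" where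
  "laurent_expansion f = (THE p. to_ratfun p = f)"

text \<open>The exponent of the \<open>i\<close>th variable in the denominator of \<open>p\<close> written in lowest terms; it is
  negative if \<open>p\<close> is a polynomial in that variable divisible by it.\<close>

definition denom_exp :: "nat \<Rightarrow> nat laurent \<Rightarrow> int" where
  "denom_exp i p = - Min ((\<lambda>m. Poly_Mapping.lookup m i) ` Poly_Mapping.keys p)"

text \<open>Substitute 1 for the variables with index \<open>< n\<close>.\<close>

definition set_one :: "nat \<Rightarrow> nat laurent \<Rightarrow> nat laurent" where
  "set_one n p = (\<Sum>m \<in> Poly_Mapping.keys p.
     Poly_Mapping.single (Poly_Mapping.mapp (\<lambda>i e. if i < n then 0 else e) m)
       (Poly_Mapping.lookup p m))"


section \<open>Dynkin diagrams and exchange matrices\<close>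

text \<open>
  Matrices are functions on pairs of naturals, indices start from 0, and the vertex set is
  $\{0,\dots,n-1\}$. A connected Dynkin diagram of finite type is given by its Cartan matrix: an
  indecomposable generalized Cartan matrix with a positive definite symmetrization.
\<close>

definition finite_type_cartan :: "nat \<Rightarrow> (nat \<Rightarrow> nat \<Rightarrow> int) \<Rightarrow> bool" where
  "finite_type_cartan n a \<longleftrightarrow>
     0 < n \<and>
     (\<forall>i<n. a i i = 2) \<and>
     (\<forall>i<n. \<forall>j<n. i \<noteq> j \<longrightarrow> a i j \<le> 0 \<and> (a i j = 0 \<longleftrightarrow> a j i = 0)) \<and>
     (\<exists>d :: nat \<Rightarrow> real. (\<forall>i<n. 0 < d i) \<and>
        (\<forall>i<n. \<forall>j<n. d i * of_int (a i j) = d j * of_int (a j i)) \<and>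
        (\<forall>v :: nat \<Rightarrow> real. (\<exists>i<n. v i \<noteq> 0) \<longrightarrow>
           0 < (\<Sum>i<n. \<Sum>j<n. d i * of_int (a i j) * v i * v j))) \<and>
     (\<forall>S. S \<subseteq> {..<n} \<and> S \<noteq> {} \<and> S \<noteq> {..<n} \<longrightarrow>
        (\<exists>i\<in>S. \<exists>j\<in>{..<n} - S. a i j \<noteq> 0))"

text \<open>\<open>(i, j) \<in> E\<close> stands for the oriented edge $i \to j$.\<close>

definition orientation :: "nat \<Rightarrow> (nat \<Rightarrow> nat \<Rightarrow> int) \<Rightarrow> (nat \<times> nat) set \<Rightarrow> bool" where
  "orientation n a E \<longleftrightarrow>
     E \<subseteq> {(i, j). i < n \<and> j < n \<and> i \<noteq> j \<and> a i j \<noteq> 0} \<and>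
     (\<forall>i<n. \<forall>j<n. i \<noteq> j \<and> a i j \<noteq> 0 \<longrightarrow> ((i, j) \<in> E \<longleftrightarrow> (j, i) \<notin> E))"

definition exchange_matrix ::
  "(nat \<Rightarrow> nat \<Rightarrow> int) \<Rightarrow> (nat \<times> nat) set \<Rightarrow> nat \<Rightarrow> nat \<Rightarrow> int" where
  "exchange_matrix a E i j =
     (if (i, j) \<in> E then - a i j else if (j, i) \<in> E then a i j else 0)"

definition principal_ext :: "nat \<Rightarrow> (nat \<Rightarrow> nat \<Rightarrow> int) \<Rightarrow> nat \<Rightarrow> nat \<Rightarrow> int" where
  "principal_ext n B i j =
     (if i < n then B i j else if j < n \<and> i = n + j then 1 else 0)"


section \<open>Cluster algebras\<close>

text \<open>
  Throughout, \<open>b\<close> is an extended exchange matrix with rows \<open>0, \<dots>, N - 1\<close> and columns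
  \<open>0, \<dots>, n - 1\<close>, where \<open>n \<le> N\<close>. The initial mutable variables are \<open>rvar i\<close> for \<open>i < n\<close> and the
  frozen variables are \<open>rvar i\<close> for \<open>n \<le> i < N\<close>. A seed consists of its variables, indexed by the
  rows, and its matrix.
\<close>

type_synonym seed = "(nat \<Rightarrow> ratfun) \<times> (nat \<Rightarrow> nat \<Rightarrow> int)"

definition mutate_matrix :: "nat \<Rightarrow> (nat \<Rightarrow> nat \<Rightarrow> int) \<Rightarrow> nat \<Rightarrow> nat \<Rightarrow> int" where
  "mutate_matrix k b i j =
     (if i = k \<or> j = k then - b i j else b i j + sgn (b i k) * max 0 (b i k * b k j))"

definition mutate :: "nat \<Rightarrow> nat \<Rightarrow> seed \<Rightarrow> seed" where
  "mutate N k s = (case s of (x, b) \<Rightarrow>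
     (x(k := ((\<Prod>i | i < N \<and> b i k > 0. x i ^ nat (b i k)) +
              (\<Prod>i | i < N \<and> b i k < 0. x i ^ nat (- b i k))) / x k),
      mutate_matrix k b))"

inductive_set seeds :: "nat \<Rightarrow> nat \<Rightarrow> (nat \<Rightarrow> nat \<Rightarrow> int) \<Rightarrow> seed set"
  for n N b where
  initial: "(rvar, b) \<in> seeds n N b"
| mutation: "s \<in> seeds n N b \<Longrightarrow> k < n \<Longrightarrow> mutate N k s \<in> seeds n N b"

definition cluster_variables :: "nat \<Rightarrow> nat \<Rightarrow> (nat \<Rightarrow> nat \<Rightarrow> int) \<Rightarrow> ratfun set" where
  "cluster_variables n N b = {fst s k |s k. s \<in> seeds n N b \<and> k < n}"

definition frozen_variables :: "nat \<Rightarrow> nat \<Rightarrow> ratfun set" where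
  "frozen_variables n N = rvar ` {n..<N}"

definition cluster_algebra :: "nat \<Rightarrow> nat \<Rightarrow> (nat \<Rightarrow> nat \<Rightarrow> int) \<Rightarrow> ratfun calg" where
  "cluster_algebra n N b = calg_on rconst (subalg_gen rconst
     (cluster_variables n N b \<union> frozen_variables n N \<union> inverse ` frozen_variables n N))"

text \<open>\<open>source_mutations n N s ks s'\<close>: mutating \<open>s\<close> successively at the entries of \<open>ks\<close>, each of
  which is a source at its turn, gives \<open>s'\<close>. There is an arrow $i \to j$ iff $b_{ij} > 0$.\<close>

definition is_source :: "nat \<Rightarrow> (nat \<Rightarrow> nat \<Rightarrow> int) \<Rightarrow> nat \<Rightarrow> bool" where
  "is_source n b k \<longleftrightarrow> k < n \<and> (\<forall>i<n. \<not> b i k > 0)"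

inductive source_mutations :: "nat \<Rightarrow> nat \<Rightarrow> seed \<Rightarrow> nat list \<Rightarrow> seed \<Rightarrow> bool" for n N where
  "source_mutations n N s [] s"
| "is_source n (snd s) k \<Longrightarrow> source_mutations n N (mutate N k s) ks s' \<Longrightarrow>
   source_mutations n N s (k # ks) s'"

text \<open>Mutation once at every vertex, always at a source. The resulting seed does not depend on the
  order, since mutations at two sources commute.\<close>

definition source_sweep :: "nat \<Rightarrow> nat \<Rightarrow> seed \<Rightarrow> seed" where
  "source_sweep n N s =
     (SOME s'. \<exists>ks. distinct ks \<and> set ks = {..<n} \<and> source_mutations n N s ks s')"

definition xvar :: "nat \<Rightarrow> nat \<Rightarrow> (nat \<Rightarrow> nat \<Rightarrow> int) \<Rightarrow> nat \<times> nat \<Rightarrow> ratfun" where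
  "xvar n N b \<gamma> = fst ((source_sweep n N ^^ fst \<gamma>) (rvar, b)) (snd \<gamma>)"

text \<open>The index set of the mutable cluster variables and the compatibility degree do not involve
  coefficients and are read off from the cluster algebra without frozen variables
  (\<open>N = n\<close>, matrix \<open>B\<close>).\<close>

definition rmax :: "nat \<Rightarrow> (nat \<Rightarrow> nat \<Rightarrow> int) \<Rightarrow> nat \<Rightarrow> nat" where
  "rmax n B i = (LEAST t. 0 < t \<and> xvar n n B (t, i) \<in> rvar ` {..<n}) - 1"

definition star :: "nat \<Rightarrow> (nat \<Rightarrow> nat \<Rightarrow> int) \<Rightarrow> nat \<Rightarrow> nat" where
  "star n B i = (THE j. j < n \<and> xvar n n B (rmax n B i + 1, i) = rvar j)"

definition Pi_index :: "nat \<Rightarrow> (nat \<Rightarrow> nat \<Rightarrow> int) \<Rightarrow> (nat \<times> nat) set" where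
  "Pi_index n B = {(s, i). i < n \<and> s \<le> rmax n B i}"

definition tau :: "nat \<Rightarrow> (nat \<Rightarrow> nat \<Rightarrow> int) \<Rightarrow> nat \<times> nat \<Rightarrow> nat \<times> nat" where
  "tau n B \<gamma> = (case \<gamma> of (t, j) \<Rightarrow>
     if 0 < t then (t - 1, j) else (rmax n B (star n B j), star n B j))"

text \<open>The first clause only normalizes the values outside \<open>Pi_index n B\<close>.\<close>

definition is_compatibility_degree ::
  "nat \<Rightarrow> (nat \<Rightarrow> nat \<Rightarrow> int) \<Rightarrow> (nat \<times> nat \<Rightarrow> nat \<times> nat \<Rightarrow> nat) \<Rightarrow> bool" where
  "is_compatibility_degree n B c \<longleftrightarrow>
     (\<forall>\<omega> \<gamma>. \<not> (\<omega> \<in> Pi_index n B \<and> \<gamma> \<in> Pi_index n B) \<longrightarrow> c \<omega> \<gamma> = 0) \<and>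
     (\<forall>\<omega>\<in>Pi_index n B. \<forall>\<gamma>\<in>Pi_index n B. c (tau n B \<omega>) (tau n B \<gamma>) = c \<omega> \<gamma>) \<and>
     (\<forall>i<n. \<forall>\<gamma>\<in>Pi_index n B.
        int (c (0, i) \<gamma>) = max 0 (denom_exp i (laurent_expansion (xvar n n B \<gamma>))))"

definition compat :: "nat \<Rightarrow> (nat \<Rightarrow> nat \<Rightarrow> int) \<Rightarrow> nat \<times> nat \<Rightarrow> nat \<times> nat \<Rightarrow> nat" where
  "compat n B = (THE c. is_compatibility_degree n B c)"


section \<open>The cluster configuration space\<close>

definition config_relation ::
  "nat \<Rightarrow> (nat \<Rightarrow> nat \<Rightarrow> int) \<Rightarrow> nat \<times> nat \<Rightarrow> (nat \<times> nat) laurent" where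
  "config_relation n B \<gamma> =
     lvar \<gamma> + (\<Prod>\<omega>\<in>Pi_index n B. lvar \<omega> ^ compat n B \<omega> \<gamma>) - 1"

definition config_ring :: "nat \<Rightarrow> (nat \<Rightarrow> nat \<Rightarrow> int) \<Rightarrow> (nat \<times> nat) laurent set calg" where
  "config_ring n B = (let L = calg_on lconst (laurent_on (Pi_index n B)) in
     calg_quot L (Idl\<^bsub>L\<^esub> (config_relation n B ` Pi_index n B)))"

definition config_space where
  "config_space n B = Spec (config_ring n B)"


section \<open>The locus of non-vanishing cluster variables and its torus quotient\<close>

definition torus :: "nat \<Rightarrow> nat \<Rightarrow> (nat \<Rightarrow> nat \<Rightarrow> int) \<Rightarrow> (ratfun \<Rightarrow> ratfun) set" where
  "torus n N b = (let A = cluster_algebra n N b in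
     {g \<in> calg_iso A A. g \<in> extensional (carrier A) \<and>
        (\<forall>z \<in> cluster_variables n N b \<union> frozen_variables n N. \<exists>c. c \<noteq> 0 \<and> g z = rconst c * z)})"

definition open_locus :: "nat \<Rightarrow> nat \<Rightarrow> (nat \<Rightarrow> nat \<Rightarrow> int) \<Rightarrow> ratfun set set" where
  "open_locus n N b =
     {p \<in> spec_points (cluster_algebra n N b). \<forall>x \<in> cluster_variables n N b. x \<notin> p}"

type_synonym locus_fun = "ratfun set \<Rightarrow> (ratfun \<times> ratfun) set"

definition open_locus_ring :: "nat \<Rightarrow> nat \<Rightarrow> (nat \<Rightarrow> nat \<Rightarrow> int) \<Rightarrow> locus_fun calg" where
  "open_locus_ring n N b = spec_sections (cluster_algebra n N b) (open_locus n N b)"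

definition invariant_ring :: "nat \<Rightarrow> nat \<Rightarrow> (nat \<Rightarrow> nat \<Rightarrow> int) \<Rightarrow> locus_fun calg" where
  "invariant_ring n N b = (open_locus_ring n N b)
     \<lparr>carrier := {f \<in> carrier (open_locus_ring n N b).
        \<forall>g \<in> torus n N b. aut_act (cluster_algebra n N b) (open_locus n N b) g f = f}\<rparr>"

definition torus_quotient where
  "torus_quotient n N b = Spec (invariant_ring n N b)"

text \<open>The closed subscheme of the (affine) open locus cut out by the equations $x_i = 1$ for the
  initial mutable variables $x_i$.\<close>

definition unit_locus_ring :: "nat \<Rightarrow> nat \<Rightarrow> (nat \<Rightarrow> nat \<Rightarrow> int) \<Rightarrow> locus_fun set calg" where
  "unit_locus_ring n N b = (let R = open_locus_ring n N b in
     calg_quot R (Idl\<^bsub>R\<^esub>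
       {to_section (cluster_algebra n N b) (open_locus n N b) (rvar i) \<ominus>\<^bsub>R\<^esub> \<one>\<^bsub>R\<^esub> |i. i < n}))"

definition unit_locus where
  "unit_locus n N b = Spec (unit_locus_ring n N b)"


section \<open>F-polynomials\<close>

text \<open>With principal coefficients the frozen variables are \<open>rvar (n + i)\<close> for \<open>i < n\<close>.\<close>

definition F_poly :: "nat \<Rightarrow> (nat \<Rightarrow> nat \<Rightarrow> int) \<Rightarrow> nat \<times> nat \<Rightarrow> ratfun" where
  "F_poly n B \<gamma> =
     to_ratfun (set_one n (laurent_expansion (xvar n (2 * n) (principal_ext n B) \<gamma>)))"

definition F_ring :: "nat \<Rightarrow> (nat \<Rightarrow> nat \<Rightarrow> int) \<Rightarrow> ratfun calg" where
  "F_ring n B = calg_on rconst (subalg_gen rconst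
     ((\<Union>\<gamma>\<in>Pi_index n B. {F_poly n B \<gamma>, inverse (F_poly n B \<gamma>)}) \<union>
      (\<Union>i<n. {rvar (n + i), inverse (rvar (n + i))})))"

end

theory Submission
  imports Defs
begin

text \<open>
  Mutating periodically at sources gives a sequence \<open>X q\<close> of cluster variables subject to mesh
  relations. The orders of their poles along an initial variable satisfy the tropical mesh relations,
  whose only non-negative solution is 0. Hence every initial variable divides some later \<open>X q\<close>,
  which by the Laurent phenomenon is equal to it: the sequence recurs, and the symmetry under time
  reversal makes \<open>j \<mapsto> j\<^sup>*\<close> an involution.

  With principal coefficients, \<open>X q\<close> is a monomial in the \<open>x\<^sub>i\<close> times \<open>F q (yhat)\<close>. Dividing a mesh
  relation by its left hand side writes 1 as the sum of two monomials \<open>u q\<close> and \<open>1 - u q\<close> in the \<open>F\<close>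
  and \<open>y\<close>; these \<open>u\<close> are multiplicatively independent, the \<open>F\<close> and \<open>y\<close> are monomials in them, and
  comparing orders of poles along the \<open>y\<^sub>i\<close> shows that \<open>1 - u\<close> is the monomial given by the
  compatibility degrees. This maps the configuration ring onto the ring of \<open>F\<close>-polynomials. The map
  is injective since, modulo the relations, the lifts of the \<open>F\<close> are polynomials in those of the
  \<open>y\<close>, and every element is a fraction of such polynomials.

  The functions on the open locus are graded by the monomials in the \<open>x\<^sub>i\<close> over a copy of the ring
  of \<open>F\<close>-polynomials, embedded by \<open>y\<^sub>j \<mapsto> yhat\<^sub>j\<close>. The torus acts through the grading, so the invariants
  are the part of degree 0, and setting all \<open>x\<^sub>i = 1\<close> maps it isomorphically onto the functions on
  the unit locus.
\<close>



section \<open>Laurent polynomials\<close>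

text \<open>Orders of poles obey a recursion because all cluster variables are subtraction-free: in
  a sum of positive quotients no leading terms cancel. Orders alone cannot show that two variables
  are equal. For this the Laurent phenomenon is proved, through the intersection of the Laurent
  rings of a seed and its neighbours, which is invariant under mutation; and each seed carries
  leading exponents and coefficients, which make its variables independent and rule out constant
  factors. Finite type enters through the positive definite form: it makes the diagram a tree, and
  it bounds the non-negative solutions of the recursion. The compatibility degrees are reached
  through \<open>M n\<close>, an endomorphism of the field that moves \<open>U q\<close> to
  \<open>U (q + n)\<close>: it makes the exponents of \<open>1 - U\<close> invariant under
  \<open>tau\<close>, so that only those at \<open>(0, i)\<close> have to be compared.
  \<open>U_general\<close> is applied twice, once with all initial variables set to 1 and once with
  \<open>yhat\<close> in place of \<open>y\<close>; comparing the results gives the separation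
  formula \<open>xeq_X\<close>, on which both the unit locus and the torus quotient rest.\<close>

abbreviation "lookup \<equiv> Poly_Mapping.lookup"
abbreviation "keys \<equiv> Poly_Mapping.keys"
abbreviation "single \<equiv> Poly_Mapping.single"

declare lookup_add [simp] lookup_single [simp] mult_single [simp]

lemma poly_mapping_sum_single:
  "(\<Sum>m\<in>keys p. single m (lookup p m)) = p"
  by (rule poly_mapping_eqI)
    (auto simp: lookup_sum when_def in_keys_iff)

lemma poly_mapping_induct_single [case_names single add]:
  assumes "\<And>m c. P (single m c)" and "\<And>p q. P p \<Longrightarrow> P q \<Longrightarrow> P (p + q)"
  shows "P (p :: 'a \<Rightarrow>\<^sub>0 'b::comm_monoid_add)"
proof -
  have "P (\<Sum>m\<in>A. single m (lookup p m))" for A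
  proof (induction A rule: infinite_finite_induct)
    case empty thus ?case using assms(1)[of _ 0] by simp
  qed (use assms assms(1)[of _ 0] in auto)
  from this[of "keys p"] show ?thesis by (simp only: poly_mapping_sum_single)
qed

text \<open>\<open>\<chi>\<close> is a character of the whole exponent group, not a choice of values
  for the variables, because the target need not be a field: \<open>ev\<close>, \<open>psi\<close>
  and \<open>theta\<close> are instances, and \<open>theta\<close> maps into a Laurent ring.\<close>

definition lev :: "(complex \<Rightarrow> 'b::comm_ring_1) \<Rightarrow> (('v \<Rightarrow>\<^sub>0 int) \<Rightarrow> 'b) \<Rightarrow> 'v laurent \<Rightarrow> 'b" where
  "lev emb \<chi> p = (\<Sum>m\<in>keys p. emb (lookup p m) * \<chi> m)"

locale laurent_hom =
  fixes emb :: "complex \<Rightarrow> 'b::comm_ring_1" and \<chi> :: "('v \<Rightarrow>\<^sub>0 int) \<Rightarrow> 'b"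
  assumes emb_add: "emb (c + d) = emb c + emb d" and emb_mult: "emb (c * d) = emb c * emb d"
    and emb_1: "emb 1 = 1" and chi_add: "\<chi> (m + m') = \<chi> m * \<chi> m'" and chi_0: "\<chi> 0 = 1"
begin

lemma emb_0: "emb 0 = 0" using emb_add[of 0 0] by simp

lemma lev_superset:
  assumes "finite A" "keys p \<subseteq> A"
  shows "lev emb \<chi> p = (\<Sum>m\<in>A. emb (lookup p m) * \<chi> m)"
  unfolding lev_def using assms
  by (intro sum.mono_neutral_left) (auto simp: in_keys_iff emb_0)

lemma lev_add: "lev emb \<chi> (p + q) = lev emb \<chi> p + lev emb \<chi> q"
proof -
  let ?A = "keys p \<union> keys q"
  have "keys (p + q) \<subseteq> ?A" by (rule keys_add)
  thus ?thesis
    using lev_superset[of ?A p] lev_superset[of ?A q] lev_superset[of ?A "p + q"]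
    by (simp add: emb_add distrib_right sum.distrib)
qed

lemma lev_0 [simp]: "lev emb \<chi> 0 = 0" by (simp add: lev_def)

lemma lev_single: "lev emb \<chi> (single m c) = emb c * \<chi> m"
  by (cases "c = 0") (simp_all add: lev_def emb_0)

lemma lev_1 [simp]: "lev emb \<chi> 1 = 1"
  using lev_single[of 0 1] by (simp add: emb_1 chi_0)

lemma lev_const: "lev emb \<chi> (lconst c) = emb c"
  by (simp add: lconst_def lev_single chi_0)

lemma lev_mult: "lev emb \<chi> (p * q) = lev emb \<chi> p * lev emb \<chi> q"
proof (induction p rule: poly_mapping_induct_single)
  case (single m c)
  show ?case
    by (induction q rule: poly_mapping_induct_single)
      (simp_all add: lev_single emb_mult chi_add lev_add distrib_left)
qed (simp add: distrib_right lev_add)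

lemma lev_uminus: "lev emb \<chi> (- p) = - lev emb \<chi> p"
  using lev_add[of p "- p"] by (simp add: eq_neg_iff_add_eq_0 add.commute)

lemma lev_diff: "lev emb \<chi> (p - q) = lev emb \<chi> p - lev emb \<chi> q"
  using lev_add[of p "- q"] by (simp add: lev_uminus)

lemma lev_power: "lev emb \<chi> (p ^ k) = lev emb \<chi> p ^ k"
  by (induction k) (simp_all add: lev_mult)

lemma lev_prod: "lev emb \<chi> (\<Prod>i\<in>A. f i) = (\<Prod>i\<in>A. lev emb \<chi> (f i))"
  by (induction A rule: infinite_finite_induct) (simp_all add: lev_mult)

lemma lev_sum: "lev emb \<chi> (\<Sum>i\<in>A. f i) = (\<Sum>i\<in>A. lev emb \<chi> (f i))"
  by (induction A rule: infinite_finite_induct) (simp_all add: lev_add)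

end

subsection \<open>Degrees\<close>

definition comp_at :: "(('v \<Rightarrow>\<^sub>0 int) \<Rightarrow> 'g) \<Rightarrow> 'g \<Rightarrow> 'v laurent \<Rightarrow> 'v laurent" where
  "comp_at \<phi> d p = (\<Sum>m | m \<in> keys p \<and> \<phi> m = d. single m (lookup p m))"

lemma lookup_comp_at [simp]: "lookup (comp_at \<phi> d p) m = (if \<phi> m = d then lookup p m else 0)"
  by (auto simp: comp_at_def lookup_sum when_def in_keys_iff)

lemma comp_at_add: "comp_at \<phi> d (p + q) = comp_at \<phi> d p + comp_at \<phi> d q"
  by (rule poly_mapping_eqI) simp

lemma comp_at_0 [simp]: "comp_at \<phi> d 0 = 0"
  by (rule poly_mapping_eqI) simp

lemma comp_at_single: "comp_at \<phi> d (single m c) = (if \<phi> m = d then single m c else 0)"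
  by (rule poly_mapping_eqI) (auto simp: when_def)

lemma keys_comp_at: "keys (comp_at \<phi> d p) = {m \<in> keys p. \<phi> m = d}"
  by (auto simp: in_keys_iff split: if_splits)

lemma comp_at_eq_0: "(\<And>m. m \<in> keys p \<Longrightarrow> \<phi> m \<noteq> d) \<Longrightarrow> comp_at \<phi> d p = 0"
  by (rule poly_mapping_eqI) (auto simp: in_keys_iff)

lemma comp_at_eq_self: "(\<And>m. m \<in> keys p \<Longrightarrow> \<phi> m = d) \<Longrightarrow> comp_at \<phi> d p = p"
  by (rule poly_mapping_eqI) (auto simp: in_keys_iff)

text \<open>Multiplying by an element of pure degree \<open>e\<close> shifts every degree by
  \<open>e\<close>.\<close>

lemma comp_at_mult_homogeneous:
  fixes \<phi> :: "('v \<Rightarrow>\<^sub>0 int) \<Rightarrow> 'g::ab_group_add"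
  assumes add: "\<And>m m'. \<phi> (m + m') = \<phi> m + \<phi> m'"
    and hom: "\<And>m. m \<in> keys q \<Longrightarrow> \<phi> m = e"
  shows "comp_at \<phi> d (p * q) = comp_at \<phi> (d - e) p * q"
proof (induction p rule: poly_mapping_induct_single)
  case (single m c)
  have "\<phi> k = \<phi> m + e" if "k \<in> keys (single m c * q)" for k
    using keys_mult[of "single m c" q] that hom
    by (fastforce simp: add split: if_splits)
  thus ?case
    by (auto simp: comp_at_single intro!: comp_at_eq_self comp_at_eq_0)
qed (simp add: comp_at_add distrib_right)

lemma comp_at_mult_top:
  fixes \<phi> :: "('v \<Rightarrow>\<^sub>0 int) \<Rightarrow> 'g::linordered_ab_group_add"
  assumes add: "\<And>m m'. \<phi> (m + m') = \<phi> m + \<phi> m'"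
    and p: "\<And>m. m \<in> keys p \<Longrightarrow> \<phi> m \<le> d" and q: "\<And>m. m \<in> keys q \<Longrightarrow> \<phi> m \<le> e"
  shows "comp_at \<phi> (d + e) (p * q) = comp_at \<phi> d p * comp_at \<phi> e q"
proof -
  let ?q = "q - comp_at \<phi> e q"
  have lt: "\<phi> m < e" if "m \<in> keys ?q" for m
    using that q[of m] by (force simp: in_keys_iff lookup_minus split: if_splits)
  have "comp_at \<phi> (d + e) (p * q) = comp_at \<phi> (d + e) (p * comp_at \<phi> e q) + comp_at \<phi> (d + e) (p * ?q)"
    by (simp add: algebra_simps flip: comp_at_add)
  moreover have "comp_at \<phi> (d + e) (p * ?q) = 0"
  proof (rule comp_at_eq_0)
    fix m assume "m \<in> keys (p * ?q)"
    then obtain k l where "k \<in> keys p" "l \<in> keys ?q" "m = k + l"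
      using keys_mult[of p ?q] by blast
    thus "\<phi> m \<noteq> d + e" using p lt add_le_less_mono[of "\<phi> k" d "\<phi> l" e] by (force simp: add)
  qed
  moreover have "comp_at \<phi> (d + e) (p * comp_at \<phi> e q) = comp_at \<phi> d p * comp_at \<phi> e q"
    by (subst comp_at_mult_homogeneous[OF add, where e = e]) (simp_all add: keys_comp_at)
  ultimately show ?thesis by simp
qed

definition ldeg :: "(('v \<Rightarrow>\<^sub>0 int) \<Rightarrow> 'g::linorder) \<Rightarrow> 'v laurent \<Rightarrow> 'g" where
  "ldeg \<phi> p = Max (\<phi> ` keys p)"

lemma ldeg_ge: "m \<in> keys p \<Longrightarrow> \<phi> m \<le> ldeg \<phi> p"
  unfolding ldeg_def by (intro Max_ge) auto

lemma ldeg_attained: "p \<noteq> 0 \<Longrightarrow> \<exists>m\<in>keys p. \<phi> m = ldeg \<phi> p"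
  using Max_in[of "\<phi> ` keys p"] unfolding ldeg_def
  by (metis (no_types, lifting) empty_is_image finite_imageI finite_keys imageE keys_eq_empty)

lemma ldeg_eqI:
  assumes "\<And>m. m \<in> keys p \<Longrightarrow> \<phi> m \<le> d" "\<exists>m\<in>keys p. \<phi> m = d"
  shows "ldeg \<phi> p = d"
  unfolding ldeg_def using assms by (intro Max_eqI) auto

lemma comp_at_ldeg_nonzero: "p \<noteq> 0 \<Longrightarrow> comp_at \<phi> (ldeg \<phi> p) p \<noteq> 0"
  using ldeg_attained[of p \<phi>] by (auto simp: keys_comp_at simp flip: keys_eq_empty)

text \<open>The product of the top components is the top component of the product; it is non-zero
  because the Laurent ring has no zero divisors.\<close>

lemma ldeg_mult:
  fixes \<phi> :: "('v::linorder \<Rightarrow>\<^sub>0 int) \<Rightarrow> 'g::linordered_ab_group_add"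
  assumes add: "\<And>m m'. \<phi> (m + m') = \<phi> m + \<phi> m'" and nz: "p \<noteq> 0" "q \<noteq> 0"
  shows "ldeg \<phi> (p * q) = ldeg \<phi> p + ldeg \<phi> q"
proof (rule ldeg_eqI)
  fix m assume "m \<in> keys (p * q)"
  then obtain k l where "k \<in> keys p" "l \<in> keys q" "m = k + l"
    using keys_mult[of p q] by blast
  thus "\<phi> m \<le> ldeg \<phi> p + ldeg \<phi> q" by (simp add: add add_mono ldeg_ge)
next
  have "comp_at \<phi> (ldeg \<phi> p + ldeg \<phi> q) (p * q) \<noteq> 0"
    using comp_at_mult_top[OF add, of p "ldeg \<phi> p" q "ldeg \<phi> q"] nz comp_at_ldeg_nonzero
    by (metis ldeg_ge mult_eq_0_iff)
  thus "\<exists>m\<in>keys (p * q). \<phi> m = ldeg \<phi> p + ldeg \<phi> q"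
    by (metis comp_at_eq_0)
qed

lemma ldeg_single: "c \<noteq> 0 \<Longrightarrow> ldeg \<phi> (single m c) = \<phi> m"
  by (simp add: ldeg_def)

definition lead :: "('v::linorder) laurent \<Rightarrow> complex" where
  "lead p = lookup p (ldeg id p)"

lemma comp_at_id: "comp_at id d p = single d (lookup p d)"
  by (rule poly_mapping_eqI) auto

lemma lead_mult:
  assumes "p \<noteq> 0" "q \<noteq> 0" shows "lead (p * q) = lead p * lead q"
proof -
  have "comp_at id (ldeg id p + ldeg id q) (p * q) = comp_at id (ldeg id p) p * comp_at id (ldeg id q) q"
    by (rule comp_at_mult_top) (use ldeg_ge[where \<phi> = id] in auto)
  thus ?thesis
    using assms by (simp add: lead_def ldeg_mult comp_at_id) (metis lookup_single_eq)
qed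

lemma lead_nonzero: "p \<noteq> 0 \<Longrightarrow> lead p \<noteq> 0"
  using ldeg_attained[of p id] by (simp add: lead_def in_keys_iff)


section \<open>Rational functions\<close>

lemma to_ratfun_simps [simp]:
  "to_ratfun (p + q) = to_ratfun p + to_ratfun q" "to_ratfun (p * q) = to_ratfun p * to_ratfun q"
  "to_ratfun 1 = 1" "to_ratfun 0 = 0" "to_ratfun (p - q) = to_ratfun p - to_ratfun q"
  "to_ratfun (p ^ k) = to_ratfun p ^ k"
proof -
  show *: "to_ratfun (p * q) = to_ratfun p * to_ratfun q" "to_ratfun 1 = 1" for p q
    by (simp_all add: to_ratfun_def fract_collapse)
  show "to_ratfun (p ^ k) = to_ratfun p ^ k" by (induction k) (simp_all add: *)
qed (simp_all add: to_ratfun_def fract_collapse)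

lemma to_ratfun_prod [simp]: "to_ratfun (\<Prod>i\<in>A. f i) = (\<Prod>i\<in>A. to_ratfun (f i))"
  by (induction A rule: infinite_finite_induct) simp_all

lemma to_ratfun_eq_iff [simp]: "to_ratfun p = to_ratfun q \<longleftrightarrow> p = q"
  by (simp add: to_ratfun_def eq_fract)

lemma to_ratfun_eq_0_iff [simp]: "to_ratfun p = 0 \<longleftrightarrow> p = 0"
  using to_ratfun_eq_iff[of p 0] by (simp only: to_ratfun_simps)

lemma ratfun_cases:
  obtains p q where "f = to_ratfun p / to_ratfun q" "q \<noteq> 0"
  by (cases f) (auto simp: to_ratfun_def)

lemma laurent_expansion_to_ratfun [simp]: "laurent_expansion (to_ratfun p) = p"
  unfolding laurent_expansion_def by (rule the_equality) simp_all

lemma rconst_simps [simp]: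
  "rconst (c + d) = rconst c + rconst d" "rconst (c * d) = rconst c * rconst d" "rconst 1 = 1" "rconst 0 = 0"
proof -
  show "rconst (c + d) = rconst c + rconst d" by (simp add: rconst_def lconst_def single_add)
  show "rconst (c * d) = rconst c * rconst d" by (simp add: rconst_def lconst_def flip: to_ratfun_simps)
  show "rconst 1 = 1" by (simp add: rconst_def lconst_def)
  show "rconst 0 = 0" by (simp add: rconst_def lconst_def)
qed

lemma rconst_eq_0_iff [simp]: "rconst c = 0 \<longleftrightarrow> c = 0"
  by (simp add: rconst_def lconst_def) (metis lookup_single_eq single_zero)

lemma lvar_nonzero [simp]: "lvar v \<noteq> 0"
  unfolding lvar_def by (metis lookup_single_eq lookup_zero zero_neq_one)

lemma rvar_nonzero [simp]: "rvar v \<noteq> 0"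
  by (simp add: rvar_def)

definition monomial :: "(nat \<Rightarrow> 'a::field) \<Rightarrow> (nat \<Rightarrow>\<^sub>0 int) \<Rightarrow> 'a" where
  "monomial x m = (\<Prod>i\<in>keys m. x i powi lookup m i)"

lemma monomial_superset:
  assumes "finite A" "keys m \<subseteq> A"
  shows "monomial x m = (\<Prod>i\<in>A. x i powi lookup m i)"
  unfolding monomial_def using assms by (intro prod.mono_neutral_left) (auto simp: in_keys_iff)

lemma monomial_0 [simp]: "monomial x 0 = 1" by (simp add: monomial_def)

lemma monomial_single [simp]: "monomial x (single i k) = x i powi k"
  by (cases "k = 0") (simp_all add: monomial_def)

lemma monomial_add:
  assumes "\<And>i. x i \<noteq> 0" shows "monomial x (m + m') = monomial x m * monomial x m'"
proof -
  let ?A = "keys m \<union> keys m'"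
  have "keys (m + m') \<subseteq> ?A" by (rule keys_add)
  thus ?thesis
    using monomial_superset[of ?A m x] monomial_superset[of ?A m' x] monomial_superset[of ?A "m + m'" x] assms
    by (simp add: power_int_add prod.distrib)
qed

lemma monomial_nonzero [simp]: "(\<And>i. x i \<noteq> 0) \<Longrightarrow> monomial x m \<noteq> 0"
  by (simp add: monomial_def)

lemma monomial_uminus: "(\<And>i. x i \<noteq> 0) \<Longrightarrow> monomial x (- m) = inverse (monomial x m)"
  using monomial_add[of x m "- m"] by (simp add: inverse_unique)

definition ev :: "(nat \<Rightarrow> ratfun) \<Rightarrow> nat laurent \<Rightarrow> ratfun" where
  "ev x = lev rconst (monomial x)"

lemma laurent_hom_ev: "(\<And>i. x i \<noteq> 0) \<Longrightarrow> laurent_hom rconst (monomial x)"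
  by unfold_locales (simp_all add: monomial_add)

lemmas ev_simps [simp] = laurent_hom.lev_add[OF laurent_hom_ev, folded ev_def]
  laurent_hom.lev_mult[OF laurent_hom_ev, folded ev_def]
  laurent_hom.lev_diff[OF laurent_hom_ev, folded ev_def]
  laurent_hom.lev_1[OF laurent_hom_ev, folded ev_def]
  laurent_hom.lev_0[OF laurent_hom_ev, folded ev_def]
  laurent_hom.lev_const[OF laurent_hom_ev, folded ev_def]
  laurent_hom.lev_power[OF laurent_hom_ev, folded ev_def]

lemma ev_single: "(\<And>i. x i \<noteq> 0) \<Longrightarrow> ev x (single m c) = rconst c * monomial x m"
  by (simp add: ev_def laurent_hom.lev_single[OF laurent_hom_ev])

lemma ev_lvar [simp]: "(\<And>i. x i \<noteq> 0) \<Longrightarrow> ev x (lvar v) = x v"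
  by (simp add: lvar_def ev_single)

lemma monomial_rvar: "monomial rvar m = to_ratfun (single m 1)"
proof -
  have "keys m \<subseteq> UNIV" by simp
  thus ?thesis
  proof (induction m rule: frag_induction)
    case (diff a b)
    have "monomial rvar (a - b) * monomial rvar b = monomial rvar a" by (simp flip: monomial_add)
    also have "\<dots> = to_ratfun (single (a - b) 1) * to_ratfun (single b 1)"
      by (simp add: diff flip: to_ratfun_simps(2))
    finally show ?case using monomial_nonzero[of rvar b] by (simp add: diff)
  qed (simp_all add: monomial_def rvar_def lvar_def)
qed

lemma ev_rvar: "ev rvar p = to_ratfun p"
proof (induction p rule: poly_mapping_induct_single)
  case (single m c)
  show ?case
    by (simp add: ev_single monomial_rvar rconst_def lconst_def flip: to_ratfun_simps(2))
qed simp

subsection \<open>Degrees of rational functions\<close>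

text \<open>A degree is chosen from some representation as a quotient of non-zero elements; by
  \<open>rdeg_quot\<close> all of them give the same value.\<close>

definition rdeg :: "((nat \<Rightarrow>\<^sub>0 int) \<Rightarrow> 'g::linordered_ab_group_add) \<Rightarrow> ratfun \<Rightarrow> 'g" where
  "rdeg \<phi> f = (SOME d. \<exists>p q. p \<noteq> 0 \<and> q \<noteq> 0 \<and> f = to_ratfun p / to_ratfun q \<and> d = ldeg \<phi> p - ldeg \<phi> q)"

locale weight =
  fixes \<phi> :: "(nat \<Rightarrow>\<^sub>0 int) \<Rightarrow> 'g::linordered_ab_group_add"
  assumes add: "\<phi> (m + m') = \<phi> m + \<phi> m'"
begin

lemma rdeg_quot:
  assumes "p \<noteq> 0" "q \<noteq> 0" shows "rdeg \<phi> (to_ratfun p / to_ratfun q) = ldeg \<phi> p - ldeg \<phi> q"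
proof -
  let ?P = "\<lambda>d. \<exists>p' q'. p' \<noteq> 0 \<and> q' \<noteq> 0 \<and> to_ratfun p / to_ratfun q = to_ratfun p' / to_ratfun q'
    \<and> d = ldeg \<phi> p' - ldeg \<phi> q'"
  have "?P (rdeg \<phi> (to_ratfun p / to_ratfun q))"
    unfolding rdeg_def by (rule someI_ex) (use assms in blast)
  then obtain p' q' where *: "p' \<noteq> 0" "q' \<noteq> 0" "to_ratfun p / to_ratfun q = to_ratfun p' / to_ratfun q'"
    "rdeg \<phi> (to_ratfun p / to_ratfun q) = ldeg \<phi> p' - ldeg \<phi> q'" by blast
  hence "to_ratfun (p * q') = to_ratfun (p' * q)"
    using assms by (simp add: field_simps)
  hence "ldeg \<phi> p + ldeg \<phi> q' = ldeg \<phi> p' + ldeg \<phi> q"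
    using * assms by (simp add: ldeg_mult[OF add, symmetric] del: to_ratfun_simps)
  hence "ldeg \<phi> p - ldeg \<phi> q = ldeg \<phi> p' - ldeg \<phi> q'" by (simp add: algebra_simps)
  with * show ?thesis by simp
qed

lemma rdeg_to_ratfun: "p \<noteq> 0 \<Longrightarrow> rdeg \<phi> (to_ratfun p) = ldeg \<phi> p"
  using rdeg_quot[of p 1] add[of 0 0] by (simp add: ldeg_def)

lemma rdeg_mult:
  assumes "f \<noteq> 0" "g \<noteq> 0" shows "rdeg \<phi> (f * g) = rdeg \<phi> f + rdeg \<phi> g"
proof -
  obtain p q where f: "f = to_ratfun p / to_ratfun q" "q \<noteq> 0" by (rule ratfun_cases)
  obtain p' q' where g: "g = to_ratfun p' / to_ratfun q'" "q' \<noteq> 0" by (rule ratfun_cases)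
  have nz: "p \<noteq> 0" "p' \<noteq> 0" using assms f g by auto
  have "f * g = to_ratfun (p * p') / to_ratfun (q * q')" by (simp add: f g)
  thus ?thesis using f g nz by (simp add: rdeg_quot ldeg_mult add del: to_ratfun_simps)
qed

lemma rdeg_1 [simp]: "rdeg \<phi> 1 = 0"
  using rdeg_mult[of 1 1] by simp

lemma rdeg_inverse: "f \<noteq> 0 \<Longrightarrow> rdeg \<phi> (inverse f) = - rdeg \<phi> f"
  using rdeg_mult[of f "inverse f"] by (simp add: eq_neg_iff_add_eq_0 add.commute)

lemma rdeg_divide: "f \<noteq> 0 \<Longrightarrow> g \<noteq> 0 \<Longrightarrow> rdeg \<phi> (f / g) = rdeg \<phi> f - rdeg \<phi> g"
  by (simp add: divide_inverse rdeg_mult rdeg_inverse)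

lemma rdeg_prod: "(\<And>i. i \<in> A \<Longrightarrow> f i \<noteq> 0) \<Longrightarrow> rdeg \<phi> (\<Prod>i\<in>A. f i) = (\<Sum>i\<in>A. rdeg \<phi> (f i))"
  by (induction A rule: infinite_finite_induct) (simp_all add: rdeg_mult)

lemma rdeg_rconst: "c \<noteq> 0 \<Longrightarrow> rdeg \<phi> (rconst c) = 0"
  using add[of 0 0] rconst_eq_0_iff[of c]
  by (simp add: rconst_def lconst_def rdeg_to_ratfun ldeg_single)

lemma rdeg_rvar: "rdeg \<phi> (rvar i) = \<phi> (single i 1)"
  using lvar_nonzero[of i] unfolding rvar_def lvar_def by (subst rdeg_to_ratfun) (simp_all add: ldeg_single)

lemma rdeg_add_less:
  assumes "f \<noteq> 0" "g \<noteq> 0" "rdeg \<phi> f < rdeg \<phi> g"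
  shows "f + g \<noteq> 0 \<and> rdeg \<phi> (f + g) = rdeg \<phi> g"
proof -
  obtain p q where f: "f = to_ratfun p / to_ratfun q" "q \<noteq> 0" by (rule ratfun_cases)
  obtain p' q' where g: "g = to_ratfun p' / to_ratfun q'" "q' \<noteq> 0" by (rule ratfun_cases)
  have nz: "p \<noteq> 0" "p' \<noteq> 0" using assms f g by auto
  let ?a = "p * q'" and ?b = "p' * q"
  have lt: "ldeg \<phi> ?a < ldeg \<phi> ?b"
    using assms f g by (simp add: rdeg_quot ldeg_mult add algebra_simps)
  have "?b \<noteq> 0" using f nz by simp
  then obtain m where m: "m \<in> keys ?b" "\<phi> m = ldeg \<phi> ?b" using ldeg_attained by blast
  have "m \<notin> keys ?a" using ldeg_ge[of m ?a \<phi>] m lt by (metis not_le)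
  hence mk: "m \<in> keys (?a + ?b)" using m by (simp add: in_keys_iff)
  have "ldeg \<phi> (?a + ?b) = ldeg \<phi> ?b"
  proof (rule ldeg_eqI)
    fix k assume "k \<in> keys (?a + ?b)"
    hence "k \<in> keys ?a \<or> k \<in> keys ?b" using keys_add[of ?a ?b] by blast
    thus "\<phi> k \<le> ldeg \<phi> ?b" using ldeg_ge[of k ?a \<phi>] ldeg_ge[of k ?b \<phi>] lt
      by (meson less_imp_le order_trans)
  qed (rule bexI[where x = m], (rule m(2) mk)+)
  moreover have ab: "?a + ?b \<noteq> 0" using mk by (metis keys_zero empty_iff)
  moreover have sum: "f + g = to_ratfun (?a + ?b) / to_ratfun (q * q')"
    using f g by (simp add: field_simps)
  ultimately have "rdeg \<phi> (f + g) = ldeg \<phi> ?b - ldeg \<phi> (q * q')"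
    using f g by (simp add: rdeg_quot del: to_ratfun_simps)
  also have "\<dots> = rdeg \<phi> g" using f g nz by (simp add: rdeg_quot ldeg_mult add)
  finally show ?thesis using sum ab f g by (simp del: to_ratfun_simps)
qed

end

lemma weight_id: "weight id" by unfold_locales simp

lemma weight_lookup: "weight (\<lambda>m. - lookup m k)" by unfold_locales simp

text \<open>With \<open>id\<close> as weight, the degree is the leading exponent vector itself, in
  the linear order of the exponent group.\<close>

definition lm :: "ratfun \<Rightarrow> nat \<Rightarrow>\<^sub>0 int" where "lm = rdeg id"

lemmas lm_mult = weight.rdeg_mult[OF weight_id, folded lm_def]
lemmas lm_prod = weight.rdeg_prod[OF weight_id, folded lm_def]
lemmas lm_1 = weight.rdeg_1[OF weight_id, folded lm_def]
lemmas lm_divide = weight.rdeg_divide[OF weight_id, folded lm_def]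
lemmas lm_inverse = weight.rdeg_inverse[OF weight_id, folded lm_def]
lemmas lm_rconst = weight.rdeg_rconst[OF weight_id, folded lm_def]
lemmas lm_add_less = weight.rdeg_add_less[OF weight_id, folded lm_def]

lemma lm_rvar: "lm (rvar i) = frag_of i"
  unfolding lm_def weight.rdeg_rvar[OF weight_id] by simp

text \<open>The order of the pole along \<open>rvar k = 0\<close>: minus the order of vanishing.\<close>

definition pole :: "nat \<Rightarrow> ratfun \<Rightarrow> int" where
  "pole k = rdeg (\<lambda>m. - lookup m k)"

lemmas pole_mult = weight.rdeg_mult[OF weight_lookup, folded pole_def]
lemmas pole_prod = weight.rdeg_prod[OF weight_lookup, folded pole_def]
lemmas pole_1 = weight.rdeg_1[OF weight_lookup, folded pole_def]
lemmas pole_divide = weight.rdeg_divide[OF weight_lookup, folded pole_def]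
lemmas pole_inverse = weight.rdeg_inverse[OF weight_lookup, folded pole_def]

lemma pole_rvar [simp]: "pole k (rvar i) = (if i = k then -1 else 0)"
  by (simp add: pole_def weight.rdeg_rvar[OF weight_lookup])

lemma pole_power: "f \<noteq> 0 \<Longrightarrow> pole k (f ^ e) = int e * pole k f"
  by (induction e) (simp_all add: pole_1 pole_mult algebra_simps)

lemma pole_powi: "f \<noteq> 0 \<Longrightarrow> pole k (f powi e) = e * pole k f"
  using pole_power[of f k "nat e"] pole_power[of f k "nat (- e)"]
  by (cases "e \<ge> 0") (auto simp: power_int_def pole_inverse power_inverse)

lemma pole_to_ratfun:
  assumes "p \<noteq> 0" shows "pole k (to_ratfun p) = denom_exp k p"
proof -
  have "- Min A = Max (uminus ` A)" if "finite A" "A \<noteq> {}" for A :: "int set"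
    using that by (intro Max_eqI[symmetric]) auto
  thus ?thesis
    using assms by (simp add: pole_def weight.rdeg_to_ratfun[OF weight_lookup] ldeg_def denom_exp_def image_image)
qed

subsection \<open>Leading coefficients\<close>

text \<open>Leading coefficient 1 for quotients, stated without normalizing numerator or
  denominator. It excludes a constant factor when a cluster variable turns out to be a multiple of
  an initial one.\<close>

definition monic :: "ratfun \<Rightarrow> bool" where
  "monic f \<longleftrightarrow> (\<exists>p q. p \<noteq> 0 \<and> q \<noteq> 0 \<and> f = to_ratfun p / to_ratfun q \<and> lead p = lead q)"

lemma monicD: "monic (to_ratfun p / to_ratfun q) \<Longrightarrow> p \<noteq> 0 \<Longrightarrow> q \<noteq> 0 \<Longrightarrow> lead p = lead q"
proof -
  assume "monic (to_ratfun p / to_ratfun q)" and nz: "p \<noteq> 0" "q \<noteq> 0"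
  then obtain p' q' where *: "p' \<noteq> 0" "q' \<noteq> 0" "to_ratfun p / to_ratfun q = to_ratfun p' / to_ratfun q'"
    "lead p' = lead q'" unfolding monic_def by blast
  hence "to_ratfun (p * q') = to_ratfun (p' * q)" using nz by (simp add: field_simps)
  hence "p * q' = p' * q" by (simp only: to_ratfun_eq_iff)
  hence "lead p * lead q' = lead p' * lead q" using * nz by (metis lead_mult)
  with * nz lead_nonzero show ?thesis by (metis mult.commute mult_cancel_left)
qed

lemma monic_nonzero: "monic f \<Longrightarrow> f \<noteq> 0" by (auto simp: monic_def)

lemma monic_mult: "monic f \<Longrightarrow> monic g \<Longrightarrow> monic (f * g)"
  unfolding monic_def
proof clarsimp
  fix p q p' q' :: "nat laurent"
  assume "p \<noteq> 0" "q \<noteq> 0" "p' \<noteq> 0" "q' \<noteq> 0" "lead p = lead q" "lead p' = lead q'"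
  thus "\<exists>a. a \<noteq> 0 \<and> (\<exists>b. b \<noteq> 0 \<and>
     to_ratfun p * to_ratfun p' / (to_ratfun q * to_ratfun q') = to_ratfun a / to_ratfun b \<and> lead a = lead b)"
    by (intro exI[of _ "p * p'"] exI[of _ "q * q'"] conjI) (simp_all add: lead_mult)
qed

lemma monic_inverse: assumes "monic f" shows "monic (inverse f)"
proof -
  obtain p q where "p \<noteq> 0" "q \<noteq> 0" "f = to_ratfun p / to_ratfun q" "lead p = lead q"
    using assms unfolding monic_def by blast
  thus ?thesis unfolding monic_def by (intro exI[of _ q] exI[of _ p]) simp
qed

lemma monic_divide: "monic f \<Longrightarrow> monic g \<Longrightarrow> monic (f / g)"
  by (simp add: divide_inverse monic_mult monic_inverse)

lemma monic_1 [simp]: "monic 1"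
  unfolding monic_def by (intro exI[of _ 1]) simp

lemma monic_rvar [simp]: "monic (rvar i)"
proof -
  have "lead (lvar i) = lead 1" "lvar i \<noteq> 0"
    using rvar_nonzero[of i] by (simp_all add: lead_def lvar_def ldeg_def rvar_def)
  thus ?thesis unfolding monic_def rvar_def by (intro exI[of _ "lvar i"] exI[of _ 1]) simp
qed

lemma monic_power: "monic f \<Longrightarrow> monic (f ^ k)" by (induction k) (simp_all add: monic_mult)

lemma monic_prod: "(\<And>i. i \<in> A \<Longrightarrow> monic (f i)) \<Longrightarrow> monic (\<Prod>i\<in>A. f i)"
  by (induction A rule: infinite_finite_induct) (simp_all add: monic_mult)

lemma monic_add_less:
  assumes "monic f" "monic g" "lm f < lm g" shows "monic (f + g)"
proof -
  obtain p q where f: "f = to_ratfun p / to_ratfun q" "p \<noteq> 0" "q \<noteq> 0" "lead p = lead q"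
    using assms(1) by (auto simp: monic_def)
  obtain p' q' where g: "g = to_ratfun p' / to_ratfun q'" "p' \<noteq> 0" "q' \<noteq> 0" "lead p' = lead q'"
    using assms(2) by (auto simp: monic_def)
  let ?a = "p * q'" and ?b = "p' * q"
  interpret weight id by (rule weight_id)
  have lt: "ldeg id ?a < ldeg id ?b"
    using assms f g by (simp add: lm_def rdeg_quot ldeg_mult algebra_simps)
  have sum: "f + g = to_ratfun (?a + ?b) / to_ratfun (q * q')"
    using f g by (simp add: field_simps)
  have "f \<noteq> 0" "g \<noteq> 0" using assms(1,2) by (simp_all add: monic_nonzero)
  hence "f + g \<noteq> 0" using lm_add_less assms(3) by blast
  hence nz: "?a + ?b \<noteq> 0" unfolding sum by (metis div_0 to_ratfun_simps(4))
  have "to_ratfun ?a + to_ratfun ?b \<noteq> 0 \<and> rdeg id (to_ratfun ?a + to_ratfun ?b) = rdeg id (to_ratfun ?b)"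
    by (rule rdeg_add_less) (use f g lt in \<open>simp_all add: rdeg_to_ratfun del: to_ratfun_simps\<close>)
  hence "ldeg id (?a + ?b) = ldeg id ?b"
    using rdeg_to_ratfun[of "?a + ?b"] rdeg_to_ratfun[of ?b] f g nz by simp
  moreover have "lookup ?a (ldeg id ?b) = 0"
    using lt ldeg_ge[of "ldeg id ?b" ?a id] by (metis id_apply in_keys_iff not_le)
  ultimately have "lead (?a + ?b) = lead ?b" by (simp add: lead_def)
  with f g nz sum show ?thesis unfolding monic_def
    by (intro exI[of _ "?a + ?b"] exI[of _ "q * q'"]) (simp add: lead_mult)
qed

lemma monic_rconst_mult: "monic f \<Longrightarrow> monic (rconst c * f) \<Longrightarrow> c = 1"
proof -
  assume f: "monic f" and cf: "monic (rconst c * f)"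
  hence c: "monic (rconst c)" using monic_divide[OF cf f] monic_nonzero[OF f] by simp
  hence "c \<noteq> 0" using monic_nonzero[OF c] by simp
  have nz: "(lconst c :: nat laurent) \<noteq> 0"
    using monic_nonzero[OF c] by (simp add: rconst_def)
  have "monic (to_ratfun (lconst c) / to_ratfun 1)" using c by (simp add: rconst_def)
  hence "lead (lconst c :: nat laurent) = lead (1 :: nat laurent)" using nz by (rule monicD) simp
  with \<open>c \<noteq> 0\<close> show "c = 1" by (simp add: lead_def lconst_def ldeg_def)
qed

subsection \<open>Positivity\<close>

definition nonneg :: "complex set" where "nonneg = complex_of_real ` {0..}"

lemma nonneg_simps [simp]: "0 \<in> nonneg" "1 \<in> nonneg"
  by (auto simp: nonneg_def)

lemma nonneg_closed: "c \<in> nonneg \<Longrightarrow> d \<in> nonneg \<Longrightarrow> c + d \<in> nonneg"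
  "c \<in> nonneg \<Longrightarrow> d \<in> nonneg \<Longrightarrow> c * d \<in> nonneg"
  unfolding nonneg_def by (auto simp flip: of_real_add of_real_mult)

lemma nonneg_add_eq_0: "c \<in> nonneg \<Longrightarrow> d \<in> nonneg \<Longrightarrow> c + d = 0 \<longleftrightarrow> c = 0 \<and> d = 0"
  unfolding nonneg_def by (auto simp flip: of_real_add)

definition lpos :: "nat laurent \<Rightarrow> bool" where
  "lpos p \<longleftrightarrow> p \<noteq> 0 \<and> (\<forall>m. lookup p m \<in> nonneg)"

text \<open>Sums of such quotients never lose leading terms, which turns exchange relations into
  recursions for degrees.\<close>

definition rpos :: "ratfun \<Rightarrow> bool" where
  "rpos f \<longleftrightarrow> (\<exists>p q. lpos p \<and> lpos q \<and> f = to_ratfun p / to_ratfun q)"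

lemma keys_add_lpos:
  assumes "lpos p" "lpos q"
  shows "keys (p + q) = keys p \<union> keys q"
  using assms by (auto simp: in_keys_iff lpos_def nonneg_add_eq_0)

lemma lpos_add: assumes "lpos p" "lpos q" shows "lpos (p + q)"
proof -
  have "keys (p + q) \<noteq> {}" using assms by (simp add: keys_add_lpos lpos_def)
  thus ?thesis using assms by (auto simp: lpos_def nonneg_closed)
qed

lemma lookup_mult_nonneg:
  assumes "\<forall>m. lookup p m \<in> nonneg" "\<forall>m. lookup q m \<in> nonneg"
  shows "lookup (p * q) m \<in> nonneg"
proof -
  have *: "sum f A \<in> nonneg" if "\<And>i. i \<in> A \<Longrightarrow> f i \<in> nonneg" for f and A :: "'b set"
    using that by (induction A rule: infinite_finite_induct) (simp_all add: nonneg_closed)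
  have "lookup ((\<Sum>m\<in>keys p. single m (lookup p m)) *
      (\<Sum>m\<in>keys q. single m (lookup q m))) m \<in> nonneg"
    unfolding sum_product lookup_sum using assms
    by (intro *) (simp add: when_def nonneg_closed)
  thus ?thesis by (simp only: poly_mapping_sum_single)
qed

lemma lpos_mult: "lpos p \<Longrightarrow> lpos q \<Longrightarrow> lpos (p * q)"
  by (simp add: lpos_def lookup_mult_nonneg)

lemma lpos_1 [simp]: "lpos 1"
  by (simp add: lpos_def lookup_one when_def)

lemma lpos_lvar: "lpos (lvar i)"
  using lvar_nonzero[of i] by (simp add: lpos_def lvar_def when_def)

lemma rpos_nonzero: "rpos f \<Longrightarrow> f \<noteq> 0" by (auto simp: rpos_def lpos_def)

lemma rposI: "lpos p \<Longrightarrow> lpos q \<Longrightarrow> rpos (to_ratfun p / to_ratfun q)"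
  unfolding rpos_def by blast

lemma rposE:
  assumes "rpos f" obtains p q where "f = to_ratfun p / to_ratfun q" "lpos p" "lpos q"
  using assms unfolding rpos_def by blast

lemma rpos_mult: assumes "rpos f" "rpos g" shows "rpos (f * g)"
proof -
  obtain p q p' q' where "f = to_ratfun p / to_ratfun q" "lpos p" "lpos q"
    "g = to_ratfun p' / to_ratfun q'" "lpos p'" "lpos q'" using assms by (elim rposE)
  thus ?thesis using rposI[of "p * p'" "q * q'"] by (simp add: lpos_mult)
qed

lemma rpos_inverse: "rpos f \<Longrightarrow> rpos (inverse f)"
  by (elim rposE) (simp add: rposI)

lemma rpos_divide: "rpos f \<Longrightarrow> rpos g \<Longrightarrow> rpos (f / g)"
  by (simp add: divide_inverse rpos_mult rpos_inverse)

lemma rpos_1 [simp]: "rpos 1"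
  using rposI[of 1 1] by simp

lemma rpos_rvar [simp]: "rpos (rvar i)"
  using rposI[OF lpos_lvar[of i], of 1] by (simp add: rvar_def)

lemma rpos_power: "rpos f \<Longrightarrow> rpos (f ^ k)" by (induction k) (simp_all add: rpos_mult)

lemma rpos_prod: "(\<And>i. i \<in> A \<Longrightarrow> rpos (f i)) \<Longrightarrow> rpos (\<Prod>i\<in>A. f i)"
  by (induction A rule: infinite_finite_induct) (simp_all add: rpos_mult)

text \<open>Over a common denominator the two numerators have non-negative coefficients, so the
  exponents of their sum are all the exponents of both.\<close>

lemma rpos_add_rdeg:
  assumes "rpos f" "rpos g"
  shows "rpos (f + g)" and "weight \<phi> \<Longrightarrow> rdeg \<phi> (f + g) = max (rdeg \<phi> f) (rdeg \<phi> g)"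
proof -
  obtain p q where f: "f = to_ratfun p / to_ratfun q" "lpos p" "lpos q" using assms by (auto simp: rpos_def)
  obtain p' q' where g: "g = to_ratfun p' / to_ratfun q'" "lpos p'" "lpos q'" using assms by (auto simp: rpos_def)
  have nz: "p \<noteq> 0" "q \<noteq> 0" "p' \<noteq> 0" "q' \<noteq> 0" using f g by (auto simp: lpos_def)
  let ?a = "p * q'" and ?b = "p' * q"
  have pos: "lpos ?a" "lpos ?b" using f g lpos_mult by auto
  have sum: "f + g = to_ratfun (?a + ?b) / to_ratfun (q * q')"
    using nz by (simp add: f g field_simps)
  thus "rpos (f + g)" using rposI lpos_add[OF pos] lpos_mult f g by (simp del: to_ratfun_simps)
  assume "weight \<phi>"
  then interpret weight \<phi> .
  have "ldeg \<phi> (?a + ?b) = max (ldeg \<phi> ?a) (ldeg \<phi> ?b)"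
    unfolding ldeg_def keys_add_lpos[OF pos] image_Un using nz
    by (intro Max_Un) simp_all
  moreover have "?a + ?b \<noteq> 0" using lpos_add[OF pos] by (simp add: lpos_def)
  ultimately have "rdeg \<phi> (f + g) = max (ldeg \<phi> ?a) (ldeg \<phi> ?b) - ldeg \<phi> (q * q')"
    unfolding sum using nz by (simp add: rdeg_quot del: to_ratfun_simps)
  also have "\<dots> = max (ldeg \<phi> ?a - ldeg \<phi> (q * q')) (ldeg \<phi> ?b - ldeg \<phi> (q * q'))"
    by (simp add: max_diff_distrib_left)
  finally show "rdeg \<phi> (f + g) = max (rdeg \<phi> f) (rdeg \<phi> g)"
    using nz unfolding f(1) g(1) by (simp add: rdeg_quot ldeg_mult add)
qed

lemmas rpos_add = rpos_add_rdeg(1)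
lemmas pole_add = rpos_add_rdeg(2)[OF _ _ weight_lookup, folded pole_def]


section \<open>Substitutions\<close>

text \<open>Linear independence of the leading exponents of the \<open>x i\<close>. It implies
  algebraic independence (\<open>ev_nonzero\<close>) and is easy to carry through mutations.\<close>

definition lm_indep :: "(nat \<Rightarrow> ratfun) \<Rightarrow> bool" where
  "lm_indep x \<longleftrightarrow> (\<forall>i. x i \<noteq> 0) \<and> inj (frag_extend (\<lambda>i. lm (x i)))"

lemma lm_powi: "f \<noteq> 0 \<Longrightarrow> lm (f powi k) = frag_cmul k (lm f)"
proof -
  assume f: "f \<noteq> 0"
  have p: "lm (f ^ j) = frag_cmul (int j) (lm f)" for j
    by (induction j) (simp_all add: lm_1 lm_mult f frag_cmul_distrib)
  show ?thesis
    using p[of "nat k"] p[of "nat (-k)"] f by (cases "k \<ge> 0") (simp_all add: power_int_def lm_inverse power_inverse)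
qed

lemma lm_monomial:
  assumes "\<And>i. x i \<noteq> 0" shows "lm (monomial x m) = frag_extend (\<lambda>i. lm (x i)) m"
  using lm_prod[of "keys m" "\<lambda>i. x i powi lookup m i"] assms
  by (simp add: monomial_def lm_powi frag_extend_def)

text \<open>Distinct monomials in the \<open>x i\<close> have distinct leading exponents, so the
  largest of them survives in any sum.\<close>

lemma ev_nonzero:
  assumes x: "lm_indep x" and p: "p \<noteq> 0"
  shows "ev x p \<noteq> 0"
proof -
  have nz: "x i \<noteq> 0" for i using x by (simp add: lm_indep_def)
  have inj: "lm (monomial x m) = lm (monomial x m') \<Longrightarrow> m = m'" for m m'
    using x by (auto simp: lm_monomial lm_indep_def inj_def)
  let ?t = "\<lambda>m. rconst (lookup p m) * monomial x m"
  have t: "?t m \<noteq> 0 \<and> lm (?t m) = lm (monomial x m)" if "lookup p m \<noteq> 0" for m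
    using that nz by (simp add: lm_mult lm_rconst)
  have "sum ?t A \<noteq> 0 \<and> (\<exists>m\<in>A. lm (sum ?t A) = lm (monomial x m))"
    if "finite A" "A \<noteq> {}" "\<forall>m\<in>A. lookup p m \<noteq> 0" for A
    using that
  proof (induction A rule: finite_ne_induct)
    case (singleton m)
    thus ?case using t[of m] by simp
  next
    case (insert m F)
    hence "sum ?t F \<noteq> 0 \<and> (\<exists>m\<in>F. lm (sum ?t F) = lm (monomial x m))" by simp
    then obtain m' where m': "m' \<in> F" "lm (sum ?t F) = lm (monomial x m')" and F: "sum ?t F \<noteq> 0" by blast
    have m: "?t m \<noteq> 0" "lm (?t m) = lm (monomial x m)" using t insert by auto
    have "m \<noteq> m'" using m' insert by auto
    hence "lm (?t m) \<noteq> lm (sum ?t F)" using inj m m' by metis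
    then consider "lm (?t m) < lm (sum ?t F)" | "lm (sum ?t F) < lm (?t m)"
      using linorder_less_linear[of "lm (?t m)" "lm (sum ?t F)"] by blast
    thus ?case
    proof cases
      case 1
      hence "?t m + sum ?t F \<noteq> 0 \<and> lm (?t m + sum ?t F) = lm (monomial x m')"
        using lm_add_less[OF m(1) F] m' by simp
      thus ?thesis unfolding sum.insert[OF insert(1,3)] using m' by blast
    next
      case 2
      hence "?t m + sum ?t F \<noteq> 0 \<and> lm (?t m + sum ?t F) = lm (monomial x m)"
        using lm_add_less[OF F m(1)] m(2) by (simp add: add.commute)
      thus ?thesis unfolding sum.insert[OF insert(1,3)] by blast
    qed
  qed
  from this[of "keys p"] p show ?thesis
    by (simp add: ev_def lev_def in_keys_iff)
qed

lemma ev_inj: "lm_indep x \<Longrightarrow> ev x p = ev x q \<longleftrightarrow> p = q"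
  using ev_nonzero[of x "p - q"] by (auto simp: lm_indep_def)

lemma frag_extend_lm_rvar: "frag_extend (\<lambda>i. lm (rvar i)) = id"
  by (rule ext) (simp add: lm_rvar flip: frag_expansion)

lemma lm_indep_rvar [simp]: "lm_indep rvar"
  by (simp add: lm_indep_def frag_extend_lm_rvar)

section \<open>Homomorphisms of the field of rational functions and partial substitutions\<close>

definition field_hom :: "(ratfun \<Rightarrow> ratfun) \<Rightarrow> bool" where
  "field_hom h \<longleftrightarrow> (\<forall>f g. h (f + g) = h f + h g) \<and> (\<forall>f g. h (f * g) = h f * h g) \<and> (\<forall>c. h (rconst c) = rconst c)"

lemma field_homD:
  assumes "field_hom h"
  shows "h (f + g) = h f + h g" "h (f * g) = h f * h g" "h (rconst c) = rconst c" "h 1 = 1" "h 0 = 0"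
  using assms rconst_simps(3,4) unfolding field_hom_def by metis+

lemma field_hom_eq_0_iff: "field_hom h \<Longrightarrow> h f = 0 \<longleftrightarrow> f = 0"
  using field_homD(2)[of h f "inverse f"] field_homD(4,5)[of h] by (cases "f = 0") auto

lemma field_hom_uminus: "field_hom h \<Longrightarrow> h (- f) = - h f"
  using field_homD(1)[of h f "- f"] by (simp add: field_homD eq_neg_iff_add_eq_0 add.commute)

lemma field_hom_diff: "field_hom h \<Longrightarrow> h (f - g) = h f - h g"
  using field_homD(1)[of h f "- g"] by (simp add: field_hom_uminus)

lemma field_hom_inj: "field_hom h \<Longrightarrow> h f = h g \<longleftrightarrow> f = g"
  using field_hom_eq_0_iff[of h "f - g"] by (simp add: field_hom_diff)

lemma field_hom_inverse: "field_hom h \<Longrightarrow> h (inverse f) = inverse (h f)"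
  using field_homD(2)[of h f "inverse f"] by (cases "f = 0") (auto simp: field_homD intro: inverse_unique[symmetric])

lemma field_hom_divide: "field_hom h \<Longrightarrow> h (f / g) = h f / h g"
  by (simp add: divide_inverse field_homD field_hom_inverse)

lemma field_hom_power: "field_hom h \<Longrightarrow> h (f ^ k) = h f ^ k"
  by (induction k) (simp_all add: field_homD)

lemma field_hom_prod: "field_hom h \<Longrightarrow> h (\<Prod>i\<in>A. f i) = (\<Prod>i\<in>A. h (f i))"
  by (induction A rule: infinite_finite_induct) (simp_all add: field_homD)

lemma field_hom_sum: "field_hom h \<Longrightarrow> h (\<Sum>i\<in>A. f i) = (\<Sum>i\<in>A. h (f i))"
  by (induction A rule: infinite_finite_induct) (simp_all add: field_homD)

lemma field_hom_powi: "field_hom h \<Longrightarrow> h (f powi k) = h f powi k"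
  by (simp add: power_int_def field_hom_power field_hom_inverse)

lemma field_hom_monomial: "field_hom h \<Longrightarrow> h (monomial x m) = monomial (h \<circ> x) m"
  by (simp add: monomial_def field_hom_prod field_hom_powi)

lemma field_hom_ev: "field_hom h \<Longrightarrow> h (ev x p) = ev (h \<circ> x) p"
  by (simp add: ev_def lev_def field_hom_sum field_homD field_hom_monomial)

text \<open>Substitution into quotients is a partial map in general. For independent
  \<open>x\<close> it is a field homomorphism; for the evaluation at \<open>unit_pt\<close> it is
  meaningful on \<open>regular\<close> only.\<close>

definition fhom :: "(nat \<Rightarrow> ratfun) \<Rightarrow> ratfun \<Rightarrow> ratfun" where
  "fhom x f = (SOME g. \<exists>p q. ev x q \<noteq> 0 \<and> f = to_ratfun p / to_ratfun q \<and> g = ev x p / ev x q)"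

definition regular :: "(nat \<Rightarrow> ratfun) \<Rightarrow> ratfun set" where
  "regular x = {to_ratfun p / to_ratfun q |p q. ev x q \<noteq> 0}"

lemma fhom_quot:
  assumes nz: "\<And>i. x i \<noteq> 0" and q: "ev x q \<noteq> 0"
  shows "fhom x (to_ratfun p / to_ratfun q) = ev x p / ev x q"
proof -
  let ?P = "\<lambda>g. \<exists>p' q'. ev x q' \<noteq> 0 \<and> to_ratfun p / to_ratfun q = to_ratfun p' / to_ratfun q' \<and> g = ev x p' / ev x q'"
  have "?P (fhom x (to_ratfun p / to_ratfun q))"
    unfolding fhom_def by (rule someI_ex) (use q in blast)
  then obtain p' q' where *: "ev x q' \<noteq> 0" "to_ratfun p / to_ratfun q = to_ratfun p' / to_ratfun q'"
    "fhom x (to_ratfun p / to_ratfun q) = ev x p' / ev x q'" by blast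
  have "q \<noteq> 0" "q' \<noteq> 0" using q *(1) by (auto simp: nz)
  hence "to_ratfun (p * q') = to_ratfun (p' * q)" using *(2) by (simp add: field_simps)
  hence "ev x (p * q') = ev x (p' * q)" by (simp only: to_ratfun_eq_iff)
  thus ?thesis using q *(1,3) by (simp add: nz frac_eq_eq)
qed

lemma fhom_regular:
  assumes nz: "\<And>i. x i \<noteq> 0" and "f \<in> regular x" "g \<in> regular x"
  shows "f + g \<in> regular x" "f * g \<in> regular x" "fhom x (f + g) = fhom x f + fhom x g" "fhom x (f * g) = fhom x f * fhom x g"
proof -
  obtain p q p' q' where f: "f = to_ratfun p / to_ratfun q" "ev x q \<noteq> 0" and g: "g = to_ratfun p' / to_ratfun q'" "ev x q' \<noteq> 0"
    using assms unfolding regular_def by blast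
  have "q \<noteq> 0" "q' \<noteq> 0" using f g by (auto simp: nz)
  hence s: "f + g = to_ratfun (p * q' + p' * q) / to_ratfun (q * q')" "f * g = to_ratfun (p * p') / to_ratfun (q * q')"
    by (simp_all add: f g field_simps)
  have qq: "ev x (q * q') \<noteq> 0" using f g by (simp add: nz)
  show "f + g \<in> regular x" "f * g \<in> regular x" unfolding s regular_def using qq by blast+
  note F = fhom_quot[of x, OF nz]
  show "fhom x (f + g) = fhom x f + fhom x g" "fhom x (f * g) = fhom x f * fhom x g"
    unfolding s F[OF qq] unfolding f(1) g(1) F[OF f(2)] F[OF g(2)] using f(2) g(2) by (simp_all add: nz add_frac_eq)
qed

lemma fhom_unit:
  assumes nz: "\<And>i. x i \<noteq> 0" and "ev x p \<noteq> 0"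
  shows "inverse (to_ratfun p) \<in> regular x" "fhom x (inverse (to_ratfun p)) = inverse (ev x p)"
proof -
  have "inverse (to_ratfun p) = to_ratfun 1 / to_ratfun p" by (simp add: divide_inverse)
  thus "inverse (to_ratfun p) \<in> regular x" "fhom x (inverse (to_ratfun p)) = inverse (ev x p)"
    using assms(2) fhom_quot[OF assms, of 1] unfolding regular_def by (blast, simp add: nz divide_inverse)
qed

lemma fhom_to_ratfun:
  assumes nz: "\<And>i. x i \<noteq> 0" shows "to_ratfun p \<in> regular x" "fhom x (to_ratfun p) = ev x p"
proof -
  have "to_ratfun p = to_ratfun p / to_ratfun 1" "ev x 1 \<noteq> 0" by (simp_all add: nz)
  thus "to_ratfun p \<in> regular x" "fhom x (to_ratfun p) = ev x p"
    using fhom_quot[of x 1 p] nz unfolding regular_def by (blast, simp)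
qed

lemma fhom_rconst: "(\<And>i. x i \<noteq> 0) \<Longrightarrow> fhom x (rconst c) = rconst c"
  by (simp add: rconst_def[of c] fhom_to_ratfun)

lemma fhom_rvar: "lm_indep x \<Longrightarrow> fhom x (rvar i) = x i"
  by (simp add: rvar_def fhom_to_ratfun lm_indep_def)

lemma fhom_comp_rvar: "lm_indep x \<Longrightarrow> fhom x \<circ> rvar = x"
  by (auto simp: fhom_rvar)

lemma field_hom_fhom:
  assumes x: "lm_indep x" shows "field_hom (fhom x)"
proof -
  have nz: "x i \<noteq> 0" for i using x by (simp add: lm_indep_def)
  have "f \<in> regular x" for f by (rule ratfun_cases[of f]) (use ev_nonzero[OF x] in \<open>auto simp: regular_def\<close>)
  thus ?thesis using fhom_regular(3,4)[of x, OF nz] fhom_rconst[of x, OF nz] unfolding field_hom_def by blast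
qed

lemma field_hom_eq_ev:
  assumes "field_hom h" shows "h (to_ratfun p) = ev (h \<circ> rvar) p"
  using field_hom_ev[OF assms, of rvar p] by (simp add: ev_rvar)

lemma field_hom_eqI:
  assumes "field_hom h" "field_hom h'" "\<And>i. h (rvar i) = h' (rvar i)" shows "h = h'"
proof
  fix f
  obtain p q where f: "f = to_ratfun p / to_ratfun q" "q \<noteq> 0" by (rule ratfun_cases)
  have "h \<circ> rvar = h' \<circ> rvar" using assms by auto
  thus "h f = h' f" by (simp add: f field_hom_divide[OF assms(1)] field_hom_divide[OF assms(2)]
      field_hom_eq_ev[OF assms(1)] field_hom_eq_ev[OF assms(2)])
qed

lemma field_hom_comp: "field_hom h \<Longrightarrow> field_hom h' \<Longrightarrow> field_hom (h \<circ> h')"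
  by (simp add: field_hom_def)

section \<open>Seeds and mutations\<close>

definition mon_pos :: "nat \<Rightarrow> (nat \<Rightarrow> 'a::comm_monoid_mult) \<Rightarrow> (nat \<Rightarrow> nat \<Rightarrow> int) \<Rightarrow> nat \<Rightarrow> 'a" where
  "mon_pos N x b k = (\<Prod>i<N. x i ^ nat (b i k))"

definition mon_neg :: "nat \<Rightarrow> (nat \<Rightarrow> 'a::comm_monoid_mult) \<Rightarrow> (nat \<Rightarrow> nat \<Rightarrow> int) \<Rightarrow> nat \<Rightarrow> 'a" where
  "mon_neg N x b k = (\<Prod>i<N. x i ^ nat (- b i k))"

lemma mutate_eq: "mutate N k (x, b) = (x(k := (mon_pos N x b k + mon_neg N x b k) / x k), mutate_matrix k b)"
proof -
  have "(\<Prod>i\<in>{i \<in> {..<N}. b i k > 0}. x i ^ nat (b i k)) = mon_pos N x b k"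
    "(\<Prod>i\<in>{i \<in> {..<N}. b i k < 0}. x i ^ nat (- b i k)) = mon_neg N x b k"
    by (simp_all only: mon_pos_def mon_neg_def prod.inter_filter[OF finite_lessThan]) (auto intro!: prod.cong)
  thus ?thesis by (simp add: mutate_def)
qed

abbreviation mutates :: "nat \<Rightarrow> nat list \<Rightarrow> seed \<Rightarrow> seed" where
  "mutates N \<equiv> fold (mutate N)"

lemma snd_mutates: "snd (mutates N ks s) = fold mutate_matrix ks (snd s)"
  by (induction ks arbitrary: s) (auto simp: mutate_def)

lemma mutate_hom:
  assumes h: "field_hom h"
  shows "mutate N k (h \<circ> x, b) = (h \<circ> fst (mutate N k (x, b)), snd (mutate N k (x, b)))"
  by (auto simp: mutate_eq mon_pos_def mon_neg_def field_hom_divide[OF h] field_homD[OF h]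
      field_hom_prod[OF h] field_hom_power[OF h])

lemma mutates_hom:
  assumes h: "field_hom h"
  shows "mutates N ks (h \<circ> x, b) = (h \<circ> fst (mutates N ks (x, b)), snd (mutates N ks (x, b)))"
proof (induction ks arbitrary: x b)
  case (Cons k ks)
  have "mutates N (k # ks) (h \<circ> x, b) = mutates N ks (h \<circ> fst (mutate N k (x, b)), snd (mutate N k (x, b)))"
    by (simp only: fold.simps comp_def[of _ "mutate N k"] mutate_hom[OF h])
  also have "\<dots> = (h \<circ> fst (mutates N ks (mutate N k (x, b))), snd (mutates N ks (mutate N k (x, b))))"
    by (subst Cons.IH) simp
  finally show ?case by (simp only: fold_simps)
qed simp

lemma mutate_matrix_involution: "mutate_matrix k (mutate_matrix k b) = b"
  by (intro ext) (auto simp: mutate_matrix_def)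

abbreviation pos :: "int \<Rightarrow> int" where "pos \<equiv> max 0"

text \<open>For \<open>b k k = 0\<close> this is a row operation with coefficients
  \<open>pos (b i k)\<close> combined with a column operation with coefficients
  \<open>pos (- b k j)\<close>; symmetrizers and rank are transported through this form.\<close>

lemma mutate_matrix_alt:
  "i \<noteq> k \<Longrightarrow> j \<noteq> k \<Longrightarrow> mutate_matrix k b i j = b i j + pos (b i k) * b k j + b i k * pos (- b k j)"
proof -
  have "sgn x * max 0 (x * y) = pos x * y + x * pos (- y)" for x y :: int
    by (cases x "0::int" rule: linorder_cases; cases y "0::int" rule: linorder_cases)
      (auto simp: max_def zero_le_mult_iff)
  thus "i \<noteq> k \<Longrightarrow> j \<noteq> k \<Longrightarrow> ?thesis" by (simp add: mutate_matrix_def)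
qed

section \<open>Properties of exchange matrices preserved by mutation\<close>

definition skew_symmetrizable :: "nat \<Rightarrow> (nat \<Rightarrow> nat \<Rightarrow> int) \<Rightarrow> bool" where
  "skew_symmetrizable n b \<longleftrightarrow> (\<exists>d :: nat \<Rightarrow> real. (\<forall>i<n. d i > 0) \<and>
    (\<forall>i<n. \<forall>j<n. d i * of_int (b i j) = - d j * of_int (b j i)))"

text \<open>Full column rank, which principal coefficients get from their identity block. It makes
  the two monomials of an exchange relation distinct, and the exchange polynomials of commuting
  mutations coprime.\<close>

definition column_indep :: "nat \<Rightarrow> nat \<Rightarrow> (nat \<Rightarrow> nat \<Rightarrow> int) \<Rightarrow> bool" where
  "column_indep n N b \<longleftrightarrow> (\<forall>c :: nat \<Rightarrow> int. (\<forall>i<N. (\<Sum>j<n. b i j * c j) = 0) \<longrightarrow> (\<forall>j<n. c j = 0))"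

lemma of_int_pos: "of_int (pos x) = max 0 (of_int x :: real)"
  by simp

lemma skew_symmetrizable_mutate:
  assumes "skew_symmetrizable n b" "k < n" shows "skew_symmetrizable n (mutate_matrix k b)"
proof -
  obtain d :: "nat \<Rightarrow> real" where d: "\<And>i. i < n \<Longrightarrow> d i > 0"
    and s: "\<And>i j. i < n \<Longrightarrow> j < n \<Longrightarrow> d i * of_int (b i j) = - d j * of_int (b j i)"
    using assms by (auto simp: skew_symmetrizable_def)
  have mp: "d i * max 0 z = max 0 (d i * z)" if "i < n" for i z
    using d[OF that] by (auto simp: max_def zero_le_mult_iff)
  have "d i * of_int (mutate_matrix k b i j) = - d j * of_int (mutate_matrix k b j i)" if ij: "i < n" "j < n" for i j
  proof (cases "i = k \<or> j = k")
    case True thus ?thesis using s[OF ij] by (auto simp: mutate_matrix_def)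
  next
    case False
    have sp: "d i * real_of_int (pos (b i k)) = d k * real_of_int (pos (- b k i))" if "i < n" for i
      using s[OF that assms(2)] mp[OF that] mp[OF assms(2)] by (simp add: of_int_pos)
    have e: "d i * real_of_int (mutate_matrix k b i j) =
        d i * of_int (b i j) + (d i * of_int (pos (b i k))) * of_int (b k j) + (d i * of_int (b i k)) * of_int (pos (- b k j))"
      if "i < n" "i \<noteq> k" "j \<noteq> k" for i j
      using that by (simp add: mutate_matrix_alt algebra_simps)
    show ?thesis
      using False e[of i j] e[of j i] s[OF ij] s[OF ij(1) assms(2)] s[OF ij(2) assms(2)] sp ij
      by simp
  qed
  with d show ?thesis unfolding skew_symmetrizable_def by blast
qed

lemma skew_symmetrizable_sign:
  assumes "skew_symmetrizable n b" "i < n" "j < n"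
  shows "b i j > 0 \<longleftrightarrow> b j i < 0" "b i j = 0 \<longleftrightarrow> b j i = 0" "b i i = 0"
proof -
  obtain d :: "nat \<Rightarrow> real" where d: "\<And>i. i < n \<Longrightarrow> d i > 0"
    and s: "\<And>i j. i < n \<Longrightarrow> j < n \<Longrightarrow> d i * of_int (b i j) = - d j * of_int (b j i)"
    using assms by (auto simp: skew_symmetrizable_def)
  have "d i * of_int (b i j) > 0 \<longleftrightarrow> d j * of_int (b j i) < 0" "d i * of_int (b i j) = 0 \<longleftrightarrow> d j * of_int (b j i) = 0"
    using s[OF assms(2,3)] by auto
  thus "b i j > 0 \<longleftrightarrow> b j i < 0" "b i j = 0 \<longleftrightarrow> b j i = 0"
    using d[OF assms(2)] d[OF assms(3)] by (simp_all add: zero_less_mult_iff mult_less_0_iff)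
  show "b i i = 0" using s[OF assms(2,2)] d[OF assms(2)] by simp
qed

lemma column_indep_mutate:
  assumes b: "column_indep n N b" and k: "k < n" "n \<le> N" and kk: "b k k = 0"
  shows "column_indep n N (mutate_matrix k b)"
  unfolding column_indep_def
proof (intro allI impI)
  fix c :: "nat \<Rightarrow> int" and j
  assume c: "\<forall>i<N. (\<Sum>j<n. mutate_matrix k b i j * c j) = 0" and j: "j < n"
  have split: "(\<Sum>j<n. f j) = f k + (\<Sum>j\<in>{..<n}-{k}. f j)" for f :: "nat \<Rightarrow> int"
    using k by (subst sum.remove[of _ k]) auto
  let ?A = "{..<n}-{k}"
  \<comment> \<open>Up to sign, column \<open>k\<close> is unchanged by the mutation, and column
    \<open>j\<close> takes up \<open>pos (- b k j)\<close> times column \<open>k\<close>. Collecting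
    these multiples at \<open>k\<close> turns a relation between the new columns into one between
    the old ones; the terms with \<open>pos (b i k)\<close> drop out by the relation in row
    \<open>k\<close>.\<close>
  define c' where "c' = c(k := (\<Sum>j\<in>?A. pos (- b k j) * c j) - c k)"
  have "(\<Sum>j<n. b k j * c j) = 0"
    using c[rule_format, of k] k by (simp add: mutate_matrix_def sum_negf)
  hence row_k: "(\<Sum>j\<in>?A. b k j * c j) = 0" by (subst (asm) split) (simp add: kk)
  have "(\<Sum>j<n. b i j * c' j) = 0" if i: "i < N" for i
  proof (cases "i = k")
    case True
    thus ?thesis using row_k by (subst split) (simp add: c'_def kk)
  next
    case False
    have "0 = (\<Sum>j<n. mutate_matrix k b i j * c j)" using c i by simp
    also have "\<dots> = - b i k * c k + (\<Sum>j\<in>?A. mutate_matrix k b i j * c j)"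
      by (subst split) (simp add: mutate_matrix_def)
    also have "(\<Sum>j\<in>?A. mutate_matrix k b i j * c j) =
      (\<Sum>j\<in>?A. b i j * c j + pos (b i k) * (b k j * c j) + b i k * (pos (- b k j) * c j))"
      by (rule sum.cong) (use False in \<open>simp_all add: mutate_matrix_alt algebra_simps\<close>)
    also have "- b i k * c k + \<dots> = b i k * c' k + (\<Sum>j\<in>?A. b i j * c j)"
      unfolding sum.distrib sum_distrib_left[symmetric] row_k by (simp add: c'_def algebra_simps)
    also have "\<dots> = (\<Sum>j<n. b i j * c' j)"
      by (subst split) (simp add: c'_def)
    finally show ?thesis by simp
  qed
  hence z: "\<forall>j<n. c' j = 0" using b unfolding column_indep_def by blast
  hence "\<forall>j\<in>?A. c j = 0" by (auto simp: c'_def split: if_splits)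
  moreover have "c k = 0" using z k calculation by (auto simp: c'_def)
  ultimately show "c j = 0" using j by (cases "j = k") auto
qed

definition good_matrix :: "nat \<Rightarrow> nat \<Rightarrow> (nat \<Rightarrow> nat \<Rightarrow> int) \<Rightarrow> bool" where
  "good_matrix n N b \<longleftrightarrow> n \<le> N \<and> skew_symmetrizable n b \<and> column_indep n N b"

lemma good_matrix_mutate: "good_matrix n N b \<Longrightarrow> k < n \<Longrightarrow> good_matrix n N (mutate_matrix k b)"
  unfolding good_matrix_def
  by (auto intro: skew_symmetrizable_mutate column_indep_mutate skew_symmetrizable_sign(3))

lemma good_matrix_diag: "good_matrix n N b \<Longrightarrow> k < n \<Longrightarrow> b k k = 0"
  by (auto simp: good_matrix_def intro: skew_symmetrizable_sign(3))

lemma good_matrix_column: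
  assumes "good_matrix n N b" "k < n" obtains i where "i < N" "b i k \<noteq> 0"
proof -
  have "\<not> (\<forall>i<N. (\<Sum>j<n. b i j * (if j = k then 1 else 0)) = 0)"
    using assms unfolding good_matrix_def column_indep_def
    by (auto dest!: spec[of _ "\<lambda>j. if j = k then 1 else 0"])
  thus ?thesis using that assms by (auto simp: if_distrib cong: if_cong)
qed

definition col_pos :: "nat \<Rightarrow> (nat \<Rightarrow> nat \<Rightarrow> int) \<Rightarrow> nat \<Rightarrow> nat \<Rightarrow>\<^sub>0 int" where
  "col_pos N b k = (\<Sum>i<N. single i (pos (b i k)))"

definition col_neg :: "nat \<Rightarrow> (nat \<Rightarrow> nat \<Rightarrow> int) \<Rightarrow> nat \<Rightarrow> nat \<Rightarrow>\<^sub>0 int" where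
  "col_neg N b k = (\<Sum>i<N. single i (pos (- b i k)))"

lemma lookup_col: "lookup (col_pos N b k) i = (if i < N then pos (b i k) else 0)"
  "lookup (col_neg N b k) i = (if i < N then pos (- b i k) else 0)"
  by (auto simp: col_pos_def col_neg_def lookup_sum when_def)

lemma mon_eq_monomial:
  "mon_pos N x b k = monomial x (col_pos N b k)" "mon_neg N x b k = monomial x (col_neg N b k)"
proof -
  have "keys (col_pos N b k) \<subseteq> {..<N}" "keys (col_neg N b k) \<subseteq> {..<N}"
    by (auto simp: in_keys_iff lookup_col split: if_splits)
  thus "mon_pos N x b k = monomial x (col_pos N b k)" "mon_neg N x b k = monomial x (col_neg N b k)"
    by (auto simp: monomial_superset[of "{..<N}"] lookup_col mon_pos_def mon_neg_def power_int_def max_def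
        intro!: prod.cong)
qed

lemma col_neq: "good_matrix n N b \<Longrightarrow> k < n \<Longrightarrow> col_pos N b k \<noteq> col_neg N b k"
proof
  assume "good_matrix n N b" "k < n" and eq: "col_pos N b k = col_neg N b k"
  from \<open>good_matrix n N b\<close> \<open>k < n\<close> obtain i where "i < N" "b i k \<noteq> 0" by (rule good_matrix_column)
  thus False using lookup_col[of N b k i] eq by auto
qed

definition seed_ok :: "nat \<Rightarrow> nat \<Rightarrow> seed \<Rightarrow> bool" where
  "seed_ok n N s \<longleftrightarrow> good_matrix n N (snd s) \<and> (\<forall>i. rpos (fst s i)) \<and> (\<forall>i. monic (fst s i)) \<and>
     lm_indep (fst s) \<and> (\<forall>i\<ge>n. fst s i = rvar i)"

lemma seed_ok_initial: "good_matrix n N b \<Longrightarrow> seed_ok n N (rvar, b)"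
  by (simp add: seed_ok_def)

lemma seed_okD:
  assumes "seed_ok n N (x, b)"
  shows "good_matrix n N b" "rpos (x i)" "x i \<noteq> 0" "monic (x i)" "lm_indep x" "i \<ge> n \<Longrightarrow> x i = rvar i"
  using assms by (auto simp: seed_ok_def rpos_nonzero)

lemma frag_extend_upd:
  "frag_extend (f(k := w)) m = frag_extend f m + frag_cmul (lookup m k) (w - f k)"
proof -
  have "keys m \<subseteq> UNIV" by simp
  thus ?thesis
  proof (induction m rule: frag_induction)
    case (one x) thus ?case by auto
  next
    case (diff a b)
    have "frag_cmul (i - j) (w - f k) = frag_cmul i (w - f k) - frag_cmul j (w - f k)" for i j
      using frag_cmul_distrib[of i "- j"] by (simp flip: minus_frag_cmul)
    thus ?case using diff by (simp add: frag_extend_diff lookup_minus)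
  qed simp
qed

text \<open>The leading exponent of the new variable is that of one of the two monomials, which do
  not involve \<open>x k\<close>, minus that of \<open>x k\<close>. The map of exponents is thus
  composed with \<open>T\<close>, which negates the coordinate at \<open>k\<close> and adds
  multiples of it to the others; such a map is injective.\<close>

lemma seed_ok_mutate:
  assumes s: "seed_ok n N (x, b)" and k: "k < n" shows "seed_ok n N (mutate N k (x, b))"
proof -
  note g = seed_okD[OF s]
  let ?p = "mon_pos N x b k" and ?n = "mon_neg N x b k"
  define y where "y = (?p + ?n) / x k"
  have nz: "?p \<noteq> 0" "?n \<noteq> 0" using g(3) by (simp_all add: mon_pos_def mon_neg_def)
  have lmp: "lm ?p = frag_extend (\<lambda>i. lm (x i)) (col_pos N b k)"
    "lm ?n = frag_extend (\<lambda>i. lm (x i)) (col_neg N b k)"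
    by (simp_all add: mon_eq_monomial lm_monomial g(3))
  have inj: "inj (frag_extend (\<lambda>i. lm (x i)))" using g(5) by (simp add: lm_indep_def)
  have ne: "lm ?p \<noteq> lm ?n" unfolding lmp using col_neq[OF g(1) k] inj by (auto dest: injD)
  have mon: "monic ?p" "monic ?n" by (auto simp: mon_pos_def mon_neg_def intro!: monic_prod monic_power g(4))
  have pos: "rpos ?p" "rpos ?n" by (auto simp: mon_pos_def mon_neg_def intro!: rpos_prod rpos_power g(2))
  have "monic (?p + ?n)"
    using monic_add_less[OF mon] monic_add_less[OF mon(2,1)] ne by (metis add.commute neqE)
  hence ym: "monic y" unfolding y_def using monic_divide g(4) by blast
  have yp: "rpos y" unfolding y_def using rpos_divide rpos_add pos g(2) by blast
  have "lm (?p + ?n) = lm ?p \<or> lm (?p + ?n) = lm ?n"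
    using lm_add_less[OF nz] lm_add_less[OF nz(2,1)] ne by (metis add.commute neqE)
  then obtain c where c: "lm (?p + ?n) = frag_extend (\<lambda>i. lm (x i)) c" "lookup c k = 0"
    using lmp good_matrix_diag[OF g(1) k] by (metis lookup_col max.idem neg_equal_0_iff_equal)
  have sum0: "?p + ?n \<noteq> 0" using rpos_add[OF pos] rpos_nonzero by blast
  have ly: "lm y = frag_extend (\<lambda>i. lm (x i)) (c - frag_of k)"
    unfolding y_def using lm_divide[OF sum0 g(3)] c by (simp add: frag_extend_diff)
  define T where "T m = m + frag_cmul (lookup m k) (c - frag_of k - frag_of k)" for m
  have lT: "frag_extend (\<lambda>i. lm ((x(k := y)) i)) m = frag_extend (\<lambda>i. lm (x i)) (T m)" for m
  proof -
    have "(\<lambda>i. lm ((x(k := y)) i)) = (\<lambda>i. lm (x i))(k := frag_extend (\<lambda>i. lm (x i)) (c - frag_of k))"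
      using ly by auto
    hence "frag_extend (\<lambda>i. lm ((x(k := y)) i)) m = frag_extend (\<lambda>i. lm (x i)) m +
        frag_cmul (lookup m k) (frag_extend (\<lambda>i. lm (x i)) (c - frag_of k) - lm (x k))"
      by (simp only: frag_extend_upd)
    thus ?thesis by (simp only: T_def frag_extend_add frag_extend_cmul frag_extend_diff frag_extend_of)
  qed
  have "inj T"
  proof (rule injI)
    fix m m' assume eq: "T m = T m'"
    have "lookup (T m) k = - lookup m k" for m
      unfolding T_def lookup_add lookup_frag_cmul lookup_minus c(2) by simp
    hence "lookup m k = lookup m' k" using eq by (metis minus_equation_iff)
    with eq show "m = m'" by (simp add: T_def)
  qed
  moreover have "frag_extend (\<lambda>i. lm ((x(k := y)) i)) = frag_extend (\<lambda>i. lm (x i)) \<circ> T"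
    using lT by (simp add: fun_eq_iff)
  ultimately have "inj (frag_extend (\<lambda>i. lm ((x(k := y)) i)))"
    using inj_compose[OF inj] by simp
  hence "lm_indep (x(k := y))"
    using g(3) rpos_nonzero[OF yp] by (auto simp: lm_indep_def)
  thus ?thesis
    using g ym yp good_matrix_mutate[OF g(1) k] k by (auto simp: seed_ok_def mutate_eq y_def)
qed

lemma seed_ok_mutates: "seed_ok n N s \<Longrightarrow> set ks \<subseteq> {..<n} \<Longrightarrow> seed_ok n N (mutates N ks s)"
proof (induction ks arbitrary: s)
  case (Cons k ks) thus ?case using seed_ok_mutate[of n N "fst s" "snd s" k] by simp
qed simp

lemma mutate_involution:
  assumes s: "seed_ok n N (x, b)" and k: "k < n" shows "mutate N k (mutate N k (x, b)) = (x, b)"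
proof -
  note g = seed_okD[OF s]
  let ?P = "mon_pos N x b k + mon_neg N x b k" and ?b = "mutate_matrix k b"
  have kk: "b k k = 0" by (rule good_matrix_diag[OF g(1) k])
  have "mon_pos N (x(k := ?P / x k)) ?b k = mon_neg N x b k"
    "mon_neg N (x(k := ?P / x k)) ?b k = mon_pos N x b k"
    unfolding mon_pos_def mon_neg_def by (auto simp: mutate_matrix_def kk intro!: prod.cong)
  moreover have "?P \<noteq> 0"
    using g(2) by (intro rpos_nonzero rpos_add) (auto simp: mon_pos_def mon_neg_def intro!: rpos_prod rpos_power)
  ultimately show ?thesis by (simp add: mutate_eq mutate_matrix_involution add.commute)
qed

lemma mutates_rev:
  assumes "seed_ok n N s" "set ks \<subseteq> {..<n}" shows "mutates N (rev ks) (mutates N ks s) = s"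
  using assms
proof (induction ks arbitrary: s)
  case (Cons k ks)
  have "seed_ok n N (mutate N k s)" using seed_ok_mutate[of n N "fst s" "snd s" k] Cons by simp
  thus ?case using Cons mutate_involution[of n N "fst s" "snd s" k] by simp
qed simp


section \<open>Laurent rings of seeds\<close>

definition Lau :: "(nat \<Rightarrow> ratfun) \<Rightarrow> ratfun set" where "Lau x = {ev x p |p. True}"

lemma Lau_rvar: "f \<in> Lau rvar \<longleftrightarrow> (\<exists>p. f = to_ratfun p)"
  by (auto simp: Lau_def ev_rvar)

lemma Lau_hom: "field_hom h \<Longrightarrow> Lau (h \<circ> x) = h ` Lau x"
  by (auto simp: Lau_def simp flip: field_hom_ev)

lemma Lau_closed:
  assumes "\<And>i. x i \<noteq> 0"
  shows "f \<in> Lau x \<Longrightarrow> g \<in> Lau x \<Longrightarrow> f + g \<in> Lau x" "f \<in> Lau x \<Longrightarrow> g \<in> Lau x \<Longrightarrow> f * g \<in> Lau x"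
    "rconst c \<in> Lau x" "1 \<in> Lau x" "monomial x m \<in> Lau x"
proof -
  show "f \<in> Lau x \<Longrightarrow> g \<in> Lau x \<Longrightarrow> f + g \<in> Lau x" "f \<in> Lau x \<Longrightarrow> g \<in> Lau x \<Longrightarrow> f * g \<in> Lau x"
    unfolding Lau_def using ev_simps(1,2)[of x, OF assms, symmetric] by auto
  show "rconst c \<in> Lau x" "1 \<in> Lau x"
    unfolding Lau_def using ev_simps(6,4)[of x, OF assms, symmetric] by auto
  show "monomial x m \<in> Lau x"
    unfolding Lau_def using ev_single[of x m 1, OF assms, symmetric] by auto
qed

lemma Lau_powi: "(\<And>i. x i \<noteq> 0) \<Longrightarrow> x i powi k \<in> Lau x"
  using Lau_closed(5)[of x "single i k"] by simp

lemma Lau_var: "(\<And>i. x i \<noteq> 0) \<Longrightarrow> x i \<in> Lau x"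
  using Lau_powi[of x i 1] by simp

definition subring_set :: "ratfun set \<Rightarrow> bool" where
  "subring_set S \<longleftrightarrow> (\<forall>f\<in>S. \<forall>g\<in>S. f + g \<in> S \<and> f * g \<in> S) \<and> (\<forall>c. rconst c \<in> S)"

lemma subring_Lau: "(\<And>i. x i \<noteq> 0) \<Longrightarrow> subring_set (Lau x)"
  by (simp add: subring_set_def Lau_closed)

lemma subring_setD:
  assumes "subring_set S"
  shows "f \<in> S \<Longrightarrow> g \<in> S \<Longrightarrow> f + g \<in> S" "f \<in> S \<Longrightarrow> g \<in> S \<Longrightarrow> f * g \<in> S" "rconst c \<in> S" "1 \<in> S"
    "f \<in> S \<Longrightarrow> f ^ k \<in> S" "(\<And>i. i \<in> A \<Longrightarrow> h i \<in> S) \<Longrightarrow> (\<Prod>i\<in>A. h i) \<in> S"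
proof -
  show *: "f \<in> S \<Longrightarrow> g \<in> S \<Longrightarrow> f + g \<in> S" "f \<in> S \<Longrightarrow> g \<in> S \<Longrightarrow> f * g \<in> S" for f g
    using assms by (auto simp: subring_set_def)
  show "rconst c \<in> S" and one: "1 \<in> S" for c
    using assms rconst_simps(3) unfolding subring_set_def by metis+
  show "f \<in> S \<Longrightarrow> f ^ k \<in> S" by (induction k) (auto simp: * one)
  show "(\<And>i. i \<in> A \<Longrightarrow> h i \<in> S) \<Longrightarrow> (\<Prod>i\<in>A. h i) \<in> S"
    by (induction A rule: infinite_finite_induct) (auto simp: * one)
qed

text \<open>Only the \<open>x i\<close> with \<open>i\<close> in \<open>J\<close> may fail to be
  invertible in \<open>S\<close>, and a high power of their product clears all negative
  exponents.\<close>

lemma Lau_clear: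
  assumes S: "subring_set S" and J: "finite J" and x: "\<And>i. x i \<noteq> 0" "\<And>i. x i \<in> S"
    and u: "\<And>i. i \<notin> J \<Longrightarrow> inverse (x i) \<in> S" and f: "f \<in> Lau x"
  shows "\<exists>a. f * (\<Prod>i\<in>J. x i) ^ a \<in> S"
proof -
  note S' = subring_setD[OF S]
  define R where "R = (\<Prod>i\<in>J. x i)"
  have R: "R ^ a \<in> S" for a unfolding R_def by (intro S'(5) S'(6) x)
  have var: "\<exists>a. x i powi e * R ^ a \<in> S" for i e
  proof (cases "e \<ge> 0")
    case True
    thus ?thesis using S'(5)[OF x(2)] by (intro exI[of _ 0]) (simp add: power_int_def)
  next
    case False
    show ?thesis
    proof (cases "i \<in> J")
      case True
      have "x i powi e * R ^ nat (- e) = (\<Prod>l\<in>J-{i}. x l) ^ nat (- e)"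
        unfolding R_def using False x(1) prod.remove[OF J True, of x]
        by (simp add: power_int_def field_simps)
      thus ?thesis using S'(5,6) x by metis
    qed (use False S'(5)[OF u] in \<open>auto intro!: exI[of _ 0] simp: power_int_def\<close>)
  qed
  have mono: "\<exists>a. (\<Prod>i\<in>I. x i powi e i) * R ^ a \<in> S" for I and e :: "nat \<Rightarrow> int"
  proof (induction I rule: infinite_finite_induct)
    case (insert i I)
    then obtain a c where "x i powi e i * R ^ a \<in> S" "(\<Prod>i\<in>I. x i powi e i) * R ^ c \<in> S" using var by blast
    hence "(x i powi e i * R ^ a) * ((\<Prod>i\<in>I. x i powi e i) * R ^ c) \<in> S" by (rule S'(2))
    thus ?case using insert by (intro exI[of _ "a + c"]) (simp add: power_add mult_ac)
  qed (auto intro!: exI[of _ 0] S'(4))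
  obtain p where "f = ev x p" using f by (auto simp: Lau_def)
  moreover have "\<exists>a. ev x p * R ^ a \<in> S"
  proof (induction p rule: poly_mapping_induct_single)
    case (single m c)
    obtain a where "monomial x m * R ^ a \<in> S" using mono unfolding monomial_def by blast
    hence "rconst c * (monomial x m * R ^ a) \<in> S" using S'(2,3) by blast
    thus ?case by (intro exI[of _ a]) (simp add: ev_single x mult_ac)
  next
    case (add p q)
    then obtain a c where "ev x p * R ^ a \<in> S" "ev x q * R ^ c \<in> S" by blast
    hence "(ev x p * R ^ a) * R ^ c + (ev x q * R ^ c) * R ^ a \<in> S" using S'(1,2) R by blast
    thus ?case by (intro exI[of _ "a + c"]) (simp add: x power_add algebra_simps)
  qed
  ultimately show ?thesis by (simp add: R_def)
qed

subsection \<open>Non-zero-divisors modulo a homogeneous element\<close>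

text \<open>Multiplication by \<open>r\<close> is injective modulo \<open>p\<close>. This stands for
  coprimality; it is stable under products and depends on \<open>r\<close> only modulo
  \<open>p\<close>.\<close>

definition nzd :: "'a::comm_ring_1 \<Rightarrow> 'a \<Rightarrow> bool" where
  "nzd p r \<longleftrightarrow> (\<forall>a. p dvd r * a \<longrightarrow> p dvd a)"

lemma nzd_1: "nzd p 1" by (simp add: nzd_def)

lemma nzd_mult: "nzd p r \<Longrightarrow> nzd p r' \<Longrightarrow> nzd p (r * r')"
  unfolding nzd_def mult.assoc by blast

lemma nzd_prod: "(\<And>i. i \<in> A \<Longrightarrow> nzd p (f i)) \<Longrightarrow> nzd p (\<Prod>i\<in>A. f i)"
  by (induction A rule: infinite_finite_induct) (simp_all add: nzd_mult nzd_1)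

lemma nzd_power: "nzd p r \<Longrightarrow> nzd p (r ^ k)"
  by (induction k) (simp_all add: nzd_mult nzd_1)

lemma nzd_add: "nzd p r \<Longrightarrow> nzd p (r + p * w)"
proof -
  have "p dvd (r + p * w) * a \<longleftrightarrow> p dvd r * a" for a
    by (simp add: distrib_right dvd_add_left_iff)
  thus "nzd p r \<Longrightarrow> ?thesis" unfolding nzd_def by blast
qed

lemma nzd_unit: assumes "r * s = 1" shows "nzd p r"
proof -
  have "p dvd a" if "p dvd r * a" for a
  proof -
    have "p dvd s * (r * a)" using that by (rule dvd_mult)
    also have "s * (r * a) = (r * s) * a" by simp
    finally show ?thesis by (simp add: assms)
  qed
  thus ?thesis unfolding nzd_def by blast
qed

lemma nzd_cancel:
  fixes p :: "'a::idom"
  assumes "p \<noteq> 0" "nzd p r" "a * r = c * p ^ k" shows "p ^ k dvd a"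
  using assms(3)
proof (induction k arbitrary: a)
  case (Suc k)
  hence "r * a = p * (c * p ^ k)" by (simp add: mult_ac)
  hence "p dvd r * a" by simp
  hence "p dvd a" using assms(2) unfolding nzd_def by blast
  then obtain a' where a: "a = p * a'" by (elim dvdE)
  hence "p * (a' * r) = p * (c * p ^ k)" using Suc.prems by simp
  thus ?case using Suc.IH[of a'] assms(1) a by simp
qed simp

definition mon :: "('v \<Rightarrow>\<^sub>0 int) \<Rightarrow> 'v laurent" where "mon m = single m 1"

lemma mon_simps [simp]: "mon m * mon m' = mon (m + m')" "mon 0 = 1"
  by (simp_all add: mon_def)

lemma mon_nonzero [simp]: "mon m \<noteq> 0"
  unfolding mon_def by (metis lookup_single_eq lookup_zero zero_neq_one)

lemma mon_inverse: "mon m * mon (- m) = 1" by simp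

lemma lvar_mon: "lvar i = mon (frag_of i)" by (simp add: lvar_def mon_def)

lemma mon_power: "mon m ^ k = mon (frag_cmul (int k) m)"
  by (induction k) (simp_all add: frag_cmul_distrib)

lemma to_ratfun_mon: "to_ratfun (mon m) = monomial rvar m"
  by (simp add: mon_def monomial_rvar)

lemma prod_lvar: "(\<Prod>i\<in>A. lvar i ^ e i) = mon (\<Sum>i\<in>A. single i (int (e i)))"
proof -
  have "frag_cmul (int k) (frag_of i) = single i (int k)" for i :: 'a and k
    by (rule poly_mapping_eqI) simp
  thus ?thesis
    by (induction A rule: infinite_finite_induct) (simp_all add: lvar_mon mon_power)
qed

text \<open>As \<open>P\<close> is homogeneous, it divides every component of its multiples. The top
  component of \<open>r * a\<close> is a unit times that of \<open>a\<close>, so \<open>P\<close>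
  divides the top component of \<open>a\<close>, which is then split off.\<close>

lemma nzd_homogeneous:
  fixes \<phi> :: "(nat \<Rightarrow>\<^sub>0 int) \<Rightarrow> int"
  assumes add: "\<And>m m'. \<phi> (m + m') = \<phi> m + \<phi> m'"
    and P: "\<And>m. m \<in> keys P \<Longrightarrow> \<phi> m = e"
    and r: "\<And>m. m \<in> keys r \<Longrightarrow> \<phi> m \<le> d" "comp_at \<phi> d r = mon u"
  shows "nzd P r"
  unfolding nzd_def
proof (intro allI impI)
  fix a
  show "P dvd r * a \<Longrightarrow> P dvd a"
  proof (induction "card (\<phi> ` keys a)" arbitrary: a rule: less_induct)
    case less
    show ?case
    proof (cases "a = 0")
      case False
      define t where "t = ldeg \<phi> a"
      define a' where "a' = comp_at \<phi> t a"
      obtain q where q: "r * a = q * P" using less.prems by (metis dvd_def mult.commute)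
      have "comp_at \<phi> (d + t) (r * a) = mon u * a'"
        unfolding a'_def r(2)[symmetric] by (rule comp_at_mult_top[OF add r(1)]) (auto simp: t_def ldeg_ge)
      moreover have "comp_at \<phi> (d + t) (q * P) = comp_at \<phi> (d + t - e) q * P"
        by (rule comp_at_mult_homogeneous[OF add P])
      ultimately have "mon u * a' = comp_at \<phi> (d + t - e) q * P" using q by simp
      hence "a' = (mon (- u) * comp_at \<phi> (d + t - e) q) * P"
        by (metis mon_inverse mult.assoc mult.commute mult_1)
      hence Pa': "P dvd a'" by (metis dvd_triv_right)
      have sub: "\<phi> ` keys (a - a') \<subseteq> \<phi> ` keys a - {t}"
        by (force simp: a'_def in_keys_iff lookup_minus split: if_splits)
      have "t \<in> \<phi> ` keys a" using ldeg_attained[OF False, of \<phi>] unfolding t_def by (metis imageI)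
      hence "card (\<phi> ` keys (a - a')) < card (\<phi> ` keys a)"
        using sub by (intro psubset_card_mono) (simp, blast)
      moreover have "P dvd r * (a - a')" using less.prems Pa' by (simp add: right_diff_distrib)
      ultimately have "P dvd a - a'" using less.hyps by blast
      with Pa' show ?thesis by (metis diff_add_cancel dvd_add)
    qed simp
  qed
qed

subsection \<open>The Laurent phenomenon\<close>

lemma mon_pos_to_ratfun:
  "mon_pos N (to_ratfun \<circ> w) b k = to_ratfun (mon_pos N w b k)" "mon_neg N (to_ratfun \<circ> w) b k = to_ratfun (mon_neg N w b k)"
  by (simp_all add: mon_pos_def mon_neg_def)

lemma mutate_to_ratfun:
  assumes "mon_pos N w b k + mon_neg N w b k = c * v" "w k = c" "c \<noteq> 0"
  shows "mutate N k (to_ratfun \<circ> w, b) = (to_ratfun \<circ> w(k := v), mutate_matrix k b)"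
proof -
  have "to_ratfun (mon_pos N w b k) + to_ratfun (mon_neg N w b k) = to_ratfun (w k) * to_ratfun v"
    using assms(1,2) by (metis to_ratfun_simps(1,2))
  thus ?thesis using assms(2,3) by (auto simp: mutate_eq mon_pos_to_ratfun)
qed

lemma rvar_comp: "rvar = to_ratfun \<circ> lvar" by (auto simp: rvar_def)

text \<open>The binomial expansion up to second order in \<open>x\<close>. The linear term has to be
  explicit: it is what remains of the second new variable at \<open>j\<close> modulo the exchange
  polynomial in \<open>Lau_three_mutations_neg\<close>.\<close>

lemma power_add_expand:
  fixes z x w :: "'a::comm_ring_1"
  shows "\<exists>v. (z + x * w) ^ q = z ^ q + x * (of_nat q * z ^ (q - 1) * w + x * v)"
proof (induction q)
  case (Suc q)
  then obtain v where v: "(z + x * w) ^ q = z ^ q + x * (of_nat q * z ^ (q - 1) * w + x * v)" by blast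
  show ?case
  proof (cases q)
    case 0 thus ?thesis by (intro exI[of _ 0]) simp
  next
    case (Suc r)
    have "(z + x * w) ^ Suc q = z ^ Suc q + x * (of_nat (Suc q) * z ^ q * w +
      x * (z * v + w * (of_nat q * z ^ r * w + x * v)))"
      unfolding power_Suc[of "z + x * w"] v using Suc by (simp add: algebra_simps)
    thus ?thesis by (intro exI[of _ "z * v + w * (of_nat q * z ^ r * w + x * v)"]) simp
  qed
qed (auto intro: exI[of _ 0])

text \<open>\<open>f\<close> has a denominator that is a power of the exchange polynomial
  \<open>P\<close>, and another one that is a product of elements which are no zero divisors modulo
  \<open>P\<close>; hence the power of \<open>P\<close> cancels.\<close>

lemma Lau_one_step:
  assumes S: "f \<in> Lau x1" "f \<in> Lau x3" and x1: "x1 = to_ratfun \<circ> lvar(j := \<xi>)" and x3: "x3 = to_ratfun \<circ> y"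
    and P: "P = \<xi> * lvar j" "P \<noteq> 0" and J: "finite J"
    and y: "\<And>i. y i \<noteq> 0" "\<And>i. i \<in> J \<Longrightarrow> nzd P (y i)" "\<And>i. i \<notin> J \<Longrightarrow> y i = lvar i"
  shows "f \<in> Lau rvar"
proof -
  have SL: "subring_set (Lau rvar)" by (rule subring_Lau) simp
  have \<xi>: "\<xi> \<noteq> 0" using P by auto
  have lv: "to_ratfun (lvar i) \<in> Lau rvar" "inverse (to_ratfun (lvar i)) \<in> Lau rvar" for i
    using Lau_powi[of rvar i 1] Lau_powi[of rvar i "-1"] by (simp_all add: rvar_def)
  have "\<exists>a. f * (\<Prod>i\<in>{j}. x1 i) ^ a \<in> Lau rvar"
    by (rule Lau_clear[OF SL _ _ _ _ S(1)]) (auto simp: x1 \<xi> Lau_rvar lv(2)[unfolded Lau_rvar])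
  then obtain k a where a: "f * to_ratfun (\<xi> ^ k) = to_ratfun a"
    by (auto simp: x1 Lau_rvar)
  have "\<exists>a. f * (\<Prod>i\<in>J. x3 i) ^ a \<in> Lau rvar"
    by (rule Lau_clear[OF SL J _ _ _ S(2)]) (auto simp: x3 y Lau_rvar lv(2)[unfolded Lau_rvar])
  then obtain l c where c: "f * to_ratfun ((\<Prod>i\<in>J. y i) ^ l) = to_ratfun c"
    by (auto simp: x3 Lau_rvar)
  define r where "r = (\<Prod>i\<in>J. y i) ^ l"
  have r: "nzd P r" unfolding r_def by (intro nzd_power nzd_prod y)
  let ?a = "a * lvar j ^ k"
  have fa: "f * to_ratfun (P ^ k) = to_ratfun ?a"
    unfolding to_ratfun_simps(2) a[symmetric] by (simp add: P power_mult_distrib)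
  have "to_ratfun (?a * r) = to_ratfun (c * P ^ k)"
    using fa c by (simp add: r_def)
      (metis (no_types, lifting) mult.assoc mult.commute)
  hence "?a * r = c * P ^ k" by (simp only: to_ratfun_eq_iff)
  hence "P ^ k dvd ?a" by (rule nzd_cancel[OF P(2) r])
  then obtain g where "?a = P ^ k * g" by auto
  hence "f * to_ratfun (P ^ k) = to_ratfun g * to_ratfun (P ^ k)" using fa by simp
  hence "f = to_ratfun g" using P(2) by simp
  thus ?thesis by (auto simp: Lau_rvar)
qed

definition neg_matrix :: "(nat \<Rightarrow> nat \<Rightarrow> int) \<Rightarrow> nat \<Rightarrow> nat \<Rightarrow> int" where "neg_matrix b i j = - b i j"

lemma mutate_neg: "mutate N k (x, neg_matrix b) = (fst (mutate N k (x, b)), neg_matrix (mutate_matrix k b))"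
proof -
  have "mutate_matrix k (neg_matrix b) = neg_matrix (mutate_matrix k b)"
    by (intro ext) (simp add: mutate_matrix_def neg_matrix_def)
  moreover have "mon_pos N x (neg_matrix b) k = mon_neg N x b k" "mon_neg N x (neg_matrix b) k = mon_pos N x b k"
    by (simp_all add: mon_pos_def mon_neg_def neg_matrix_def)
  ultimately show ?thesis by (simp add: mutate_eq add.commute)
qed

lemma mutates_neg: "mutates N ks (x, neg_matrix b) = (fst (mutates N ks (x, b)), neg_matrix (snd (mutates N ks (x, b))))"
proof (induction ks arbitrary: x b)
  case (Cons k ks)
  show ?case unfolding fold_simps mutate_neg Cons by (simp only: mutate_eq fst_conv)
qed simp

lemma neg_neg [simp]: "neg_matrix (neg_matrix b) = b" by (intro ext) (simp add: neg_matrix_def)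

lemma good_matrix_neg: "good_matrix n N b \<Longrightarrow> good_matrix n N (neg_matrix b)"
proof -
  have "skew_symmetrizable n b \<Longrightarrow> skew_symmetrizable n (neg_matrix b)"
    unfolding skew_symmetrizable_def neg_matrix_def of_int_minus mult_minus_right neg_equal_iff_equal by blast
  thus "good_matrix n N b \<Longrightarrow> good_matrix n N (neg_matrix b)"
    by (simp add: good_matrix_def column_indep_def neg_matrix_def sum_negf)
qed

lemma prod_split2: "j < (N::nat) \<Longrightarrow> k < N \<Longrightarrow> j \<noteq> k \<Longrightarrow>
    (\<Prod>i<N. g i) = g j * (g k * (\<Prod>i\<in>{..<N} - {j, k}. (g i :: 'a::comm_monoid_mult)))"
proof -
  assume *: "j < N" "k < N" "j \<noteq> k"
  have e: "{..<N} - {j} - {k} = {..<N} - {j, k}" by auto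
  have "prod g {..<N} = g j * prod g ({..<N} - {j})" by (rule prod.remove) (use * in auto)
  also have "prod g ({..<N} - {j}) = g k * prod g ({..<N} - {j} - {k})" by (rule prod.remove) (use * in auto)
  finally show ?thesis unfolding e .
qed

text \<open>\<open>P\<close> is the exchange polynomial at \<open>j\<close>. The new variable
  \<open>z\<close> at \<open>k\<close> is a unit modulo \<open>P\<close>, since \<open>\<xi>\<close>
  is a multiple of \<open>P\<close>. The second new variable \<open>y\<close> at \<open>j\<close> is
  modulo \<open>P\<close> a monomial of degree 1 in \<open>lvar j\<close> plus a term of degree 0,
  while \<open>P\<close> itself has degree 0; so \<open>nzd_homogeneous\<close> applies.\<close>

lemma Lau_three_mutations_neg:
  assumes b: "good_matrix n N b" and jk: "j < n" "k < n" "j \<noteq> k" and neg: "b j k < 0"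
    and f: "f \<in> Lau (fst (mutates N [j] (rvar, b)))" "f \<in> Lau (fst (mutates N [j, k, j] (rvar, b)))"
  shows "f \<in> Lau rvar"
proof -
  have skew: "skew_symmetrizable n b" and nN: "n \<le> N" using b by (auto simp: good_matrix_def)
  have N: "j < N" "k < N" using jk nN by auto
  define q where "q = nat (b k j)"
  have q: "b k j = int q" "q > 0" and d0: "b j j = 0" "b k k = 0"
    using skew_symmetrizable_sign[OF skew, of k j] skew_symmetrizable_sign(3)[OF skew] jk neg by (auto simp: q_def)
  define p where "p = nat (- b j k)"
  have p: "b j k = - int p" "p > 0" using neg by (auto simp: p_def)
  define A where "A = {..<N} - {j, k}"
  define b1 where "b1 = mutate_matrix j b"
  define b2 where "b2 = mutate_matrix k b1"
  have b1: "b1 j k = int p" "b1 k j = - int q" "b1 k k = 0" "b1 i j = - b i j" for i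
    using p q d0 by (auto simp: b1_def mutate_matrix_def)
  have b2: "b2 k j = int q" "b2 j j = 0" "i \<in> A \<Longrightarrow> b2 i j = - b i j - int q * pos (- b1 i k)" for i
  proof -
    show "b2 k j = int q" "b2 j j = 0" using b1 d0 by (auto simp: b2_def mutate_matrix_def)
    have "pos x * (- int q) + x * int q = - (int q * pos (- x))" for x
      by (simp add: max_def)
    thus "i \<in> A \<Longrightarrow> b2 i j = - b i j - int q * pos (- b1 i k)"
      using jk b1 by (simp add: b2_def A_def mutate_matrix_alt)
  qed
  define E where "E g = (\<Sum>i\<in>A. single i (pos (g i)))" for g :: "nat \<Rightarrow> int"
  have lookup_E: "lookup (E g) i = (if i \<in> A then pos (g i) else 0)" for g i
    by (auto simp: E_def A_def lookup_sum when_def)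
  have prodE: "(\<Prod>i\<in>A. w i ^ nat (g i)) = mon (E g)" if "\<And>i. i \<in> A \<Longrightarrow> w i = lvar i" for w g
  proof -
    have "(\<Prod>i\<in>A. w i ^ nat (g i)) = (\<Prod>i\<in>A. lvar i ^ nat (g i))" using that by (intro prod.cong) auto
    also have "\<dots> = mon (E g)" unfolding prod_lvar E_def by (intro arg_cong[of _ _ mon] sum.cong) auto
    finally show ?thesis .
  qed
  have powk: "lvar k ^ e = mon (frag_cmul (int e) (frag_of k))" for e by (simp add: lvar_mon mon_power)
  have lk: "lvar k * mon (m - frag_of k) = mon m" for m by (simp add: lvar_mon)
  have pA: "(\<Prod>i\<in>A. (lvar(j := \<xi>)) i ^ nat (g i)) = mon (E g)"
    "(\<Prod>i\<in>A. (lvar(j := \<xi>, k := z)) i ^ nat (g i)) = mon (E g)" for \<xi> z g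
    by (rule prodE; simp add: A_def)+
  note split2 = prod_split2[OF N jk(3), folded A_def]
  define cp where "cp = E (\<lambda>i. b i j) + frag_cmul (int q) (frag_of k)"
  define cn where "cn = E (\<lambda>i. - b i j)"
  define P where "P = mon cp + mon cn"
  define \<xi> where "\<xi> = P * mon (- frag_of j)"
  define \<zeta> where "\<zeta> = mon (E (\<lambda>i. - b1 i k) - frag_of k)"
  define \<omega> where "\<omega> = \<xi> ^ (p - 1) * mon (E (\<lambda>i. b1 i k) - frag_of k)"
  define z where "z = \<zeta> + \<xi> * \<omega>"
  define \<gamma> where "\<gamma> = E (\<lambda>i. b2 i j)"
  define \<delta> where "\<delta> = E (\<lambda>i. - b2 i j)"
  obtain v where v: "z ^ q = \<zeta> ^ q + \<xi> * (of_nat q * \<zeta> ^ (q - 1) * \<omega> + \<xi> * v)"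
    unfolding z_def using power_add_expand by blast
  define W where "W = (of_nat q * \<zeta> ^ (q - 1) * \<omega> + \<xi> * v) * mon \<gamma>"
  define y where "y = mon (\<delta> - cp) * lvar j + W"
  have P\<xi>: "P = \<xi> * lvar j" by (simp add: \<xi>_def lvar_mon)
  have Peq: "mon_pos N lvar b j + mon_neg N lvar b j = lvar j * \<xi>"
  proof -
    have "mon_pos N lvar b j = mon cp" "mon_neg N lvar b j = mon cn"
      unfolding mon_pos_def mon_neg_def split2 cp_def cn_def
      using q d0 by (simp_all add: prodE powk add.commute)
    thus ?thesis by (simp add: P_def[symmetric] P\<xi>)
  qed
  have P0: "P \<noteq> 0"
  proof -
    have "lookup cp k \<noteq> lookup cn k" using q by (simp add: cp_def cn_def lookup_E)
    hence "lookup P cp = 1" by (auto simp: P_def mon_def when_def)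
    thus ?thesis by auto
  qed
  have \<xi>0: "\<xi> \<noteq> 0" using P0 P\<xi> by auto
  have s1: "mutates N [j] (rvar, b) = (to_ratfun \<circ> lvar(j := \<xi>), b1)"
    using mutate_to_ratfun[OF Peq refl] by (simp add: b1_def rvar_comp)
  have z_eq: "mon_pos N (lvar(j := \<xi>)) b1 k + mon_neg N (lvar(j := \<xi>)) b1 k = lvar k * z"
  proof -
    have "\<xi> ^ p = \<xi> * \<xi> ^ (p - 1)" using p(2) by (cases p) auto
    hence "lvar k * z = \<xi> ^ p * mon (E (\<lambda>i. b1 i k)) + mon (E (\<lambda>i. - b1 i k))"
      by (simp add: z_def \<omega>_def \<zeta>_def distrib_left lk)
    thus ?thesis
      unfolding mon_pos_def mon_neg_def split2 pA using b1 by simp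
  qed
  have z0: "z \<noteq> 0"
  proof -
    have "seed_ok n N (mutates N [j, k] (rvar, b))"
      using seed_ok_mutates[OF seed_ok_initial[OF b], of "[j, k]"] jk by simp
    hence "fst (mutates N [j, k] (rvar, b)) k \<noteq> 0" using rpos_nonzero by (simp only: seed_ok_def) blast
    thus ?thesis using s1 mutate_to_ratfun[OF z_eq] jk by auto
  qed
  have s2: "mutates N [j, k] (rvar, b) = (to_ratfun \<circ> lvar(j := \<xi>, k := z), b2)"
    using s1 mutate_to_ratfun[OF z_eq] jk by (simp add: b2_def)
  \<comment> \<open>The matrix mutation rule for column \<open>j\<close>. It makes
    \<open>\<zeta> ^ q * mon \<gamma> + mon \<delta>\<close> a monomial multiple of
    \<open>P\<close>, so that \<open>\<xi>\<close> can be divided out and \<open>y\<close> is a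
    Laurent polynomial.\<close>
  have expo: "E (\<lambda>i. b2 i j) + frag_cmul (int q) (E (\<lambda>i. - b1 i k) - frag_of k) = \<delta> - cp + cn"
  proof (rule poly_mapping_eqI)
    fix i
    show "lookup (E (\<lambda>i. b2 i j) + frag_cmul (int q) (E (\<lambda>i. - b1 i k) - frag_of k)) i =
        lookup (\<delta> - cp + cn) i"
    proof (cases "i \<in> A")
      case True
      hence "i \<noteq> k" by (simp add: A_def)
      with True show ?thesis using b2(3)[OF True]
        by (simp only: \<delta>_def cp_def cn_def lookup_add lookup_minus lookup_E lookup_single when_def lookup_frag_cmul)
          simp
    qed (use jk in \<open>simp add: \<delta>_def cp_def cn_def lookup_minus lookup_E when_def\<close>)
  qed
  have y_eq: "mon_pos N (lvar(j := \<xi>, k := z)) b2 j + mon_neg N (lvar(j := \<xi>, k := z)) b2 j = \<xi> * y"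
  proof -
    have "mon_pos N (lvar(j := \<xi>, k := z)) b2 j + mon_neg N (lvar(j := \<xi>, k := z)) b2 j = z ^ q * mon \<gamma> + mon \<delta>"
      unfolding mon_pos_def mon_neg_def split2 pA using b2(1,2) by (simp add: \<gamma>_def \<delta>_def)
    also have "\<dots> = (\<zeta> ^ q * mon \<gamma> + mon \<delta>) + \<xi> * W" by (simp add: v W_def algebra_simps)
    also have "\<zeta> ^ q * mon \<gamma> = mon (\<delta> - cp + cn)"
      unfolding expo[symmetric] by (simp add: \<zeta>_def \<gamma>_def mon_power add.commute)
    also have "mon (\<delta> - cp + cn) + mon \<delta> = mon (\<delta> - cp) * P" by (simp add: P_def distrib_left)
    finally show ?thesis unfolding y_def P\<xi> by (simp add: algebra_simps del: fun_upd_apply)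
  qed
  have y0: "y \<noteq> 0"
  proof -
    have "seed_ok n N (mutates N [j, k, j] (rvar, b))"
      using seed_ok_mutates[OF seed_ok_initial[OF b], of "[j, k, j]"] jk by simp
    hence "fst (mutates N [j, k, j] (rvar, b)) j \<noteq> 0" using rpos_nonzero by (simp only: seed_ok_def) blast
    thus ?thesis using s2 mutate_to_ratfun[OF y_eq] jk \<xi>0 by auto
  qed
  have s3: "fst (mutates N [j, k, j] (rvar, b)) = to_ratfun \<circ> lvar(k := z, j := y)"
    using s2 mutate_to_ratfun[OF y_eq] jk \<xi>0 by simp
  have nz: "nzd P z"
  proof -
    have "z = \<zeta> + P * (mon (- frag_of j) * \<omega>)" by (simp add: z_def \<xi>_def)
    moreover have "nzd P \<zeta>" unfolding \<zeta>_def by (rule nzd_unit[OF mon_inverse])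
    ultimately show ?thesis using nzd_add by metis
  qed
  have ny: "nzd P y"
  proof -
    \<comment> \<open>For \<open>p > 1\<close> the factor \<open>\<xi> ^ (p - 1)\<close> of
      \<open>\<omega>\<close> is already a multiple of \<open>P\<close>, so nothing remains modulo
      \<open>P\<close>.\<close>
    define \<omega>0 where "\<omega>0 = (if p = 1 then mon (E (\<lambda>i. b1 i k) - frag_of k) else 0)"
    have "\<exists>w. \<omega> = \<omega>0 + P * w"
    proof (cases "p = 1")
      case False
      hence "\<xi> ^ (p - 1) = \<xi> * \<xi> ^ (p - 2)" using p(2) by (metis Suc_diff_Suc Suc_lessI nat_1_add_1 One_nat_def plus_1_eq_Suc power_Suc)
      thus ?thesis using False by (auto simp: \<omega>_def \<omega>0_def \<xi>_def)
    qed (auto simp: \<omega>_def \<omega>0_def intro: exI[of _ 0])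
    then obtain w where w: "\<omega> = \<omega>0 + P * w" by blast
    define W0 where "W0 = of_nat q * \<zeta> ^ (q - 1) * \<omega>0 * mon \<gamma>"
    have y': "y = (mon (\<delta> - cp) * lvar j + W0) +
        P * ((of_nat q * \<zeta> ^ (q - 1) * w + mon (- frag_of j) * v) * mon \<gamma>)"
      by (simp add: y_def W_def W0_def w \<xi>_def algebra_simps)
    have oc: "(of_nat q :: nat laurent) = single 0 (of_nat q)" by simp
    have "\<exists>c m. W0 = single m c \<and> lookup m j = 0"
    proof (cases "p = 1")
      case True
      thus ?thesis unfolding W0_def \<omega>0_def \<zeta>_def mon_power oc
        by (simp add: mon_def del: single_of_nat)
          (intro exI conjI, rule refl, use jk in \<open>simp add: lookup_minus lookup_E \<gamma>_def A_def when_def\<close>)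
    next
      case False
      thus ?thesis by (intro exI[of _ 0]) (simp add: W0_def \<omega>0_def)
    qed
    then obtain c m where W0: "W0 = single m c" "lookup m j = 0" by blast
    have lu: "mon (\<delta> - cp) * lvar j = mon (\<delta> - cp + frag_of j)" by (simp add: lvar_mon)
    have lu1: "lookup (\<delta> - cp + frag_of j) j = 1"
      using jk by (simp add: \<delta>_def cp_def lookup_minus lookup_E A_def)
    have "nzd P (mon (\<delta> - cp + frag_of j) + W0)"
    proof (rule nzd_homogeneous[where \<phi> = "\<lambda>m. lookup m j" and e = 0 and d = 1])
      show "lookup m j = 0" if "m \<in> keys P" for m
        using that keys_add[of "mon cp" "mon cn"] jk
        by (auto simp: P_def mon_def cp_def cn_def lookup_E A_def when_def split: if_splits)
      show "lookup m' j \<le> 1" if "m' \<in> keys (mon (\<delta> - cp + frag_of j) + W0)" for m'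
        using that keys_add[of "mon (\<delta> - cp + frag_of j)" W0] lu1 W0 by (auto simp: mon_def split: if_splits)
      show "comp_at (\<lambda>m. lookup m j) 1 (mon (\<delta> - cp + frag_of j) + W0) = mon (\<delta> - cp + frag_of j)"
        using lu1 W0 by (simp add: comp_at_add mon_def comp_at_single)
    qed simp
    thus ?thesis unfolding y' lu by (rule nzd_add)
  qed
  show ?thesis
  proof (rule Lau_one_step[where J = "{j, k}" and y = "lvar(k := z, j := y)", OF _ _ refl refl P\<xi> P0])
    show "f \<in> Lau (to_ratfun \<circ> lvar(j := \<xi>))" using f(1) s1 by simp
    show "f \<in> Lau (to_ratfun \<circ> lvar(k := z, j := y))" using f(2) s3 by simp
  qed (use nz ny z0 y0 jk in auto)
qed


text \<open>The two mutations commute, and what matters is that their exchange polynomials are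
  coprime. Independence of the columns provides a non-zero 2 x 2 minor in rows \<open>r\<close> and
  \<open>s\<close>; it yields a weight \<open>\<phi>\<close> that is constant on \<open>P j\<close>
  and separates the two monomials of \<open>P k\<close>.\<close>

lemma Lau_three_mutations_zero:
  assumes b: "good_matrix n N b" and jk: "j < n" "k < n" "j \<noteq> k" and zero: "b j k = 0"
    and f: "f \<in> Lau (fst (mutates N [j] (rvar, b)))" "f \<in> Lau (fst (mutates N [j, k, j] (rvar, b)))"
  shows "f \<in> Lau rvar"
proof -
  have skew: "skew_symmetrizable n b" and nN: "n \<le> N" and ind: "column_indep n N b"
    using b by (auto simp: good_matrix_def)
  have zero': "b k j = 0" "b j j = 0" "b k k = 0"
    using skew_symmetrizable_sign[OF skew, of k j] skew_symmetrizable_sign(3)[OF skew] jk zero by auto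
  have "\<exists>r s. r < N \<and> s < N \<and> b r j * b s k \<noteq> b s j * b r k"
  proof (rule ccontr)
    assume *: "\<not> ?thesis"
    obtain r where r: "r < N" "b r j \<noteq> 0" using good_matrix_column[OF b jk(1)] by blast
    define c where "c i = (if i = j then b r k else if i = k then - b r j else 0)" for i
    have "(\<Sum>i<n. b s i * c i) = 0" if "s < N" for s
    proof -
      have "(\<Sum>i<n. b s i * c i) = (\<Sum>i\<in>{j, k}. b s i * c i)"
        using jk by (intro sum.mono_neutral_right) (auto simp: c_def)
      thus ?thesis using * r that jk(3) by (auto simp: c_def)
    qed
    hence "c k = 0" using ind jk unfolding column_indep_def by blast
    thus False using r jk by (simp add: c_def)
  qed
  then obtain r s where rs: "r < N" "s < N" "b r j * b s k \<noteq> b s j * b r k" by blast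
  define cp cn where "cp l = col_pos N b l" and "cn l = col_neg N b l" for l
  define P where "P l = mon (cp l) + mon (cn l)" for l
  have lk: "lookup (cp l) i = (if i < N then pos (b i l) else 0)"
    "lookup (cn l) i = (if i < N then pos (- b i l) else 0)" for l i
    by (simp_all add: cp_def cn_def lookup_col)
  have lv: "mon_pos N lvar b l = mon (cp l)" "mon_neg N lvar b l = mon (cn l)" for l
    unfolding mon_pos_def mon_neg_def prod_lvar cp_def cn_def col_pos_def col_neg_def
    by (intro arg_cong[of _ _ mon] sum.cong; simp)+
  define b1 where "b1 = mutate_matrix j b"
  define b2 where "b2 = mutate_matrix k b1"
  have b1: "b1 i k = b i k" for i
    using jk zero by (cases "i = j") (simp_all add: b1_def mutate_matrix_alt, simp_all add: mutate_matrix_def)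
  have b2: "b2 i j = - b i j" for i
    using jk zero' unfolding b2_def
    by (cases "i = k") (simp_all add: mutate_matrix_alt, simp_all add: mutate_matrix_def b1_def)
  have P0: "P l \<noteq> 0" if "l < n" for l
  proof -
    have "cp l \<noteq> cn l" using col_neq[OF b that] by (simp add: cp_def cn_def)
    hence "lookup (P l) (cp l) = 1" by (auto simp: P_def mon_def)
    thus ?thesis by auto
  qed
  define \<xi> where "\<xi> = P j * mon (- frag_of j)"
  define z where "z = P k * mon (- frag_of k)"
  have li: "lvar l * (p * mon (- frag_of l)) = p" for l p
    by (simp add: lvar_mon mult.left_commute[of _ p])
  have P\<xi>: "P j = \<xi> * lvar j" using li[of j "P j"] by (simp add: \<xi>_def mult.commute)
  have nz: "\<xi> \<noteq> 0" "z \<noteq> 0" using P0 jk by (auto simp: \<xi>_def z_def)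
  have "mon_pos N lvar b j + mon_neg N lvar b j = lvar j * \<xi>"
    by (simp only: lv li \<xi>_def P_def[symmetric])
  from mutate_to_ratfun[OF this refl] have s1: "mutates N [j] (rvar, b) = (to_ratfun \<circ> lvar(j := \<xi>), b1)"
    by (simp add: b1_def rvar_comp)
  have drop: "(\<Prod>i<N. (w(l := v)) i ^ nat (g i)) = (\<Prod>i<N. w i ^ nat (g i))" if "g l = 0"
    for w :: "nat \<Rightarrow> nat laurent" and l v g using that by (intro prod.cong) auto
  have "mon_pos N (lvar(j := \<xi>)) b1 k + mon_neg N (lvar(j := \<xi>)) b1 k = mon_pos N lvar b k + mon_neg N lvar b k"
    unfolding mon_pos_def mon_neg_def b1 by (simp only: drop zero minus_zero)
  also have "\<dots> = lvar k * z" by (simp only: lv li z_def P_def[symmetric])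
  finally have s2: "mutates N [j, k] (rvar, b) = (to_ratfun \<circ> lvar(j := \<xi>, k := z), b2)"
    using mutate_to_ratfun[of N "lvar(j := \<xi>)" b1 k "lvar k" z] s1 jk by (simp add: b2_def)
  have "mon_pos N (lvar(j := \<xi>, k := z)) b2 j + mon_neg N (lvar(j := \<xi>, k := z)) b2 j = mon_neg N lvar b j + mon_pos N lvar b j"
    unfolding mon_pos_def mon_neg_def b2 by (simp only: drop zero' minus_zero minus_minus)
  also have "\<dots> = \<xi> * lvar j" by (simp only: lv P\<xi>[symmetric]) (simp add: P_def)
  finally have s3: "fst (mutates N [j, k, j] (rvar, b)) = to_ratfun \<circ> lvar(k := z)"
    using mutate_to_ratfun[of N "lvar(j := \<xi>, k := z)" b2 j \<xi> "lvar j"] s2 jk nz by (simp add: fun_upd_idem)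
  define \<phi> where "\<phi> m = b r j * lookup m s - b s j * lookup m r" for m
  have pp: "pos x = x + pos (- x)" for x :: int by simp
  have \<phi>_col: "\<phi> (cp l) - \<phi> (cn l) = b r j * b s l - b s j * b r l" for l
    using rs pp[of "b s l"] pp[of "b r l"] by (simp add: \<phi>_def lk algebra_simps)
  have \<phi>_add: "\<phi> (m + m') = \<phi> m + \<phi> m'" for m m' by (simp add: \<phi>_def algebra_simps)
  define u where "u = (if \<phi> (cn k) < \<phi> (cp k) then cp k else cn k)"
  have ne: "\<phi> (cp k) \<noteq> \<phi> (cn k)" using \<phi>_col[of k] rs by auto
  have kP: "m = cp l \<or> m = cn l" if "m \<in> keys (P l)" for m l
    using that keys_add[of "mon (cp l)" "mon (cn l)"] by (auto simp: P_def mon_def)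
  have "nzd (P j) (P k)"
  proof (rule nzd_homogeneous[where \<phi> = \<phi> and e = "\<phi> (cp j)" and d = "\<phi> u" and u = u, OF \<phi>_add])
    show "\<phi> m = \<phi> (cp j)" if "m \<in> keys (P j)" for m
      using kP[OF that] \<phi>_col[of j] by auto
    show "\<phi> m \<le> \<phi> u" if "m \<in> keys (P k)" for m
      using kP[OF that] by (auto simp: u_def)
    show "comp_at \<phi> (\<phi> u) (P k) = mon u"
      using ne by (auto simp: P_def comp_at_add mon_def comp_at_single u_def)
  qed
  hence nzz: "nzd (P j) z" unfolding z_def by (rule nzd_mult) (rule nzd_unit[OF mon_inverse])
  show ?thesis
  proof (rule Lau_one_step[where J = "{k}" and y = "lvar(k := z)", OF _ _ refl refl P\<xi> P0[OF jk(1)]])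
    show "f \<in> Lau (to_ratfun \<circ> lvar(j := \<xi>))" using f(1) s1 by simp
    show "f \<in> Lau (to_ratfun \<circ> lvar(k := z))" using f(2) s3 by simp
  qed (use nz nzz in auto)
qed

lemma Lau_three_mutations:
  assumes b: "good_matrix n N b" and jk: "j < n" "k < n" "j \<noteq> k"
    and f: "f \<in> Lau (fst (mutates N [j] (rvar, b)))" "f \<in> Lau (fst (mutates N [j, k, j] (rvar, b)))"
  shows "f \<in> Lau rvar"
proof -
  consider "b j k < 0" | "b j k = 0" | "neg_matrix b j k < 0" unfolding neg_matrix_def by linarith
  thus ?thesis
  proof cases
    \<comment> \<open>Changing the sign of the whole matrix exchanges the two monomials everywhere
      and leaves all variables unchanged.\<close>
    case 3
    thus ?thesis
      using Lau_three_mutations_neg[OF good_matrix_neg[OF b] jk, of f] f by (simp only: mutates_neg fst_conv)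
  qed (use Lau_three_mutations_neg Lau_three_mutations_zero assms in blast)+
qed

definition upper :: "nat \<Rightarrow> nat \<Rightarrow> seed \<Rightarrow> ratfun set" where
  "upper n N s = {f \<in> Lau (fst s). \<forall>j<n. f \<in> Lau (fst (mutate N j s))}"

lemma seed_ok_as_hom:
  assumes "seed_ok n N (x, b)"
  shows "field_hom (fhom x)" "mutates N ks (x, b) = (fhom x \<circ> fst (mutates N ks (rvar, b)), snd (mutates N ks (rvar, b)))"
proof -
  have x: "lm_indep x" using assms by (simp add: seed_ok_def)
  show h: "field_hom (fhom x)" by (rule field_hom_fhom[OF x])
  show "mutates N ks (x, b) = (fhom x \<circ> fst (mutates N ks (rvar, b)), snd (mutates N ks (rvar, b)))"
    using mutates_hom[OF h, of N ks rvar b] by (simp add: fhom_comp_rvar[OF x])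
qed

text \<open>Only the neighbours at \<open>j \<noteq> k\<close> need an argument. Seen from
  \<open>t\<close>, which is \<open>s\<close> mutated at \<open>k\<close> and then at
  \<open>j\<close>, the seeds \<open>mutate N k s\<close> and \<open>mutate N j s\<close> are the
  first and the third in the chain of mutations at \<open>j\<close>, \<open>k\<close>,
  \<open>j\<close>.\<close>

lemma upper_mutate_subset:
  assumes s: "seed_ok n N s" and k: "k < n" and f: "f \<in> upper n N s"
  shows "f \<in> upper n N (mutate N k s)"
proof -
  have "f \<in> Lau (fst (mutate N j (mutate N k s)))" if j: "j < n" for j
  proof (cases "j = k")
    case True
    thus ?thesis using f mutate_involution[of n N "fst s" "snd s" k] s k by (simp add: upper_def)
  next
    case False
    define t where "t = mutates N [k, j] s"
    obtain x b where t: "t = (x, b)" by fastforce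
    have tok: "seed_ok n N (x, b)" using seed_ok_mutates[OF s, of "[k, j]"] j k by (simp add: t[symmetric] t_def)
    have ok1: "seed_ok n N (mutate N k s)" using seed_ok_mutates[OF s, of "[k]"] k by simp
    have t1: "mutate N j t = mutate N k s"
      using mutate_involution[of n N "fst (mutate N k s)" "snd (mutate N k s)" j] ok1 j by (simp add: t_def)
    have t2: "mutate N k (mutate N j t) = s" using mutate_involution[of n N "fst s" "snd s" k] s k t1 by simp
    note h = seed_ok_as_hom[OF tok]
    have tr: "Lau (fst (mutates N ks t)) = fhom x ` Lau (fst (mutates N ks (rvar, b)))" for ks
      unfolding t h(2) by (simp add: Lau_hom[OF h(1)])
    have "f \<in> Lau (fst (mutates N [j] t))" using f k t1 by (simp add: upper_def)
    then obtain g where g: "f = fhom x g" "g \<in> Lau (fst (mutates N [j] (rvar, b)))" unfolding tr by blast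
    have "f \<in> Lau (fst (mutates N [j, k, j] t))" using f j t2 by (simp add: upper_def)
    hence "g \<in> Lau (fst (mutates N [j, k, j] (rvar, b)))"
      unfolding tr g using field_hom_inj[OF h(1)] by auto
    hence "g \<in> Lau rvar" using Lau_three_mutations g j k False tok by (simp add: seed_ok_def) blast
    hence "f \<in> Lau (fst (mutates N [] t))" unfolding tr g by simp
    thus ?thesis by (simp add: t_def)
  qed
  thus ?thesis using f k by (simp add: upper_def)
qed

lemma upper_mutates:
  assumes s: "seed_ok n N s" and ks: "set ks \<subseteq> {..<n}" shows "upper n N (mutates N ks s) = upper n N s"
proof -
  have sub: "upper n N s \<subseteq> upper n N (mutates N ks s)" if "seed_ok n N s" "set ks \<subseteq> {..<n}" for ks s
    using that
  proof (induction ks arbitrary: s)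
    case (Cons k ks)
    have "seed_ok n N (mutate N k s)" using seed_ok_mutates[of n N s "[k]"] Cons by simp
    thus ?case using Cons upper_mutate_subset[of n N s k] by fastforce
  qed simp
  show ?thesis
    using sub[OF s ks] sub[of "mutates N ks s" "rev ks"] seed_ok_mutates[OF s ks] mutates_rev[OF s ks] ks by auto
qed

lemma var_in_upper:
  assumes s: "seed_ok n N s" shows "fst s i \<in> upper n N s"
proof -
  obtain x b where xb: "s = (x, b)" by fastforce
  have nz: "x l \<noteq> 0" for l using seed_okD(3)[OF s[unfolded xb]] .
  have "x i \<in> Lau (fst (mutate N j (x, b)))" if j: "j < n" for j
  proof -
    obtain x' b' where m: "mutate N j (x, b) = (x', b')" by fastforce
    have ok: "seed_ok n N (x', b')" using seed_ok_mutate[OF s[unfolded xb] j] m by simp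
    have nz': "x' l \<noteq> 0" for l using seed_okD(3)[OF ok] .
    note S = subring_setD[OF subring_Lau[of x', OF nz']]
    show ?thesis
    proof (cases "i = j")
      case False
      hence "x' i = x i" using m by (auto simp: mutate_eq)
      thus ?thesis using Lau_var[of x' i] nz' m by simp
    next
      case True
      have "mutate N j (x', b') = (x, b)" using mutate_involution[OF s[unfolded xb] j] m by simp
      hence "x j = (mon_pos N x' b' j + mon_neg N x' b' j) / x' j" by (auto simp: mutate_eq)
      also have "\<dots> = (monomial x' (col_pos N b' j) + monomial x' (col_neg N b' j)) * x' j powi (-1)"
        by (simp add: mon_eq_monomial divide_inverse)
      also have "\<dots> \<in> Lau x'"
        by (intro S(1,2) Lau_closed(5) Lau_powi nz')
      finally show ?thesis using True m by simp
    qed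
  qed
  thus ?thesis using Lau_var[of x i] nz by (simp add: upper_def xb)
qed

lemma Laurent_phenomenon:
  assumes "seed_ok n N s" "set ks \<subseteq> {..<n}" shows "fst (mutates N ks s) i \<in> upper n N s"
  using var_in_upper[OF seed_ok_mutates[OF assms], of i] by (simp add: upper_mutates assms)


subsection \<open>A cluster variable divisible by an initial variable\<close>

lemma pole_mutate:
  assumes x: "\<And>i. rpos (x i)"
  shows "pole t (fst (mutate N k (x, b)) k) =
    max (\<Sum>i<N. pos (b i k) * pole t (x i)) (\<Sum>i<N. pos (- b i k) * pole t (x i)) - pole t (x k)"
proof -
  note g = rpos_nonzero[OF x]
  have p: "rpos (mon_pos N x b k)" "rpos (mon_neg N x b k)"
    by (auto simp: mon_pos_def mon_neg_def intro!: rpos_prod rpos_power x)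
  have nat: "int (nat e) * c = pos e * c" for e c by simp
  have "pole t (mon_pos N x b k) = (\<Sum>i<N. int (nat (b i k)) * pole t (x i))"
    "pole t (mon_neg N x b k) = (\<Sum>i<N. int (nat (- b i k)) * pole t (x i))"
    unfolding mon_pos_def mon_neg_def by (subst pole_prod, auto simp: pole_power g)+
  hence "pole t (mon_pos N x b k) = (\<Sum>i<N. pos (b i k) * pole t (x i))"
    "pole t (mon_neg N x b k) = (\<Sum>i<N. pos (- b i k) * pole t (x i))"
    by (simp_all only: nat)
  thus ?thesis
    using rpos_nonzero[OF rpos_add[OF p]] by (simp add: mutate_eq pole_divide g pole_add[OF p])
qed

text \<open>A frozen variable has order -1 along itself and enters at most one of the two monomials
  of an exchange relation, so the larger of their orders is 0.\<close>

lemma pole_frozen: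
  assumes s: "good_matrix n N b" and ks: "set ks \<subseteq> {..<n}" and t: "t \<ge> n" and j: "j < n"
  shows "pole t (fst (mutates N ks (rvar, b)) j) = 0"
proof -
  have "\<forall>j<n. pole t (fst (mutates N ks (x, b)) j) = 0"
    if "seed_ok n N (x, b)" "\<forall>j<n. pole t (x j) = 0" for x b
    using ks that
  proof (induction ks arbitrary: x b)
    case (Cons k ks)
    note g = seed_okD[OF Cons.prems(2)]
    obtain x' b' where m: "mutate N k (x, b) = (x', b')" by fastforce
    have "(\<Sum>i<N. e i * pole t (x i)) = (\<Sum>i<N. if i = t then - e t else 0)" for e
    proof (rule sum.cong[OF refl])
      fix i show "e i * pole t (x i) = (if i = t then - e t else 0)"
      using Cons.prems(3) t g(6)[of i] by force
    qed
    note sm = this[of "\<lambda>i. pos (b i k)"] this[of "\<lambda>i. pos (- b i k)"]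
    have kn: "k < n" using Cons.prems(1) by simp
    have "pole t (x' k) = 0"
      using pole_mutate[of x t N k b, OF g(2)] m Cons.prems(3) kn unfolding sm by auto
    hence "\<forall>j<n. pole t (x' j) = 0" using Cons.prems(3) m by (auto simp: mutate_eq)
    moreover have "seed_ok n N (x', b')" using seed_ok_mutate[OF Cons.prems(2), of k] m Cons.prems(1) by simp
    ultimately show ?case using Cons.IH[of x' b'] Cons.prems(1) m by simp
  qed simp
  thus ?thesis using seed_ok_initial[OF s] t j by auto
qed

text \<open>The largest and the smallest exponent are both additive under multiplication, so in a
  unit they coincide.\<close>

lemma laurent_unit:
  fixes p q :: "nat laurent"
  assumes "p * q = 1" obtains m c where "p = single m c" "c \<noteq> 0"
proof -
  have nz: "p \<noteq> 0" "q \<noteq> 0" using assms by auto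
  have "ldeg id p + ldeg id q = 0" "ldeg uminus p + ldeg uminus q = 0"
    using ldeg_mult[of id p q] ldeg_mult[of uminus p q] ldeg_single[of 1 id "0 :: nat \<Rightarrow>\<^sub>0 int"]
      ldeg_single[of 1 uminus "0 :: nat \<Rightarrow>\<^sub>0 int"] nz
    unfolding assms by auto
  moreover have ge: "- ldeg uminus r \<le> ldeg id r" if "r \<noteq> 0" for r :: "nat laurent"
  proof -
    obtain m where m: "m \<in> keys r" using \<open>r \<noteq> 0\<close> by (metis all_not_in_conv keys_eq_empty)
    have "- m \<le> ldeg uminus r" "m \<le> ldeg id r" using ldeg_ge[OF m, of uminus] ldeg_ge[OF m, of id] by auto
    thus ?thesis by (meson minus_le_iff order_trans)
  qed
  ultimately have eq: "- ldeg uminus p = ldeg id p"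
    using ge[OF nz(1)] ge[OF nz(2)]
    by (metis (no_types, lifting) add_eq_0_iff antisym neg_le_iff_le)
  have "m = ldeg id p" if "m \<in> keys p" for m
    using ldeg_ge[OF that, of uminus] ldeg_ge[OF that, of id] eq by (metis antisym id_apply minus_le_iff)
  hence "p = single (ldeg id p) (lookup p (ldeg id p))"
    by (intro poly_mapping_eqI) (auto simp: when_def in_keys_iff)
  moreover from this have "lookup p (ldeg id p) \<noteq> 0" using nz by (metis single_zero)
  ultimately show ?thesis using that by blast
qed

lemma ev_in_subring:
  assumes S: "subring_set S" and x: "\<And>i. x i \<in> S" and u: "\<And>i. i \<noteq> k \<Longrightarrow> inverse (x i) \<in> S"
    and p: "\<And>m. m \<in> keys p \<Longrightarrow> lookup m k \<ge> 0"
  shows "ev x p \<in> S"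
proof -
  note S' = subring_setD[OF S]
  have sum: "(\<And>i. i \<in> A \<Longrightarrow> h i \<in> S) \<Longrightarrow> (\<Sum>i\<in>A. h i) \<in> S" for A and h :: "(nat \<Rightarrow>\<^sub>0 int) \<Rightarrow> ratfun"
    using S'(3)[of 0] by (induction A rule: infinite_finite_induct) (simp_all add: S')
  have "x i powi lookup m i \<in> S" if "m \<in> keys p" for m i
    using p[OF that] S'(5)[OF x] S'(5)[OF u]
    by (cases "i = k") (auto simp: power_int_def)
  thus ?thesis unfolding ev_def lev_def monomial_def
    by (intro sum S'(2,3,6))
qed

lemma monomial_fun_upd:
  assumes "\<And>i. x i \<noteq> 0" "v \<noteq> 0"
  shows "monomial (x(k := v)) m = monomial x (m - single k (lookup m k)) * v powi lookup m k"
proof -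
  let ?y = "x(k := v)" and ?m = "m - single k (lookup m k)"
  have nz: "?y i \<noteq> 0" for i using assms by simp
  have "monomial ?y (?m + single k (lookup m k)) =
      monomial ?y ?m * v powi lookup m k" by (subst monomial_add[OF nz]) simp
  moreover have "monomial ?y ?m = monomial x ?m"
    unfolding monomial_def by (intro prod.cong) (auto simp: lookup_minus)
  ultimately show ?thesis by simp
qed

text \<open>In the mutated seed, \<open>x j\<close> is the exchange polynomial \<open>P\<close>
  divided by \<open>y j\<close>. A negative exponent of \<open>x j\<close> would make
  \<open>P\<close> a unit of the Laurent ring, but \<open>P\<close> has two terms.\<close>

lemma monomial_exponent_nonneg:
  assumes s: "seed_ok n N (x, b)" and j: "j < n" and c: "c \<noteq> 0"
    and f: "rconst c * monomial x m \<in> Lau (fst (mutate N j (x, b)))"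
  shows "lookup m j \<ge> 0"
proof (rule ccontr)
  assume neg: "\<not> ?thesis"
  obtain y a where y: "mutate N j (x, b) = (y, a)" by fastforce
  have ok: "seed_ok n N (y, a)" using seed_ok_mutate[OF s j] y by simp
  note g = seed_okD[OF ok]
  define P where "P = mon (col_pos N a j) + mon (col_neg N a j)"
  have evP: "ev y P = mon_pos N y a j + mon_neg N y a j"
    by (simp add: P_def mon_def ev_single g(3) mon_eq_monomial)
  have "mutate N j (y, a) = (x, b)" using mutate_involution[OF s j] y by simp
  hence x: "x = y(j := ev y P / y j)" by (simp add: mutate_eq evP)
  have evP0: "ev y P \<noteq> 0" using seed_okD(3)[OF s, of j] by (auto simp: x)
  define t where "t = nat (- lookup m j)"
  have t: "lookup m j = - int t" "t > 0" using neg by (auto simp: t_def)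
  obtain r where r: "rconst c * monomial x m = ev y r" using f y by (auto simp: Lau_def)
  define m0 where "m0 = m - single j (lookup m j)"
  have "monomial x m = monomial y m0 * (y j / ev y P) ^ t"
    using monomial_fun_upd[of y "ev y P / y j" j m] g(3) evP0 unfolding x m0_def t
    by (simp add: power_int_def flip: power_inverse)
  hence "ev y r * ev y P ^ t = rconst c * monomial y m0 * y j ^ t"
    using evP0 by (simp add: r[symmetric] power_divide)
  hence "ev y (r * P ^ t) = ev y (single m0 c * lvar j ^ t)"
    by (simp add: g(3) ev_single)
  hence eq: "r * P ^ t = single m0 c * lvar j ^ t" using ev_inj[OF g(5)] by simp
  have unit: "single m0 c * lvar j ^ t * (single (- m0) (inverse c) * mon (- frag_of j) ^ t) = 1"
  proof -
    have "lvar j ^ t * mon (- frag_of j) ^ t = 1" by (simp add: lvar_mon flip: power_mult_distrib)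
    moreover have "single m0 c * single (- m0) (inverse c) = 1" using c by simp
    ultimately show ?thesis by (metis (no_types, lifting) mult.left_commute mult_1_right)
  qed
  have "P * (r * P ^ (t - 1) * (single (- m0) (inverse c) * mon (- frag_of j) ^ t)) = 1"
  proof -
    have "P ^ t = P * P ^ (t - 1)" using t(2) by (cases t) auto
    thus ?thesis using unit unfolding eq[symmetric] by (simp add: mult_ac)
  qed
  then obtain m' c' where P': "P = single m' c'" by (rule laurent_unit)
  have "col_pos N a j \<noteq> col_neg N a j" by (rule col_neq[OF g(1) j])
  hence "lookup P (col_pos N a j) = 1" "lookup P (col_neg N a j) = 1"
    by (auto simp: P_def mon_def)
  with \<open>col_pos N a j \<noteq> col_neg N a j\<close> show False by (auto simp: P' when_def split: if_splits)
qed

text \<open>In the Laurent rings of the initial seed and of its neighbours at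
  \<open>j \<noteq> k\<close> the divisor is a unit. In the neighbour at \<open>k\<close> it is not;
  there the hypothesis on the pole keeps the exponents of \<open>rvar k\<close>
  non-negative.\<close>

lemma upper_divide_var:
  assumes b: "good_matrix n N b" and k: "k < n" and z: "z \<in> upper n N (rvar, b)" "z \<noteq> 0" "pole k z < 0"
  shows "z / rvar k \<in> upper n N (rvar, b)"
proof -
  have ok: "seed_ok n N (rvar, b)" by (rule seed_ok_initial[OF b])
  obtain p where p: "z = to_ratfun p" using z by (auto simp: upper_def Lau_rvar)
  define q where "q = p * mon (- frag_of k)"
  have w: "z / rvar k = to_ratfun q"
    unfolding p q_def by (simp add: to_ratfun_mon monomial_uminus divide_inverse)
  have kq: "lookup m k \<ge> 0" if "m \<in> keys q" for m
  proof -
    have "m \<in> {a + c |a c. a \<in> keys p \<and> c \<in> keys (mon (- frag_of k))}"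
      using subsetD[OF keys_mult] that unfolding q_def by blast
    then obtain m' where m': "m' \<in> keys p" "m = m' + (- frag_of k)"
      unfolding mon_def by auto
    have "p \<noteq> 0" using m' by auto
    hence "pole k z = ldeg (\<lambda>m. - lookup m k) p"
      unfolding p pole_def by (rule weight.rdeg_to_ratfun[OF weight_lookup])
    thus ?thesis using ldeg_ge[OF m'(1), of "\<lambda>m. - lookup m k"] z(3) by (simp add: m'(2) lookup_minus)
  qed
  have "z / rvar k \<in> Lau (fst (mutate N j (rvar, b)))" if j: "j < n" for j
  proof -
    define y where "y = fst (mutate N j (rvar, b))"
    have nz: "y i \<noteq> 0" for i
      using seed_ok_mutate[OF ok j] rpos_nonzero unfolding y_def seed_ok_def by blast
    note S = subring_Lau[of y, OF nz] and Y = Lau_powi[of y, OF nz]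
    have y: "y i = rvar i" if "i \<noteq> j" for i using that by (simp add: y_def mutate_eq)
    show ?thesis
    proof (cases "j = k")
      case False
      have "z * inverse (y k) \<in> Lau y"
        using z(1) j subring_setD(2)[OF S, of z] Y[of k "-1"] by (simp add: upper_def y_def)
      thus ?thesis using False y[of k] by (simp add: divide_inverse y_def)
    next
      case True
      have "ev rvar q \<in> Lau y"
      proof (rule ev_in_subring[OF S, of _ k])
        show "rvar i \<in> Lau y" for i using var_in_upper[OF ok, of i] j by (simp add: upper_def y_def)
        show "inverse (rvar i) \<in> Lau y" if "i \<noteq> k" for i using Y[of i "-1"] y[of i] that True by simp
      qed (use kq in auto)
      thus ?thesis by (simp add: w ev_rvar y_def)
    qed
  qed
  thus ?thesis by (auto simp: upper_def w Lau_rvar)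
qed

text \<open>\<open>x l\<close> is the product of \<open>rvar k\<close> and \<open>w\<close>, and
  both lie in the Laurent ring of the seed of \<open>x l\<close>. Factors of a variable are units
  there, hence monomials. Comparing exponents leaves \<open>rvar k = rconst c * x l\<close>, and the
  leading coefficients give \<open>c = 1\<close>.\<close>

theorem cluster_variable_eq_initial:
  assumes b: "good_matrix n N b" and ks: "set ks \<subseteq> {..<n}" and k: "k < n" and l: "l < n"
    and neg: "pole k (fst (mutates N ks (rvar, b)) l) < 0"
  shows "fst (mutates N ks (rvar, b)) l = rvar k"
proof -
  have ok: "seed_ok n N (rvar, b)" by (rule seed_ok_initial[OF b])
  obtain x a where xa: "mutates N ks (rvar, b) = (x, a)" by fastforce
  have oks: "seed_ok n N (x, a)" using seed_ok_mutates[OF ok ks] xa by simp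
  note g = seed_okD[OF oks]
  have up: "upper n N (x, a) = upper n N (rvar, b)" using upper_mutates[OF ok ks] xa by simp
  have "x l \<in> upper n N (rvar, b)" using Laurent_phenomenon[OF ok ks, of l] xa by simp
  moreover define w where "w = x l / rvar k"
  ultimately have w: "w \<in> upper n N (x, a)"
    using upper_divide_var[OF b k] neg xa g(3) up by simp
  have rk: "rvar k \<in> upper n N (x, a)" using var_in_upper[OF ok, of k] up by simp
  obtain p q where p: "rvar k = ev x p" and q: "w = ev x q" using w rk by (auto simp: upper_def Lau_def)
  have "rvar k * w = x l" by (simp add: w_def)
  hence "ev x (p * q) = ev x (lvar l)" by (simp add: g(3) flip: p q)
  hence pq: "p * q = lvar l" using ev_inj[OF g(5)] by simp
  hence "p * (q * mon (- frag_of l)) = 1" by (simp add: mult.assoc[symmetric] lvar_mon)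
  then obtain m c where m: "p = single m c" "c \<noteq> 0" by (rule laurent_unit)
  have "q * (p * mon (- frag_of l)) = 1" using pq by (simp add: mult.assoc[symmetric] mult.commute[of q] lvar_mon)
  then obtain m' c' where m': "q = single m' c'" "c' \<noteq> 0" by (rule laurent_unit)
  have "single (m + m') (c * c') = single (frag_of l) 1"
    using pq m m' by (simp add: lvar_def)
  hence mm: "m + m' = frag_of l"
    using m(2) m'(2) by (metis keys_single mult_eq_0_iff singleton_insert_inj_eq' zero_neq_one)
  have nonneg: "lookup m j \<ge> 0" "lookup m' j \<ge> 0" if j: "j < n" for j
    using monomial_exponent_nonneg[OF oks j] w rk j m m' p q
    by (auto simp: upper_def ev_single g(3))
  have mj: "lookup m j = 0" if "j < n" "j \<noteq> l" for j
    using nonneg[OF that(1)] that arg_cong[OF mm, of "\<lambda>m. lookup m j"]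
    by simp
  have rvk: "rvar k = rconst c * monomial x m" using p m by (simp add: ev_single g(3))
  have pole_mon: "pole t (rvar k) = (\<Sum>i\<in>keys m. lookup m i * pole t (x i))" for t
  proof -
    have "pole t (rconst c) = 0"
      unfolding pole_def by (rule weight.rdeg_rconst[OF weight_lookup m(2)])
    thus ?thesis unfolding rvk monomial_def using m(2) g(3) by (simp add: pole_mult pole_prod pole_powi)
  qed
  \<comment> \<open>A frozen factor would show in the order along that frozen variable, where
    \<open>rvar k\<close> and all mutable variables have order 0.\<close>
  have m0: "lookup m t = 0" if t: "t \<ge> n" for t
  proof -
    have "lookup m i * pole t (x i) = (if i = t then - lookup m t else 0)" for i
      using pole_frozen[OF b ks t, of i] xa g(6)[of i] t by (cases "i < n") auto
    hence "pole t (rvar k) = (if t \<in> keys m then - lookup m t else 0)"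
      unfolding pole_mon by simp
    thus ?thesis using t k by (auto simp: in_keys_iff split: if_splits)
  qed
  define e where "e = lookup m l"
  have me: "m = single l e"
    using mj m0 by (intro poly_mapping_eqI) (metis e_def leI lookup_single_eq lookup_single_not_eq)
  have "e \<noteq> 0"
  using rvk me pole_rvar[of k k] weight.rdeg_rconst[OF weight_lookup m(2), folded pole_def, of k] by auto
  moreover have "e \<ge> 0" "e \<le> 1"
    using nonneg[OF l] arg_cong[OF mm, of "\<lambda>m. lookup m l"] by (auto simp: e_def)
  ultimately have "e = 1" by simp
  hence "rvar k = rconst c * x l" using rvk me by simp
  hence "c = 1" using monic_rconst_mult[OF g(4), of c l] monic_rvar by metis
  thus ?thesis using \<open>rvar k = rconst c * x l\<close> xa by simp
qed


subsection \<open>Cartan matrices of finite type\<close>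

locale cartan_datum =
  fixes n :: nat and a :: "nat \<Rightarrow> nat \<Rightarrow> int" and d :: "nat \<Rightarrow> real"
  assumes n_pos: "0 < n"
    and diag: "i < n \<Longrightarrow> a i i = 2"
    and offdiag: "i < n \<Longrightarrow> j < n \<Longrightarrow> i \<noteq> j \<Longrightarrow> a i j \<le> 0"
    and zero_sym: "i < n \<Longrightarrow> j < n \<Longrightarrow> a i j = 0 \<longleftrightarrow> a j i = 0"
    and d_pos: "i < n \<Longrightarrow> 0 < d i"
    and d_sym: "i < n \<Longrightarrow> j < n \<Longrightarrow> d i * of_int (a i j) = d j * of_int (a j i)"
    and pos_def: "i < n \<Longrightarrow> v i \<noteq> 0 \<Longrightarrow> 0 < (\<Sum>i<n. \<Sum>j<n. d i * of_int (a i j) * v i * v j)"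
begin

text \<open>The symmetrization \<open>d i * a i j\<close> in the coordinates
  \<open>v i / d i\<close>. In these the reflection at \<open>k\<close> changes \<open>v k\<close>
  by minus the sum of the \<open>a i k * v i\<close>, the same coefficients as in the mesh
  relations.\<close>

definition qform :: "(nat \<Rightarrow> real) \<Rightarrow> real" where
  "qform v = (\<Sum>i<n. \<Sum>j<n. of_int (a i j) / d j * v i * v j)"

lemma d_nz: "i < n \<Longrightarrow> d i \<noteq> 0"
  using d_pos by fastforce

lemma qform_pos:
  assumes "i < n" "v i \<noteq> 0" shows "qform v > 0"
proof -
  have "qform v = (\<Sum>i<n. \<Sum>j<n. d i * of_int (a i j) * (v i / d i) * (v j / d j))"
    unfolding qform_def by (intro sum.cong refl) (simp add: d_nz)
  thus ?thesis using pos_def[of i "\<lambda>i. v i / d i"] assms d_pos[of i] by simp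
qed

lemma qform_zero: "(\<And>i. i < n \<Longrightarrow> v i = 0) \<Longrightarrow> qform v = 0"
  by (simp add: qform_def)

lemma qform_nonneg: "qform v \<ge> 0"
  using qform_pos[of _ v] qform_zero[of v] by (metis less_eq_real_def)

lemma qform_scale: "qform (\<lambda>i. c * v i) = c\<^sup>2 * qform v"
  unfolding qform_def sum_distrib_left by (intro sum.cong refl) (simp add: power2_eq_square)

text \<open>Compactness: \<open>K i\<close> is a face of the unit cube, on which the form attains a
  positive minimum, and dividing a vector by its entry of largest absolute value moves it to some
  face.\<close>

lemma qform_bound: "\<exists>\<epsilon>>0. \<forall>v. \<forall>i<n. \<epsilon> * (v i)\<^sup>2 \<le> qform v"
proof -
  define K where "K i = (\<Pi>\<^sub>E j\<in>UNIV. if j = i then {1} else if j < n then {-1..1::real} else {0})" for i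
  have "compactin (product_topology (\<lambda>i::nat. euclideanreal) UNIV) (K i)" for i
    unfolding K_def compactin_PiE by auto
  hence comp: "compact (K i)" for i
    by (simp add: euclidean_product_topology)
  have cont: "continuous_on (K i) qform" for i
    unfolding qform_def
    by (intro continuous_intros continuous_on_subset[OF continuous_on_product_coordinates])
       auto
  have "\<exists>q>0. \<forall>v\<in>K i. q \<le> qform v" if i: "i < n" for i
  proof -
    have "(\<lambda>j. if j = i then 1 else 0) \<in> K i" by (auto simp: K_def)
    then obtain v where v: "v \<in> K i" "\<And>w. w \<in> K i \<Longrightarrow> qform v \<le> qform w"
      using continuous_attains_inf[OF comp _ cont, of i] by auto
    have "v i = 1" using v(1) by (auto simp: K_def dest: PiE_mem[of _ _ _ i])
    thus ?thesis using qform_pos[OF i, of v] v by auto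
  qed
  then obtain q where q: "\<And>i. i < n \<Longrightarrow> q i > 0" "\<And>i v. i < n \<Longrightarrow> v \<in> K i \<Longrightarrow> q i \<le> qform v"
    by metis
  define \<epsilon> where "\<epsilon> = Min (q ` {..<n})"
  have \<epsilon>: "\<epsilon> > 0" "i < n \<Longrightarrow> \<epsilon> \<le> q i" for i using q(1) n_pos by (auto simp: \<epsilon>_def lessThan_empty_iff)
  have "\<epsilon> * (v i)\<^sup>2 \<le> qform v" if i: "i < n" for v i
  proof (cases "v i = 0")
    case False
    have "Max ((\<lambda>j. \<bar>v j\<bar>) ` {..<n}) \<in> (\<lambda>j. \<bar>v j\<bar>) ` {..<n}" using n_pos by (intro Max_in) auto
    then obtain k where k: "k < n" "Max ((\<lambda>j. \<bar>v j\<bar>) ` {..<n}) = \<bar>v k\<bar>" by auto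
    have le: "\<bar>v j\<bar> \<le> \<bar>v k\<bar>" if "j < n" for j using that unfolding k(2)[symmetric] by (intro Max_ge) auto
    have vk: "v k \<noteq> 0" using le[OF i] False by auto
    define w where "w j = (if j < n then v j / v k else 0)" for j
    have "\<bar>w j\<bar> \<le> 1" for j using le[of j] by (auto simp: w_def divide_le_eq_1)
    hence "w j \<le> 1" "- 1 \<le> w j" for j by (auto simp: abs_le_iff)
    moreover have "w k = 1" "\<And>j. \<not> j < n \<Longrightarrow> w j = 0" using k(1) vk by (simp_all add: w_def)
    ultimately have "w \<in> K k" by (auto simp: K_def)
    hence "\<epsilon> \<le> qform w" using q(2)[OF k(1)] \<epsilon>(2)[OF k(1)] by force
    moreover have "qform v = (v k)\<^sup>2 * qform w"
      unfolding qform_scale[symmetric] unfolding qform_def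
      by (intro sum.cong refl) (use vk in \<open>auto simp: w_def\<close>)
    ultimately have "\<epsilon> * (v k)\<^sup>2 \<le> qform v" by (metis mult.commute mult_left_mono zero_le_power2)
    moreover have "(v i)\<^sup>2 \<le> (v k)\<^sup>2" using le[OF i] by (simp add: abs_le_square_iff)
    ultimately show ?thesis using \<epsilon>(1) by (meson less_imp_le mult_left_mono order_trans)
  qed (use qform_nonneg in simp)
  thus ?thesis using \<epsilon>(1) by blast
qed

lemma qform_add_unit:
  assumes k: "k < n" and w: "\<And>i. i < n \<Longrightarrow> w i = v i + (if i = k then c else 0)"
  shows "qform w = qform v + 2 * c / d k * (\<Sum>i<n. of_int (a i k) * v i) + 2 * c\<^sup>2 / d k"
proof -
  have swap: "(\<Sum>i<n. \<Sum>j<n. if i = k then F j else 0) = (\<Sum>j<n. F j :: real)" for F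
    by (subst sum.swap) (simp add: k)
  have "qform w = (\<Sum>i<n. \<Sum>j<n. of_int (a i j) / d j * v i * v j
      + (if j = k then of_int (a i k) / d k * v i * c else 0)
      + (if i = k then of_int (a k j) / d j * c * v j else 0)
      + (if j = k then (if i = k then of_int (a k k) / d k * c * c else 0) else 0))"
    unfolding qform_def by (intro sum.cong refl) (auto simp: w algebra_simps add_divide_distrib)
  also have "\<dots> = qform v + (\<Sum>i<n. of_int (a i k) / d k * v i * c)
      + (\<Sum>j<n. of_int (a k j) / d j * c * v j) + of_int (a k k) / d k * c * c"
    unfolding sum.distrib qform_def using k swap by simp
  also have "(\<Sum>j<n. of_int (a k j) / d j * c * v j) = (\<Sum>i<n. of_int (a i k) / d k * v i * c)"
  proof (intro sum.cong refl)
    fix j assume "j \<in> {..<n}"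
    thus "of_int (a k j) / d j * c * v j = of_int (a j k) / d k * v j * c"
      using d_sym[OF k, of j] d_pos[OF k] d_pos[of j] by (simp add: field_simps)
  qed
  finally show ?thesis using diag[OF k]
    by (simp add: sum_distrib_left power2_eq_square algebra_simps)
qed

text \<open>The square of the left hand side is \<open>a i j * a j i\<close>, a product of two
  negative integers.\<close>

lemma neighbour_le:
  assumes "i < n" "j < n" "i \<noteq> j" "a i j \<noteq> 0"
  shows "d i * of_int (a i j) / (sqrt (d i) * sqrt (d j)) \<le> -1"
proof -
  define s where "s = d i * of_int (a i j)"
  have aij: "a i j \<le> -1" "a j i \<le> -1"
    using offdiag[of i j] offdiag[of j i] zero_sym[of i j] assms by auto
  hence "1 \<le> a i j * a j i" using mult_mono[of 1 "- a i j" 1 "- a j i"] by simp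
  hence "1 \<le> (of_int (a i j * a j i) :: real)" by linarith
  moreover have "s\<^sup>2 = d i * d j * of_int (a i j * a j i)"
    using d_sym[of i j] assms by (simp add: s_def power2_eq_square)
  moreover have dd: "0 < d i * d j" using assms d_pos by simp
  ultimately have "d i * d j \<le> s\<^sup>2" by (metis less_imp_le mult.right_neutral mult_left_mono)
  hence "sqrt (d i * d j) \<le> \<bar>s\<bar>" by (metis real_sqrt_abs real_sqrt_le_iff)
  moreover have "s \<le> 0" using d_pos[of i] aij assms by (simp add: s_def mult_le_0_iff)
  ultimately show ?thesis using dd by (simp add: s_def[symmetric] real_sqrt_mult[symmetric] divide_le_eq)
qed

text \<open>On the vector with entries \<open>1 / sqrt (d i)\<close> for \<open>i\<close> in
  \<open>S\<close>, each vertex contributes 2 from the diagonal and at most -1 for each neighbour.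
  If every vertex had two neighbours in \<open>S\<close>, the form would not be positive.\<close>

lemma exists_leaf:
  assumes S: "S \<subseteq> {..<n}" "S \<noteq> {}"
  shows "\<exists>s\<in>S. card {j\<in>S. j \<noteq> s \<and> a s j \<noteq> 0} \<le> 1"
proof (rule ccontr)
  assume "\<not> ?thesis"
  hence c: "2 \<le> card {j\<in>S. j \<noteq> s \<and> a s j \<noteq> 0}" if "s \<in> S" for s using that by force
  have fin: "finite S" using S(1) by (rule finite_subset) simp
  define v where "v i = (if i \<in> S then 1 / sqrt (d i) else 0)" for i
  define t where "t i j = d i * of_int (a i j) * v i * v j" for i j
  obtain s0 where s0: "s0 \<in> S" using S(2) by auto
  have "v s0 \<noteq> 0" using s0 S(1) d_pos[of s0] by (auto simp: v_def)
  hence "0 < (\<Sum>i<n. \<Sum>j<n. t i j)" unfolding t_def using pos_def[of s0 v] s0 S(1) by auto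
  also have "\<dots> = (\<Sum>i\<in>S. \<Sum>j\<in>S. t i j)"
  proof (rule sum.mono_neutral_cong_right)
    show "(\<Sum>j<n. t i j) = (\<Sum>j\<in>S. t i j)" for i
      using S(1) by (intro sum.mono_neutral_right) (auto simp: t_def v_def)
  qed (use S(1) in \<open>auto simp: t_def v_def\<close>)
  also have "\<dots> \<le> (\<Sum>i\<in>S. 0)"
  proof (rule sum_mono)
    fix i assume i: "i \<in> S"
    define T where "T = {j\<in>S. j \<noteq> i \<and> a i j \<noteq> 0}"
    have T: "finite T" "T \<subseteq> S" "i \<notin> T" using fin by (auto simp: T_def)
    have t: "t i j \<le> -1" if "j \<in> T" for j
      using neighbour_le[of i j] that i S(1) by (auto simp: t_def v_def T_def)
    have "t i i = 2" using i S(1) diag[of i] d_pos[of i] by (auto simp: t_def v_def)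
    moreover have "(\<Sum>j\<in>S. t i j) = (\<Sum>j\<in>insert i T. t i j)"
      using i fin by (intro sum.mono_neutral_right) (auto simp: T_def t_def)
    moreover have "(\<Sum>j\<in>T. t i j) \<le> (\<Sum>j\<in>T. -1)" using t by (rule sum_mono)
    ultimately show "(\<Sum>j\<in>S. t i j) \<le> 0" using T c[OF i] by (simp add: T_def[symmetric])
  qed
  finally show False by simp
qed

end

text \<open>Leaves are removed one by one; the height of a leaf is dictated by its only neighbour,
  if there is one.\<close>

lemma exists_height:
  assumes "cartan_datum n a d" and E: "orientation n a E"
  shows "\<exists>h::nat \<Rightarrow> int. \<forall>(i, j)\<in>E. h j = h i + 1"
proof -
  interpret cartan_datum n a d by fact
  have "\<exists>h::nat \<Rightarrow> int. \<forall>(i, j)\<in>E. i \<in> S \<longrightarrow> j \<in> S \<longrightarrow> h j = h i + 1"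
    if "finite S" "S \<subseteq> {..<n}" for S
    using that
  proof (induction S rule: finite_psubset_induct)
    case (psubset S)
    show ?case
    proof (cases "S = {}")
      case False
      then obtain s where s: "s \<in> S" "card {j\<in>S. j \<noteq> s \<and> a s j \<noteq> 0} \<le> 1"
        using exists_leaf[OF psubset.prems] by auto
      obtain h :: "nat \<Rightarrow> int" where h: "\<forall>(i, j)\<in>E. i \<in> S - {s} \<longrightarrow> j \<in> S - {s} \<longrightarrow> h j = h i + 1"
        using psubset.IH[of "S - {s}"] s(1) psubset.prems by auto
      define J where "J = {j\<in>S. j \<noteq> s \<and> a s j \<noteq> 0}"
      have nb: "j \<in> J" if "j \<in> S" "(s, j) \<in> E \<or> (j, s) \<in> E" for j
      proof -
        have "a s j \<noteq> 0 \<and> j \<noteq> s"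
          using that E zero_sym[of j s] unfolding orientation_def by auto
        thus ?thesis using that by (simp add: J_def)
      qed
      have "finite J" using psubset.hyps by (simp add: J_def)
      then obtain c where c: "J \<subseteq> {c}" using s(2) unfolding J_def[symmetric]
        by (metis One_nat_def card_0_eq card_1_singletonE empty_subsetI le_Suc_eq le_zero_eq order_refl)
      define h' where "h' = h(s := if (s, c) \<in> E then h c - 1 else h c + 1)"
      have loop: "(i, i) \<notin> E" "(i, j) \<in> E \<Longrightarrow> (j, i) \<notin> E" for i j
        using E unfolding orientation_def by (auto 0 3)
      have "h' j = h' i + 1" if ij: "(i, j) \<in> E" "i \<in> S" "j \<in> S" for i j
      proof -
        have "i \<noteq> j" using loop ij by blast
        consider "i = s" | "j = s" | "i \<noteq> s" "j \<noteq> s" by blast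
        thus ?thesis
        proof cases
          case 1
          hence "j = c" using nb[of j] ij c by auto
          thus ?thesis using 1 \<open>i \<noteq> j\<close> ij by (simp add: h'_def)
        next
          case 2
          hence "i = c" using nb[of i] ij c by auto
          thus ?thesis using 2 \<open>i \<noteq> j\<close> ij loop by (simp add: h'_def)
        next
          case 3
          thus ?thesis using h ij by (auto simp: h'_def)
        qed
      qed
      thus ?thesis by blast
    qed simp
  qed
  from this[of "{..<n}"] obtain h :: "nat \<Rightarrow> int"
    where h: "\<forall>(i, j)\<in>E. i \<in> {..<n} \<longrightarrow> j \<in> {..<n} \<longrightarrow> h j = h i + 1" by auto
  have "h j = h i + 1" if "(i, j) \<in> E" for i j
    using h that E unfolding orientation_def by auto
  thus ?thesis by auto
qed

subsection \<open>Tropical mesh relations\<close>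

text \<open>The function \<open>h\<close> is a height function of the tree. Listing the vertices by height gives an
  order \<open>kk 0, \<dots>, kk (n - 1)\<close> of mutations at sources, continued periodically. Slot \<open>q\<close> of a
  sequence stands for the vertex \<open>kk q\<close> after \<open>q div n\<close> sweeps.\<close>

locale dynkin = cartan_datum +
  fixes E :: "(nat \<times> nat) set" and h :: "nat \<Rightarrow> int"
  assumes orient: "orientation n a E" and height: "(i, j) \<in> E \<Longrightarrow> h j = h i + 1"
begin

definition ks :: "nat list" where "ks = sort_key h [0..<n]"
definition kk :: "nat \<Rightarrow> nat" where "kk p = ks ! (p mod n)"

lemma ks: "distinct ks" "set ks = {..<n}" "length ks = n"
  by (auto simp: ks_def)

lemma ks_kk: "ks = map kk [0..<n]"
  by (rule nth_equalityI) (auto simp: kk_def ks(3))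

lemma kk_less [simp]: "kk p < n"
  using nth_mem[of "p mod n" ks] n_pos ks by (simp add: kk_def)

lemma kk_add [simp]: "kk (p + n) = kk p" "kk (n + p) = kk p" "kk (p + n * t) = kk p" "kk (p + t * n) = kk p"
  by (simp_all add: kk_def)

lemma edge: "(i, j) \<in> E \<Longrightarrow> i < n \<and> j < n \<and> i \<noteq> j \<and> a i j \<noteq> 0 \<and> (j, i) \<notin> E"
  using orient unfolding orientation_def by auto

lemma edge_cases:
  assumes "i < n" "j < n" "i \<noteq> j" "a i j \<noteq> 0" shows "(i, j) \<in> E \<or> (j, i) \<in> E"
  using assms orient unfolding orientation_def by auto

lemma kk_inj: "inj_on kk {p..<p + n}"
proof (rule inj_onI)
  fix q r assume qr: "q \<in> {p..<p + n}" "r \<in> {p..<p + n}" "kk q = kk r"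
  have "q mod n = r mod n"
    using qr(3) n_pos ks nth_eq_iff_index_eq[of ks "q mod n" "r mod n"] by (simp add: kk_def)
  hence "n dvd q - r" "n dvd r - q" by (metis mod_eq_dvd_iff_nat nat_le_linear diff_is_0_eq)+
  moreover have "q - r < n" "r - q < n" using qr by auto
  ultimately have "q - r = 0" "r - q = 0" by auto
  thus "q = r" by simp
qed

lemma kk_bij: "bij_betw kk {p..<p + n} {..<n}"
proof -
  have "kk ` {p..<p + n} = {..<n}"
    by (rule card_subset_eq) (auto simp: card_image[OF kk_inj])
  thus ?thesis using kk_inj by (simp add: bij_betw_def)
qed

text \<open>The index in the window of length \<open>n\<close> starting at \<open>p\<close> that
  stands for vertex \<open>i\<close>. It names the variable that the seed before step
  \<open>p\<close> carries at \<open>i\<close> (\<open>seed_at_slot\<close>).\<close>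

definition slot :: "nat \<Rightarrow> nat \<Rightarrow> nat" where
  "slot p = the_inv_into {p..<p + n} kk"

lemma slot:
  assumes "i < n" shows "p \<le> slot p i" "slot p i < p + n" "kk (slot p i) = i"
  using bij_betw_the_inv_into[OF kk_bij[of p]] f_the_inv_into_f_bij_betw[OF kk_bij[of p], of i] assms
  by (auto simp: slot_def bij_betw_def)

lemma slot_kk [simp]: "p \<le> q \<Longrightarrow> q < p + n \<Longrightarrow> slot p (kk q) = q"
  unfolding slot_def by (rule the_inv_into_f_f[OF kk_inj]) auto

lemma slot_add: "i < n \<Longrightarrow> slot (p + n * t) i = slot p i + n * t"
  using slot_kk[of "p + n * t" "slot p i + n * t"] slot[of i p] by simp

lemma slot_Suc: "i < n \<Longrightarrow> slot (Suc p) i = (if i = kk p then p + n else slot p i)"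
proof (cases "i = kk p")
  case False
  assume i: "i < n"
  have "slot p i \<noteq> p" using slot(3)[OF i, of p] False by auto
  thus ?thesis using slot_kk[of "Suc p" "slot p i"] slot[OF i, of p] False by simp
qed (use slot_kk[of "Suc p" "p + n"] n_pos in auto)

lemma edge_slot:
  assumes "(i, j) \<in> E" shows "slot 0 i < slot 0 j"
proof -
  have ij: "i < n" "j < n" using edge[OF assms] by auto
  have "sorted (map h ks)" by (simp add: ks_def)
  hence "h (ks ! q) \<le> h (ks ! r)" if "q \<le> r" "r < n" for q r
    using sorted_nth_mono[of "map h ks" q r] that ks by simp
  hence le: "h (kk q) \<le> h (kk r)" if "q \<le> r" "r < n" for q r using that by (simp add: kk_def)
  show ?thesis
    using le[of "slot 0 j" "slot 0 i"] slot[OF ij(1), of 0] slot[OF ij(2), of 0] height[OF assms] by fastforce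
qed

lemma mesh_induct [case_names initial step]:
  assumes "\<And>q. q < n \<Longrightarrow> P q" "\<And>q. P q \<Longrightarrow> (\<And>j. j < n \<Longrightarrow> P (slot q j)) \<Longrightarrow> P (q + n)"
  shows "P q"
proof (induction q rule: less_induct)
  case (less q)
  show ?case
  proof (cases "q < n")
    case False
    define r where "r = q - n"
    have r: "q = r + n" using False by (simp add: r_def)
    show ?thesis unfolding r using less.IH slot(2) n_pos by (intro assms(2)) (auto simp: r)
  qed (rule assms(1))
qed

abbreviation nbprod :: "nat \<Rightarrow> (nat \<Rightarrow> 'x) \<Rightarrow> 'x::comm_monoid_mult" where
  "nbprod q f \<equiv> \<Prod>j\<in>{..<n} - {kk q}. f (slot q j) ^ nat (- a j (kk q))"

abbreviation nbsum :: "nat \<Rightarrow> (nat \<Rightarrow> int) \<Rightarrow> int" where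
  "nbsum q f \<equiv> \<Sum>r\<in>{q<..<q + n}. - a (kk r) (kk q) * f r"

lemma sum_shift_open: "(\<Sum>r\<in>{q + c<..<q + c + n}. f r) = (\<Sum>r\<in>{q<..<q + n}. f (r + c))" for c :: nat
  by (rule sum.reindex_bij_witness[of _ "\<lambda>r. r + c" "\<lambda>r. r - c"]) auto

lemma sum_slots: "(\<Sum>r\<in>{q<..<q + n}. f (kk r) r) = (\<Sum>j\<in>{..<n} - {kk q}. f j (slot q j))"
proof (rule sum.reindex_bij_witness[of _ "slot q" kk])
  fix r assume "r \<in> {q<..<q + n}"
  thus "kk r \<in> {..<n} - {kk q}" "slot q (kk r) = r" "f (kk r) (slot q (kk r)) = f (kk r) r"
    using inj_onD[OF kk_inj[of q], of r q] by auto
next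
  fix j assume j: "j \<in> {..<n} - {kk q}"
  hence "slot q j \<noteq> q" using slot(3)[of j q] by auto
  thus "slot q j \<in> {q<..<q + n}" "kk (slot q j) = j" using slot[of j q] j by auto
qed

text \<open>The recursion satisfied by the orders of poles of the variables obtained by mutating
  successively at \<open>kk p\<^sub>0\<close>, \<open>kk (p\<^sub>0 + 1)\<close>, \<open>\<dots>\<close>\<close>

definition trop_mesh :: "nat \<Rightarrow> (nat \<Rightarrow> int) \<Rightarrow> bool" where
  "trop_mesh p V \<longleftrightarrow> (\<forall>q\<ge>p. V (q + n) = - V q + max 0 (nbsum q V))"

lemma trop_meshD:
  "trop_mesh p V \<Longrightarrow> p \<le> q \<Longrightarrow> V (q + n) = - V q + max 0 (nbsum q V)"
  by (simp add: trop_mesh_def)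

lemma trop_mesh_later: "trop_mesh p V \<Longrightarrow> p \<le> p' \<Longrightarrow> trop_mesh p' V"
  by (auto simp: trop_mesh_def)

lemma trop_mesh_unique:
  assumes V: "trop_mesh p V" and W: "trop_mesh p' W"
    and w: "\<And>q. q < n \<Longrightarrow> V (p + q) = W (p' + q)" and p: "kk p = kk p'"
  shows "V (p + q) = W (p' + q)"
proof (induction q rule: less_induct)
  case (less q)
  have kp: "kk (p + r) = kk (p' + r)" for r
  proof -
    have "p mod n = p' mod n"
      using p n_pos ks nth_eq_iff_index_eq[of ks "p mod n" "p' mod n"] by (simp add: kk_def)
    thus ?thesis by (metis kk_def mod_add_left_eq)
  qed
  show ?case
  proof (cases "q < n")
    case False
    define r where "r = q - n"
    have q: "q = r + n" using False by (simp add: r_def)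
    have "(\<Sum>s\<in>{p + r<..<p + r + n}. - a (kk s) (kk (p + r)) * V s) =
        (\<Sum>s\<in>{p' + r<..<p' + r + n}. - a (kk s) (kk (p' + r)) * W s)"
    proof (rule sum.reindex_bij_witness[of _ "\<lambda>s. s - p' + p" "\<lambda>s. s - p + p'"], goal_cases)
      case (5 s)
      define u where "u = s - p"
      have "s = p + u" "u < q" using 5 by (auto simp: u_def q)
      thus ?case using less.IH[of u] kp by (simp add: add.commute[of u])
    qed auto
    moreover have "V (p + r) = W (p' + r)" using less.IH[of r] n_pos by (simp add: q)
    ultimately show ?thesis
      using trop_meshD[OF V, of "p + r"] trop_meshD[OF W, of "p' + r"] by (simp add: q add.assoc)
  qed (use w in simp)
qed

text \<open>The relation also determines \<open>V p\<close> from \<open>V (p + n)\<close> and the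
  values between them, so the recursion runs backwards.\<close>

lemma trop_mesh_extend:
  assumes "trop_mesh p V" obtains W where "trop_mesh 0 W" "\<And>q. q \<ge> p \<Longrightarrow> W q = V q"
proof -
  have "\<exists>W. trop_mesh 0 W \<and> (\<forall>q\<ge>p. W q = V q)"
    using assms
  proof (induction p arbitrary: V)
    case (Suc p)
    define V' where "V' = V(p := - V (p + n) + max 0 (nbsum p V))"
    have "V' (q + n) = - V' q + max 0 (nbsum q V')" if "q \<ge> p" for q
    proof (cases "q = p")
      case True
      thus ?thesis using n_pos by (simp add: V'_def)
    next
      case False
      thus ?thesis using trop_meshD[OF Suc.prems, of q] that by (simp add: V'_def)
    qed
    hence "trop_mesh p V'" by (simp add: trop_mesh_def)
    from Suc.IH[OF this] show ?case by (auto simp: V'_def)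
  qed auto
  thus ?thesis using that by auto
qed

definition state :: "(nat \<Rightarrow> int) \<Rightarrow> nat \<Rightarrow> nat \<Rightarrow> int" where
  "state V p i = (if i < n then V (slot p i) else 0)"

lemma state_Suc: "state V (Suc p) = (state V p)(kk p := V (p + n))"
  by (auto simp: state_def slot_Suc)

lemma sum_state:
  "nbsum q V = 2 * V q - (\<Sum>i<n. a i (kk q) * state V q i)"
proof -
  have "(\<Sum>i<n. a i (kk q) * state V q i) =
      a (kk q) (kk q) * state V q (kk q) + (\<Sum>i\<in>{..<n} - {kk q}. a i (kk q) * state V q i)"
    by (rule sum.remove) auto
  moreover have "state V q (kk q) = V q" using n_pos by (simp add: state_def)
  moreover have "(\<Sum>i\<in>{..<n} - {kk q}. a i (kk q) * state V q i) = - nbsum q V"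
    unfolding sum_slots[of "\<lambda>j r. - a j (kk q) * V r"] by (simp add: state_def sum_negf)
  ultimately show ?thesis using diag[of "kk q"] by simp
qed

text \<open>Without the truncation at 0, the mesh relation is the reflection at \<open>kk q\<close>,
  which preserves the form.\<close>

lemma qform_state_Suc:
  assumes "V (q + n) = - V q + nbsum q V"
  shows "qform (\<lambda>i. of_int (state V (Suc q) i)) = qform (\<lambda>i. of_int (state V q i))"
proof -
  define c where "c = (\<Sum>i<n. a i (kk q) * state V q i)"
  have "state V q (kk q) = V q" using n_pos by (simp add: state_def)
  hence "state V (Suc q) i = state V q i + (if i = kk q then - c else 0)" for i
    unfolding state_Suc assms sum_state c_def by simp
  hence "qform (\<lambda>i. of_int (state V (Suc q) i)) =
      qform (\<lambda>i. of_int (state V q i)) + 2 * of_int (- c) / d (kk q) * of_int c + 2 * (of_int (- c))\<^sup>2 / d (kk q)"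
    by (subst qform_add_unit[of "kk q" _ "\<lambda>i. of_int (state V q i)" "of_int (- c)"]) (auto simp: c_def)
  thus ?thesis by (simp add: power2_eq_square)
qed

lemma nonneg_sum:
  assumes "\<And>r. r \<in> {q<..<q + n} \<Longrightarrow> V r \<ge> (0::int)"
  shows "nbsum q V \<ge> 0"
proof (rule sum_nonneg)
  fix r assume r: "r \<in> {q<..<q + n}"
  hence "kk r \<noteq> kk q" using inj_onD[OF kk_inj[of q], of r q] by auto
  thus "0 \<le> - a (kk r) (kk q) * V r" using assms[OF r] offdiag[of "kk r" "kk q"] by (simp add: mult_nonpos_nonneg)
qed

text \<open>A non-negative solution is linear, so it preserves a positive definite form; hence it is
  periodic, and the sum over a period is a null vector of the Cartan matrix.\<close>

theorem trop_mesh_nonneg_zero: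
  assumes V: "trop_mesh p V" and nn: "\<And>q. q \<ge> p \<Longrightarrow> V q \<ge> 0" and q: "q \<ge> p"
  shows "V q = 0"
proof -
  have lin: "V (q + n) = - V q + nbsum q V" if "q \<ge> p" for q
    using trop_meshD[OF V that] nonneg_sum[of q V] nn that by simp
  define Q where "Q q = qform (\<lambda>i. of_int (state V q i))" for q
  have Q: "Q (p + k) = Q p" for k
    by (induction k) (use qform_state_Suc[OF lin] in \<open>auto simp: Q_def\<close>)
  obtain \<epsilon> where \<epsilon>: "\<epsilon> > 0" "\<And>v i. i < n \<Longrightarrow> \<epsilon> * (v i)\<^sup>2 \<le> qform v" using qform_bound by blast
  \<comment> \<open>States are integer vectors, so a bound on them leaves finitely many, and one
    must recur.\<close>
  define M where "M = \<lceil>Q p / \<epsilon>\<rceil>"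
  have bd: "\<bar>state V (p + k) i\<bar> \<le> M" if "i < n" for i k
  proof -
    have "\<epsilon> * of_int ((state V (p + k) i)\<^sup>2) \<le> Q p" using \<epsilon>(2)[OF that, of "\<lambda>i. of_int (state V (p + k) i)"] Q by (simp add: Q_def)
    hence "of_int ((state V (p + k) i)\<^sup>2) \<le> Q p / \<epsilon>" using \<epsilon>(1) by (simp add: field_simps)
    hence "(state V (p + k) i)\<^sup>2 \<le> M" unfolding M_def by linarith
    moreover have "\<bar>z\<bar> \<le> z\<^sup>2" for z :: int by (metis linorder_not_le mult_less_cancel_right2 order_trans power2_abs power2_eq_square zero_less_abs_iff zle_diff1_eq int_one_le_iff_zero_less abs_of_nonneg mult_left_le_one_le zero_power2 abs_eq_0_iff)
    ultimately show ?thesis using order_trans by blast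
  qed
  have "range (\<lambda>t. state V (p + n * t)) \<subseteq> {f. (\<forall>i\<in>{..<n}. f i \<in> {-M..M}) \<and> (\<forall>i. i \<notin> {..<n} \<longrightarrow> f i = 0)}"
    using bd by (auto simp: state_def abs_le_iff minus_le_iff)
  moreover have "finite {f. (\<forall>i\<in>{..<n}. f i \<in> {-M..M}) \<and> (\<forall>i. i \<notin> {..<n} \<longrightarrow> f i = 0)}"
    by (rule rev_finite_subset[OF finite_set_of_finite_funs[of "{..<n}" "{-M..M}" 0]]) auto
  ultimately have "finite (range (\<lambda>t. state V (p + n * t)))" by (rule finite_subset)
  hence "\<not> inj (\<lambda>t. state V (p + n * t))" using finite_imageD by blast
  then obtain t1 t2 where t: "t1 < t2" "state V (p + n * t1) = state V (p + n * t2)"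
    unfolding inj_def by (metis linorder_neqE_nat)
  define L where "L = t2 - t1"
  define p1 where "p1 = p + n * t1"
  have "t2 = t1 + L" using t(1) by (simp add: L_def)
  hence per: "state V p1 = state V (p1 + n * L)" and L: "L > 0"
    using t by (simp_all add: p1_def algebra_simps)
  have Vper: "V (p1 + r) = V (p1 + n * L + r)" for r
  proof (rule trop_mesh_unique)
    show "V (p1 + q) = V (p1 + n * L + q)" if "q < n" for q
      using fun_cong[OF per, of "kk (p1 + q)"] slot_add[of "kk (p1 + q)" p1 L] that
      by (simp add: state_def algebra_simps)
  qed (auto simp: p1_def intro!: trop_mesh_later[OF V])
  define S where "S q = (\<Sum>t<L. V (q + n * t))" for q
  have Slin: "S (q + n) = - S q + nbsum q S" if "q \<ge> p" for q
  proof -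
    have "V (q + n * t + n) = - V (q + n * t) + nbsum q (\<lambda>r. V (r + n * t))" for t
    proof -
      have "(\<Sum>r\<in>{q + n * t<..<q + n * t + n}. - a (kk r) (kk (q + n * t)) * V r) =
          nbsum q (\<lambda>r. V (r + n * t))"
        unfolding sum_shift_open by simp
      thus ?thesis using lin[of "q + n * t"] that by simp
    qed
    hence "S (q + n) = (\<Sum>t<L. - V (q + n * t) + nbsum q (\<lambda>r. V (r + n * t)))"
      unfolding S_def by (intro sum.cong) (auto simp: algebra_simps)
    also have "\<dots> = - S q + nbsum q S"
      unfolding sum.distrib S_def by (subst sum.swap) (simp add: sum_negf sum_distrib_left)
    finally show ?thesis .
  qed
  have Sper: "S (q + n) = S q" if "q \<ge> p1" for q
  proof -
    have "S (q + n) + V q = (\<Sum>t<Suc L. V (q + n * t))"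
      unfolding S_def by (subst sum.lessThan_Suc_shift) (simp add: algebra_simps)
    also have "\<dots> = S q + V (q + n * L)" by (simp add: S_def)
    also have "V (q + n * L) = V q" using Vper[of "q - p1"] that by (simp add: algebra_simps)
    finally show ?thesis by simp
  qed
  have "qform (\<lambda>i. of_int (state S p1 i)) = 0"
  proof -
    have st: "state S (p1 + k) = state S p1" for k
    proof (induction k)
      case (Suc k)
      have "state S (p1 + k) (kk (p1 + k)) = S (p1 + k)" using n_pos by (simp add: state_def)
      thus ?case using Suc Sper[of "p1 + k"] by (simp add: state_Suc fun_upd_idem)
    qed simp
    have 0: "(\<Sum>i<n. a i j * state S p1 i) = 0" if j: "j < n" for j
    proof -
      define q where "q = slot p1 j"
      have q: "p1 \<le> q" "kk q = j" using slot[OF j, of p1] by (auto simp: q_def)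
      have "state S q = state S p1" using st[of "q - p1"] q by simp
      moreover have "q \<ge> p" using q(1) by (simp add: p1_def)
      ultimately show ?thesis using Slin[of q] Sper[OF q(1)] sum_state[of q S] q by simp
    qed
    have "(\<Sum>i<n. \<Sum>j<n. of_int (a i j) / d j * of_int (state S p1 i) * of_int (state S p1 j)) =
        (\<Sum>j<n. of_int (\<Sum>i<n. a i j * state S p1 i) / d j * of_int (state S p1 j))"
      by (subst sum.swap) (simp add: sum_distrib_right sum_divide_distrib)
    thus ?thesis unfolding qform_def using 0 by simp
  qed
  hence S0: "S r = 0" if "r \<ge> p1" "r < p1 + n" for r
    using qform_pos[of "kk r" "\<lambda>i. of_int (state S p1 i)"] that by (auto simp: state_def)
  have "V r = 0" if "r \<ge> p1" "r < p1 + n" for r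
  proof -
    have "r \<ge> p" using that by (simp add: p1_def)
    hence "\<forall>t\<in>{..<L}. V (r + n * t) = 0"
      using S0[OF that] nn unfolding S_def by (subst (asm) sum_nonneg_eq_0_iff) auto
    thus ?thesis using L by force
  qed
  hence "Q p1 = 0" unfolding Q_def by (intro qform_zero) (use slot[of _ p1] in \<open>auto simp: state_def\<close>)
  hence "Q q = 0" using Q[of "q - p"] Q[of "p1 - p"] q by (simp add: p1_def)
  thus ?thesis using qform_pos[of "kk q" "\<lambda>i. of_int (state V q i)"] n_pos by (auto simp: Q_def state_def)
qed

end


subsection \<open>Mutating at sources\<close>

lemma mutate_commute:
  assumes ik: "i \<noteq> k" and b: "b i k = 0" "b k i = 0"
  shows "mutate N i (mutate N k (x, b)) = mutate N k (mutate N i (x, b))"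
proof -
  have col: "mutate_matrix k b u i = b u i" if "u \<noteq> k" for u using ik b by (simp add: mutate_matrix_def)
  have col': "mutate_matrix i b u k = b u k" if "u \<noteq> i" for u using ik b by (simp add: mutate_matrix_def)
  have z: "mutate_matrix k b k i = 0" "mutate_matrix i b i k = 0" using b by (simp_all add: mutate_matrix_def)
  have m: "mutate_matrix i (mutate_matrix k b) = mutate_matrix k (mutate_matrix i b)"
  using b by (force simp: mutate_matrix_def)
  have *: "mon_pos N (x(k := c)) (mutate_matrix k b) i = mon_pos N x b i"
      "mon_neg N (x(k := c)) (mutate_matrix k b) i = mon_neg N x b i" for c
    using z b col by (auto simp: mon_pos_def mon_neg_def intro!: prod.cong)
  have **: "mon_pos N (x(i := c)) (mutate_matrix i b) k = mon_pos N x b k"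
      "mon_neg N (x(i := c)) (mutate_matrix i b) k = mon_neg N x b k" for c
    using z b col' by (auto simp: mon_pos_def mon_neg_def intro!: prod.cong)
  show ?thesis unfolding mutate_eq * ** m by (simp add: fun_upd_twist)
qed

lemma snd_mutate: "snd (mutate N k s) = mutate_matrix k (snd s)"
  by (cases s) (simp add: mutate_eq)

lemma mutates_other: "k \<notin> set ks \<Longrightarrow> fst (mutates N ks s) k = fst s k"
by (induction ks arbitrary: s) (auto simp: mutate_def)

lemma sources_commute:
  assumes s: "skew_symmetrizable n b" and k: "is_source n b k" and l: "is_source n b l" "k \<noteq> l"
  shows "b k l = 0" "b l k = 0" "is_source n (mutate_matrix l b) k"
proof -
  have kl: "b k l \<le> 0" "b l k \<le> 0" using k l by (auto simp: is_source_def)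
  have "k < n" "l < n" using k l by (simp_all add: is_source_def)
  note sg = skew_symmetrizable_sign[OF s this] skew_symmetrizable_sign[OF s this(2,1)]
  from kl show 0: "b k l = 0" "b l k = 0"
    using sg(4,5) by linarith+
  thus "is_source n (mutate_matrix l b) k"
    using k l by (auto simp: is_source_def mutate_matrix_def)
qed

text \<open>Two sources are not adjacent. So \<open>k\<close> stays a source while other sources are
  mutated, and its mutation commutes with theirs.\<close>

lemma source_mutations_to_front:
  assumes "source_mutations n N s (l1 @ k # l2) s'" "skew_symmetrizable n (snd s)"
    "is_source n (snd s) k" "k \<notin> set l1"
  shows "source_mutations n N s (k # l1 @ l2) s'"
  using assms
proof (induction l1 arbitrary: s)
  case (Cons l l1)
  obtain x b where s: "s = (x, b)" by fastforce
  have l: "is_source n b l" and m: "source_mutations n N (mutate N l s) (l1 @ k # l2) s'"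
    using Cons.prems(1) by (auto simp: s elim: source_mutations.cases)
  have kl: "k \<noteq> l" "k \<notin> set l1" using Cons.prems(4) by auto
  note c = sources_commute[OF _ _ l kl(1)] sources_commute[OF _ l _ kl(1)[symmetric]]
  have sk: "skew_symmetrizable n b" "is_source n b k" using Cons.prems by (auto simp: s)
  have ln: "l < n" "k < n" using l sk by (auto simp: is_source_def)
  have "source_mutations n N (mutate N l s) (k # l1 @ l2) s'"
    using Cons.IH[OF m] c(3)[OF sk] kl skew_symmetrizable_mutate[OF sk(1) ln(1)] by (simp add: s mutate_eq)
  hence "source_mutations n N (mutate N k (mutate N l s)) (l1 @ l2) s'"
    by (auto elim: source_mutations.cases)
  moreover have "mutate N k (mutate N l s) = mutate N l (mutate N k s)"
    unfolding s by (rule mutate_commute) (use kl c(1,2)[OF sk] in auto)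
  moreover have "is_source n (snd (mutate N k s)) l" using c(6)[OF sk] by (simp add: s mutate_eq)
  ultimately show ?case using sk by (auto simp: s intro!: source_mutations.intros)
qed simp

lemma source_mutations_unique:
  assumes "source_mutations n N s ks s'" "source_mutations n N s ls s''"
    "distinct ks" "distinct ls" "set ks = set ls" "skew_symmetrizable n (snd s)"
  shows "s' = s''"
  using assms
proof (induction arbitrary: ls rule: source_mutations.induct)
  case (2 s k ks s')
  have "k \<in> set ls" using 2 by (metis list.set_intros(1))
  then obtain l1 l2 where ls: "ls = l1 @ k # l2" by (meson split_list)
  have "source_mutations n N s (k # l1 @ l2) s''"
    using 2 ls by (intro source_mutations_to_front) auto
  hence "source_mutations n N (mutate N k s) (l1 @ l2) s''" by (auto elim: source_mutations.cases)
  moreover have "k \<notin> set ks" "k \<notin> set (l1 @ l2)" using 2(5,6) ls by auto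
  hence "set ks = set (l1 @ l2)" using 2(7) ls by auto
  moreover have "skew_symmetrizable n (snd (mutate N k s))"
    using skew_symmetrizable_mutate[of n "snd s" k] 2 by (auto simp: snd_mutate is_source_def)
  moreover have "distinct (l1 @ l2)" using 2(6) ls by auto
  ultimately show ?case using 2(3) 2(5) by auto
qed (auto elim: source_mutations.cases)

lemma rpos_mutate:
  assumes "\<And>i. rpos (x i)" shows "rpos (fst (mutate N k (x, b)) i)"
  using assms by (auto simp: mutate_eq mon_pos_def mon_neg_def intro!: rpos_divide rpos_add rpos_prod rpos_power)

lemma rpos_mutates: "(\<And>i. rpos (fst s i)) \<Longrightarrow> rpos (fst (mutates N ks s) i)"
proof (induction ks arbitrary: s)
  case (Cons k ks)
  thus ?case using rpos_mutate[of "fst s" N k "snd s"] by simp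
qed simp

context dynkin
begin

text \<open>The exchange matrix before the step \<open>p\<close> of the sequence of source mutations\<close>

definition top_block :: "nat \<Rightarrow> (nat \<Rightarrow> nat \<Rightarrow> int) \<Rightarrow> bool" where
  "top_block p b \<longleftrightarrow> (\<forall>q\<in>{p..<p + n}. \<forall>r\<in>{p..<p + n}.
     b (kk q) (kk r) = (if q < r then - a (kk q) (kk r) else if r < q then a (kk q) (kk r) else 0))"

lemma top_blockD:
  assumes "top_block p b" "p \<le> q" "q < p + n" "p \<le> r" "r < p + n"
  shows "q < r \<Longrightarrow> b (kk q) (kk r) = - a (kk q) (kk r)" "r < q \<Longrightarrow> b (kk q) (kk r) = a (kk q) (kk r)"
    "b (kk q) (kk q) = 0"
  using assms unfolding top_block_def by auto

lemma top_block_initial: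
  assumes b: "\<And>i j. i < n \<Longrightarrow> j < n \<Longrightarrow> b i j = exchange_matrix a E i j" shows "top_block 0 b"
proof -
  have "exchange_matrix a E (kk q) (kk r) = (if q < r then - a (kk q) (kk r) else if r < q then a (kk q) (kk r) else 0)"
    if "q < n" "r < n" for q r
  proof -
    consider "q = r" | "q \<noteq> r" "a (kk q) (kk r) = 0" | "q \<noteq> r" "a (kk q) (kk r) \<noteq> 0" by blast
    thus ?thesis
    proof cases
      case 1
      thus ?thesis using edge[of "kk q" "kk q"] by (auto simp: exchange_matrix_def)
    next
      case 2
      thus ?thesis by (auto simp: exchange_matrix_def)
    next
      case 3
      have "kk q \<noteq> kk r" using inj_onD[OF kk_inj[of 0], of q r] 3 that by auto
      hence "(kk q, kk r) \<in> E \<or> (kk r, kk q) \<in> E" using edge_cases 3 by simp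
      thus ?thesis
        using edge_slot[of "kk q" "kk r"] edge_slot[of "kk r" "kk q"] that 3(1)
        by (auto simp: exchange_matrix_def)
    qed
  qed
  thus ?thesis using b by (simp add: top_block_def)
qed

lemma top_block_add: "top_block (p + n) b \<longleftrightarrow> top_block p b"
  unfolding top_block_def image_add_atLeastLessThan'[symmetric] by (simp del: image_add_atLeastLessThan')

lemma top_block_diag: "top_block p b \<Longrightarrow> b (kk p) (kk p) = 0"
  using top_blockD(3)[of p b p p] n_pos by simp

lemma top_block_signs:
  assumes b: "top_block p b" and i: "i < n"
  shows "b i (kk p) \<le> 0" "b (kk p) i \<ge> 0" "i \<noteq> kk p \<Longrightarrow> b i (kk p) = a i (kk p)"
    "i \<noteq> kk p \<Longrightarrow> b (kk p) i = - a (kk p) i"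
proof -
  note s = slot[OF i, of p]
  have "i \<noteq> kk p \<Longrightarrow> p < slot p i" using s by (metis le_neq_implies_less)
  thus 1: "i \<noteq> kk p \<Longrightarrow> b i (kk p) = a i (kk p)" "i \<noteq> kk p \<Longrightarrow> b (kk p) i = - a (kk p) i"
    using top_blockD[OF b, of "slot p i" p] top_blockD[OF b, of p "slot p i"] s by auto
  show "b i (kk p) \<le> 0" "b (kk p) i \<ge> 0"
    using 1 top_block_diag[OF b] offdiag[of i "kk p"] offdiag[of "kk p" i] i by (cases "i = kk p"; simp)+
qed

lemma top_block_source: "top_block p b \<Longrightarrow> is_source n b (kk p)"
  using top_block_signs(1) by (force simp: is_source_def)

text \<open>No path leads through a source, so mutation there only reverses its arrows; the vertex
  moves from the front of the window to its end.\<close>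

lemma top_block_mutate:
  assumes b: "top_block p b" shows "top_block (Suc p) (mutate_matrix (kk p) b)"
  unfolding top_block_def
proof (intro ballI)
  fix q r assume qr: "q \<in> {Suc p..<Suc p + n}" "r \<in> {Suc p..<Suc p + n}"
  note sg = top_block_signs[OF b] and dg = top_block_diag[OF b]
  have k: "kk q = kk p \<longleftrightarrow> q = p + n" if "q \<in> {Suc p..<Suc p + n}" for q
  proof (cases "q = p + n")
    case False
    thus ?thesis using that inj_onD[OF kk_inj[of p], of q p] by auto
  qed simp
  have keep: "mutate_matrix (kk p) b (kk q) (kk r) = b (kk q) (kk r)" if "kk q \<noteq> kk p" "kk r \<noteq> kk p"
  proof -
    have "b (kk q) (kk p) * b (kk p) (kk r) \<le> 0" using sg(1)[of "kk q"] sg(2)[of "kk r"] by (simp add: mult_nonpos_nonneg)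
    thus ?thesis using that by (simp add: mutate_matrix_def)
  qed
  consider "q \<noteq> p + n" "r \<noteq> p + n" | "q = p + n" | "q \<noteq> p + n" "r = p + n" by blast
  thus "mutate_matrix (kk p) b (kk q) (kk r) =
      (if q < r then - a (kk q) (kk r) else if r < q then a (kk q) (kk r) else 0)"
  using keep k qr b by (auto simp: mutate_matrix_def top_block_def)
qed

lemma top_block_mutates:
  assumes "top_block p (snd s)" shows "top_block (p + r) (snd (mutates N (map kk [p..<p + r]) s))"
proof (induction r)
  case (Suc r)
  thus ?case using top_block_mutate[OF Suc] by (simp add: snd_mutate)
qed (use assms in simp)

lemma source_mutations_step:
  "top_block p (snd s) \<Longrightarrow> source_mutations n N s (map kk [p..<p + r]) (mutates N (map kk [p..<p + r]) s)"
proof (induction r arbitrary: p s)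
  case (Suc r)
  have e: "[p..<p + Suc r] = p # [Suc p..<Suc p + r]" by (simp add: upt_rec)
  have "top_block (Suc p) (snd (mutate N (kk p) s))"
    using top_block_mutate[OF Suc.prems] by (simp add: snd_mutate)
  from Suc.IH[OF this] show ?case
    unfolding e using top_block_source[OF Suc.prems] by (auto intro: source_mutations.intros)
qed (auto intro: source_mutations.intros)

lemma source_sweep_eq:
  assumes s: "top_block 0 (snd s)" "skew_symmetrizable n (snd s)"
  shows "source_sweep n N s = mutates N ks s"
proof -
  have m: "source_mutations n N s ks (mutates N ks s)"
    using source_mutations_step[OF s(1), of N n] by (simp add: ks_kk)
  show ?thesis unfolding source_sweep_def
  proof (rule some_equality)
    fix s' assume "\<exists>ls. distinct ls \<and> set ls = {..<n} \<and> source_mutations n N s ls s'"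
    thus "s' = mutates N ks s" using source_mutations_unique[OF _ m _ ks(1) _ s(2)] ks(2) by metis
  qed (use m ks in blast)
qed

definition seed_at :: "nat \<Rightarrow> seed \<Rightarrow> nat \<Rightarrow> nat \<Rightarrow> seed" where
  "seed_at N s p q = mutates N (map kk [p..<q]) s"

definition var :: "nat \<Rightarrow> seed \<Rightarrow> nat \<Rightarrow> nat \<Rightarrow> ratfun" where
  "var N s p q = fst (seed_at N s p q) (kk q)"

lemma seed_at_same [simp]: "seed_at N s p p = s"
  by (simp add: seed_at_def)

lemma seed_at_Suc: "p \<le> q \<Longrightarrow> seed_at N s p (Suc q) = mutate N (kk q) (seed_at N s p q)"
  by (simp add: seed_at_def)

lemma seed_at_trans: "p \<le> q \<Longrightarrow> q \<le> r \<Longrightarrow> seed_at N s p r = seed_at N (seed_at N s p q) q r"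
  unfolding seed_at_def using upt_add_eq_append[of p q "r - q"] by simp

lemma var_trans: "p \<le> q \<Longrightarrow> q \<le> r \<Longrightarrow> var N s p r = var N (seed_at N s p q) q r"
  by (simp add: var_def seed_at_trans[of p q r])

lemma seed_at_row:
  assumes "p \<le> p'" "p' \<le> q" "q < p' + n"
  shows "fst (seed_at N s p p') (kk q) = var N s p q"
proof -
  have "kk q \<notin> kk ` {p'..<q}" using inj_onD[OF kk_inj[of p'], of q] assms by fastforce
  thus ?thesis using mutates_other[of "kk q" "map kk [p'..<q]" N "seed_at N s p p'"] assms
    by (simp add: var_def seed_at_trans[of p p' q]) (simp add: seed_at_def)
qed

lemma seed_at_slot: "p \<le> p' \<Longrightarrow> i < n \<Longrightarrow> fst (seed_at N s p p') i = var N s p (slot p' i)"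
  using seed_at_row[of p p' "slot p' i"] slot[of i p'] by simp

lemma seed_at_frozen:
  assumes "i \<ge> n" shows "fst (seed_at N s p q) i = fst s i"
proof -
  have "i \<noteq> kk r" for r using kk_less[of r] assms by linarith
  thus ?thesis unfolding seed_at_def by (intro mutates_other) auto
qed

lemma var_add:
  "p \<le> q \<Longrightarrow> var N s p (q + n) = fst (mutate N (kk q) (seed_at N s p q)) (kk q)"
  using seed_at_row[of p "Suc q" "q + n" N s] n_pos by (simp add: seed_at_Suc)

lemma seed_at_block: "top_block p (snd s) \<Longrightarrow> p \<le> q \<Longrightarrow> top_block q (snd (seed_at N s p q))"
  using top_block_mutates[of p s "q - p" N] by (simp add: seed_at_def)

text \<open>At the source \<open>kk q\<close> the entries of the column in the mutable rows are
  non-positive, so mutable variables occur in the second monomial only.\<close>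

lemma prod_rows:
  assumes b: "top_block q b" and n: "n \<le> N"
  shows "mon_pos N x b (kk q) = (\<Prod>i\<in>{n..<N}. x i ^ nat (b i (kk q)))"
    "mon_neg N x b (kk q) = (\<Prod>i\<in>{n..<N}. x i ^ nat (- b i (kk q))) *
       (\<Prod>j\<in>{..<n} - {kk q}. x j ^ nat (- a j (kk q)))"
proof -
  note sg = top_block_signs[OF b]
  have N: "{..<N} = {n..<N} \<union> {..<n}" "{n..<N} \<inter> {..<n} = {}" using n by auto
  have "(\<Prod>i<n. x i ^ nat (b i (kk q))) = 1" using sg(1) by (intro prod.neutral) auto
  thus "mon_pos N x b (kk q) = (\<Prod>i\<in>{n..<N}. x i ^ nat (b i (kk q)))"
    unfolding mon_pos_def N(1) by (subst prod.union_disjoint[OF _ _ N(2)]) auto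
  have "(\<Prod>i<n. x i ^ nat (- b i (kk q))) = (\<Prod>j\<in>{..<n} - {kk q}. x j ^ nat (- a j (kk q)))"
    using sg(3) top_block_diag[OF b] by (intro prod.mono_neutral_cong_right) auto
  thus "mon_neg N x b (kk q) = (\<Prod>i\<in>{n..<N}. x i ^ nat (- b i (kk q))) *
       (\<Prod>j\<in>{..<n} - {kk q}. x j ^ nat (- a j (kk q)))"
    unfolding mon_neg_def N(1) by (subst prod.union_disjoint[OF _ _ N(2)]) auto
qed

lemma var_mesh:
  assumes s: "top_block p (snd s)" and nz: "\<And>i. rpos (fst s i)" and q: "p \<le> q" and n: "n \<le> N"
  shows "var N s p q * var N s p (q + n) =
    (\<Prod>i\<in>{n..<N}. fst s i ^ nat (snd (seed_at N s p q) i (kk q))) +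
    (\<Prod>i\<in>{n..<N}. fst s i ^ nat (- snd (seed_at N s p q) i (kk q))) *
    nbprod q (var N s p)"
proof -
  obtain x b where xb: "seed_at N s p q = (x, b)" by fastforce
  have b: "top_block q b" using seed_at_block[OF s q, of N] xb by simp
  have x: "x i = fst s i" if "i \<ge> n" for i using seed_at_frozen[OF that, of N s p q] xb by simp
  have x': "x i = var N s p (slot q i)" if "i < n" for i using seed_at_slot[OF q that, of N s] xb by simp
  have "x (kk q) = var N s p q" by (simp add: var_def xb)
  moreover have "x (kk q) \<noteq> 0" using rpos_nonzero[OF rpos_mutates[OF nz]] xb by (metis fst_conv seed_at_def)
  ultimately show ?thesis unfolding var_add[OF q] xb by (simp add: mutate_eq prod_rows[OF b n] x x')
qed

lemma pole_var_mesh: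
  assumes s: "top_block p (snd s)" and nz: "\<And>i. rpos (fst s i)" and n: "n \<le> N"
    and fr: "\<And>i. n \<le> i \<Longrightarrow> pole l (fst s i) = 0"
  shows "trop_mesh p (\<lambda>q. pole l (var N s p q))"
  unfolding trop_mesh_def
proof (intro allI impI)
  fix q assume q: "p \<le> q"
  obtain x b where xb: "seed_at N s p q = (x, b)" by fastforce
  have b: "top_block q b" using seed_at_block[OF s q, of N] xb by simp
  have x: "pole l (x i) = 0" if "i \<ge> n" for i using seed_at_frozen[OF that, of N s p q] fr[OF that] xb by simp
  have x': "x i = var N s p (slot q i)" if "i < n" for i using seed_at_slot[OF q that, of N s] xb by simp
  have xr: "rpos (x i)" for i using rpos_mutates[OF nz] xb by (metis fst_conv seed_at_def)
  note sg = top_block_signs[OF b]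
  have k: "x (kk q) = var N s p q" by (simp add: var_def xb)
  have le: "{..<n} \<subseteq> {..<N}" using n by auto
  have 1: "(\<Sum>i<N. pos (b i (kk q)) * pole l (x i)) = 0"
    by (intro sum.neutral ballI) (use sg(1) x in \<open>metis max.absorb1 mult_eq_0_iff not_less\<close>)
  have "(\<Sum>i<N. pos (- b i (kk q)) * pole l (x i)) = (\<Sum>j\<in>{..<n} - {kk q}. - a j (kk q) * pole l (var N s p (slot q j)))"
  proof (rule sum.mono_neutral_cong_right)
    show "\<forall>i\<in>{..<N} - ({..<n} - {kk q}). pos (- b i (kk q)) * pole l (x i) = 0"
    using x top_block_diag[OF b] by force
    fix j assume j: "j \<in> {..<n} - {kk q}"
    hence "pos (- b j (kk q)) = - a j (kk q)" using sg(3)[of j] offdiag[of j "kk q"] by simp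
    thus "pos (- b j (kk q)) * pole l (x j) = - a j (kk q) * pole l (var N s p (slot q j))"
      using j x' by simp
  qed (use le in auto)
  thus "pole l (var N s p (q + n)) = - pole l (var N s p q) +
      max 0 (nbsum q (\<lambda>r. pole l (var N s p r)))"
    unfolding sum_slots[of "\<lambda>j r. - a j (kk q) * pole l (var N s p r)"] var_add[OF q] xb
      pole_mutate[of x l N "kk q" b, OF xr] 1 by (simp add: k)
qed

end


subsection \<open>Recurrence of the sequence of cluster variables\<close>

context dynkin
begin

lemma var_window: "p \<le> q \<Longrightarrow> q < p + n \<Longrightarrow> var N s p q = fst s (kk q)"
  using seed_at_row[of p p q N s] by simp

text \<open>A single non-positive value among zeros makes each sum over neighbours non-positive. The
  maximum is then 0, and the new value is minus an earlier one, which vanishes.\<close>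

lemma unit_forward:
  assumes V: "trop_mesh p V" and neg: "V q0 \<le> 0"
    and z: "\<And>r. p \<le> r \<Longrightarrow> q0 < r + n \<Longrightarrow> r < q0 \<Longrightarrow> V r = 0"
    and z': "\<And>r. q0 < r \<Longrightarrow> r < p + n \<Longrightarrow> V r = 0"
  shows "q0 < r \<Longrightarrow> r < q0 + n \<Longrightarrow> V r = 0"
proof (induction r rule: less_induct)
  case (less r)
  show ?case
  proof (cases "r < p + n")
    case False
    define q where "q = r - n"
    have q: "r = q + n" "q < q0" "q0 < q + n" "p \<le> q" using less.prems False by (auto simp: q_def)
    have "nbsum q V \<le> 0"
    proof (rule sum_nonpos)
      fix s assume s: "s \<in> {q<..<q + n}"
      hence "kk s \<noteq> kk q" using inj_onD[OF kk_inj[of q], of s q] by auto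
      hence "a (kk s) (kk q) \<le> 0" using offdiag by simp
      moreover have "V s = 0 \<or> V s \<le> 0"
        using less.IH[of s] z[of s] neg s q by (cases s q0 rule: linorder_cases) auto
      ultimately show "- a (kk s) (kk q) * V s \<le> 0" by (auto simp: mult_nonpos_nonpos)
    qed
    thus ?thesis using trop_meshD[OF V q(4)] z[of q] q by simp
  qed (use z' less.prems in simp)
qed

text \<open>The argument of \<open>unit_forward\<close>, with each relation solved for its earlier
  value.\<close>

lemma unit_backward:
  assumes V: "trop_mesh 0 V" and neg: "V q0 \<le> 0"
    and z: "\<And>r. q0 < r \<Longrightarrow> r < q0 + n \<Longrightarrow> V r = 0"
  shows "r < q0 \<Longrightarrow> q0 < r + n \<Longrightarrow> V r = 0"
proof (induction "q0 - r" arbitrary: r rule: less_induct)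
  case less
  have "nbsum r V \<le> 0"
  proof (rule sum_nonpos)
    fix s assume s: "s \<in> {r<..<r + n}"
    hence "kk s \<noteq> kk r" using inj_onD[OF kk_inj[of r], of s r] by auto
    hence "a (kk s) (kk r) \<le> 0" using offdiag by simp
    moreover have "V s = 0 \<or> V s \<le> 0"
      using less.hyps[of s] z[of s] neg s less.prems by (cases s q0 rule: linorder_cases) auto
    ultimately show "- a (kk s) (kk r) * V s \<le> 0" by (auto simp: mult_nonpos_nonpos)
  qed
  thus ?case using trop_meshD[OF V, of r] z[of "r + n"] less.prems by simp
qed

text \<open>The mesh relations in terms of sweeps and vertices. Here the symmetry under time reversal is
  visible: it maps \<open>(t, i)\<close> to \<open>(c - h i - t, i)\<close>.\<close>

abbreviation wsum :: "nat \<Rightarrow> (nat \<Rightarrow> int) \<Rightarrow> (nat \<Rightarrow> int) \<Rightarrow> int" where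
  "wsum i f g \<equiv> \<Sum>j\<in>{..<n} - {i}. - a j i * (if (i, j) \<in> E then f j else g j)"

definition sweep_mesh :: "(nat \<Rightarrow> nat \<Rightarrow> int) \<Rightarrow> bool" where
  "sweep_mesh v \<longleftrightarrow> (\<forall>t. \<forall>i<n. v (Suc t) i = - v t i +
     max 0 (wsum i (v t) (v (Suc t))))"

lemma slot_sweep:
  assumes "i < n" "j < n"
  shows "slot (slot 0 i + n * t) j = (if slot 0 i \<le> slot 0 j then slot 0 j + n * t else slot 0 j + n * Suc t)"
  using slot_kk[of "slot 0 i + n * t" "slot 0 j + n * t"] slot_kk[of "slot 0 i + n * t" "slot 0 j + n * Suc t"]
    slot[OF assms(1), of 0] slot[OF assms(2), of 0]
  by (auto simp del: mult_Suc_right) simp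

lemma edge_slot_iff:
  assumes "i < n" "j < n" "i \<noteq> j" "a j i \<noteq> 0" shows "slot 0 i \<le> slot 0 j \<longleftrightarrow> (i, j) \<in> E"
  using edge_slot[of i j] edge_slot[of j i] edge_cases[of i j] assms zero_sym[of i j] by fastforce

lemma sweep_mesh:
  assumes "trop_mesh 0 V" shows "sweep_mesh (\<lambda>t i. V (slot 0 i + n * t))"
  unfolding sweep_mesh_def
proof (intro allI impI)
  fix t i assume i: "i < n"
  let ?q = "slot 0 i + n * t"
  have k: "kk ?q = i" using slot(3)[OF i, of 0] by simp
  have "(\<Sum>r\<in>{?q<..<?q + n}. - a (kk r) (kk ?q) * V r) = (\<Sum>j\<in>{..<n} - {i}. - a j i *
      (if (i, j) \<in> E then V (slot 0 j + n * t) else V (slot 0 j + n * Suc t)))"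
    unfolding sum_slots[of "\<lambda>j r. - a j (kk ?q) * V r" ?q] unfolding k
  proof (intro sum.cong refl)
    fix j assume j: "j \<in> {..<n} - {i}"
    show "- a j i * V (slot ?q j) = - a j i * (if (i, j) \<in> E then V (slot 0 j + n * t) else V (slot 0 j + n * Suc t))"
      using slot_sweep[OF i, of j t] edge_slot_iff[OF i, of j] j by (cases "a j i = 0") auto
  qed
  thus "V (slot 0 i + n * Suc t) = - V ?q + max 0 (\<Sum>j\<in>{..<n} - {i}. - a j i *
      (if (i, j) \<in> E then V (slot 0 j + n * t) else V (slot 0 j + n * Suc t)))"
    using trop_meshD[OF assms, of ?q] by (simp add: algebra_simps)
qed

lemma sweep_meshD:
  "sweep_mesh v \<Longrightarrow> i < n \<Longrightarrow> v (Suc t) i = - v t i +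
     max 0 (wsum i (v t) (v (Suc t)))"
  by (simp add: sweep_mesh_def)

lemma neighbour_cases:
  assumes "j \<in> {..<n} - {i}" "i < n"
  obtains "a j i = 0" | "(i, j) \<in> E" "h j = h i + 1" "a j i < 0" | "(j, i) \<in> E" "(i, j) \<notin> E" "h j = h i - 1" "a j i < 0"
proof -
  have "a j i \<le> 0" using offdiag[of j i] assms by auto
  hence "a j i = 0 \<or> a j i < 0" by auto
  thus ?thesis
    using that edge_cases[of i j] zero_sym[of i j] assms height[of i j] height[of j i] by auto
qed

text \<open>As in \<open>unit_forward\<close>, a lone non-positive entry keeps the maximum at 0,
  here as long as the other entries reached lie in the cone. Together with
  \<open>cone_backward\<close> this fills a slice on which \<open>t + h i\<close> is constant, the
  initial slice for the reversed recursion.\<close>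

lemma cone_forward:
  assumes v: "sweep_mesh v" and j: "v B j \<le> 0" and z: "\<And>i. i < n \<Longrightarrow> i \<noteq> j \<Longrightarrow> v B i = 0"
  shows "i < n \<Longrightarrow> i \<noteq> j \<Longrightarrow> int s \<le> h j - h i \<Longrightarrow> v (B + s) i = 0"
proof (induction "s * n + slot 0 i" arbitrary: s i rule: less_induct)
  case less
  show ?case
  proof (cases s)
    case (Suc s')
    have "v (B + s') i = 0" using less.hyps[of s' i] less.prems by (simp add: Suc)
    moreover have "wsum i (v (B + s')) (v (Suc (B + s'))) \<le> 0"
    proof (rule sum_nonpos)
      fix l assume l: "l \<in> {..<n} - {i}"
      from l less.prems(1) show "- a l i * (if (i, l) \<in> E then v (B + s') l else v (Suc (B + s')) l) \<le> 0"
      proof (cases rule: neighbour_cases)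
        case 2
        have "v (B + s') l \<le> 0"
        proof (cases "l = j")
          case True
          hence "s' = 0" using less.prems(3) 2 by (simp add: Suc)
          thus ?thesis using True j by simp
        next
          case False
          have "s' * n + slot 0 l < s * n + slot 0 i" using slot(2)[of l 0] l by (simp add: Suc)
          thus ?thesis using less.hyps[of s' l] False l less.prems(3) 2 by (simp add: Suc)
        qed
        thus ?thesis using 2 by (simp add: mult_nonpos_nonpos)
      next
        case 3
        have "l \<noteq> j" using less.prems(3) 3 by auto
        hence "v (B + s) l = 0" using less.hyps[of s l] l less.prems(3) 3 edge_slot[of l i] by simp
        thus ?thesis using 3 by (simp add: Suc)
      qed simp
    qed
    ultimately show ?thesis using sweep_meshD[OF v less.prems(1), of "B + s'"] by (simp add: Suc)
  qed (use z less.prems in simp)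
qed

lemma cone_backward:
  assumes v: "sweep_mesh v" and j: "v B j \<le> 0" and z: "\<And>i. i < n \<Longrightarrow> i \<noteq> j \<Longrightarrow> v B i = 0"
  shows "i < n \<Longrightarrow> i \<noteq> j \<Longrightarrow> s \<le> B \<Longrightarrow> int s \<le> h i - h j \<Longrightarrow> v (B - s) i = 0"
proof (induction "s * n + (n - slot 0 i)" arbitrary: s i rule: less_induct)
  case less
  show ?case
  proof (cases s)
    case (Suc s')
    define t where "t = B - s"
    have t: "B - s' = Suc t" using less.prems by (simp add: t_def Suc)
    have less': "s' * n + (n - slot 0 l) < s * n + (n - slot 0 i)" for l
      using slot(2)[OF less.prems(1), of 0] by (simp add: Suc)
    have "v (Suc t) i = 0" using less.hyps[OF less', of i] less.prems by (simp add: Suc flip: t)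
    moreover have "wsum i (v t) (v (Suc t)) \<le> 0"
    proof (rule sum_nonpos)
      fix l assume l: "l \<in> {..<n} - {i}"
      from l less.prems(1) show "- a l i * (if (i, l) \<in> E then v t l else v (Suc t) l) \<le> 0"
      proof (cases rule: neighbour_cases)
        case 2
        have "l \<noteq> j" using less.prems(4) 2 by auto
        moreover have "s * n + (n - slot 0 l) < s * n + (n - slot 0 i)"
          using edge_slot[OF 2(1)] slot(2)[of l 0] l by auto
        ultimately have "v t l = 0" using less.hyps[of s l] l less.prems 2 by (simp add: t_def)
        thus ?thesis using 2 by simp
      next
        case 3
        have "v (Suc t) l \<le> 0"
        proof (cases "l = j")
          case True
          hence "s' = 0" using less.prems(4) 3 by (simp add: Suc)
          thus ?thesis using True j by (simp flip: t)
        next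
          case False
          thus ?thesis using less.hyps[OF less', of l] l less.prems 3 by (simp add: Suc flip: t)
        qed
        thus ?thesis using 3 by (simp add: mult_nonpos_nonpos)
      qed simp
    qed
    ultimately show ?thesis using sweep_meshD[OF v less.prems(1), of t] by (simp add: t_def)
  qed (use z less.prems in simp)
qed

text \<open>Under \<open>(t, i) \<mapsto> (C - h i - t, i)\<close> the two values at
  \<open>i\<close> in a mesh relation trade places, while each neighbour keeps its term, because its
  height differs from \<open>h i\<close> by 1.\<close>

lemma reversed_mesh_unique:
  assumes v: "sweep_mesh v" and w: "sweep_mesh w"
    and init: "\<And>i. i < n \<Longrightarrow> v (nat (C - h i)) i = w 0 i"
  shows "i < n \<Longrightarrow> (\<And>l. l < n \<Longrightarrow> int t \<le> C - h l) \<Longrightarrow> v (nat (C - h i - int t)) i = w t i"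
proof (induction "t * n + slot 0 i" arbitrary: t i rule: less_induct)
  case less
  show ?case
  proof (cases t)
    case (Suc t')
    define s where "s = nat (C - h i - int t)"
    have s: "nat (C - h i - int t') = Suc s" using less.prems(2)[OF less.prems(1)] by (simp add: s_def Suc)
    have bd: "int t' \<le> C - h l" if "l < n" for l using less.prems(2)[OF that] by (simp add: Suc)
    have IH: "v (nat (C - h l - int t')) l = w t' l" if l: "l < n" for l
      using less.hyps[of t' l] slot(2)[OF l, of 0] l bd by (simp add: Suc)
    have "wsum i (v s) (v (Suc s)) =
        wsum i (w t') (w (Suc t'))"
    proof (rule sum.cong[OF refl])
      fix l assume l: "l \<in> {..<n} - {i}"
      from l less.prems(1) show "- a l i * (if (i, l) \<in> E then v s l else v (Suc s) l) =
          - a l i * (if (i, l) \<in> E then w t' l else w (Suc t') l)"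
      proof (cases rule: neighbour_cases)
        case 2
        have "nat (C - h l - int t') = s" by (simp add: s_def 2 Suc)
        thus ?thesis using IH[of l] l 2 by simp
      next
        case 3
        have "nat (C - h l - int t) = Suc s"
          using less.prems(2)[OF less.prems(1)] by (simp add: s_def 3)
        thus ?thesis using less.hyps[of t l] l 3 edge_slot[of l i] less.prems(2) by (simp add: Suc)
      qed simp
    qed
    thus ?thesis
      using sweep_meshD[OF v less.prems(1), of s] sweep_meshD[OF w less.prems(1), of t'] IH[OF less.prems(1)]
      unfolding s s_def[symmetric] Suc[symmetric] by simp
  qed (use init less.prems in simp)
qed

end

section \<open>Occurrences of a cluster variable in the sequence\<close>

locale dynkin_seed = dynkin +
  fixes N :: nat and b :: "nat \<Rightarrow> nat \<Rightarrow> int"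
  assumes good: "good_matrix n N b" and top: "top_block 0 b"
begin

abbreviation "sd \<equiv> seed_at N (rvar, b) 0"
abbreviation "X \<equiv> var N (rvar, b) 0"

lemma kk_set: "set (map kk qs) \<subseteq> {..<n}"
  by auto

lemma nN: "n \<le> N"
  using good by (simp add: good_matrix_def)

lemma seed_ok_sd: "seed_ok n N (sd p)"
  unfolding seed_at_def by (rule seed_ok_mutates[OF seed_ok_initial[OF good]]) auto

lemma good_sd: "good_matrix n N (snd (sd p))"
  using seed_ok_sd[of p] by (simp add: seed_ok_def)

lemma top_sd: "top_block p (snd (sd p))"
  using seed_at_block[of 0 "(rvar, b)" p N] top by simp

lemma lm_indep_sd: "lm_indep (fst (sd p))"
  using seed_ok_sd[of p] by (simp add: seed_ok_def)

lemma X_chart: "p \<le> q \<Longrightarrow> X q = fhom (fst (sd p)) (var N (rvar, snd (sd p)) p q)"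
proof -
  assume pq: "p \<le> q"
  have "X q = var N (sd p) p q" using var_trans[of 0 p q] pq by simp
  thus ?thesis
    using seed_ok_as_hom(2)[of n N "fst (sd p)" "snd (sd p)" "map kk [p..<q]"] seed_ok_sd[of p]
    by (simp add: var_def seed_at_def)
qed

lemma X_row: "p \<le> q \<Longrightarrow> q < p + n \<Longrightarrow> fst (sd p) (kk q) = X q"
  using seed_at_row[of 0 p q N "(rvar, b)"] by simp

lemma X_initial: "q < n \<Longrightarrow> X q = rvar (kk q)"
  using X_row[of 0 q] by simp

text \<open>The order of the pole of \<open>X q\<close> along \<open>X q0\<close>, computed in the
  seed before step \<open>q0\<close>, which contains \<open>X q0\<close>.\<close>

definition D :: "nat \<Rightarrow> nat \<Rightarrow> int" where
  "D q0 q = pole (kk q0) (var N (rvar, snd (sd q0)) q0 q)"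

lemma D_mesh: "trop_mesh q0 (D q0)"
  unfolding D_def
proof (rule pole_var_mesh)
  show "pole (kk q0) (fst (rvar, snd (sd q0)) i) = 0" if "n \<le> i" for i
    using that kk_less[of q0] by (auto simp: simp del: kk_less)
qed (auto simp: top_sd nN)

lemma D_unit: "q0 \<le> q \<Longrightarrow> q < q0 + n \<Longrightarrow> D q0 q = (if q = q0 then -1 else 0)"
  using inj_onD[OF kk_inj[of q0], of q q0] by (auto simp: D_def var_window)

lemma X_eq_iff:
  assumes "q0 \<le> q" shows "X q = X q0 \<longleftrightarrow> D q0 q < 0" "D q0 q < 0 \<Longrightarrow> D q0 q = -1"
proof -
  let ?Y = "var N (rvar, snd (sd q0)) q0"
  have h: "field_hom (fhom (fst (sd q0)))" by (rule field_hom_fhom[OF lm_indep_sd])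
  have "X q = X q0 \<longleftrightarrow> ?Y q = ?Y q0" using X_chart[OF assms] X_chart[of q0 q0] field_hom_inj[OF h] by simp
  moreover have "?Y q0 = rvar (kk q0)" using var_window[of q0 q0] n_pos by simp
  moreover have "?Y q = rvar (kk q0)" if "D q0 q < 0"
    using cluster_variable_eq_initial[OF good_sd[of q0] kk_set kk_less kk_less] that
    unfolding D_def var_def seed_at_def[of N "(rvar, snd (sd q0))"] by blast
  ultimately have "X q = X q0 \<longleftrightarrow> D q0 q < 0" "D q0 q < 0 \<longrightarrow> D q0 q = -1"
    unfolding D_def by (metis pole_rvar zero_less_one neg_less_0_iff_less, metis pole_rvar)
  thus "X q = X q0 \<longleftrightarrow> D q0 q < 0" "D q0 q < 0 \<Longrightarrow> D q0 q = -1" by auto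
qed

lemma D_unique:
  assumes V: "trop_mesh p V" and p: "p \<le> q0" and "V q0 = -1" "\<And>r. q0 < r \<Longrightarrow> r < q0 + n \<Longrightarrow> V r = 0"
    and q: "q0 \<le> q"
  shows "V q = D q0 q"
proof -
  have "V (q0 + (q - q0)) = D q0 (q0 + (q - q0))"
    by (rule trop_mesh_unique[OF trop_mesh_later[OF V p] D_mesh]) (use assms in \<open>auto simp: D_unit\<close>)
  thus ?thesis using q by simp
qed

lemma D_add: "q0 \<le> q \<Longrightarrow> D (q0 + n * t) (q + n * t) = D q0 q"
  using trop_mesh_unique[OF D_mesh[of "q0 + n * t"] D_mesh[of q0], of "q - q0"]
  by (auto simp: D_unit algebra_simps)

text \<open>Whether two terms of the sequence are equal depends only on the sign of
  \<open>D\<close>, and \<open>D\<close> obeys a recursion of period \<open>n\<close> with the same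
  starting values in every sweep.\<close>

lemma X_add: "X (q + n * t) = X (q' + n * t) \<longleftrightarrow> X q = X q'"
proof -
  have *: "X (q' + n * t) = X (q + n * t) \<longleftrightarrow> X q' = X q" if "q \<le> q'" for q q'
    using that X_eq_iff(1)[of q q'] X_eq_iff(1)[of "q + n * t" "q' + n * t"] D_add[of q q' t] by simp
  show ?thesis using *[of q q'] *[of q' q] by (cases "q \<le> q'") auto
qed

lemma X_inj_window: "inj_on X {p..<p + n}"
proof (rule inj_onI)
  fix q r assume *: "q \<in> {p..<p + n}" "r \<in> {p..<p + n}" "X q = X r"
  show "q = r"
  proof (cases "q \<le> r")
    case True
    thus ?thesis using * X_eq_iff(1)[of q r] D_unit[of q r] by (auto split: if_splits)
  next
    case False
    thus ?thesis using * X_eq_iff(1)[of r q] D_unit[of r q] by auto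
  qed
qed

lemma D_next: "D q (q + n) = 1"
proof -
  have "nbsum q (D q) = 0" by (intro sum.neutral) (auto simp: D_unit)
  thus ?thesis using trop_meshD[OF D_mesh, of q q] D_unit[of q q] n_pos by simp
qed

text \<open>Otherwise \<open>D q\<close> would be a non-negative solution after \<open>q\<close>,
  hence 0; but its value at \<open>q + n\<close> is 1.\<close>

lemma X_returns: "\<exists>q'>q. X q' = X q"
proof (rule ccontr)
  assume "\<not> ?thesis"
  hence "D q q' \<ge> 0" if "q' > q" for q' using X_eq_iff(1)[of q q'] that by (metis less_imp_le not_less)
  hence "D q (q + n) = 0"
    using trop_mesh_nonneg_zero[OF trop_mesh_later[OF D_mesh[of q], of "Suc q"], of "q + n"] n_pos by auto
  thus False by (simp add: D_next)
qed

definition nx :: "nat \<Rightarrow> nat" where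
  "nx q = (LEAST q'. q < q' \<and> X q' = X q)"

lemma nx: "q < nx q" "X (nx q) = X q" "\<And>q'. q < q' \<Longrightarrow> X q' = X q \<Longrightarrow> nx q \<le> q'"
  using LeastI_ex[OF X_returns[of q]] by (auto simp: nx_def intro: Least_le)

lemma nx_ge: "q + n < nx q"
proof -
  have "\<not> nx q < q + n" using inj_onD[OF X_inj_window[of q], of "nx q" q] nx(1,2)[of q] by auto
  moreover have "nx q \<noteq> q + n" using X_eq_iff(1)[of q "q + n"] nx(2)[of q] D_next[of q] by auto
  ultimately show ?thesis by simp
qed

lemma nx_add: "nx (q + n * t) = nx q + n * t"
  unfolding nx_def[of "q + n * t"]
proof (rule Least_equality)
  show "q + n * t < nx q + n * t \<and> X (nx q + n * t) = X (q + n * t)" using nx(1,2)[of q] X_add by simp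
next
  fix y assume y: "q + n * t < y \<and> X y = X (q + n * t)"
  define z where "z = y - n * t"
  have "y = z + n * t" using y by (simp add: z_def)
  thus "nx q + n * t \<le> y" using y nx(3)[of q z] X_add[of z t q] by simp
qed

lemma nx_inj: "nx q = nx q' \<Longrightarrow> q = q'"
proof (rule ccontr)
  have *: False if "nx q = nx q'" "q < q'" for q q'
    using nx(3)[of q q'] nx(1,2)[of q'] nx(2)[of q] that by simp
  assume "nx q = nx q'" "q \<noteq> q'"
  thus False using *[of q q'] *[of q' q] by (metis linorder_neqE_nat)
qed

lemma nx_surj:
  assumes "q0 < q" "X q = X q0" shows "\<exists>q1\<ge>q0. nx q1 = q \<and> X q1 = X q"
proof -
  define S where "S = {r. q0 \<le> r \<and> r < q \<and> X r = X q}"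
  have S: "finite S" "q0 \<in> S" using assms by (auto simp: S_def)
  obtain m where m: "m \<in> S" "\<And>r. r \<in> S \<Longrightarrow> r \<le> m"
    using Max_in[OF S(1)] Max_ge[OF S(1)] S(2) by blast
  hence "nx m \<le> q" using nx(3)[of m q] by (simp add: S_def)
  moreover have "\<not> nx m < q"
  proof
    assume "nx m < q"
    hence "nx m \<in> S" using m(1) nx(1,2)[of m] by (simp add: S_def)
    thus False using m(2)[of "nx m"] nx(1)[of m] by simp
  qed
  ultimately show ?thesis using m(1) unfolding S_def by (intro exI[of _ m]) auto
qed

text \<open>If two next occurrences lie at the same vertex, shifts by whole sweeps make them equal,
  and \<open>nx\<close> is injective.\<close>

lemma kk_nx_bij: "bij_betw (\<lambda>q. kk (nx q)) {..<n} {..<n}"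
proof -
  have "inj_on (\<lambda>q. kk (nx q)) {..<n}"
  proof (rule inj_onI)
    fix q q' assume q: "q \<in> {..<n}" "q' \<in> {..<n}" "kk (nx q) = kk (nx q')"
    have "slot 0 (kk r) = r mod n" for r
      using slot_kk[of 0 "r mod n"] n_pos by (simp add: kk_def)
    hence "nx q = slot 0 (kk (nx q)) + n * (nx q div n)" "nx q' = slot 0 (kk (nx q')) + n * (nx q' div n)"
      by simp_all
    then obtain t t' where "nx q = slot 0 (kk (nx q)) + n * t" "nx q' = slot 0 (kk (nx q)) + n * t'"
      using q(3) by metis
    hence "nx q + n * t' = nx q' + n * t" by simp
    hence "nx (q + n * t') = nx (q' + n * t)" by (simp add: nx_add)
    hence "(q + n * t') mod n = (q' + n * t) mod n" using nx_inj by metis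
    thus "q = q'" using q by simp
  qed
  moreover have "(\<lambda>q. kk (nx q)) ` {..<n} = {..<n}"
    using calculation by (intro endo_inj_surj) auto
  ultimately show ?thesis by (simp add: bij_betw_def)
qed

lemma D_between: "q < r \<Longrightarrow> r < nx q \<Longrightarrow> D q r \<ge> 0"
  using X_eq_iff(1)[of q r] nx(3)[of q r] by (meson leD less_imp_le not_less)

lemma D_nx: "D q (nx q) = -1"
  using X_eq_iff[of q "nx q"] nx(1,2)[of q] by simp

text \<open>Between two occurrences of a variable the mesh relation is linear, so that the value of the
  invariant form at \<open>- e\<^sub>k + u\<close> is that at a simple root \<open>e\<^sub>j\<close>. Adding up over a permutation of the
  vertices gives \<open>u = 0\<close>.\<close>

lemma D_before_nx: "nx q < r + n \<Longrightarrow> r < nx q \<Longrightarrow> D q r = 0"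
proof -
  define u where "u q i = real_of_int (if i = kk (nx q) then 0 else state (D q) (Suc (nx q - n)) i)" for q i
  have step: "2 / d (kk (nx q)) + qform (u q) \<le> 2 / d (kk q)" for q
  proof -
    let ?Q = "\<lambda>p. qform (\<lambda>i. of_int (state (D q) p i))"
    have lin: "D q (r + n) = - D q r + nbsum r (D q)" if "q < r" "r + n \<le> nx q" for r
      using trop_meshD[OF D_mesh, of q r] nonneg_sum[of r "D q"] D_between[of q] that by simp
    have Q: "?Q (Suc q + t) = ?Q (Suc q)" if "Suc q + t \<le> Suc (nx q - n)" for t
      using that
    proof (induction t)
      case (Suc t)
      hence "?Q (Suc (Suc q + t)) = ?Q (Suc q + t)" by (intro qform_state_Suc lin) auto
      thus ?case using Suc by simp
    qed simp
    have st: "state (D q) (Suc q) i = (if i = kk q then 1 else 0)" for i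
      using slot[of i q] by (auto simp: state_def slot_Suc D_next D_unit)
    have "?Q (Suc q) = qform (\<lambda>_. 0) + 2 * 1 / d (kk q) * (\<Sum>i<n. of_int (a i (kk q)) * 0) + 2 * 1\<^sup>2 / d (kk q)"
      by (rule qform_add_unit) (auto simp: st)
    hence 1: "?Q (Suc q) = 2 / d (kk q)" by (simp add: qform_zero)
    have nq: "nx q - n + n = nx q" "q < nx q - n" using nx_ge[of q] by auto
    have k: "state (D q) (Suc (nx q - n)) (kk (nx q)) = -1"
      using state_Suc[of "D q" "nx q - n"] kk_add(1)[of "nx q - n"] nq D_nx[of q] by simp
    have "?Q (Suc (nx q - n)) = qform (u q) + 2 * (-1) / d (kk (nx q)) * (\<Sum>i<n. of_int (a i (kk (nx q))) * u q i) +
        2 * (-1)\<^sup>2 / d (kk (nx q))"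
      by (rule qform_add_unit) (auto simp: u_def k)
    \<comment> \<open>The cross term between minus the unit vector and the non-negative
      \<open>u q\<close> contributes non-negatively to the form, since the off-diagonal entries of
      the Cartan matrix are non-positive.\<close>
    moreover have "(\<Sum>i<n. of_int (a i (kk (nx q))) * u q i) \<le> 0"
    proof (rule sum_nonpos)
      fix i assume "i \<in> {..<n}"
      hence i: "i < n" by simp
      show "of_int (a i (kk (nx q))) * u q i \<le> 0"
      proof (cases "i = kk (nx q)")
        case False
        have "i \<noteq> kk (nx q - n)" using False kk_add(1)[of "nx q - n"] nq by simp
        hence "state (D q) (Suc (nx q - n)) i \<ge> 0"
          using slot[OF i, of "nx q - n"] nq D_between[of q "slot (nx q - n) i"]
          by (auto simp: state_Suc state_def)
        thus ?thesis using offdiag[OF i, of "kk (nx q)"] by (simp add: u_def mult_nonpos_nonneg)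
      qed (simp add: u_def)
    qed
    ultimately have "2 / d (kk (nx q)) + qform (u q) \<le> ?Q (Suc (nx q - n))"
      using d_pos[of "kk (nx q)"] by (simp add: divide_nonpos_pos)
    also have "\<dots> = 2 / d (kk q)" using Q[of "nx q - n - q"] nq 1 by simp
    finally show ?thesis .
  qed
  have "(\<Sum>q<n. 2 / d (kk (nx q)) + qform (u q)) \<le> (\<Sum>q<n. 2 / d (kk q))"
    by (intro sum_mono step)
  moreover have "(\<Sum>q<n. 2 / d (kk (nx q))) = (\<Sum>i<n. 2 / d i)" "(\<Sum>q<n. 2 / d (kk q)) = (\<Sum>i<n. 2 / d i)"
    using sum.reindex_bij_betw[OF kk_nx_bij, of "\<lambda>i. 2 / d i"] sum.reindex_bij_betw[OF kk_bij[of 0], of "\<lambda>i. 2 / d i"]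
    by (simp_all add: lessThan_atLeast0)
  ultimately have "(\<Sum>q<n. qform (u q)) \<le> 0" by (simp add: sum.distrib)
  moreover have "(\<Sum>q<n. qform (u q)) \<ge> 0" by (intro sum_nonneg qform_nonneg)
  ultimately have "(\<Sum>q<n. qform (u q)) = 0" by simp
  hence u0: "qform (u q) = 0" if "q < n" for q
    using that sum_nonneg_eq_0_iff[of "{..<n}" "\<lambda>q. qform (u q)"] qform_nonneg by simp
  have main: "D q r = 0" if "q < n" "nx q < r + n" "r < nx q" for q r
  proof -
    have nq: "nx q - n + n = nx q" "q < nx q - n" using nx_ge[of q] by auto
    have k: "kk r \<noteq> kk (nx q)" using inj_onD[OF kk_inj[of r], of r "nx q"] that by auto
    have "u q (kk r) = 0" using qform_pos[of "kk r" "u q"] u0[OF that(1)] by auto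
    moreover have "u q (kk r) = D q r"
      using k that nq by (simp add: u_def state_def)
    ultimately show ?thesis by simp
  qed
  assume r: "nx q < r + n" "r < nx q"
  define t where "t = q div n"
  have q: "q = q mod n + n * t" by (simp add: t_def)
  have nq: "nx q = nx (q mod n) + n * t" by (subst q) (rule nx_add)
  have le: "q mod n + n * t \<le> r" using r nx_ge[of q] q by linarith
  hence r': "r = (r - n * t) + n * t" by simp
  have "D q r = D (q mod n) (r - n * t)"
    by (subst q, subst r') (rule D_add, use le in simp)
  also have "\<dots> = 0" by (rule main) (use n_pos r nq le in auto)
  finally show ?thesis .
qed

lemma D_after_nx: "nx q < r \<Longrightarrow> r < nx q + n \<Longrightarrow> D q r = 0"
  by (rule unit_forward[OF D_mesh, of q "nx q"]) (use nx_ge[of q] D_nx[of q] D_before_nx[of q] in auto)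

text \<open>\<open>vx j\<close> is the vertex where the initial variable \<open>x\<^sub>j\<close> occurs for the next time, and \<open>rt j\<close>
  the number of sweeps when this happens.\<close>

definition vx :: "nat \<Rightarrow> nat" where "vx j = kk (nx (slot 0 j))"
definition rt :: "nat \<Rightarrow> nat" where "rt j = nx (slot 0 j) div n"

lemma nx_slot: "j < n \<Longrightarrow> nx (slot 0 j) = slot 0 (vx j) + n * rt j"
  using slot_kk[of 0 "nx (slot 0 j) mod n"] by (simp add: vx_def rt_def kk_def)

lemma vx_less [simp]: "vx j < n" by (simp add: vx_def)

lemma vx_bij: "bij_betw vx {..<n} {..<n}"
proof -
  have "bij_betw (slot 0) {..<n} {..<n}"
    using bij_betw_the_inv_into[OF kk_bij[of 0]] by (simp add: slot_def lessThan_atLeast0)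
  from bij_betw_trans[OF this kk_nx_bij] show ?thesis unfolding vx_def[abs_def] by (simp add: comp_def)
qed

text \<open>The hypothesis on the following window covers the later slots of the same sweep;
  \<open>unit_backward\<close> supplies the earlier ones.\<close>

lemma initial_window:
  assumes V: "trop_mesh 0 V" and j: "j < n" and u: "V (slot 0 j + n * B) = -1"
    "\<And>r. slot 0 j + n * B < r \<Longrightarrow> r < slot 0 j + n * B + n \<Longrightarrow> V r = 0"
    and i: "i < n" "i \<noteq> j"
  shows "V (slot 0 i + n * B) = 0"
proof -
  have "slot 0 i \<noteq> slot 0 j" using slot(3)[OF i(1), of 0] slot(3)[OF j, of 0] i by auto
  thus ?thesis
    using unit_backward[OF V, of "slot 0 j + n * B" "slot 0 i + n * B"] u
      slot(2)[OF i(1), of 0] slot(2)[OF j, of 0] by (cases "slot 0 i < slot 0 j") auto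
qed

text \<open>Time reversal turns the solution between two occurrences of \<open>x\<^sub>j\<close>
  into the orders of poles along \<open>x\<^sub>k\<close>, where \<open>k = vx j\<close>. The value
  -1 at the earlier occurrence then says that \<open>x\<^sub>k\<close> returns to vertex
  \<open>j\<close>.\<close>

lemma vx_reversed:
  assumes j: "j < n"
  obtains t where "int t = int (rt j) + h (vx j) - h j" "t > 0" "X (slot 0 j + n * t) = X (slot 0 (vx j))"
proof -
  define k where "k = vx j"
  have k: "k < n" by (simp add: k_def)
  \<comment> \<open>All heights differ from \<open>h j\<close> by at most \<open>B\<close>. Starting
    \<open>B\<close> sweeps late keeps the reversed slices at non-negative times.\<close>
  define B where "B = nat (\<Sum>i<n. \<bar>h j - h i\<bar>)"
  have hB: "h i - h j \<le> int B" "h j - h i \<le> int B" if "i < n" for i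
    using member_le_sum[of i "{..<n}" "\<lambda>i. \<bar>h j - h i\<bar>"] that by (simp_all add: B_def)
  define q0 where "q0 = slot 0 j + n * B"
  obtain V where V: "trop_mesh 0 V" "\<And>q. q \<ge> q0 \<Longrightarrow> V q = D q0 q"
    using trop_mesh_extend[OF D_mesh] by blast
  define v where "v t i = V (slot 0 i + n * t)" for t i
  have v: "sweep_mesh v" unfolding v_def by (rule sweep_mesh[OF V(1)])
  have vB: "v B j = -1" "\<And>i. i < n \<Longrightarrow> i \<noteq> j \<Longrightarrow> v B i = 0"
    using initial_window[OF V(1) j, of B] V(2) D_unit[of q0] n_pos by (auto simp: v_def q0_def)
  define C where "C = rt j + B"
  have nq: "nx q0 = slot 0 k + n * C" using nx_slot[OF j] unfolding q0_def nx_add C_def k_def by (simp add: algebra_simps)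
  have vC: "v C k = -1" "\<And>i. i < n \<Longrightarrow> i \<noteq> k \<Longrightarrow> v C i = 0"
  proof -
    have 1: "V (slot 0 k + n * C) = -1" using V(2)[of "nx q0"] nx(1)[of q0] D_nx[of q0] nq by simp
    have 2: "V r = 0" if "slot 0 k + n * C < r" "r < slot 0 k + n * C + n" for r
      using V(2)[of r] D_after_nx[of q0 r] nq nx(1)[of q0] that by simp
    show "v C k = -1" using 1 by (simp add: v_def)
    show "v C i = 0" if "i < n" "i \<noteq> k" for i
      using initial_window[OF V(1) k 1 2 that] by (simp add: v_def)
  qed
  \<comment> \<open>Otherwise the slot of \<open>k\<close> in sweep \<open>C\<close> would lie in
    the cone of zeros that starts at \<open>j\<close> in sweep \<open>B\<close>.\<close>
  have pos: "h j - h k < int (rt j)"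
  proof (rule ccontr)
    assume "\<not> ?thesis"
    moreover have "rt j > 0"
    proof (rule ccontr)
      assume "\<not> rt j > 0"
      hence "nx (slot 0 j) = slot 0 (vx j)" using nx_slot[OF j] by simp
      thus False using nx_ge[of "slot 0 j"] slot(2)[OF vx_less, of 0 j] by linarith
    qed
    ultimately have "k \<noteq> j" "int (rt j) \<le> h j - h k" by auto
    hence "v (B + rt j) k = 0" using vB(1) by (intro cone_forward[OF v _ vB(2) k]) auto
    moreover have "C = B + rt j" by (simp add: C_def)
    ultimately show False using vC(1) by (metis zero_neq_neg_one)
  qed
  define w where "w t i = (pole k (var N (rvar, b) 0 (slot 0 i + n * t)))" for t i
  have wm: "trop_mesh 0 (\<lambda>q. pole k (X q))"
    by (rule pole_var_mesh) (use top nN k in \<open>auto\<close>)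
  have w: "sweep_mesh w" unfolding w_def by (rule sweep_mesh[OF wm])
  have w0: "w 0 i = (if i = k then -1 else 0)" if "i < n" for i
    using X_initial[of "slot 0 i"] slot[OF that, of 0] by (simp add: w_def)
  define C' where "C' = int C + h k"
  have init: "v (nat (C' - h i)) i = w 0 i" if i: "i < n" for i
  proof (cases "i = k")
    case True
    thus ?thesis using vC(1) w0[OF i] by (simp add: C'_def)
  next
    case ik: False
    show ?thesis
    proof (cases "h i \<le> h k")
      case True
      hence "nat (C' - h i) = C + nat (h k - h i)" by (simp add: C'_def)
      thus ?thesis using cone_forward[OF v _ vC(2) i ik, of "nat (h k - h i)"] vC(1) True w0[OF i] ik by simp
    next
      case False
      have "h i - h k \<le> int C" using hB(1)[OF i] pos by (simp add: C_def)
      hence "nat (C' - h i) = C - nat (h i - h k)" "nat (h i - h k) \<le> C" using False by (auto simp: C'_def)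
      thus ?thesis using cone_backward[OF v _ vC(2) i ik, of "nat (h i - h k)"] vC(1) False w0[OF i] ik by simp
    qed
  qed
  define t1 where "t1 = nat (int (rt j) + h k - h j)"
  have t1: "int t1 = int (rt j) + h k - h j" "t1 > 0" using pos by (auto simp: t1_def)
  have "v (nat (C' - h j - int t1)) j = w t1 j"
  proof (rule reversed_mesh_unique[OF v w init j])
    fix l assume "l < n"
    thus "int t1 \<le> C' - h l" using hB(1)[of l] by (simp add: t1 C'_def C_def)
  qed auto
  moreover have "nat (C' - h j - int t1) = B" by (simp add: t1 C'_def C_def)
  ultimately have "pole k (X (slot 0 j + n * t1)) < 0" using vB(1) by (simp add: w_def)
  hence "X (slot 0 j + n * t1) = rvar k"
    using cluster_variable_eq_initial[OF good kk_set k kk_less] unfolding var_def seed_at_def by blast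
  hence "X (slot 0 j + n * t1) = X (slot 0 k)" using X_initial[of "slot 0 k"] slot[OF k, of 0] by simp
  thus ?thesis using that t1 by (simp add: k_def)
qed

lemma rt_vx_le:
  assumes j: "j < n" shows "int (rt (vx j)) \<le> int (rt j) + h (vx j) - h j"
proof -
  obtain t where t: "int t = int (rt j) + h (vx j) - h j" "t > 0" "X (slot 0 j + n * t) = X (slot 0 (vx j))"
    using vx_reversed[OF j] .
  have "n \<le> n * t" using t(2) by simp
  hence "slot 0 (vx j) < slot 0 j + n * t" using slot(2)[OF vx_less, of 0 j] by linarith
  hence "slot 0 (vx (vx j)) + n * rt (vx j) \<le> slot 0 j + n * t"
    using nx(3)[of "slot 0 (vx j)"] nx_slot[of "vx j"] t(3) by simp
  hence "n * rt (vx j) < n * Suc t" using slot(2)[OF j, of 0] by simp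
  hence "rt (vx j) < Suc t" by (metis mult_less_cancel1)
  thus ?thesis using t(1) by simp
qed

text \<open>The inequalities \<open>rt_vx_le\<close> add up to an equality because \<open>vx\<close>
  permutes the vertices. So the occurrence of \<open>x\<^sub>k\<close>, \<open>k = vx j\<close>,
  found at \<open>j\<close> lies in the same sweep as its next one, at \<open>vx (vx j)\<close>, and
  within a sweep the variables are distinct.\<close>

theorem vx_involution:
  assumes j: "j < n" shows "vx (vx j) = j"
proof -
  define f where "f j = int (rt j) + h (vx j) - h j - int (rt (vx j))" for j
  have "(\<Sum>j<n. h (vx j)) = (\<Sum>j<n. h j)" "(\<Sum>j<n. int (rt (vx j))) = (\<Sum>j<n. int (rt j))"
    by (rule sum.reindex_bij_betw[OF vx_bij])+
  hence "sum f {..<n} = 0" unfolding f_def sum_subtractf sum.distrib by linarith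
  moreover have "0 \<le> f j" if "j \<in> {..<n}" for j using rt_vx_le[of j] that by (simp add: f_def)
  ultimately have "f j = 0" using sum_nonneg_eq_0_iff[of "{..<n}" f] j by blast
  hence r: "int (rt (vx j)) = int (rt j) + h (vx j) - h j" by (simp add: f_def)
  obtain t where "int t = int (rt j) + h (vx j) - h j" "X (slot 0 j + n * t) = X (slot 0 (vx j))"
    using vx_reversed[OF j] .
  hence "X (slot 0 j + n * rt (vx j)) = X (slot 0 (vx j))" using r by (metis of_nat_eq_iff)
  hence "X (slot 0 j + n * rt (vx j)) = X (slot 0 (vx (vx j)) + n * rt (vx j))"
    unfolding nx_slot[OF vx_less, of j, symmetric] nx(2) .
  hence "X (slot 0 j) = X (slot 0 (vx (vx j)))" unfolding X_add .
  hence "slot 0 j = slot 0 (vx (vx j))"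
    by (rule inj_onD[OF X_inj_window[of 0]]) (use slot(2)[OF j, of 0] slot(2)[OF vx_less, of 0] in auto)
  thus ?thesis using slot(3)[OF j, of 0] slot(3)[OF vx_less, of 0 "vx j"] by argo
qed

end


lemma pole_zero_mutates:
  "(\<And>i. rpos (fst s i)) \<Longrightarrow> (\<And>i. pole l (fst s i) = 0) \<Longrightarrow> pole l (fst (mutates N qs s) i) = 0"
proof (induction qs arbitrary: s)
  case (Cons k qs)
  obtain x b where s: "s = (x, b)" by fastforce
  have "pole l (fst (mutate N k s) k) = 0"
    using pole_mutate[of x l N k b] Cons.prems by (simp add: s)
  hence "pole l (fst (mutate N k s) i) = 0" for i
    using Cons.prems(2)[of i] by (cases "i = k") (auto simp: s mutate_eq)
  moreover have "rpos (fst (mutate N k s) i)" for i using rpos_mutate[of x N k b] Cons.prems(1) by (simp add: s)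
  ultimately show ?case using Cons.IH[of "mutate N k s"] by simp
qed simp

lemma seeds_mutates:
  assumes "s \<in> seeds n N b" shows "\<exists>qs. set qs \<subseteq> {..<n} \<and> s = mutates N qs (rvar, b)"
  using assms
proof induction
  case initial
  show ?case by (rule exI[of _ "[]"]) simp
next
  case (mutation s k)
  then obtain qs where "set qs \<subseteq> {..<n}" "s = mutates N qs (rvar, b)" by auto
  thus ?case using mutation.hyps by (intro exI[of _ "qs @ [k]"]) simp
qed

lemma mutates_seeds: "set qs \<subseteq> {..<n} \<Longrightarrow> s \<in> seeds n N b \<Longrightarrow> mutates N qs s \<in> seeds n N b"
proof (induction qs arbitrary: s)
  case (Cons k qs)
  thus ?case using seeds.mutation[OF Cons.prems(2), of k] by simp
qed simp

section \<open>All cluster variables occur in the sequence; first occurrences\<close>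

context dynkin_seed
begin

text \<open>Seen from \<open>s\<close>, the initial seed is \<open>(y, b)\<close>, and the orders
  along variable \<open>l\<close> of the sequence starting there satisfy \<open>trop_mesh\<close>.
  If none were negative, all would be 0, and mutating back to \<open>s\<close> would give order 0
  for \<open>rvar l\<close>, which has order -1.\<close>

theorem cluster_variable_X:
  assumes s: "s \<in> seeds n N b" and l: "l < n" shows "\<exists>q. fst s l = X q"
proof -
  obtain qs where qs: "set qs \<subseteq> {..<n}" "s = mutates N qs (rvar, b)" using seeds_mutates[OF s] by auto
  obtain x c where xc: "s = (x, c)" by fastforce
  have ok: "seed_ok n N (x, c)"
    using seed_ok_mutates[OF seed_ok_initial[OF good] qs(1)] qs(2) xc by simp
  have rv: "mutates N (rev qs) (x, c) = (rvar, b)"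
    using mutates_rev[OF seed_ok_initial[OF good] qs(1)] qs(2) xc by simp
  note hom = seed_ok_as_hom[OF ok]
  define y where "y = fst (mutates N (rev qs) (rvar, c))"
  have yb: "mutates N (rev qs) (rvar, c) = (y, b)" using hom(2)[of "rev qs"] rv by (simp add: y_def)
  have oky: "seed_ok n N (y, b)"
    using seed_ok_mutates[OF seed_ok_initial[OF seed_okD(1)[OF ok]], of "rev qs"] qs(1) yb by simp
  note g = seed_okD[OF oky]
  have fr: "pole l (y i) = 0" if "i \<ge> n" for i using g(6)[OF that] l that by simp
  define W where "W q = pole l (var N (y, b) 0 q)" for q
  have W: "trop_mesh 0 W" unfolding W_def
    by (rule pole_var_mesh) (use g top nN fr in auto)
  have "\<exists>q. W q < 0"
  proof (rule ccontr)
    assume "\<not> ?thesis"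
    hence "W q = 0" for q using trop_mesh_nonneg_zero[OF W, of q] by (auto simp: not_less)
    hence "pole l (y i) = 0" if "i < n" for i
    proof -
      have "pole l (y i) = W (slot 0 i)"
        using slot[OF that, of 0] var_window[of 0 "slot 0 i" N "(y, b)"] by (simp add: W_def)
      thus ?thesis using \<open>W (slot 0 i) = 0\<close> by simp
    qed
    hence "pole l (y i) = 0" for i using fr by (cases "i < n") auto
    hence "pole l (fst (mutates N qs (y, b)) l) = 0" using g(2) by (intro pole_zero_mutates) auto
    moreover have "mutates N qs (y, b) = (rvar, c)"
      using mutates_rev[OF seed_ok_initial[OF seed_okD(1)[OF ok]], of "rev qs"] qs(1) yb by simp
    ultimately show False by simp
  qed
  then obtain q where "W q < 0" by auto
  hence neg: "pole l (fst (mutates N (rev qs @ map kk [0..<q]) (rvar, c)) (kk q)) < 0"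
    by (simp add: W_def var_def seed_at_def yb)
  have sub: "set (rev qs @ map kk [0..<q]) \<subseteq> {..<n}" using qs(1) by auto
  have "fst (mutates N (rev qs @ map kk [0..<q]) (rvar, c)) (kk q) = rvar l"
    by (rule cluster_variable_eq_initial[OF seed_okD(1)[OF ok] sub l kk_less neg])
  hence "fst (mutates N (rev qs @ map kk [0..<q]) (x, c)) (kk q) = x l"
    unfolding hom(2) using ok by (simp add: fhom_rvar seed_ok_def)
  hence "fst (mutates N (map kk [0..<q]) (rvar, b)) (kk q) = fst s l" using rv xc by simp
  thus ?thesis unfolding var_def seed_at_def by metis
qed

lemma X_cluster_variable: "X q \<in> cluster_variables n N b"
  unfolding cluster_variables_def var_def seed_at_def
  using mutates_seeds[OF kk_set seeds.initial] kk_less by blast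

lemma cluster_variables_X: "cluster_variables n N b = range X"
proof
  show "cluster_variables n N b \<subseteq> range X"
    using cluster_variable_X unfolding cluster_variables_def by blast
qed (use X_cluster_variable in auto)

definition V :: "nat \<Rightarrow> nat \<Rightarrow> int" where
  "V l q = pole l (X q)"

lemma V_mesh: "l < n \<Longrightarrow> trop_mesh 0 (V l)"
  unfolding V_def by (rule pole_var_mesh) (use top nN in \<open>auto\<close>)

lemma V_initial: "l < n \<Longrightarrow> q < n \<Longrightarrow> V l q = (if q = slot 0 l then -1 else 0)"
  using slot[of l 0] by (auto simp: V_def X_initial)

lemma X_initial_iff:
  assumes l: "l < n" shows "X q = rvar l \<longleftrightarrow> V l q < 0" "V l q < 0 \<Longrightarrow> V l q = -1"
proof -
  have "X q = rvar l" if "V l q < 0"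
    using cluster_variable_eq_initial[OF good kk_set l kk_less] that unfolding V_def var_def seed_at_def by blast
  thus "X q = rvar l \<longleftrightarrow> V l q < 0" "V l q < 0 \<Longrightarrow> V l q = -1" by (auto simp: V_def)
qed

lemma X_slot0: "l < n \<Longrightarrow> X (slot 0 l) = rvar l"
  using X_initial[of "slot 0 l"] slot[of l 0] by simp

text \<open>From each occurrence of \<open>rvar l\<close> on, \<open>V l\<close> is the function
  \<open>D\<close> of this occurrence, and \<open>D_before_nx\<close> and \<open>D_after_nx\<close>
  give the zeros around the next one; the induction passes from one occurrence to the next.\<close>

lemma V_window:
  assumes l: "l < n" shows "V l q < 0 \<Longrightarrow> s \<noteq> q \<Longrightarrow> s < q + n \<Longrightarrow> q < s + n \<Longrightarrow> V l s = 0"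
proof (induction q arbitrary: s rule: less_induct)
  case (less q)
  define q0 where "q0 = slot 0 l"
  have q0: "q0 < n" "V l q0 = -1" using slot[OF l, of 0] V_initial[OF l] by (auto simp: q0_def)
  have V0: "V l r = D q0 r" if "r \<ge> q0" for r
  proof (rule D_unique[OF V_mesh[OF l] _ q0(2) _ that])
    fix r assume r: "q0 < r" "r < q0 + n"
    show "V l r = 0"
      by (rule unit_forward[OF V_mesh[OF l] _ _ _ r]) (use q0 V_initial[OF l] in \<open>auto\<close>)
  qed simp
  have "q0 \<le> q" using less.prems(1) q0 V_initial[OF l, of q] by (cases "q < n") (auto simp: q0_def split: if_splits)
  have Xq: "X q = X q0" using X_initial_iff(1)[OF l, of q] less.prems(1) X_slot0[OF l] by (metis q0_def)
  show ?case
  proof (cases "q = q0")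
    case True
    thus ?thesis
      using V0[of s] D_unit[of q0 s] V_initial[OF l, of s] less.prems q0 by (cases "q0 \<le> s") (auto simp: q0_def)
  next
    case False
    then obtain q1 where q1: "q1 \<ge> q0" "nx q1 = q" "X q1 = X q" using nx_surj[of q0 q] \<open>q0 \<le> q\<close> Xq by auto
    have V1: "V l q1 = -1" using X_initial_iff[OF l, of q1] X_initial_iff[OF l, of q] q1(3) less.prems(1) by simp
    have "V l r = D q1 r" if "r \<ge> q1" for r
    proof (rule D_unique[OF V_mesh[OF l] _ V1 _ that])
      show "V l r = 0" if "q1 < r" "r < q1 + n" for r
        using less.IH[of q1 r] nx(1)[of q1] q1(2) V1 that by simp
    qed simp
    thus ?thesis
      using D_before_nx[of q1 s] D_after_nx[of q1 s] less.prems q1(2) nx_ge[of q1] by (cases "s < q") auto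
  qed
qed

lemma rt_pos: "j < n \<Longrightarrow> 0 < rt j"
proof (rule ccontr)
  assume j: "j < n" "\<not> 0 < rt j"
  hence "nx (slot 0 j) = slot 0 (vx j)" using nx_slot[OF j(1)] by simp
  thus False using nx_ge[of "slot 0 j"] slot(2)[OF vx_less, of 0 j] by linarith
qed

text \<open>A slot outside the range of \<open>nx\<close> holds a variable that has not occurred
  before. These slots will correspond to \<open>Pi_index\<close>.\<close>

lemma nx_range:
  assumes i: "i < n" shows "slot 0 i + n * t \<in> range nx \<longleftrightarrow> rt (vx i) \<le> t"
proof
  assume "slot 0 i + n * t \<in> range nx"
  then obtain q where q: "slot 0 i + n * t = nx q" by auto
  define k where "k = kk q"
  have k: "k < n" by (simp add: k_def)
  have "q = slot 0 k + n * (q div n)" using slot_kk[of 0 "q mod n"] n_pos by (simp add: k_def kk_def)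
  hence e: "slot 0 i + n * t = slot 0 (vx k) + n * rt k + n * (q div n)"
    using q nx_add[of "slot 0 k" "q div n"] nx_slot[OF k] by simp
  hence "kk (slot 0 i + n * t) = kk (slot 0 (vx k) + n * (rt k + q div n))" by simp
  hence "i = vx k" using slot(3)[OF i, of 0] slot(3)[OF vx_less, of 0 k] by simp
  moreover from this have "n * t = n * (rt k + q div n)" using e by (simp add: algebra_simps)
  ultimately show "rt (vx i) \<le> t" using vx_involution[OF k] n_pos by simp
next
  assume "rt (vx i) \<le> t"
  then obtain s where "t = rt (vx i) + s" by (metis le_Suc_ex)
  hence "slot 0 i + n * t = nx (slot 0 (vx i) + n * s)"
    using nx_add[of "slot 0 (vx i)" s] nx_slot[of "vx i"] vx_involution[OF i] by (simp add: algebra_simps)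
  thus "slot 0 i + n * t \<in> range nx" by simp
qed

lemma X_return: "i < n \<Longrightarrow> X (slot 0 i + n * (rt (vx i) + s)) = X (slot 0 (vx i) + n * s)"
  using nx(2)[of "slot 0 (vx i)"] nx_slot[of "vx i"] vx_involution[of i]
    X_add[of "nx (slot 0 (vx i))" s "slot 0 (vx i)"] by (simp add: algebra_simps)

lemma X_first_initial:
  assumes i: "i < n"
  shows "(LEAST t. 0 < t \<and> X (slot 0 i + n * t) \<in> rvar ` {..<n}) = rt (vx i)"
proof (rule Least_equality)
  show "0 < rt (vx i) \<and> X (slot 0 i + n * rt (vx i)) \<in> rvar ` {..<n}"
    using X_return[OF i, of 0] X_slot0[of "vx i"] rt_pos[of "vx i"] by simp
next
  fix t assume t: "0 < t \<and> X (slot 0 i + n * t) \<in> rvar ` {..<n}"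
  then obtain l where l: "l < n" "X (slot 0 i + n * t) = X (slot 0 l)" using X_slot0 by auto
  have "n \<le> n * t" using t by simp
  hence "slot 0 l < slot 0 i + n * t" using slot(2)[OF l(1), of 0] by linarith
  from nx_surj[OF this l(2)] have "slot 0 i + n * t \<in> range nx" by (metis rangeI)
  thus "rt (vx i) \<le> t" unfolding nx_range[OF i] .
qed

end

subsection \<open>Specializing variables to 1\<close>

text \<open>\<open>S = {..<n}\<close> leads to the F-polynomials, \<open>S = {n..}\<close> removes
  the coefficients, and the complement of \<open>{n..<2 * n}\<close> keeps only the variables
  \<open>y\<close>.\<close>

definition set_ones :: "nat set \<Rightarrow> nat laurent \<Rightarrow> nat laurent" where
  "set_ones S p = (\<Sum>m \<in> keys p.
     single (Poly_Mapping.mapp (\<lambda>i e. if i \<in> S then 0 else e) m) (lookup p m))"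

abbreviation one_on :: "nat set \<Rightarrow> nat \<Rightarrow> ratfun" where
  "one_on S \<equiv> \<lambda>i. if i \<in> S then 1 else rvar i"

lemma set_one_eq: "set_one n p = set_ones {..<n} p"
  by (simp add: set_one_def set_ones_def)

lemma to_ratfun_sum: "to_ratfun (\<Sum>i\<in>A. f i) = (\<Sum>i\<in>A. to_ratfun (f i))"
  by (induction A rule: infinite_finite_induct) simp_all

lemma to_ratfun_set_ones: "to_ratfun (set_ones S p) = ev (one_on S) p"
proof -
  have "monomial (one_on S) m = monomial rvar (Poly_Mapping.mapp (\<lambda>i e. if i \<in> S then 0 else e) m)" for m
  proof -
    let ?m = "Poly_Mapping.mapp (\<lambda>i e. if i \<in> S then 0 else e) m"
    have l: "lookup ?m i = (if i \<in> S then 0 else lookup m i)" for i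
      by (auto simp: mapp.rep_eq in_keys_iff)
    have "monomial rvar ?m = (\<Prod>i\<in>keys m. rvar i powi lookup ?m i)"
      by (rule monomial_superset) (auto simp: in_keys_iff l split: if_splits)
    thus ?thesis by (simp add: monomial_def l) (auto intro!: prod.cong)
  qed
  moreover have "to_ratfun (single m c) = rconst c * monomial rvar m" for m c
    by (simp add: monomial_rvar rconst_def lconst_def flip: to_ratfun_simps)
  ultimately show ?thesis by (simp add: set_ones_def to_ratfun_sum ev_def lev_def)
qed

lemma rpos_one_on: "rpos (one_on S i)"
  by simp

context dynkin_seed
begin

definition L :: "nat \<Rightarrow> nat laurent" where "L q = laurent_expansion (X q)"

lemma X_L: "X q = to_ratfun (L q)"
proof -
  have "X q \<in> upper n N (rvar, b)"
    unfolding var_def seed_at_def by (rule Laurent_phenomenon[OF seed_ok_initial[OF good] kk_set])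
  thus ?thesis by (auto simp: upper_def Lau_rvar L_def)
qed

lemma rpos_X: "rpos (X q)"
  unfolding var_def seed_at_def by (rule rpos_mutates) simp

definition A :: "nat \<Rightarrow> (nat \<Rightarrow> 'x) \<Rightarrow> 'x::comm_monoid_mult" where
  "A q x = (\<Prod>i\<in>{n..<N}. x i ^ nat (snd (sd q) i (kk q)))"

definition Q :: "nat \<Rightarrow> (nat \<Rightarrow> 'x) \<Rightarrow> 'x::comm_monoid_mult" where
  "Q q x = (\<Prod>i\<in>{n..<N}. x i ^ nat (- snd (sd q) i (kk q)))"

lemma snd_seed_at: "snd (seed_at N (x, b) 0 q) = snd (sd q)"
  by (simp add: seed_at_def snd_mutates)

lemma var_mesh':
  assumes "\<And>i. rpos (x i)"
  shows "var N (x, b) 0 q * var N (x, b) 0 (q + n) =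
    A q x + Q q x * nbprod q (var N (x, b) 0)"
  using var_mesh[of 0 "(x, b)" q N] assms top nN by (simp add: A_def Q_def snd_seed_at[of x])

lemma to_ratfun_A_Q [simp]: "to_ratfun (A q lvar) = A q rvar" "to_ratfun (Q q lvar) = Q q rvar"
  by (simp_all add: A_def Q_def rvar_def)

lemma L_mesh: "L q * L (q + n) = A q lvar + Q q lvar * nbprod q L"
  unfolding to_ratfun_eq_iff[symmetric] using var_mesh'[of rvar q] by (simp add: X_L)

lemma L_initial: "q < n \<Longrightarrow> L q = lvar (kk q)"
  by (simp add: L_def X_initial rvar_def)

lemma ev_prod: "(\<And>i. x i \<noteq> 0) \<Longrightarrow> ev x (\<Prod>i\<in>I. f i) = (\<Prod>i\<in>I. ev x (f i))"
  by (induction I rule: infinite_finite_induct) simp_all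

text \<open>Specialization is a homomorphism on Laurent polynomials, so it respects the mesh
  relations, and these can be solved because positive quotients do not vanish.\<close>

lemma set_ones_L: "to_ratfun (set_ones S (L q)) = var N (one_on S, b) 0 q"
  unfolding to_ratfun_set_ones
proof (induction q rule: mesh_induct)
  case (initial q)
  thus ?case using var_window[of 0 q N "(one_on S, b)"] by (simp add: L_initial)
next
  case (step r)
  have nz: "one_on S i \<noteq> 0" for i by simp
  note e = ev_simps[of "one_on S", OF nz] ev_lvar[of "one_on S", OF nz] ev_prod[of "one_on S", OF nz]
  have "ev (one_on S) (A r lvar) = A r (one_on S)" "ev (one_on S) (Q r lvar) = Q r (one_on S)"
    unfolding A_def Q_def by (simp_all add: e)
  moreover have "nbprod r (\<lambda>s. ev (one_on S) (L s)) = nbprod r (var N (one_on S, b) 0)"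
    by (intro prod.cong refl) (simp add: step)
  ultimately have "ev (one_on S) (L r) * ev (one_on S) (L (r + n)) = var N (one_on S, b) 0 r * var N (one_on S, b) 0 (r + n)"
    using arg_cong[OF L_mesh[of r], of "ev (one_on S)"] var_mesh'[of "one_on S" r, OF rpos_one_on]
    by (simp add: e)
  moreover have "var N (one_on S, b) 0 r \<noteq> 0"
    unfolding var_def seed_at_def by (intro rpos_nonzero rpos_mutates) simp
  ultimately show ?case using step(1) by simp
qed

lemma pole_set_ones:
  assumes l: "l < n" shows "denom_exp l (set_ones {n..} (L q)) = V l q"
proof -
  let ?f = "\<lambda>q. var N (one_on {n..}, b) 0 q"
  have rp: "rpos (?f q)" for q
    unfolding var_def seed_at_def by (intro rpos_mutates) simp
  have "set_ones {n..} (L q) \<noteq> 0"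
    using rpos_nonzero[OF rp[of q]] unfolding set_ones_L[symmetric] by (metis to_ratfun_simps(4))
  hence "denom_exp l (set_ones {n..} (L q)) = pole l (?f q)"
    unfolding set_ones_L[symmetric] by (rule pole_to_ratfun[symmetric])
  also have "\<dots> = V l q"
  proof -
    have m: "trop_mesh 0 (\<lambda>q. pole l (?f q))"
      by (rule pole_var_mesh) (use top nN rpos_one_on in \<open>auto simp: pole_1\<close>)
    have kn: "\<not> n \<le> kk q" for q using kk_less[of q] by (simp only: not_le)
    have "pole l (?f (0 + q)) = V l (0 + q)"
      by (rule trop_mesh_unique[OF m V_mesh[OF l]]) (auto simp: var_window V_def kn)
    thus ?thesis by simp
  qed
  finally show ?thesis .
qed

end


subsection \<open>Principal coefficients\<close>

lemma skew_symmetrizable_mutates: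
  "skew_symmetrizable n (snd s) \<Longrightarrow> set qs \<subseteq> {..<n} \<Longrightarrow> skew_symmetrizable n (snd (mutates N qs s))"
  by (induction qs arbitrary: s) (simp_all add: snd_mutate skew_symmetrizable_mutate)

context dynkin
begin

lemma top_block_add_mult: "top_block (n * t) b \<longleftrightarrow> top_block 0 b"
  by (induction t) (use top_block_add[of "n * _"] in \<open>simp_all add: add.commute\<close>)

lemma map_kk: "map kk [n * t..<n * t + n] = ks"
  unfolding ks_kk by (rule nth_equalityI) (simp_all add: add.commute[of "n * t"])

lemma seed_at_sweep: "seed_at N s 0 (n * Suc t) = mutates N ks (seed_at N s 0 (n * t))"
  using seed_at_trans[of 0 "n * t" "n * t + n" N s]
  by (simp add: add.commute[of n]) (simp add: seed_at_def map_kk)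

lemma sweeps:
  assumes b: "top_block 0 (snd s)" "skew_symmetrizable n (snd s)"
  shows "(source_sweep n N ^^ t) s = seed_at N s 0 (n * t)"
proof (induction t)
  case (Suc t)
  have "top_block 0 (snd (seed_at N s 0 (n * t)))" using seed_at_block[OF b(1), of "n * t" N] by (simp add: top_block_add_mult)
  moreover have "skew_symmetrizable n (snd (seed_at N s 0 (n * t)))"
    unfolding seed_at_def using b(2) by (rule skew_symmetrizable_mutates) auto
  ultimately show ?case unfolding seed_at_sweep using Suc by (simp add: source_sweep_eq)
qed simp

lemma xvar_eq:
  assumes "top_block 0 b" "skew_symmetrizable n b" "i < n"
  shows "xvar n N b (t, i) = var N (rvar, b) 0 (slot 0 i + n * t)"
  using sweeps[of "(rvar, b)" t N] assms seed_at_slot[of 0 "n * t" i N "(rvar, b)"] slot_add[of i 0 t]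
  by (simp add: xvar_def)

lemma skew_symmetrizable_exchange: "skew_symmetrizable n (exchange_matrix a E)"
  unfolding skew_symmetrizable_def
proof (intro exI[of _ d] conjI allI impI)
  fix i j assume "i < n" "j < n"
  thus "d i * of_int (exchange_matrix a E i j) = - d j * of_int (exchange_matrix a E j i)"
    using d_sym[of i j] edge[of i j] by (auto simp: exchange_matrix_def)
qed (rule d_pos)

abbreviation "B \<equiv> exchange_matrix a E"
abbreviation "B_prin \<equiv> principal_ext n B"

lemma good_matrix_prin: "good_matrix n (2 * n) B_prin"
proof -
  obtain e :: "nat \<Rightarrow> real" where e: "\<forall>i<n. e i > 0" "\<forall>i<n. \<forall>j<n. e i * of_int (B i j) = - e j * of_int (B j i)"
    using skew_symmetrizable_exchange by (auto simp: skew_symmetrizable_def)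
  have "B_prin i j = B i j" if "i < n" for i j using that by (simp add: principal_ext_def)
  hence "skew_symmetrizable n B_prin"
    unfolding skew_symmetrizable_def using e by (intro exI[of _ e]) metis
  moreover have "column_indep n (2 * n) B_prin" unfolding column_indep_def
  proof (intro allI impI)
    fix c :: "nat \<Rightarrow> int" and j
    assume c: "\<forall>i<2 * n. (\<Sum>j<n. B_prin i j * c j) = 0" and j: "j < n"
    have "(\<Sum>j'<n. B_prin (n + j) j' * c j') = (\<Sum>j'<n. if j' = j then c j else 0)"
      using j by (intro sum.cong refl) (auto simp: principal_ext_def)
    thus "c j = 0" using c[rule_format, of "n + j"] j by simp
  qed
  ultimately show ?thesis by (simp add: good_matrix_def)
qed

end

text \<open>From here on \<open>X\<close>, \<open>V\<close> and \<open>L\<close> belong to principal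
  coefficients. The cluster algebra without coefficients, from which the index set and the
  compatibility degrees are taken, is reached by specialization (\<open>var_free\<close>), since its
  exchange matrix need not have independent columns.\<close>

sublocale dynkin \<subseteq> dynkin_seed n a d E h "2 * n" B_prin
  by unfold_locales (auto simp: good_matrix_prin principal_ext_def intro!: top_block_initial)

context dynkin
begin

lemma var_free: "var n (rvar, B) 0 q = to_ratfun (set_ones {n..} (L q))"
proof -
  let ?f = "\<lambda>q. var (2 * n) (one_on {n..}, B_prin) 0 q" and ?g = "\<lambda>q. var n (rvar, B) 0 q"
  have B: "top_block 0 B" by (rule top_block_initial) simp
  have kn: "\<not> n \<le> kk q" for q using kk_less[of q] by (simp only: not_le)
  have "?g q = ?f q"
  proof (induction q rule: mesh_induct)
    case (step r)
    have ones: "A r (one_on {n..}) = 1" "Q r (one_on {n..}) = 1" unfolding A_def Q_def by auto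
    have "?g r * ?g (r + n) = 1 + nbprod r ?g"
      using var_mesh[of 0 "(rvar, B)" r n] B by simp
    also have "\<dots> = 1 + nbprod r ?f"
      by (intro arg_cong2[of _ _ _ _ "(+)"] prod.cong refl) (simp add: step)
    also have "\<dots> = ?f r * ?f (r + n)"
      using var_mesh'[of "one_on {n..}" r, OF rpos_one_on] unfolding ones by simp
    finally have "?g r * ?g (r + n) = ?g r * ?f (r + n)" using step(1) by simp
    moreover have "?g r \<noteq> 0" unfolding var_def seed_at_def by (intro rpos_nonzero rpos_mutates) simp
    ultimately show ?case by simp
  qed (simp add: var_window kn)
  thus ?thesis by (simp only: set_ones_L)
qed

section \<open>The index set, the involution \<open>star\<close> and the rotation
  \<open>tau\<close>\<close>

definition sl :: "nat \<times> nat \<Rightarrow> nat" where "sl \<gamma> = slot 0 (snd \<gamma>) + n * fst \<gamma>"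

lemma xvar_prin: "snd \<gamma> < n \<Longrightarrow> xvar n (2 * n) B_prin \<gamma> = X (sl \<gamma>)"
  using xvar_eq[of B_prin "snd \<gamma>" "2 * n" "fst \<gamma>"] good_matrix_prin top by (simp add: sl_def good_matrix_def)

lemma xvar_free: "snd \<gamma> < n \<Longrightarrow> xvar n n B \<gamma> = to_ratfun (set_ones {n..} (L (sl \<gamma>)))"
  using xvar_eq[of B "snd \<gamma>" n "fst \<gamma>"] skew_symmetrizable_exchange top_block_initial[of B]
  by (simp add: sl_def var_free)

lemma xvar_free_eq_iff:
  assumes "snd \<gamma> < n" "l < n" shows "xvar n n B \<gamma> = rvar l \<longleftrightarrow> X (sl \<gamma>) = rvar l"
proof
  assume "xvar n n B \<gamma> = rvar l"
  hence "set_ones {n..} (L (sl \<gamma>)) = lvar l" using assms(1) by (simp add: xvar_free rvar_def)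
  hence "V l (sl \<gamma>) = denom_exp l (lvar l)" using pole_set_ones[OF assms(2), of "sl \<gamma>"] by simp
  also have "\<dots> = pole l (rvar l)"
    unfolding rvar_def using rvar_nonzero[of l] by (subst pole_to_ratfun) auto
  finally show "X (sl \<gamma>) = rvar l" using X_initial_iff(1)[OF assms(2)] by simp
next
  assume "X (sl \<gamma>) = rvar l"
  hence "L (sl \<gamma>) = lvar l" by (simp add: L_def rvar_def)
  thus "xvar n n B \<gamma> = rvar l" using assms by (simp add: xvar_free to_ratfun_set_ones)
qed

lemma rmax_eq: "i < n \<Longrightarrow> rmax n B i = rt (vx i) - 1"
proof -
  assume i: "i < n"
  have "xvar n n B (t, i) \<in> rvar ` {..<n} \<longleftrightarrow> X (slot 0 i + n * t) \<in> rvar ` {..<n}" for t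
    using xvar_free_eq_iff[of "(t, i)"] i by (auto simp: sl_def)
  thus ?thesis using X_first_initial[OF i] by (simp add: rmax_def)
qed

lemma rvar_inj: "rvar i = rvar j \<longleftrightarrow> i = j"
  using pole_rvar[of i i] pole_rvar[of i j] by (auto simp del: pole_rvar split: if_splits)

lemma star_eq:
  assumes i: "i < n" shows "star n B i = vx i"
proof -
  have "rmax n B i + 1 = rt (vx i)" using rmax_eq[OF i] rt_pos[of "vx i"] by simp
  moreover have "X (slot 0 i + n * rt (vx i)) = rvar (vx i)"
    using X_return[OF i, of 0] X_slot0[of "vx i"] by simp
  ultimately have "xvar n n B (rmax n B i + 1, i) = rvar j \<longleftrightarrow> j = vx i" if "j < n" for j
    using xvar_free_eq_iff[of "(rmax n B i + 1, i)" j] i that by (auto simp: sl_def rvar_inj)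
  thus ?thesis unfolding star_def by (intro the_equality) auto
qed

abbreviation "I \<equiv> Pi_index n B"
abbreviation "ta \<equiv> tau n B"

lemma Pi_iff: "(t, i) \<in> I \<longleftrightarrow> i < n \<and> t < rt (vx i)"
using rt_pos[of "vx i"] by (auto simp: Pi_index_def rmax_eq)

lemma Pi_snd: "\<gamma> \<in> I \<Longrightarrow> snd \<gamma> < n"
  by (cases \<gamma>) (simp add: Pi_iff)

lemma Pi_0: "i < n \<Longrightarrow> (0, i) \<in> I"
  using rt_pos[of "vx i"] by (simp add: Pi_iff)

lemma finite_Pi: "finite I"
proof (rule finite_subset)
  show "I \<subseteq> {..<Max (rt ` {..<n})} \<times> {..<n}"
  proof
    fix \<gamma> assume "\<gamma> \<in> I"
    then obtain t i where "\<gamma> = (t, i)" "i < n" "t < rt (vx i)" by (metis Pi_iff surj_pair)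
    moreover have "rt (vx i) \<le> Max (rt ` {..<n})" by (intro Max_ge) auto
    ultimately have "t < Max (rt ` {..<n})" by linarith
    thus "\<gamma> \<in> {..<Max (rt ` {..<n})} \<times> {..<n}" using \<open>\<gamma> = (t, i)\<close> \<open>i < n\<close> by simp
  qed
qed simp

lemma tau_simps: "ta (Suc t, i) = (t, i)" "i < n \<Longrightarrow> ta (0, i) = (rt i - 1, vx i)"
  by (simp_all add: tau_def star_eq rmax_eq vx_involution)

lemma tau_Pi: "\<gamma> \<in> I \<Longrightarrow> ta \<gamma> \<in> I"
proof (cases \<gamma>)
  case (Pair t i)
  assume "\<gamma> \<in> I"
  thus ?thesis using Pair rt_pos[of i] vx_involution[of i]
    by (cases t) (auto simp: Pi_iff tau_simps)
qed

lemma sl_range: "\<gamma> \<in> I \<Longrightarrow> sl \<gamma> \<notin> range nx"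
proof (cases \<gamma>)
  case (Pair t i)
  assume "\<gamma> \<in> I"
  thus ?thesis using Pair nx_range[of i t] by (simp add: sl_def Pi_iff)
qed

lemma sl_inj: "snd \<gamma> < n \<Longrightarrow> snd \<gamma>' < n \<Longrightarrow> sl \<gamma> = sl \<gamma>' \<Longrightarrow> \<gamma> = \<gamma>'"
proof -
  assume *: "snd \<gamma> < n" "snd \<gamma>' < n" "sl \<gamma> = sl \<gamma>'"
  have "kk (sl \<gamma>) = snd \<gamma>" if "snd \<gamma> < n" for \<gamma> using slot(3)[OF that, of 0] by (simp add: sl_def)
  hence 1: "snd \<gamma> = snd \<gamma>'" using * by metis
  hence "n * fst \<gamma> = n * fst \<gamma>'" using *(3) by (simp add: sl_def)
  thus "\<gamma> = \<gamma>'" using 1 n_pos by (simp add: prod_eq_iff)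
qed

lemma X_sl_inj: "inj_on (\<lambda>\<gamma>. X (sl \<gamma>)) I"
proof (rule inj_onI)
  fix \<gamma> \<gamma>' assume *: "\<gamma> \<in> I" "\<gamma>' \<in> I" "X (sl \<gamma>) = X (sl \<gamma>')"
  have False if "sl \<gamma> < sl \<gamma>'" "\<gamma>' \<in> I" "X (sl \<gamma>) = X (sl \<gamma>')" for \<gamma> \<gamma>'
    using nx_surj[OF that(1)] that(3) sl_range[OF that(2)] by (metis rangeI)
  hence "sl \<gamma> = sl \<gamma>'" using * by (metis linorder_neqE_nat)
  thus "\<gamma> = \<gamma>'" using sl_inj * Pi_snd by blast
qed

lemma X_rep: "\<exists>\<gamma>\<in>I. X q = X (sl \<gamma>) \<and> sl \<gamma> \<le> q"
proof (induction q rule: less_induct)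
  case (less q)
  show ?case
  proof (cases "q \<in> range nx")
    case True
    then obtain q1 where q1: "q = nx q1" by auto
    then obtain \<gamma> where "\<gamma> \<in> I" "X q1 = X (sl \<gamma>)" "sl \<gamma> \<le> q1" using less.IH[of q1] nx(1)[of q1] by auto
    thus ?thesis using q1 nx(1,2)[of q1] by (intro bexI[of _ \<gamma>]) auto
  next
    case False
    define \<gamma> where "\<gamma> = (q div n, kk q)"
    have q: "sl \<gamma> = q" using slot_kk[of 0 "q mod n"] n_pos by (simp add: \<gamma>_def sl_def kk_def)
    hence "\<gamma> \<in> I" using False nx_range[of "kk q" "q div n"] by (simp add: \<gamma>_def sl_def Pi_iff)
    thus ?thesis using q by auto
  qed
qed

text \<open>For \<open>\<gamma> = (0, i)\<close> the index \<open>ta \<gamma>\<close> lies one sweep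
  before the return of \<open>x\<^sub>i\<close> at the vertex \<open>vx i\<close>. So on cluster
  variables \<open>ta\<close> undoes a shift by one sweep.\<close>

lemma X_tau: "\<gamma> \<in> I \<Longrightarrow> X (sl (ta \<gamma>) + n) = X (sl \<gamma>)"
proof (cases \<gamma>)
  case (Pair t i)
  assume "\<gamma> \<in> I"
  hence i: "i < n" using Pi_snd Pair by fastforce
  show ?thesis
  proof (cases t)
    case 0
    have "sl (ta \<gamma>) + n = slot 0 (vx i) + n * rt i"
      using rt_pos[OF i] i by (cases "rt i") (simp_all add: Pair 0 tau_simps sl_def)
    thus ?thesis using nx(2)[of "slot 0 i"] nx_slot[OF i] by (simp add: Pair 0 sl_def)
  next
    case (Suc s)
    have "sl (ta \<gamma>) + n = sl \<gamma>" by (simp add: Pair Suc tau_simps sl_def)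
    thus ?thesis by simp
  qed
qed

lemma tau_bij: "bij_betw ta I I"
proof -
  have "inj_on ta I"
  proof (rule inj_onI)
    fix \<gamma> \<gamma>' assume *: "\<gamma> \<in> I" "\<gamma>' \<in> I" "ta \<gamma> = ta \<gamma>'"
    hence "X (sl \<gamma>) = X (sl \<gamma>')" using X_tau by metis
    thus "\<gamma> = \<gamma>'" using inj_onD[OF X_sl_inj] * by blast
  qed
  moreover from this have "ta ` I = I" using tau_Pi finite_Pi by (intro endo_inj_surj) auto
  ultimately show ?thesis by (simp add: bij_betw_def)
qed

lemma tau_induct [consumes 1, case_names initial step]:
  assumes "\<gamma> \<in> I" and "\<And>i. i < n \<Longrightarrow> P (0, i)" and "\<And>\<gamma>. \<gamma> \<in> I \<Longrightarrow> P (ta \<gamma>) \<Longrightarrow> P \<gamma>"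
  shows "P \<gamma>"
proof -
  have "(t, i) \<in> I \<Longrightarrow> P (t, i)" for t i
  proof (induction t)
    case (Suc t)
    thus ?case using assms(3)[of "(Suc t, i)"] by (simp add: tau_simps Pi_iff)
  qed (use assms(2) in \<open>simp add: Pi_iff\<close>)
  thus ?thesis using assms(1) by (cases \<gamma>) auto
qed

text \<open>\<open>ta\<close> moves every first argument to some \<open>(0, i)\<close>, where the
  value is prescribed.\<close>

lemma compat_eq:
  assumes c: "is_compatibility_degree n B c" shows "compat n B = c"
  unfolding compat_def
proof (rule the_equality[of "is_compatibility_degree n B", OF c])
  fix c' assume c': "is_compatibility_degree n B c'"
  have "c' \<omega> \<gamma> = c \<omega> \<gamma>" if "\<omega> \<in> I" "\<gamma> \<in> I" for \<omega> \<gamma>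
    using that
  proof (induction \<omega> arbitrary: \<gamma> rule: tau_induct)
    case (initial i)
    hence "int (c' (0, i) \<gamma>) = int (c (0, i) \<gamma>)" using c c' by (simp add: is_compatibility_degree_def)
    thus ?case by simp
  next
    case (step \<omega>)
    thus ?case using c c' unfolding is_compatibility_degree_def by metis
  qed
  thus "c' = c" using c c' unfolding is_compatibility_degree_def by (intro ext) metis
qed

lemma denom_xvar:
  assumes "\<gamma> \<in> I" "l < n"
  shows "denom_exp l (laurent_expansion (xvar n n B \<gamma>)) = V l (sl \<gamma>)"
  using Pi_snd[OF assms(1)] pole_set_ones[OF assms(2)] by (simp add: xvar_free)

end


text \<open>The matrix of leading exponents is block triangular: the identity on \<open>S\<close>,
  and a diagonal of signs outside \<open>S\<close>.\<close>

lemma lm_indep_triangular: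
  assumes nz: "\<And>i. x i \<noteq> 0"
    and S: "\<And>i. i \<in> S \<Longrightarrow> \<exists>w. lm (x i) = frag_of i + w \<and> (\<forall>j\<in>S. lookup w j = 0)"
    and nS: "\<And>i. i \<notin> S \<Longrightarrow> lm (x i) = frag_of i \<or> lm (x i) = - frag_of i"
  shows "lm_indep x"
proof -
  let ?f = "\<lambda>i. lm (x i)"
  have l: "lookup (frag_extend ?f m) i = (\<Sum>j\<in>keys m. lookup m j * lookup (?f j) i)" for m i
    by (simp add: frag_extend_def lookup_sum)
  have ker: "m = 0" if m: "frag_extend ?f m = 0" for m
  proof -
    have 1: "lookup m i = 0" if i: "i \<in> S" for i
    proof -
      have "lookup (?f j) i = (if j = i then 1 else 0)" for j
      proof (cases "j \<in> S")
        case True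
        thus ?thesis using S[OF True] i by auto
      next
        case False
        thus ?thesis using nS[OF False] i by auto
      qed
      hence "lookup (frag_extend ?f m) i = (\<Sum>j\<in>keys m. if j = i then lookup m i else 0)"
        unfolding l by (intro sum.cong) auto
      thus ?thesis using m by (cases "lookup m i = 0") (auto simp: in_keys_iff)
    qed
    have 2: "lookup m i = 0" if i: "i \<notin> S" for i
    proof -
      obtain e where e: "?f i = frag_cmul e (frag_of i)" "e \<noteq> 0"
        using nS[OF i] by (metis frag_cmul_minus_one frag_cmul_one zero_neq_one zero_neq_neg_one)
      have "lookup m j * lookup (?f j) i = (if j = i then lookup m i * e else 0)"
        if "j \<in> keys m" for j
      proof -
        have "j \<notin> S" using 1[of j] that by auto
        thus ?thesis using nS[of j] e by auto
      qed
      hence "lookup (frag_extend ?f m) i = (\<Sum>j\<in>keys m. if j = i then lookup m i * e else 0)"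
        unfolding l by (intro sum.cong) auto
      thus ?thesis using m e by (auto simp: in_keys_iff split: if_splits)
    qed
    show ?thesis using 1 2 by (intro poly_mapping_eqI) (metis lookup_zero)
  qed
  have "inj (frag_extend ?f)"
  proof (rule injI)
    fix m m' assume "frag_extend ?f m = frag_extend ?f m'"
    hence "frag_extend ?f (m - m') = 0" by (simp add: frag_extend_diff)
    thus "m = m'" using ker by fastforce
  qed
  thus ?thesis using nz by (simp add: lm_indep_def)
qed

lemma lm_add: "rpos f \<Longrightarrow> rpos g \<Longrightarrow> lm (f + g) = max (lm f) (lm g)"
  unfolding lm_def by (rule rpos_add_rdeg(2)[OF _ _ weight_id])

subsection \<open>The variables \<open>yhat\<close>\<close>

definition yhat :: "nat \<Rightarrow> seed \<Rightarrow> nat \<Rightarrow> ratfun" where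
  "yhat N s j = (\<Prod>i<N. fst s i powi snd s i j)"

lemma power_int_pos_neg: "(f::'a::field) \<noteq> 0 \<Longrightarrow> f powi e = f ^ nat e / f ^ nat (- e)"
  by (cases "e \<ge> 0") (auto simp: power_int_def divide_inverse power_inverse)

lemma yhat_quotient: "(\<And>i. x i \<noteq> 0) \<Longrightarrow> yhat N (x, b) j = mon_pos N x b j / mon_neg N x b j"
  by (simp add: yhat_def mon_pos_def mon_neg_def power_int_pos_neg prod_dividef)

lemma prod_powi: "(\<Prod>i\<in>S. f i) powi e = (\<Prod>i\<in>S. (f i :: 'a::field) powi e)"
  by (induction S rule: infinite_finite_induct) (simp_all add: power_int_mult_distrib)

text \<open>The cluster variables drop out of the rule, so the \<open>yhat\<close> mutate like
  variables of their own. The second case is the one that occurs at a source \<open>k\<close>, where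
  all \<open>b k j\<close> are non-negative.\<close>

lemma yhat_mutate:
  assumes x: "\<And>i. rpos (x i)" and k: "k < N" "b k k = 0"
  shows "yhat N (mutate N k (x, b)) k = inverse (yhat N (x, b) k)"
    "b k j \<ge> 0 \<Longrightarrow> j \<noteq> k \<Longrightarrow> yhat N (mutate N k (x, b)) j =
      yhat N (x, b) j * (yhat N (x, b) k / (1 + yhat N (x, b) k)) ^ nat (b k j)"
proof -
  have nz: "x i \<noteq> 0" for i by (rule rpos_nonzero[OF x])
  define P where "P = mon_pos N x b k"
  define R where "R = mon_neg N x b k"
  have PR: "rpos P" "rpos R" using x by (auto simp: P_def R_def mon_pos_def mon_neg_def intro!: rpos_prod rpos_power)
  have pr: "P \<noteq> 0" "R \<noteq> 0" "P + R \<noteq> 0" using PR rpos_add[OF PR] by (auto dest: rpos_nonzero)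
  have Yk: "yhat N (x, b) k = P / R" by (simp add: yhat_quotient nz P_def R_def)
  define z where "z = (P + R) / x k"
  have z: "z \<noteq> 0" using pr nz by (simp add: z_def)
  have fst: "fst (mutate N k (x, b)) = x(k := z)" "snd (mutate N k (x, b)) = mutate_matrix k b"
    by (simp_all add: mutate_eq z_def P_def R_def)
  have split: "(\<Prod>i<N. g i) = g k * (\<Prod>i\<in>{..<N} - {k}. g i)" for g :: "nat \<Rightarrow> ratfun"
    using k(1) by (intro prod.remove) auto
  have "yhat N (mutate N k (x, b)) k = (\<Prod>i\<in>{..<N} - {k}. x i powi (- b i k))"
    unfolding yhat_def fst by (subst split) (use k(2) in \<open>simp add: mutate_matrix_def\<close>)
  also have "\<dots> = inverse (yhat N (x, b) k)"
    unfolding yhat_def by (subst split)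
      (simp add: k(2) power_int_minus flip: prod_inversef)
  finally show "yhat N (mutate N k (x, b)) k = inverse (yhat N (x, b) k)" .
  assume j: "b k j \<ge> 0" "j \<noteq> k"
  define c where "c = b k j"
  have P': "(\<Prod>i\<in>{..<N} - {k}. x i powi pos (b i k)) = P"
  proof -
    have "nat (pos e) = nat e" for e by (cases "e \<ge> 0") auto
    thus ?thesis unfolding P_def mon_pos_def by (subst split) (simp add: k(2) power_int_def)
  qed
  have bj: "mutate_matrix k b k j = - c" "\<And>i. i \<noteq> k \<Longrightarrow> mutate_matrix k b i j = b i j + pos (b i k) * c"
    using j by (simp_all add: mutate_matrix_alt c_def) (simp add: mutate_matrix_def)
  have "yhat N (mutate N k (x, b)) j = z powi (- c) * (\<Prod>i\<in>{..<N} - {k}. x i powi (b i j + pos (b i k) * c))"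
    unfolding yhat_def fst by (subst split) (auto simp: bj)
  also have "(\<Prod>i\<in>{..<N} - {k}. x i powi (b i j + pos (b i k) * c)) =
      (\<Prod>i\<in>{..<N} - {k}. x i powi b i j) * P powi c"
    unfolding P'[symmetric] prod_powi prod.distrib[symmetric]
    by (intro prod.cong refl) (simp add: power_int_add nz power_int_mult)
  also have "(\<Prod>i\<in>{..<N} - {k}. x i powi b i j) = yhat N (x, b) j / x k powi c"
    unfolding yhat_def by (subst split) (simp add: nz c_def)
  finally have "yhat N (mutate N k (x, b)) j = yhat N (x, b) j * (P powi c / (x k powi c * z powi c))"
    by (simp add: power_int_minus divide_inverse)
  also have "P powi c / (x k powi c * z powi c) = (P / (P + R)) powi c"
    by (simp add: z_def power_int_divide_distrib nz)
  also have "P / (P + R) = yhat N (x, b) k / (1 + yhat N (x, b) k)"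
    using pr by (simp add: Yk field_simps)
  finally show "yhat N (mutate N k (x, b)) j =
      yhat N (x, b) j * (yhat N (x, b) k / (1 + yhat N (x, b) k)) ^ nat (b k j)"
    using j(1) by (simp add: c_def power_int_def)
qed

context dynkin
begin

text \<open>The mutation of \<open>y\<close>-variables at a source\<close>

definition mu_var :: "nat \<Rightarrow> nat \<Rightarrow> ratfun" where
  "mu_var k i = (if n \<le> i \<and> i < 2 * n then
     if i = n + k then inverse (rvar i)
     else rvar i * (rvar (n + k) / (1 + rvar (n + k))) ^ nat (- a k (i - n))
   else rvar i)"

definition mu :: "nat \<Rightarrow> ratfun \<Rightarrow> ratfun" where "mu k = fhom (mu_var k)"

lemma lm_indep_mu_var: "lm_indep (mu_var k)"
proof (rule lm_indep_triangular[of _ "- {n + k}"])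
  have "rpos (1 + rvar (n + k))" by (intro rpos_add rpos_1 rpos_rvar)
  hence nz: "1 + rvar (n + k) \<noteq> 0" by (rule rpos_nonzero)
  thus "mu_var k i \<noteq> 0" for i by (simp add: mu_var_def)
  have "lm (rvar (n + k) / (1 + rvar (n + k))) = frag_of (n + k) - max 0 (frag_of (n + k))"
    using nz by (simp add: lm_divide lm_add lm_1 lm_rvar)
  then obtain e where e: "lm (rvar (n + k) / (1 + rvar (n + k))) = frag_cmul e (frag_of (n + k))"
    by (metis cancel_comm_monoid_add_class.diff_cancel diff_zero frag_cmul_one frag_cmul_zero max_def)
  show "\<exists>w. lm (mu_var k i) = frag_of i + w \<and> (\<forall>j\<in>- {n + k}. lookup w j = 0)" if "i \<in> - {n + k}" for i
  proof (cases "n \<le> i \<and> i < 2 * n")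
    case True
    define c where "c = nat (- a k (i - n))"
    have "lm ((rvar (n + k) / (1 + rvar (n + k))) ^ c) = frag_cmul (int c * e) (frag_of (n + k))"
      using lm_powi[of "rvar (n + k) / (1 + rvar (n + k))" "int c"] nz by (simp add: e)
    moreover have "mu_var k i = rvar i * (rvar (n + k) / (1 + rvar (n + k))) ^ c"
      using True that by (simp add: mu_var_def c_def)
    ultimately have "lm (mu_var k i) = frag_of i + frag_cmul (int c * e) (frag_of (n + k))"
      using nz by (simp add: lm_mult lm_rvar)
    thus ?thesis by (intro exI[of _ "frag_cmul (int c * e) (frag_of (n + k))"])
        auto
  next
    case False
    hence "mu_var k i = rvar i" by (auto simp: mu_var_def)
    thus ?thesis by (intro exI[of _ 0]) (simp add: lm_rvar)
  qed
  show "lm (mu_var k i) = frag_of i \<or> lm (mu_var k i) = - frag_of i" if "i \<notin> - {n + k}" for i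
    using that by (auto simp: mu_var_def lm_rvar lm_inverse)
qed

lemma field_hom_mu: "field_hom (mu k)"
  unfolding mu_def by (rule field_hom_fhom[OF lm_indep_mu_var])

lemma mu_y:
  "k < n \<Longrightarrow> mu k (rvar (n + k)) = inverse (rvar (n + k))"
  "j < n \<Longrightarrow> j \<noteq> k \<Longrightarrow> mu k (rvar (n + j)) = rvar (n + j) * (rvar (n + k) / (1 + rvar (n + k))) ^ nat (- a k j)"
  by (simp_all add: mu_def fhom_rvar[OF lm_indep_mu_var] mu_var_def)

text \<open>\<open>M p\<close> expresses the \<open>y\<close> variables after \<open>p\<close> steps
  in terms of the initial ones; hence the latest rule is applied first. As \<open>kk\<close> has
  period \<open>n\<close>, composing with \<open>M n\<close> is a shift by one sweep.\<close>

primrec M :: "nat \<Rightarrow> ratfun \<Rightarrow> ratfun" where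
  "M 0 f = f"
| "M (Suc p) f = M p (mu (kk p) f)"

lemma field_hom_M: "field_hom (M p)"
proof (induction p)
  case 0
  thus ?case by (simp add: field_hom_def)
next
  case (Suc p)
  from field_hom_comp[OF this field_hom_mu] show ?case by (simp add: comp_def)
qed

lemma M_add: "M (n + p) f = M n (M p f)"
proof (induction p arbitrary: f)
  case (Suc p)
  thus ?case by simp
qed simp

text \<open>A homomorphism that computes the \<open>yhat\<close> of the first seed computes those of
  all later seeds. The \<open>x i\<close> are arbitrary because the case of initial variables 1 and
  the generic case are both needed.\<close>

lemma M_yhat:
  assumes g: "field_hom g" and x: "\<And>i. rpos (x i)"
    and init: "\<And>j. j < n \<Longrightarrow> g (rvar (n + j)) = yhat (2 * n) (x, B_prin) j" and j: "j < n"
  shows "g (M p (rvar (n + j))) = yhat (2 * n) (seed_at (2 * n) (x, B_prin) 0 p) j"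
  using j
proof (induction p arbitrary: j)
  case (Suc p)
  obtain z b where zb: "seed_at (2 * n) (x, B_prin) 0 p = (z, b)" by fastforce
  have z: "rpos (z i)" for i
    using rpos_mutates[of "(x, B_prin)"] x zb by (metis fst_conv seed_at_def)
  have b: "top_block p b" using seed_at_block[of 0 "(x, B_prin)" p "2 * n"] top zb by simp
  note sg = top_block_signs[OF b] and dg = top_block_diag[OF b]
  have hM: "field_hom (\<lambda>f. g (M p f))"
    using field_hom_comp[OF g field_hom_M] by (simp add: comp_def)
  have IH: "g (M p (rvar (n + j))) = yhat (2 * n) (z, b) j" if "j < n" for j using Suc.IH[OF that] zb by simp
  have kn: "kk p < 2 * n" using kk_less[of p] by linarith
  have st: "seed_at (2 * n) (x, B_prin) 0 (Suc p) = mutate (2 * n) (kk p) (z, b)" by (simp add: seed_at_Suc zb)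
  note ym = yhat_mutate[of z "kk p" "2 * n" b, OF z kn dg]
  show ?case
  proof (cases "j = kk p")
    case True
    thus ?thesis unfolding st
      by (simp add: ym(1) mu_y field_hom_inverse[OF field_hom_M] field_hom_inverse[OF g] IH)
  next
    case False
    have "nat (b (kk p) j) = nat (- a (kk p) j)" using sg(4)[OF Suc.prems False] by simp
    thus ?thesis unfolding st using ym(2)[OF sg(2)[OF Suc.prems] False] False Suc.prems
      by (simp add: mu_y field_homD[OF hM] field_hom_power[OF hM] field_hom_divide[OF hM] IH)
  qed
qed (use init in simp)

text \<open>For \<open>q = sl \<gamma>\<close> this is the image of the coordinate
  \<open>u\<^sub>\<gamma>\<close> of the configuration space.\<close>

definition U :: "nat \<Rightarrow> ratfun" where "U q = M q (inverse (1 + rvar (n + kk q)))"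

definition F :: "nat \<Rightarrow> ratfun" where "F q = var (2 * n) (one_on {..<n}, B_prin) 0 q"

text \<open>\<open>yhat\<close> at \<open>kk q\<close> is the quotient \<open>P / R\<close> of the
  two monomials of the exchange relation, so \<open>1 - g (U q)\<close> and \<open>g (U q)\<close>
  are the shares of \<open>P\<close> and \<open>R\<close> in their sum.\<close>

lemma U_general:
  assumes g: "field_hom g" and x: "\<And>i. rpos (x i)" and fr: "\<And>i. i \<ge> n \<Longrightarrow> x i = rvar i"
    and init: "\<And>j. j < n \<Longrightarrow> g (rvar (n + j)) = yhat (2 * n) (x, B_prin) j"
  defines "Z \<equiv> var (2 * n) (x, B_prin) 0"
  shows "g (U q) * (Z q * Z (q + n)) = Q q rvar * nbprod q Z"
    "(1 - g (U q)) * (Z q * Z (q + n)) = A q rvar"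
proof -
  obtain z b where zb: "seed_at (2 * n) (x, B_prin) 0 q = (z, b)" by fastforce
  have z: "rpos (z i)" for i
    using rpos_mutates[of "(x, B_prin)"] x zb by (metis fst_conv seed_at_def)
  have b: "top_block q b" using seed_at_block[of 0 "(x, B_prin)" q "2 * n"] top zb by simp
  have fz: "z i = rvar i" if "i \<ge> n" for i using seed_at_frozen[OF that, of "2 * n" "(x, B_prin)" 0 q] zb fr[OF that] by simp
  have bb: "b = snd (sd q)" using snd_seed_at[of x q] zb by simp
  define P where "P = mon_pos (2 * n) z b (kk q)"
  define R where "R = mon_neg (2 * n) z b (kk q)"
  have P: "P = A q rvar" unfolding P_def prod_rows(1)[OF b nN] unfolding A_def bb by (intro prod.cong) (auto simp: fz)
  have "(\<Prod>j\<in>{..<n} - {kk q}. z j ^ nat (- a j (kk q))) = nbprod q Z"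
    using seed_at_slot[of 0 q _ "2 * n" "(x, B_prin)"] zb by (intro prod.cong) (auto simp: Z_def)
  hence R: "R = Q q rvar * nbprod q Z"
  proof -
    assume e: "(\<Prod>j\<in>{..<n} - {kk q}. z j ^ nat (- a j (kk q))) = nbprod q Z"
    have "(\<Prod>i\<in>{n..<2 * n}. z i ^ nat (- b i (kk q))) = Q q rvar"
      unfolding Q_def bb by (intro prod.cong) (auto simp: fz)
    thus ?thesis unfolding R_def prod_rows(2)[OF b nN] e by simp
  qed
  have rPR: "rpos P" "rpos R" using z by (auto simp: P_def R_def mon_pos_def mon_neg_def intro!: rpos_prod rpos_power)
  have pr: "R \<noteq> 0" "P + R \<noteq> 0" using rPR(2) rpos_add[OF rPR] by (auto dest: rpos_nonzero)
  have "g (M q (rvar (n + kk q))) = P / R"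
    using M_yhat[OF g x init, of "kk q" q] zb rpos_nonzero[OF z] by (simp add: yhat_quotient P_def R_def)
  hence "g (U q) = inverse (1 + P / R)"
    unfolding U_def
    by (simp add: field_hom_inverse[OF field_hom_M] field_homD[OF field_hom_M] field_hom_inverse[OF g] field_homD[OF g])
  hence gU: "g (U q) = R / (P + R)" using pr by (simp add: field_simps)
  have ZZ: "Z q * Z (q + n) = P + R" unfolding Z_def P R var_mesh'[of x q, OF x]
    by (auto simp: A_def Q_def fr intro!: arg_cong2[of _ _ _ _ "(*)"] prod.cong)
  show "g (U q) * (Z q * Z (q + n)) = Q q rvar * nbprod q Z"
    using pr unfolding ZZ gU R[symmetric] by simp
  show "(1 - g (U q)) * (Z q * Z (q + n)) = A q rvar"
    using pr unfolding ZZ gU P[symmetric] by (simp add: field_simps)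
qed

lemma prin_frozen: "n \<le> i \<Longrightarrow> i < 2 * n \<Longrightarrow> j < n \<Longrightarrow> B_prin i j = (if i = n + j then 1 else 0)"
  by (simp add: principal_ext_def)

lemma U_F:
  "U q * (F q * F (q + n)) = Q q rvar * nbprod q F"
  "(1 - U q) * (F q * F (q + n)) = A q rvar"
proof -
  have "yhat (2 * n) (one_on {..<n}, B_prin) j = rvar (n + j)" if "j < n" for j
  proof -
    have "yhat (2 * n) (one_on {..<n}, B_prin) j = (\<Prod>i<2 * n. if i = n + j then rvar (n + j) else 1)"
      unfolding yhat_def by (intro prod.cong) (auto simp: prin_frozen[OF _ _ that])
    thus ?thesis using that by simp
  qed
  thus "U q * (F q * F (q + n)) = Q q rvar * nbprod q F"
    "(1 - U q) * (F q * F (q + n)) = A q rvar"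
    using U_general[of "\<lambda>f. f" "one_on {..<n}", OF _ rpos_one_on] unfolding F_def by (simp_all add: field_hom_def)
qed

lemma U_shift: "M n (U q) = U (q + n)"
  using M_add[of q] by (simp add: U_def add.commute)

lemma rpos_F: "rpos (F q)"
  unfolding F_def var_def seed_at_def by (intro rpos_mutates) simp

lemma F_nonzero [simp]: "F q \<noteq> 0"
  by (rule rpos_nonzero[OF rpos_F])

lemma F_L: "F q = to_ratfun (set_ones {..<n} (L q))"
  by (simp only: F_def set_ones_L)

lemma F_X: "X q = X q' \<Longrightarrow> F q = F q'"
  by (simp add: F_L L_def)

lemma F_initial: "q < n \<Longrightarrow> F q = 1"
  by (simp add: F_def var_window)

subsection \<open>Sign coherence\<close>

text \<open>A step adds to the neighbours a multiple of the positive part of the entry at the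
  mutated source. This entry is \<open>V l (p + n)\<close>: by \<open>V_window\<close> a negative
  \<open>V l\<close> in a window stands among zeros, so the sum of positive parts is the positive
  part of the sum.\<close>

lemma c_vector:
  assumes l: "l < n"
  shows "p \<le> q \<Longrightarrow> q < p + n \<Longrightarrow> snd (sd p) (n + l) (kk q) =
    - V l q + (\<Sum>s\<in>{q<..<p + n}. - a (kk s) (kk q) * pos (V l s))"
proof (induction p arbitrary: q)
  case 0
  have "(\<Sum>s\<in>{q<..<n}. - a (kk s) (kk q) * pos (V l s)) = 0"
    by (intro sum.neutral) (auto simp: V_initial[OF l])
  moreover have "kk q = l \<longleftrightarrow> q = slot 0 l" using 0 slot[OF l, of 0] by auto
  ultimately show ?case using 0 V_initial[OF l, of q] prin_frozen[of "n + l" "kk q"] l by auto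
next
  case (Suc p)
  let ?k = "kk p" and ?b = "snd (sd p)"
  note sg = top_block_signs[OF top_sd[of p]]
  have st: "snd (sd (Suc p)) = mutate_matrix ?k ?b" by (simp add: seed_at_Suc snd_mutate)
  have k: "?b (n + l) ?k = V l (p + n)"
  proof -
    have "?b (n + l) ?k = - V l p + nbsum p (\<lambda>s. pos (V l s))"
      using Suc.IH[of p] n_pos by simp
    moreover have "nbsum p (\<lambda>s. pos (V l s)) =
        max 0 (nbsum p (V l))"
    proof (cases "\<exists>s\<in>{p<..<p + n}. V l s < 0")
      case True
      then obtain s0 where s0: "s0 \<in> {p<..<p + n}" "V l s0 < 0" by auto
      have V0: "V l s = 0" if "s \<in> {p<..<p + n}" "s \<noteq> s0" for s
        using V_window[OF l s0(2) that(2)] that(1) s0(1) by auto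
      have "nbsum p (V l) = (\<Sum>s\<in>{s0}. - a (kk s) (kk p) * V l s)"
        using s0(1) V0 by (intro sum.mono_neutral_right) auto
      moreover have "kk s0 \<noteq> kk p" using inj_onD[OF kk_inj[of p], of s0 p] s0 by auto
      hence "- a (kk s0) (kk p) * V l s0 \<le> 0" using s0(2) offdiag by (simp add: mult_nonpos_nonpos)
      moreover have "nbsum p (\<lambda>s. pos (V l s)) = 0"
      using V0 s0(2) by (intro sum.neutral ballI) force+
      ultimately show ?thesis by simp
    next
      case False
      hence "nbsum p (\<lambda>s. pos (V l s)) = nbsum p (V l)"
        by (intro sum.cong) (auto simp: not_less)
      thus ?thesis using nonneg_sum[of p "V l"] False by (simp add: not_less)
    qed
    ultimately show ?thesis using trop_meshD[OF V_mesh[OF l], of p] by simp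
  qed
  show ?case
  proof (cases "q = p + n")
    case True
    thus ?thesis using k by (simp add: st mutate_matrix_def)
  next
    case False
    hence q: "p < q" "q < p + n" using Suc.prems by auto
    have kq: "kk q \<noteq> kk p" using inj_onD[OF kk_inj[of p], of q p] q by auto
    have ln: "n + l \<noteq> ?k" using kk_less[of p] by linarith
    have b: "?b ?k (kk q) = - a ?k (kk q)" "?b ?k (kk q) \<ge> 0" using sg(4)[of "kk q"] sg(2)[of "kk q"] kq by simp_all
    have "snd (sd (Suc p)) (n + l) (kk q) = ?b (n + l) (kk q) - a ?k (kk q) * pos (V l (p + n))"
      unfolding st mutate_matrix_alt[OF ln kq] k using b by simp
    moreover have "{q<..<Suc p + n} = insert (p + n) {q<..<p + n}" using q by auto
    ultimately show ?thesis using Suc.IH[of q] q by simp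
  qed
qed

lemma c_vector': "l < n \<Longrightarrow> snd (sd q) (n + l) (kk q) = V l (q + n)"
proof -
  assume l: "l < n"
  have "snd (sd (Suc q)) (n + l) (kk (q + n)) = - V l (q + n)" using c_vector[OF l, of "Suc q" "q + n"] n_pos by simp
  thus ?thesis by (simp add: seed_at_Suc snd_mutate mutate_matrix_def)
qed

lemma A_Q: "A q x = (\<Prod>l<n. x (n + l) ^ nat (V l (q + n)))" "Q q x = (\<Prod>l<n. x (n + l) ^ nat (- V l (q + n)))"
proof -
  have *: "(\<Prod>i\<in>{n..<2 * n}. f i) = (\<Prod>l<n. f (n + l))" for f :: "nat \<Rightarrow> 'x::comm_monoid_mult"
    by (rule prod.reindex_bij_witness[of _ "\<lambda>l. n + l" "\<lambda>i. i - n"]) auto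
  show "A q x = (\<Prod>l<n. x (n + l) ^ nat (V l (q + n)))" "Q q x = (\<Prod>l<n. x (n + l) ^ nat (- V l (q + n)))"
    unfolding A_def Q_def * by (auto simp: c_vector')
qed

end


lemma pole_prod_rvar: "pole k (\<Prod>l<n. rvar (n + l) ^ e l) = (if n \<le> k \<and> k < 2 * n then - int (e (k - n)) else 0)"
proof -
  have "pole k (\<Prod>l<n. rvar (n + l) ^ e l) = (\<Sum>l<n. if n + l = k then - int (e l) else 0)"
    by (subst pole_prod) (auto simp: pole_power intro!: sum.cong)
  also have "\<dots> = (if n \<le> k \<and> k < 2 * n then - int (e (k - n)) else 0)"
  proof (cases "n \<le> k")
    case True
    hence "(n + l = k) = (l = k - n)" for l by auto
    thus ?thesis using True by auto
  qed (auto intro!: sum.neutral)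
  finally show ?thesis .
qed

context dynkin
begin

lemma pole_A: "l < n \<Longrightarrow> pole (n + l) (A q rvar) = - int (nat (V l (q + n)))"
  by (simp only: A_Q pole_prod_rvar) simp

lemma pole_Q: "l < n \<Longrightarrow> pole (n + l) (Q q rvar) = - int (nat (- V l (q + n)))"
  by (simp only: A_Q pole_prod_rvar) simp

lemma rpos_A_Q: "rpos (A q rvar)" "rpos (Q q rvar)"
  unfolding A_def Q_def by (auto intro!: rpos_prod rpos_power)

lemma F_mesh: "F q * F (q + n) = A q rvar + Q q rvar * nbprod q F"
  using U_F[of q] by (simp add: algebra_simps)

text \<open>Of the exponents of \<open>y\<^sub>l\<close> in \<open>A\<close> and \<open>Q\<close>,
  the positive and the negative part of one integer, at least one is 0; so the sum of the two
  monomials has order 0.\<close>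

lemma pole_F:
  assumes l: "l < n" shows "pole (n + l) (F q) = 0"
proof (induction q rule: mesh_induct)
  case (step r)
  let ?P = "nbprod r F"
  have "pole (n + l) ?P = 0"
    using step(2) by (subst pole_prod) (auto simp: pole_power)
  moreover have P: "rpos ?P" by (intro rpos_prod rpos_power rpos_F)
  ultimately have "pole (n + l) (F r * F (r + n)) = max (- int (nat (V l (r + n)))) (- int (nat (- V l (r + n))))"
    using pole_A[OF l, of r] pole_Q[OF l, of r] rpos_nonzero[OF rpos_A_Q(2)]
    unfolding F_mesh pole_add[OF rpos_A_Q(1) rpos_mult[OF rpos_A_Q(2) P]] by (simp add: pole_mult)
  thus ?case using step(1) by (simp add: pole_mult)
qed (simp add: F_initial pole_1)

lemma A_X: "X q = X q' \<Longrightarrow> A q rvar = A q' rvar"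
  using X_add[of q 1 q'] by (simp only: A_Q) (simp add: V_def)

lemma one_minus_U: "1 - U q = A q rvar / (F q * F (q + n))"
  using U_F(2)[of q] by (simp add: field_simps)

lemma U_X: "X q = X q' \<Longrightarrow> U q = U q'"
proof -
  assume x: "X q = X q'"
  have "F (q + n) = F (q' + n)" using X_add[of q 1 q'] x by (intro F_X) simp
  hence "1 - U q = 1 - U q'" unfolding one_minus_U A_X[OF x] F_X[OF x] by simp
  thus ?thesis by simp
qed

lemma U_nonzero [simp]: "U q \<noteq> 0"
using rpos_nonzero rpos_add by (auto simp: U_def field_hom_eq_0_iff field_hom_M)

lemma one_minus_U_nonzero [simp]: "1 - U q \<noteq> 0"
  using rpos_nonzero[OF rpos_A_Q(1)[of q]] by (simp only: one_minus_U) simp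

lemma pole_one_minus_U: "l < n \<Longrightarrow> pole (n + l) (1 - U q) = - int (nat (V l (q + n)))"
  using rpos_nonzero[OF rpos_A_Q(1)[of q]]
  by (simp only: one_minus_U) (simp add: pole_divide pole_mult pole_A pole_F)

lemma U_eq: "U q = Q q rvar * nbprod q F / (F q * F (q + n))"
  using U_F(1)[of q] by (simp add: field_simps)

lemma pole_U: "l < n \<Longrightarrow> pole (n + l) (U q) = - int (nat (- V l (q + n)))"
proof -
  assume l: "l < n"
  have "pole (n + l) (nbprod q F) = 0"
    using l by (subst pole_prod) (auto simp: pole_power pole_F)
  thus ?thesis using rpos_nonzero[OF rpos_A_Q(2)[of q]] l
    by (simp only: U_eq) (simp add: pole_divide pole_mult pole_Q pole_F)
qed

section \<open>The group of monomials in the \<open>U (sl \<gamma>)\<close>\<close>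

definition MU :: "(nat \<times> nat \<Rightarrow> int) \<Rightarrow> ratfun" where
  "MU e = (\<Prod>\<gamma>\<in>I. U (sl \<gamma>) powi e \<gamma>)"

lemma MU_nonzero [simp]: "MU e \<noteq> 0"
  using finite_Pi by (simp add: MU_def)

lemma MU_add: "MU (\<lambda>\<gamma>. e \<gamma> + e' \<gamma>) = MU e * MU e'"
  by (simp add: MU_def power_int_add prod.distrib)

lemma MU_uminus: "MU (\<lambda>\<gamma>. - e \<gamma>) = inverse (MU e)"
  by (simp add: MU_def power_int_minus prod_inversef[symmetric])

lemma MU_0: "MU (\<lambda>\<gamma>. 0) = 1"
  by (simp add: MU_def)

lemma MU_mult_closed: "f \<in> range MU \<Longrightarrow> g \<in> range MU \<Longrightarrow> f * g \<in> range MU"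
  by (auto simp flip: MU_add)

lemma MU_1_closed: "1 \<in> range MU"
  using MU_0 by (metis rangeI)

lemma MU_inverse_closed: "f \<in> range MU \<Longrightarrow> inverse f \<in> range MU"
  by (auto simp flip: MU_uminus)

lemma MU_divide_closed: "f \<in> range MU \<Longrightarrow> g \<in> range MU \<Longrightarrow> f / g \<in> range MU"
  by (simp add: divide_inverse MU_mult_closed MU_inverse_closed)

lemma MU_power_closed: "f \<in> range MU \<Longrightarrow> f ^ k \<in> range MU"
  by (induction k) (simp_all add: MU_1_closed MU_mult_closed)

lemma MU_prod_closed: "(\<And>i. i \<in> S \<Longrightarrow> f i \<in> range MU) \<Longrightarrow> (\<Prod>i\<in>S. f i) \<in> range MU"
  by (induction S rule: infinite_finite_induct) (simp_all add: MU_1_closed MU_mult_closed)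

lemma U_closed: "U q \<in> range MU"
proof -
  obtain \<gamma> where g: "\<gamma> \<in> I" "X q = X (sl \<gamma>)" using X_rep by blast
  have "MU (\<lambda>\<omega>. if \<omega> = \<gamma> then 1 else 0) = (\<Prod>\<omega>\<in>I. if \<omega> = \<gamma> then U (sl \<omega>) else 1)"
    unfolding MU_def by (intro prod.cong) auto
  also have "\<dots> = U q" using g(1) finite_Pi by (simp add: U_X[OF g(2)])
  finally show ?thesis by (metis rangeI)
qed

lemma V_nonneg:
  assumes l: "l < n" and q: "n \<le> q" "q \<notin> range nx" shows "V l q \<ge> 0"
using X_initial_iff(1)[OF l, of q] X_slot0[OF l] slot(2)[OF l, of 0] q nx_surj[of "slot 0 l" q] by force

text \<open>At a variable that has not occurred before, \<open>V l q \<ge> 0\<close> for all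
  \<open>l\<close>, so \<open>Q\<close> is 1 and the relation for \<open>U\<close> can be solved for
  \<open>F q\<close>. A variable that has occurred before has the same \<open>F\<close> as
  then.\<close>

lemma F_closed: "F q \<in> range MU"
proof (induction q rule: less_induct)
  case (less q)
  consider "q < n" | "q \<in> range nx" | "n \<le> q" "q \<notin> range nx" by force
  thus ?case
  proof cases
    case 1
    thus ?thesis by (simp add: F_initial MU_1_closed)
  next
    case 2
    then obtain q1 where "q = nx q1" by auto
    thus ?thesis using less.IH[of q1] nx(1,2)[of q1] F_X[of q q1] by simp
  next
    case 3
    define r where "r = q - n"
    have r: "q = r + n" using 3 by (simp add: r_def)
    have "Q r rvar = 1" unfolding A_Q using V_nonneg[OF _ 3] by (intro prod.neutral) (simp add: r)
    hence "F q = nbprod r F / (F r * U r)"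
      using U_F(1)[of r] by (simp add: r field_simps)
    moreover have "F (slot r j) \<in> range MU" if "j < n" for j using slot(2)[OF that, of r] by (intro less.IH) (simp add: r)
    ultimately show ?thesis using less.IH[of r] n_pos
      by (auto simp: r intro!: MU_divide_closed MU_prod_closed MU_power_closed MU_mult_closed U_closed)
  qed
qed

lemma Q_nx:
  assumes l: "l < n" and q: "q + n = nx (slot 0 l)" shows "Q q x = x (n + l)" "Q q x = (\<Prod>k<n. x (n + k) ^ nat (- V k (q + n)))"
proof -
  have x: "X (q + n) = rvar l" using nx(2)[of "slot 0 l"] X_slot0[OF l] q by simp
  have "nat (- V k (q + n)) = (if k = l then 1 else 0)" if "k < n" for k
    using x by (simp add: V_def)
  hence "Q q x = (\<Prod>k<n. if k = l then x (n + l) else 1)" unfolding A_Q by (intro prod.cong) auto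
  thus "Q q x = x (n + l)" using l by simp
qed (rule A_Q)

text \<open>When \<open>x\<^sub>l\<close> returns, its \<open>F\<close> is 1 and \<open>Q\<close> is
  \<open>y\<^sub>l\<close> itself, so the relation for \<open>U\<close> can be solved for
  \<open>y\<^sub>l\<close>.\<close>

lemma y_eq:
  assumes l: "l < n" and q: "q + n = nx (slot 0 l)"
  shows "rvar (n + l) = U q * F q / nbprod q F"
using F_X[OF nx(2)[of "slot 0 l"]] F_initial[of "slot 0 l"] slot(2)[OF l, of 0] q U_F(1)[of q] Q_nx(1)[OF l q, of rvar] by auto

lemma y_closed: "l < n \<Longrightarrow> rvar (n + l) \<in> range MU"
proof -
  assume l: "l < n"
  have "nx (slot 0 l) - n + n = nx (slot 0 l)" using nx_ge[of "slot 0 l"] by simp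
  from y_eq[OF l this] show ?thesis
    by (auto intro!: MU_divide_closed MU_prod_closed MU_power_closed MU_mult_closed U_closed F_closed)
qed

lemma U_tau: "\<gamma> \<in> I \<Longrightarrow> U (sl (ta \<gamma>) + n) = U (sl \<gamma>)"
  by (rule U_X[OF X_tau])

lemma M_MU: "M n (MU e) = MU (\<lambda>\<gamma>. e (ta \<gamma>))"
proof -
  have "M n (MU e) = (\<Prod>\<gamma>\<in>I. U (sl \<gamma> + n) powi e \<gamma>)"
    by (simp add: MU_def field_hom_prod[OF field_hom_M] field_hom_powi[OF field_hom_M] U_shift)
  also have "\<dots> = (\<Prod>\<gamma>\<in>I. U (sl (ta \<gamma>) + n) powi e (ta \<gamma>))"
    by (rule prod.reindex_bij_betw[OF tau_bij, symmetric])
  also have "\<dots> = MU (\<lambda>\<gamma>. e (ta \<gamma>))" unfolding MU_def by (intro prod.cong) (simp_all add: U_tau)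
  finally show ?thesis .
qed

lemma V_tau: "\<gamma> \<in> I \<Longrightarrow> V l (sl (ta \<gamma>) + n) = V l (sl \<gamma>)"
  by (simp add: V_def X_tau)

lemma V_initial_Pi:
  assumes "\<gamma> \<in> I" "l < n" shows "nat (- V l (sl \<gamma>)) = (if \<gamma> = (0, l) then 1 else 0)"
using inj_onD[OF X_sl_inj _ assms(1) Pi_0[OF assms(2)]] X_slot0[OF assms(2)] X_initial_iff[OF assms(2), of "sl \<gamma>"] by (fastforce simp: sl_def)

text \<open>\<open>U (sl \<gamma>)\<close> vanishes along \<open>y\<^sub>l\<close> only if
  \<open>X (sl \<gamma> + n)\<close> is \<open>x\<^sub>l\<close>, that is, for
  \<open>\<gamma> = ta (0, l)\<close>.\<close>

lemma pole_MU: "l < n \<Longrightarrow> pole (n + l) (MU e) = - e (ta (0, l))"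
proof -
  assume l: "l < n"
  have "pole (n + l) (MU e) = (\<Sum>\<gamma>\<in>I. e \<gamma> * - int (nat (- V l (sl \<gamma> + n))))"
    unfolding MU_def by (subst pole_prod) (auto simp: pole_powi pole_U[OF l])
  also have "\<dots> = (\<Sum>\<gamma>\<in>I. e (ta \<gamma>) * - int (nat (- V l (sl (ta \<gamma>) + n))))"
    by (rule sum.reindex_bij_betw[OF tau_bij, symmetric])
  also have "\<dots> = (\<Sum>\<gamma>\<in>I. if \<gamma> = (0, l) then - e (ta (0, l)) else 0)"
    by (intro sum.cong refl) (simp add: V_tau V_initial_Pi l)
  finally show ?thesis using finite_Pi Pi_0[OF l] by simp
qed

text \<open>\<open>Z\<close> collects the indices whose exponent vanishes in every relation. Orders
  of poles put \<open>ta (0, l)\<close> into \<open>Z\<close>, and applying \<open>M n\<close> to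
  relations shows that \<open>Z\<close> is stable under \<open>ta\<close>. As \<open>ta\<close>
  permutes a finite set, \<open>Z\<close> is also stable under its inverse, which reaches every
  index.\<close>

lemma MU_eq_1:
  assumes "MU e = 1" "\<gamma> \<in> I" shows "e \<gamma> = 0"
proof -
  define Z where "Z = {\<gamma> \<in> I. \<forall>e. MU e = 1 \<longrightarrow> e \<gamma> = 0}"
  have shift: "MU (\<lambda>\<gamma>. e (ta \<gamma>)) = 1" if "MU e = 1" for e
    using M_MU[of e] that by (simp add: field_homD[OF field_hom_M])
  have Z: "Z \<subseteq> I" "finite Z" using finite_Pi by (auto simp: Z_def)
  have sub: "ta ` Z \<subseteq> Z"
  proof
    fix y assume "y \<in> ta ` Z"
    then obtain \<gamma> where g: "y = ta \<gamma>" "\<gamma> \<in> Z" by auto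
    have "e y = 0" if "MU e = 1" for e using shift[OF that] g by (auto simp: Z_def)
    thus "y \<in> Z" using g tau_Pi by (auto simp: Z_def)
  qed
  have inj: "inj_on ta I" using tau_bij by (simp add: bij_betw_def)
  have img: "ta ` Z = Z" by (rule endo_inj_surj[OF Z(2) sub inj_on_subset[OF inj Z(1)]])
  have pull: "\<gamma> \<in> Z" if g: "\<gamma> \<in> I" "ta \<gamma> \<in> Z" for \<gamma>
  proof -
    obtain z where "z \<in> Z" "ta \<gamma> = ta z" using g(2) img by (metis imageE)
    thus ?thesis using inj_onD[OF inj, of \<gamma> z] g(1) Z(1) by auto
  qed
  have "\<gamma> \<in> Z" using assms(2)
  proof (induction rule: tau_induct)
    case (initial i)
    have "e (ta (0, i)) = 0" if "MU e = 1" for e using pole_MU[OF initial, of e] that by (simp add: pole_1)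
    thus ?case using pull[OF Pi_0[OF initial]] tau_Pi[OF Pi_0[OF initial]] by (auto simp: Z_def)
  next
    case (step \<gamma>)
    thus ?case using pull by blast
  qed
  thus ?thesis using assms(1) by (simp add: Z_def)
qed

lemma MU_inj: "MU e = MU e' \<Longrightarrow> \<gamma> \<in> I \<Longrightarrow> e \<gamma> = e' \<gamma>"
  using MU_eq_1[of "\<lambda>\<gamma>. e \<gamma> + - e' \<gamma>" \<gamma>] by (simp only: MU_add MU_uminus) simp

section \<open>The exponents of \<open>1 - U\<close> are the compatibility degrees\<close>

definition expo :: "nat \<times> nat \<Rightarrow> nat \<times> nat \<Rightarrow> int" where
  "expo \<omega> \<gamma> = (SOME e. 1 - U (sl \<gamma>) = MU e) \<omega>"

lemma expo: "1 - U (sl \<gamma>) = MU (\<lambda>\<omega>. expo \<omega> \<gamma>)"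
proof -
  have "A q rvar \<in> range MU" for q unfolding A_Q
    by (intro MU_prod_closed MU_power_closed y_closed) simp
  hence "1 - U (sl \<gamma>) \<in> range MU" unfolding one_minus_U
    by (intro MU_divide_closed MU_mult_closed F_closed) auto
  hence "\<exists>e. 1 - U (sl \<gamma>) = MU e" by auto
  from someI_ex[OF this] show ?thesis by (simp add: expo_def)
qed

lemma expo_tau: "\<omega> \<in> I \<Longrightarrow> \<gamma> \<in> I \<Longrightarrow> expo (ta \<omega>) (ta \<gamma>) = expo \<omega> \<gamma>"
proof -
  assume *: "\<omega> \<in> I" "\<gamma> \<in> I"
  have "MU (\<lambda>\<omega>. expo (ta \<omega>) (ta \<gamma>)) = M n (1 - U (sl (ta \<gamma>)))" unfolding expo M_MU ..
  also have "\<dots> = 1 - U (sl \<gamma>)"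
    using *(2) by (simp add: field_hom_diff[OF field_hom_M] field_homD[OF field_hom_M] U_shift U_tau)
  finally show ?thesis using MU_inj[OF _ *(1)] unfolding expo by blast
qed

text \<open>The exponent at \<open>ta (0, l)\<close> is read off from the order of
  \<open>1 - U\<close> along \<open>y\<^sub>l\<close>, and the invariance under \<open>ta\<close>
  carries it to \<open>(0, l)\<close>.\<close>

lemma expo_initial: "l < n \<Longrightarrow> \<gamma> \<in> I \<Longrightarrow> expo (0, l) \<gamma> = max 0 (V l (sl \<gamma>))"
proof -
  assume *: "l < n" "\<gamma> \<in> I"
  have "- expo (ta (0, l)) (ta \<gamma>) = - int (nat (V l (sl (ta \<gamma>) + n)))"
    using pole_one_minus_U[OF *(1), of "sl (ta \<gamma>)"] pole_MU[OF *(1), of "\<lambda>\<omega>. expo \<omega> (ta \<gamma>)"] by (simp only: expo)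
  thus ?thesis using expo_tau[OF Pi_0[OF *(1)] *(2)] V_tau[OF *(2)] by simp
qed

lemma expo_nonneg: "\<omega> \<in> I \<Longrightarrow> \<gamma> \<in> I \<Longrightarrow> expo \<omega> \<gamma> \<ge> 0"
proof (induction \<omega> arbitrary: \<gamma> rule: tau_induct)
  case (initial i)
  thus ?case by (simp add: expo_initial)
next
  case (step \<omega>)
  thus ?case using expo_tau[of \<omega> \<gamma>] tau_Pi by metis
qed

lemma compat_expo: "compat n B \<omega> \<gamma> = (if \<omega> \<in> I \<and> \<gamma> \<in> I then nat (expo \<omega> \<gamma>) else 0)"
proof -
  have "is_compatibility_degree n B (\<lambda>\<omega> \<gamma>. if \<omega> \<in> I \<and> \<gamma> \<in> I then nat (expo \<omega> \<gamma>) else 0)"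
    unfolding is_compatibility_degree_def
    using tau_Pi expo_tau Pi_0 expo_initial denom_xvar by auto
  from compat_eq[OF this] show ?thesis by simp
qed

theorem U_relation:
  assumes "\<gamma> \<in> I" shows "U (sl \<gamma>) + (\<Prod>\<omega>\<in>I. U (sl \<omega>) ^ compat n B \<omega> \<gamma>) = 1"
proof -
  have "(\<Prod>\<omega>\<in>I. U (sl \<omega>) ^ compat n B \<omega> \<gamma>) = MU (\<lambda>\<omega>. expo \<omega> \<gamma>)"
    unfolding MU_def using assms expo_nonneg by (intro prod.cong) (auto simp: compat_expo power_int_def)
  thus ?thesis using expo[of \<gamma>] by (simp add: algebra_simps)
qed

end


section \<open>Algebras and their spectra\<close>

definition calg :: "'a calg \<Rightarrow> bool" where
  "calg A \<longleftrightarrow> cring A \<and> (\<forall>c. \<forall>a\<in>carrier A. c \<odot>\<^bsub>A\<^esub> a \<in> carrier A)"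

lemma cring_cong:
  assumes R: "cring R" and eq: "carrier S = carrier R" "mult S = mult R" "one S = one R" "zero S = zero R" "add S = add R"
  shows "cring S"
proof -
  interpret cring R by fact
  show ?thesis
  proof (rule cringI)
    show "abelian_group S"
    proof (rule abelian_groupI)
      show "\<exists>y\<in>carrier S. y \<oplus>\<^bsub>S\<^esub> x = \<zero>\<^bsub>S\<^esub>" if "x \<in> carrier S" for x
        using that by (intro bexI[of _ "\<ominus>\<^bsub>R\<^esub> x"]) (auto simp: eq l_neg)
    qed (auto simp: eq a_assoc intro: a_comm)
    show "comm_monoid S"
      by (rule comm_monoidI) (auto simp: eq m_assoc intro: m_comm)
  qed (simp add: eq l_distr)
qed

lemma calg_isoD:
  assumes "g \<in> calg_iso A B"
  shows "bij_betw g (carrier A) (carrier B)" "a \<in> carrier A \<Longrightarrow> g a \<in> carrier B"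
    "a \<in> carrier A \<Longrightarrow> b \<in> carrier A \<Longrightarrow> g (a \<otimes>\<^bsub>A\<^esub> b) = g a \<otimes>\<^bsub>B\<^esub> g b"
    "a \<in> carrier A \<Longrightarrow> b \<in> carrier A \<Longrightarrow> g (a \<oplus>\<^bsub>A\<^esub> b) = g a \<oplus>\<^bsub>B\<^esub> g b"
    "g \<one>\<^bsub>A\<^esub> = \<one>\<^bsub>B\<^esub>" "a \<in> carrier A \<Longrightarrow> g (c \<odot>\<^bsub>A\<^esub> a) = c \<odot>\<^bsub>B\<^esub> g a"
    "g \<in> ring_iso A B"
  using assms ring_iso_memE[of g A B] by (auto simp: calg_iso_def)

lemma calg_isoI:
  assumes "bij_betw g (carrier A) (carrier B)"
    "\<And>a b. a \<in> carrier A \<Longrightarrow> b \<in> carrier A \<Longrightarrow> g (a \<otimes>\<^bsub>A\<^esub> b) = g a \<otimes>\<^bsub>B\<^esub> g b"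
    "\<And>a b. a \<in> carrier A \<Longrightarrow> b \<in> carrier A \<Longrightarrow> g (a \<oplus>\<^bsub>A\<^esub> b) = g a \<oplus>\<^bsub>B\<^esub> g b"
    "g \<one>\<^bsub>A\<^esub> = \<one>\<^bsub>B\<^esub>" "\<And>c a. a \<in> carrier A \<Longrightarrow> g (c \<odot>\<^bsub>A\<^esub> a) = c \<odot>\<^bsub>B\<^esub> g a"
  shows "g \<in> calg_iso A B"
  using assms by (auto simp: calg_iso_def intro!: ring_iso_memI dest: bij_betwE)

lemma calg_iso_inv:
  assumes A: "calg A" and g: "g \<in> calg_iso A B"
  shows "inv_into (carrier A) g \<in> calg_iso B A"
proof -
  let ?k = "inv_into (carrier A) g"
  have "?k \<in> ring_iso B A"
    using A g by (intro ring_iso_set_sym) (auto simp: calg_def calg_iso_def cring.axioms(1))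
  moreover have "?k (c \<odot>\<^bsub>B\<^esub> b) = c \<odot>\<^bsub>A\<^esub> ?k b" if b: "b \<in> carrier B" for c b
  proof -
    obtain a where a: "a \<in> carrier A" "b = g a" using b calg_isoD(1)[OF g] by (auto simp: bij_betw_def)
    hence "c \<odot>\<^bsub>B\<^esub> b = g (c \<odot>\<^bsub>A\<^esub> a)" using calg_isoD(6)[OF g] by simp
    moreover have "inj_on g (carrier A)" using calg_isoD(1)[OF g] by (simp add: bij_betw_def)
    ultimately show ?thesis using a A by (simp add: calg_def)
  qed
  ultimately show ?thesis by (simp add: calg_iso_def)
qed

lemma calg_iso_trans: "g \<in> calg_iso A B \<Longrightarrow> g' \<in> calg_iso B C \<Longrightarrow> g' \<circ> g \<in> calg_iso A C"
  using ring_iso_set_trans[of g A B g' C] calg_isoD(2)[of g A B] by (auto simp: calg_iso_def)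

lemma calg_isomorphic_sym: "calg A \<Longrightarrow> calg_isomorphic A B \<Longrightarrow> calg_isomorphic B A"
  using calg_iso_inv by (fastforce simp: calg_isomorphic_def)

lemma calg_isomorphic_trans: "calg_isomorphic A B \<Longrightarrow> calg_isomorphic B C \<Longrightarrow> calg_isomorphic A C"
  using calg_iso_trans by (fastforce simp: calg_isomorphic_def)

text \<open>The definition of a ring isomorphism does not mention 0, which is a separate field of
  the record \<open>B\<close>; hence the hypothesis \<open>z\<close>.\<close>

lemma calg_image:
  assumes A: "calg A" and g: "g \<in> calg_iso A B" and z: "g \<zero>\<^bsub>A\<^esub> = \<zero>\<^bsub>B\<^esub>"
  shows "calg B"
proof -
  have "cring (B \<lparr> zero := g \<zero>\<^bsub>A\<^esub> \<rparr>)"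
    by (rule cring.ring_iso_imp_img_cring) (use A calg_isoD(7)[OF g] in \<open>auto simp: calg_def\<close>)
  hence "cring B" by (rule cring_cong) (simp_all add: z)
  moreover have "c \<odot>\<^bsub>B\<^esub> b \<in> carrier B" if b: "b \<in> carrier B" for c b
  proof -
    obtain a where "a \<in> carrier A" "b = g a" using b calg_isoD(1)[OF g] by (auto simp: bij_betw_def)
    thus ?thesis using calg_isoD(6)[OF g, of a c] calg_isoD(2)[OF g, of "c \<odot>\<^bsub>A\<^esub> a"] A by (simp add: calg_def)
  qed
  ultimately show ?thesis by (simp add: calg_def)
qed

lemma calg_on_simps [simp]:
  "carrier (calg_on emb S) = S" "mult (calg_on emb S) = (*)" "one (calg_on emb S) = 1"
  "zero (calg_on emb S) = 0" "add (calg_on emb S) = (+)" "smult (calg_on emb S) = (\<lambda>c a. emb c * a)"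
  by (simp_all add: calg_on_def)

lemma calg_calg_on:
  assumes emb: "\<And>c. emb c \<in> S" "emb 0 = 0" "emb 1 = 1" "emb (-1) = -1"
    and S: "\<And>a b. a \<in> S \<Longrightarrow> b \<in> S \<Longrightarrow> a + b \<in> S" "\<And>a b. a \<in> S \<Longrightarrow> b \<in> S \<Longrightarrow> a * b \<in> S"
  shows "calg (calg_on emb S)"
proof -
  have 01: "0 \<in> S" "1 \<in> S" using emb by metis+
  have neg: "- a \<in> S" if "a \<in> S" for a using S(2)[OF emb(1)[of "-1"] that] emb(4) by simp
  have "cring (calg_on emb S)"
  proof (rule cringI)
    show "abelian_group (calg_on emb S)"
    proof (rule abelian_groupI)
      show "\<exists>y\<in>carrier (calg_on emb S). y \<oplus>\<^bsub>calg_on emb S\<^esub> x = \<zero>\<^bsub>calg_on emb S\<^esub>" if "x \<in> carrier (calg_on emb S)" for x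
        using neg that by (intro bexI[of _ "- x"]) auto
    qed (use S 01 in \<open>auto simp: algebra_simps\<close>)
    show "comm_monoid (calg_on emb S)" by (rule comm_monoidI) (use S 01 in \<open>auto\<close>)
  qed (simp add: algebra_simps)
  thus ?thesis using S(2) emb(1) by (simp add: calg_def)
qed

lemma calg_quot_simps [simp]:
  "carrier (calg_quot A J) = carrier (A Quot J)" "mult (calg_quot A J) = mult (A Quot J)"
  "one (calg_quot A J) = one (A Quot J)" "zero (calg_quot A J) = zero (A Quot J)"
  "add (calg_quot A J) = add (A Quot J)"
  "smult (calg_quot A J) = (\<lambda>c X. J +>\<^bsub>A\<^esub> (c \<odot>\<^bsub>A\<^esub> (SOME a. a \<in> X)))"
  by (simp_all add: calg_quot_def)

text \<open>The isomorphism theorem including scalars. These act on a coset through a chosen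
  representative, which is harmless because \<open>g\<close> is constant on cosets.\<close>

lemma calg_quot_iso:
  assumes A: "calg A" and B: "calg B"
    and g: "\<And>a. a \<in> carrier A \<Longrightarrow> g a \<in> carrier B"
    "\<And>a b. a \<in> carrier A \<Longrightarrow> b \<in> carrier A \<Longrightarrow> g (a \<otimes>\<^bsub>A\<^esub> b) = g a \<otimes>\<^bsub>B\<^esub> g b"
    "\<And>a b. a \<in> carrier A \<Longrightarrow> b \<in> carrier A \<Longrightarrow> g (a \<oplus>\<^bsub>A\<^esub> b) = g a \<oplus>\<^bsub>B\<^esub> g b"
    "g \<one>\<^bsub>A\<^esub> = \<one>\<^bsub>B\<^esub>" "\<And>c a. a \<in> carrier A \<Longrightarrow> g (c \<odot>\<^bsub>A\<^esub> a) = c \<odot>\<^bsub>B\<^esub> g a"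
    and surj: "g ` carrier A = carrier B"
    and J: "J = {a \<in> carrier A. g a = \<zero>\<^bsub>B\<^esub>}"
  shows "calg (calg_quot A J)" "calg_isomorphic (calg_quot A J) B"
proof -
  interpret A: cring A using A by (simp add: calg_def)
  interpret B: cring B using B by (simp add: calg_def)
  have hom: "g \<in> ring_hom A B" by (rule ring_hom_memI) (use g in auto)
  interpret g: ring_hom_ring A B g by (rule ring_hom_ringI2[OF A.ring_axioms B.ring_axioms hom])
  have ker: "J = a_kernel A B g" unfolding J a_kernel_def' ..
  let ?f = "\<lambda>X. the_elem (g ` X)"
  have f: "?f \<in> ring_iso (A Quot J) B" unfolding ker by (rule g.FactRing_iso_set[OF surj])
  have "ideal J A" unfolding ker by (rule g.kernel_is_ideal)
  interpret J: ideal J A by fact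
  have "cring (A Quot J)" by (rule J.quotient_is_cring[OF A.is_cring])
  hence c: "cring (calg_quot A J)" by (rule cring_cong) simp_all
  have coset: "X \<noteq> {}" "X \<subseteq> carrier A" "\<And>x. x \<in> X \<Longrightarrow> ?f X = g x" if X: "X \<in> carrier (A Quot J)" for X
  proof -
    obtain a where a: "a \<in> carrier A" "X = J +>\<^bsub>A\<^esub> a" using X by (auto simp: FactRing_simps)
    have X': "X = (\<lambda>j. j \<oplus>\<^bsub>A\<^esub> a) ` J" unfolding a(2) a_r_coset_def' by auto
    have "\<zero>\<^bsub>A\<^esub> \<oplus>\<^bsub>A\<^esub> a \<in> X" unfolding X' by (rule imageI) simp
    thus ne: "X \<noteq> {}" by blast
    show "X \<subseteq> carrier A" unfolding X' using a(1) by auto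
    have "g (j \<oplus>\<^bsub>A\<^esub> a) = g a" if "j \<in> J" for j
    proof -
      have j: "j \<in> carrier A" "g j = \<zero>\<^bsub>B\<^esub>" using that unfolding J by auto
      show ?thesis using g(3)[OF j(1) a(1)] j g(1)[OF a(1)] by simp
    qed
    hence const: "g x = g a" if "x \<in> X" for x using that unfolding X' by auto
    show "?f X = g x" if "x \<in> X" for x
    proof -
      have "g ` X = {g x}" using const that by auto
      thus ?thesis by simp
    qed
  qed
  have sc: "c \<odot>\<^bsub>A\<^esub> (SOME a. a \<in> X) \<in> carrier A" "(SOME a. a \<in> X) \<in> X" if "X \<in> carrier (A Quot J)" for c X
    using coset(1,2)[OF that] some_in_eq A by (auto simp: calg_def)
  have carr: "J +>\<^bsub>A\<^esub> a \<in> carrier (A Quot J)" if "a \<in> carrier A" for a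
    using that by (auto simp: FactRing_simps)
  show "calg (calg_quot A J)" using c sc carr by (simp add: calg_def)
  have "?f \<in> calg_iso (calg_quot A J) B"
  proof (rule calg_isoI)
    show "bij_betw ?f (carrier (calg_quot A J)) (carrier B)" using f by (simp add: ring_iso_def)
    fix c X assume X: "X \<in> carrier (calg_quot A J)"
    hence "?f (J +>\<^bsub>A\<^esub> (c \<odot>\<^bsub>A\<^esub> (SOME a. a \<in> X))) = g (c \<odot>\<^bsub>A\<^esub> (SOME a. a \<in> X))"
      using sc(1) carr J.a_rcos_self by (intro coset(3)) auto
    also have "\<dots> = c \<odot>\<^bsub>B\<^esub> g (SOME a. a \<in> X)"
      using coset(2)[of X] sc(2)[of X] X by (intro g(5)) auto
    also have "g (SOME a. a \<in> X) = ?f X" using coset(3)[of X] sc(2)[of X] X by simp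
    finally show "?f (c \<odot>\<^bsub>calg_quot A J\<^esub> X) = c \<odot>\<^bsub>B\<^esub> ?f X" by simp
  qed (use ring_iso_memE[OF f] in auto)
  thus "calg_isomorphic (calg_quot A J) B" by (auto simp: calg_isomorphic_def)
qed

section \<open>Isomorphic algebras have isomorphic spectra\<close>

lemma image_Union_pair:
  assumes "\<And>a b. (a, b) \<in> X \<Longrightarrow> f ` W a b = W' (k a) (k b)"
  shows "f ` (\<Union>(a, b)\<in>X. W a b) = (\<Union>(a, b)\<in>map_prod k k ` X. W' a b)"
proof -
  have "f ` W (fst x) (snd x) = W' (k (fst x)) (k (snd x))" if "x \<in> X" for x
    using assms[of "fst x" "snd x"] that by simp
  thus ?thesis by (simp add: case_prod_unfold image_UN)
qed

lemma image_Union_pairs: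
  assumes "\<And>a b c d. (a, b) \<in> X \<Longrightarrow> (c, d) \<in> Y \<Longrightarrow> f ` W a b c d = W' (k a) (k b) (k c) (k d)"
  shows "f ` (\<Union>(a, b)\<in>X. \<Union>(c, d)\<in>Y. W a b c d) =
    (\<Union>(a, b)\<in>map_prod k k ` X. \<Union>(c, d)\<in>map_prod k k ` Y. W' a b c d)"
  by (intro image_Union_pair assms)

lemma spec_sectionsD:
  assumes "s \<in> carrier (spec_sections A U)" "p \<in> U"
  obtains V a b where "openin (zariski A) V" "p \<in> V" "V \<subseteq> U" "a \<in> carrier A" "b \<in> carrier A"
    "\<forall>q\<in>V. b \<notin> q \<and> s q = loc_frac A q a b"
proof -
  have "\<exists>V. openin (zariski A) V \<and> p \<in> V \<and> V \<subseteq> U \<and>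
      (\<exists>a\<in>carrier A. \<exists>b\<in>carrier A. \<forall>q\<in>V. b \<notin> q \<and> s q = loc_frac A q a b)"
    using assms by (simp add: spec_sections_def)
  then obtain V where V: "openin (zariski A) V" "p \<in> V" "V \<subseteq> U"
    and ab: "\<exists>a\<in>carrier A. \<exists>b\<in>carrier A. \<forall>q\<in>V. b \<notin> q \<and> s q = loc_frac A q a b"
    by (elim exE conjE)
  from ab obtain a b where "a \<in> carrier A" "b \<in> carrier A" "\<forall>q\<in>V. b \<notin> q \<and> s q = loc_frac A q a b"
    by (elim bexE)
  thus ?thesis by (rule that[OF V])
qed

lemma topspace_zariski: "cring A \<Longrightarrow> topspace (zariski A) = spec_points A"
proof -
  assume "cring A"
  then interpret cring A .
  have "\<one>\<^bsub>A\<^esub> \<notin> p" if "p \<in> spec_points A" for p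
    using that ideal.one_imp_carrier[of p A] by (auto simp: spec_points_def primeideal_def primeideal_axioms_def)
  thus ?thesis unfolding zariski_def by auto
qed

text \<open>The inverse \<open>k\<close> is a parameter, so that the locale can be interpreted a
  second time with the two sides exchanged.\<close>

locale calg_iso_pair =
  fixes A :: "'a calg" and B :: "'b calg" and g k
  assumes A: "calg A" and B: "calg B" and g: "g \<in> calg_iso A B" and k: "k \<in> calg_iso B A"
    and kg: "a \<in> carrier A \<Longrightarrow> k (g a) = a" and gk: "b \<in> carrier B \<Longrightarrow> g (k b) = b"
begin

definition pt :: "'a set \<Rightarrow> 'b set" where "pt p = {b \<in> carrier B. k b \<in> p}"

abbreviation pre :: "'b set set \<Rightarrow> 'a set set" where "pre U \<equiv> {p \<in> spec_points A. pt p \<in> U}"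

definition pull :: "'b set set \<Rightarrow> ('b set \<Rightarrow> ('b \<times> 'b) set) \<Rightarrow> 'a set \<Rightarrow> ('a \<times> 'a) set" where
  "pull U s = (\<lambda>p\<in>pre U. map_prod k k ` s (pt p))"

lemma pt_spec:
  assumes "p \<in> spec_points A" shows "pt p \<in> spec_points B"
proof -
  interpret A: cring A using A by (simp add: calg_def)
  interpret B: cring B using B by (simp add: calg_def)
  have hom: "k \<in> ring_hom B A" using k by (simp add: calg_iso_def ring_iso_def)
  interpret k: ring_hom_ring B A k by (rule ring_hom_ringI2[OF B.ring_axioms A.ring_axioms hom])
  show ?thesis unfolding pt_def
    using k.primeideal_vimage[OF B.is_cring, of p] assms by (simp add: spec_points_def)
qed

lemma pt_open: "openin (zariski B) U \<Longrightarrow> openin (zariski A) (pre U)"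
proof -
  assume U: "openin (zariski B) U"
  have "continuous_map (zariski A) (zariski B) pt"
    unfolding zariski_def[of B]
  proof (rule continuous_on_generated_topo)
    have top: "topspace (zariski A) = spec_points A" using A by (simp add: topspace_zariski calg_def)
    fix V assume "V \<in> {{p \<in> spec_points B. f \<notin> p} |f. f \<in> carrier B}"
    then obtain f where f: "f \<in> carrier B" "V = {p \<in> spec_points B. f \<notin> p}" by auto
    hence "pt -` V \<inter> topspace (zariski A) = {p \<in> spec_points A. k f \<notin> p}"
      using pt_spec unfolding top by (auto simp: pt_def)
    thus "openin (zariski A) (pt -` V \<inter> topspace (zariski A))"
      using f calg_isoD(2)[OF k] unfolding zariski_def by (auto intro!: topology_generated_by_Basis)
  next
    show "pt ` topspace (zariski A) \<subseteq> \<Union> {{p \<in> spec_points B. f \<notin> p} |f. f \<in> carrier B}"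
      using pt_spec B topspace_zariski[of B] unfolding zariski_def
      by (auto simp: calg_def)
  qed
  thus ?thesis using U A unfolding continuous_map_def by (simp add: topspace_zariski calg_def)
qed

lemma loc_frac_pt:
  assumes a: "a \<in> carrier B" "b \<in> carrier B" and cd: "(c, d) \<in> loc_frac B (pt p) a b"
  shows "(k c, k d) \<in> loc_frac A p (k a) (k b)"
proof -
  note K = calg_isoD[OF k]
  interpret A: cring A using A by (simp add: calg_def)
  interpret B: cring B using B by (simp add: calg_def)
  obtain t where t: "c \<in> carrier B" "d \<in> carrier B" "k d \<notin> p" "t \<in> carrier B" "k t \<notin> p"
    "t \<otimes>\<^bsub>B\<^esub> (a \<otimes>\<^bsub>B\<^esub> d) = t \<otimes>\<^bsub>B\<^esub> (c \<otimes>\<^bsub>B\<^esub> b)"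
    using cd by (auto simp: loc_frac_def pt_def)
  have "k t \<otimes>\<^bsub>A\<^esub> (k a \<otimes>\<^bsub>A\<^esub> k d) = k t \<otimes>\<^bsub>A\<^esub> (k c \<otimes>\<^bsub>A\<^esub> k b)"
    using arg_cong[OF t(6), of k] t(1,2,4) a by (simp add: K(3))
  thus ?thesis using t K(2) by (auto simp: loc_frac_def)
qed

end

lemma calg_iso_pair_swap: "calg_iso_pair A B g k \<Longrightarrow> calg_iso_pair B A k g"
  by (simp add: calg_iso_pair_def)

context calg_iso_pair
begin

interpretation swap: calg_iso_pair B A k g
  by (rule calg_iso_pair_swap) unfold_locales

lemma pt_swap: "p \<in> spec_points A \<Longrightarrow> swap.pt (pt p) = p"
proof -
  assume "p \<in> spec_points A"
  hence "p \<subseteq> carrier A" using ideal.Icarr[of p A] by (auto simp: spec_points_def primeideal_def)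
  thus ?thesis using kg calg_isoD(2)[OF g] by (auto simp: pt_def swap.pt_def)
qed

lemma loc_frac_image:
  assumes p: "p \<in> spec_points A" and a: "a \<in> carrier B" "b \<in> carrier B"
  shows "map_prod k k ` loc_frac B (pt p) a b = loc_frac A p (k a) (k b)"
proof
  note K = calg_isoD[OF k]
  show "map_prod k k ` loc_frac B (pt p) a b \<subseteq> loc_frac A p (k a) (k b)"
    using loc_frac_pt[OF a] by auto
  have "(c, d) \<in> map_prod k k ` loc_frac B (pt p) a b" if "(c, d) \<in> loc_frac A p (k a) (k b)" for c d
  proof -
    have "c \<in> carrier A" "d \<in> carrier A" using that by (auto simp: loc_frac_def)
    moreover have "(g c, g d) \<in> loc_frac B (pt p) a b"
      using swap.loc_frac_pt[of "k a" "k b" c d "pt p"] that a K(2) by (simp add: pt_swap[OF p] gk)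
    ultimately show ?thesis by (intro image_eqI[of _ _ "(g c, g d)"]) (simp_all add: kg)
  qed
  thus "loc_frac A p (k a) (k b) \<subseteq> map_prod k k ` loc_frac B (pt p) a b" by auto
qed

lemma loc_carrier: "X \<in> carrier (localization B q) \<Longrightarrow> (a, b) \<in> X \<Longrightarrow> a \<in> carrier B \<and> b \<in> carrier B"
  by (auto simp: localization_def loc_frac_def)

lemma localization_image:
  assumes p: "p \<in> spec_points A" and X: "X \<in> carrier (localization B (pt p))" and Y: "Y \<in> carrier (localization B (pt p))"
  shows "map_prod k k ` (X \<otimes>\<^bsub>localization B (pt p)\<^esub> Y) = map_prod k k ` X \<otimes>\<^bsub>localization A p\<^esub> map_prod k k ` Y" (is ?M)
    "map_prod k k ` (X \<oplus>\<^bsub>localization B (pt p)\<^esub> Y) = map_prod k k ` X \<oplus>\<^bsub>localization A p\<^esub> map_prod k k ` Y" (is ?A)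
    "map_prod k k ` (c \<odot>\<^bsub>localization B (pt p)\<^esub> X) = c \<odot>\<^bsub>localization A p\<^esub> map_prod k k ` X" (is ?S)
proof -
  note K = calg_isoD[OF k]
  interpret A: cring A using A by (simp add: calg_def)
  interpret B: cring B using B by (simp add: calg_def)
  have cl: "c \<odot>\<^bsub>B\<^esub> a \<in> carrier B" if "a \<in> carrier B" for c a using B that by (simp add: calg_def)
  note XB = loc_carrier[OF X] and YB = loc_carrier[OF Y]
  show ?M ?A ?S
    unfolding localization_def ring.simps monoid.simps module.simps
    by (rule image_Union_pairs image_Union_pair, drule XB, (drule YB)?, simp add: loc_frac_image[OF p] cl K(3,4,6))+
qed

lemma open_subset_spec: "openin (zariski B) U \<Longrightarrow> U \<subseteq> spec_points B"
  using openin_subset[of "zariski B" U] B by (simp add: topspace_zariski calg_def)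

lemma section_localization:
  assumes "s \<in> carrier (spec_sections B U)" "q \<in> U" shows "s q \<in> carrier (localization B q)"
  using assms by (rule spec_sectionsD) (auto simp: localization_def)

lemma pull_section:
  assumes s: "s \<in> carrier (spec_sections B U)"
  shows "pull U s \<in> carrier (spec_sections A (pre U))"
proof -
  have "\<exists>V. openin (zariski A) V \<and> p \<in> V \<and> V \<subseteq> pre U \<and>
      (\<exists>a\<in>carrier A. \<exists>b\<in>carrier A. \<forall>q\<in>V. b \<notin> q \<and> pull U s q = loc_frac A q a b)"
    if p: "p \<in> spec_points A" "pt p \<in> U" for p
  proof -
    obtain V a b where V: "openin (zariski B) V" "pt p \<in> V" "V \<subseteq> U" "a \<in> carrier B" "b \<in> carrier B"
      "\<forall>q\<in>V. b \<notin> q \<and> s q = loc_frac B q a b"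
      by (rule spec_sectionsD[OF s p(2)])
    have "k b \<notin> q \<and> pull U s q = loc_frac A q (k a) (k b)" if q: "q \<in> spec_points A" "pt q \<in> V" for q
    proof -
      have "b \<notin> pt q" using bspec[OF V(6) q(2)] by simp
      hence "k b \<notin> q" using V(5) by (simp add: pt_def)
      moreover have "pt q \<in> U" using q V(3) by auto
      ultimately show ?thesis using bspec[OF V(6) q(2)] q V(4,5) by (simp add: pull_def loc_frac_image)
    qed
    moreover have "openin (zariski A) (pre V)" by (rule pt_open[OF V(1)])
    moreover have "k a \<in> carrier A" "k b \<in> carrier A" using V calg_isoD(2)[OF k] by auto
    ultimately show ?thesis using p V(2,3)
      by (intro exI[of _ "pre V"] conjI bexI[of _ "k a"] bexI[of _ "k b"]) auto
  qed
  thus ?thesis by (auto simp: spec_sections_def pull_def)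
qed

lemma pull_hom:
  assumes "s \<in> carrier (spec_sections B U)" "t \<in> carrier (spec_sections B U)"
  shows "pull U (s \<otimes>\<^bsub>spec_sections B U\<^esub> t) = pull U s \<otimes>\<^bsub>spec_sections A (pre U)\<^esub> pull U t"
    "pull U (s \<oplus>\<^bsub>spec_sections B U\<^esub> t) = pull U s \<oplus>\<^bsub>spec_sections A (pre U)\<^esub> pull U t"
    "pull U (c \<odot>\<^bsub>spec_sections B U\<^esub> s) = c \<odot>\<^bsub>spec_sections A (pre U)\<^esub> pull U s"
  using section_localization[OF assms(1)] section_localization[OF assms(2)]
  by (simp_all add: pull_def spec_sections_def fun_eq_iff localization_image(1,2) localization_image(3)[OF _ _ section_localization[OF assms(1)]])

lemma pull_one: "pull U \<one>\<^bsub>spec_sections B U\<^esub> = \<one>\<^bsub>spec_sections A (pre U)\<^esub>"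
proof -
  have "map_prod k k ` \<one>\<^bsub>localization B (pt p)\<^esub> = \<one>\<^bsub>localization A p\<^esub>" if p: "p \<in> spec_points A" for p
  proof -
    interpret B: cring B using B by (simp add: calg_def)
    show ?thesis by (simp add: localization_def loc_frac_image[OF p] calg_isoD(5)[OF k])
  qed
  thus ?thesis by (simp add: pull_def spec_sections_def fun_eq_iff)
qed

end

context calg_iso_pair
begin

interpretation swap: calg_iso_pair B A k g
  by (rule calg_iso_pair_swap) unfold_locales

lemma pull_pull:
  assumes s: "s \<in> carrier (spec_sections B U)" and U: "openin (zariski B) U"
  shows "swap.pull (pre U) (pull U s) = s"
proof
  fix q
  show "swap.pull (pre U) (pull U s) q = s q"
  proof (cases "q \<in> U")
    case True
    have q: "q \<in> spec_points B" using open_subset_spec[OF U] True by auto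
    have "pt (swap.pt q) = q" by (rule swap.pt_swap[OF q])
    hence "swap.pull (pre U) (pull U s) q = map_prod g g ` map_prod k k ` s q"
      using q True swap.pt_spec[OF q] by (simp add: swap.pull_def pull_def)
    also have "\<dots> = s q"
    proof -
      have "map_prod g g (map_prod k k x) = x" if "x \<in> s q" for x
        using loc_carrier[OF section_localization[OF s True], of "fst x" "snd x"] that gk by (cases x) auto
      thus ?thesis by (simp add: image_image)
    qed
    finally show ?thesis .
  next
    case False
    have "pt (swap.pt q) = q" if "q \<in> spec_points B" by (rule swap.pt_swap[OF that])
    hence "swap.pull (pre U) (pull U s) q = undefined"
      using False by (auto simp: swap.pull_def)
    thus ?thesis using s False by (auto simp: spec_sections_def extensional_def)
  qed
qed

lemma pt_pt: "openin (zariski B) U \<Longrightarrow> {q \<in> spec_points B. swap.pt q \<in> pre U} = U"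
  using open_subset_spec[of U] swap.pt_spec swap.pt_swap by auto

end

context calg_iso_pair
begin

interpretation swap: calg_iso_pair B A k g
  by (rule calg_iso_pair_swap) unfold_locales

lemma pull_iso:
  assumes U: "openin (zariski B) U"
  shows "pull U \<in> calg_iso (spec_sections B U) (spec_sections A (pre U))"
proof (rule calg_isoI)
  let ?W = "pre U"
  have W: "openin (zariski A) ?W" by (rule pt_open[OF U])
  show "bij_betw (pull U) (carrier (spec_sections B U)) (carrier (spec_sections A ?W))"
  proof (rule bij_betwI[where g = "swap.pull ?W"])
    show "swap.pull ?W \<in> carrier (spec_sections A ?W) \<rightarrow> carrier (spec_sections B U)"
      using swap.pull_section[of _ ?W] pt_pt[OF U] by auto
    show "pull U (swap.pull ?W t) = t" if "t \<in> carrier (spec_sections A ?W)" for t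
      using swap.pull_pull[OF that W] unfolding pt_pt[OF U] .
  qed (use pull_section pull_pull[OF _ U] in auto)
qed (simp_all add: pull_hom pull_one)

lemma Spec_isomorphic: "cspace_isomorphic (Spec A) (Spec B)"
proof -
  have top: "topspace (zariski A) = spec_points A" "topspace (zariski B) = spec_points B"
    using A B by (simp_all add: topspace_zariski calg_def)
  have "homeomorphic_maps (zariski A) (zariski B) pt swap.pt"
    unfolding homeomorphic_maps_def continuous_map_def top
    using pt_open swap.pt_open pt_spec swap.pt_spec pt_swap swap.pt_swap by auto
  hence "homeomorphic_map (zariski A) (zariski B) pt" by (meson homeomorphic_map_maps)
  moreover have "pull V (restrict s V) = restrict (pull U s) (pre V)"
    if "V \<subseteq> U" for U V s
    using that by (auto simp: pull_def fun_eq_iff)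
  ultimately show ?thesis
    unfolding cspace_isomorphic_def using pull_iso
    by (intro exI[of _ pt] exI[of _ pull]) (simp add: Spec_def top)
qed

end

lemma Spec_isomorphic:
  assumes "calg A" "calg B" "calg_isomorphic A B" shows "cspace_isomorphic (Spec A) (Spec B)"
proof -
  obtain g where g: "g \<in> calg_iso A B" using assms(3) by (auto simp: calg_isomorphic_def)
  have b: "bij_betw g (carrier A) (carrier B)" by (rule calg_isoD(1)[OF g])
  interpret calg_iso_pair A B g "inv_into (carrier A) g"
    using assms g calg_iso_inv[OF assms(1) g] bij_betw_inv_into_left[OF b] bij_betw_inv_into_right[OF b]
    by unfold_locales auto
  show ?thesis by (rule Spec_isomorphic)
qed

lemma ideal_calg_on:
  fixes emb :: "complex \<Rightarrow> 'a::comm_ring_1"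
  assumes A: "calg (calg_on emb S)" and p: "p \<subseteq> S" "0 \<in> p"
    and add: "\<And>a b. a \<in> p \<Longrightarrow> b \<in> p \<Longrightarrow> a + b \<in> p" and mult: "\<And>a s. a \<in> p \<Longrightarrow> s \<in> S \<Longrightarrow> s * a \<in> p"
  shows "ideal p (calg_on emb S)"
proof -
  interpret cring "calg_on emb S" using A by (simp add: calg_def)
  have neg: "\<ominus>\<^bsub>calg_on emb S\<^esub> a = - a" "- 1 \<in> S" if a: "a \<in> S" for a
  proof -
    have "\<ominus>\<^bsub>calg_on emb S\<^esub> b = - b" if "b \<in> S" for b
      using l_neg[of b] that by (simp add: eq_neg_iff_add_eq_0)
    thus "\<ominus>\<^bsub>calg_on emb S\<^esub> a = - a" "- 1 \<in> S" using a a_inv_closed[of 1] one_closed by auto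
  qed
  show ?thesis
  proof (rule idealI[OF ring_axioms])
    show "subgroup p (add_monoid (calg_on emb S))"
    proof (rule add.subgroupI)
      show "\<ominus>\<^bsub>calg_on emb S\<^esub> a \<in> p" if "a \<in> p" for a
        using neg[of a] mult[OF that, of "- 1"] p that by auto
    qed (use p add in auto)
  qed (use mult in \<open>auto simp: mult.commute\<close>)
qed


lemma laurent_on_single: "keys m \<subseteq> S \<Longrightarrow> single m c \<in> laurent_on S"
  by (simp add: laurent_on_def)

lemma laurent_on_add: "p \<in> laurent_on S \<Longrightarrow> q \<in> laurent_on S \<Longrightarrow> p + q \<in> laurent_on S"
  using keys_add[of p q] by (auto simp: laurent_on_def)

lemma laurent_on_mult:
  assumes "p \<in> laurent_on S" "q \<in> laurent_on S" shows "p * q \<in> laurent_on S"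
  unfolding laurent_on_def
proof clarify
  fix m v assume m: "m \<in> keys (p * q)" and v: "v \<in> keys m"
  have "m \<in> {a + b |a b. a \<in> keys p \<and> b \<in> keys q}"
    using subsetD[OF keys_mult m] .
  then obtain a b where "m = a + b" "a \<in> keys p" "b \<in> keys q" by auto
  moreover from this have "v \<in> keys a \<union> keys b" using v keys_add[of a b] by blast
  ultimately show "v \<in> S" using assms unfolding laurent_on_def by blast
qed

lemma laurent_on_const: "lconst c \<in> laurent_on S" "1 \<in> laurent_on S" "0 \<in> laurent_on S"
  using laurent_on_single[of 0 S 1] by (simp_all add: lconst_def laurent_on_single) (simp add: laurent_on_def)

lemma laurent_on_uminus: "p \<in> laurent_on S \<Longrightarrow> - p \<in> laurent_on S"
  by (simp add: laurent_on_def)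

lemma laurent_on_lvar: "v \<in> S \<Longrightarrow> lvar v \<in> laurent_on S"
  by (simp add: lvar_def laurent_on_single)

lemma laurent_on_power: "p \<in> laurent_on S \<Longrightarrow> p ^ k \<in> laurent_on S"
  by (induction k) (simp_all add: laurent_on_const laurent_on_mult)

lemma laurent_on_sum: "(\<And>i. i \<in> A \<Longrightarrow> f i \<in> laurent_on S) \<Longrightarrow> (\<Sum>i\<in>A. f i) \<in> laurent_on S"
  by (induction A rule: infinite_finite_induct) (simp_all add: laurent_on_const laurent_on_add)

lemma laurent_on_prod: "(\<And>i. i \<in> A \<Longrightarrow> f i \<in> laurent_on S) \<Longrightarrow> (\<Prod>i\<in>A. f i) \<in> laurent_on S"
  by (induction A rule: infinite_finite_induct) (simp_all add: laurent_on_const laurent_on_mult)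

lemma lconst_simps: "lconst (c + d) = lconst c + lconst d" "lconst (c * d) = lconst c * lconst d"
  "lconst 0 = 0" "lconst 1 = 1" "lconst (- c) = - lconst c"
  by (simp_all add: lconst_def single_add single_uminus)

lemma rconst_uminus: "rconst (- c) = - rconst c"
  using rconst_simps(1)[of c "- c"] by (simp add: eq_neg_iff_add_eq_0 add.commute)

section \<open>The cluster configuration space and the ring of F-polynomials\<close>

context dynkin
begin

abbreviation "LI \<equiv> laurent_on I"
abbreviation "LA \<equiv> calg_on lconst LI"
abbreviation "J \<equiv> Idl\<^bsub>LA\<^esub> (config_relation n B ` I)"

lemma calg_LA: "calg LA"
  by (rule calg_calg_on) (auto simp: lconst_simps laurent_on_const laurent_on_add laurent_on_mult)

lemma relation_LI: "\<gamma> \<in> I \<Longrightarrow> config_relation n B \<gamma> \<in> LI"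
  unfolding config_relation_def diff_conv_add_uminus
  by (intro laurent_on_add laurent_on_uminus laurent_on_prod laurent_on_power laurent_on_lvar laurent_on_const)

lemma J_ideal: "ideal J LA"
  using calg_LA relation_LI by (intro ring.genideal_ideal) (auto simp: calg_def cring.axioms(1))

lemma J_LI: "p \<in> J \<Longrightarrow> p \<in> LI"
  using ideal.Icarr[OF J_ideal] by simp

lemma J_add: "p \<in> J \<Longrightarrow> q \<in> J \<Longrightarrow> p + q \<in> J"
  using additive_subgroup.a_closed[OF ideal.axioms(1)[OF J_ideal]] by simp

lemma J_mult: "p \<in> J \<Longrightarrow> q \<in> LI \<Longrightarrow> q * p \<in> J"
  using ideal.I_l_closed[OF J_ideal] by simp

lemma J_0: "0 \<in> J"
  using additive_subgroup.zero_closed[OF ideal.axioms(1)[OF J_ideal]] by simp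

lemma J_uminus: "p \<in> J \<Longrightarrow> - p \<in> J"
  using J_mult[of p "- 1"] laurent_on_uminus[OF laurent_on_const(2)[of I]] by simp

lemma J_relation: "\<gamma> \<in> I \<Longrightarrow> config_relation n B \<gamma> \<in> J"
proof -
  have "config_relation n B ` I \<subseteq> carrier LA" using relation_LI by (simp only: calg_on_simps) blast
  moreover have "ring LA" using calg_LA by (simp add: calg_def cring.axioms(1))
  ultimately show "\<gamma> \<in> I \<Longrightarrow> config_relation n B \<gamma> \<in> J" using ring.genideal_self by blast
qed

section \<open>Congruence modulo the ideal of relations\<close>

definition congr :: "(nat \<times> nat) laurent \<Rightarrow> (nat \<times> nat) laurent \<Rightarrow> bool" (infix "\<simeq>\<^sub>J" 50) where
  "p \<simeq>\<^sub>J q \<longleftrightarrow> p - q \<in> J"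

lemma congr_refl: "p \<simeq>\<^sub>J p" by (simp add: congr_def J_0)

lemma congr_sym: "p \<simeq>\<^sub>J q \<Longrightarrow> q \<simeq>\<^sub>J p" using J_uminus[of "p - q"] by (simp add: congr_def)

lemma congr_trans: "p \<simeq>\<^sub>J q \<Longrightarrow> q \<simeq>\<^sub>J r \<Longrightarrow> p \<simeq>\<^sub>J r"
  using J_add[of "p - q" "q - r"] by (simp add: congr_def)

lemma congr_add: "p \<simeq>\<^sub>J p' \<Longrightarrow> q \<simeq>\<^sub>J q' \<Longrightarrow> p + q \<simeq>\<^sub>J p' + q'"
  using J_add[of "p - p'" "q - q'"] by (simp add: congr_def algebra_simps)

lemma congr_mult:
  assumes "p \<simeq>\<^sub>J p'" "q \<simeq>\<^sub>J q'" "p' \<in> LI" "q \<in> LI" shows "p * q \<simeq>\<^sub>J p' * q'"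
proof -
  have "q * (p - p') + p' * (q - q') \<in> J" using assms by (intro J_add J_mult) (simp_all add: congr_def)
  thus ?thesis by (simp add: congr_def algebra_simps)
qed

lemma congr_power: "p \<simeq>\<^sub>J q \<Longrightarrow> p \<in> LI \<Longrightarrow> q \<in> LI \<Longrightarrow> p ^ k \<simeq>\<^sub>J q ^ k"
  by (induction k) (simp_all add: congr_refl congr_mult laurent_on_power)

lemma congr_prod:
  "(\<And>i. i \<in> S \<Longrightarrow> f i \<simeq>\<^sub>J g i) \<Longrightarrow> (\<And>i. i \<in> S \<Longrightarrow> f i \<in> LI) \<Longrightarrow> (\<And>i. i \<in> S \<Longrightarrow> g i \<in> LI) \<Longrightarrow>
    (\<Prod>i\<in>S. f i) \<simeq>\<^sub>J (\<Prod>i\<in>S. g i)"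
  by (induction S rule: infinite_finite_induct) (simp_all add: congr_refl congr_mult laurent_on_prod)

text \<open>It sends \<open>lvar \<gamma>\<close> to \<open>U (sl \<gamma>)\<close> and will induce
  the isomorphism of the configuration ring with the ring of F-polynomials.\<close>

definition psi :: "(nat \<times> nat) laurent \<Rightarrow> ratfun" where
  "psi = lev rconst (\<lambda>m. MU (lookup m))"

lemma psi_hom: "laurent_hom rconst (\<lambda>m. MU (lookup m))"
proof
  show "MU (lookup (m + m')) = MU (lookup m) * MU (lookup m')" for m m'
  proof -
    have "lookup (m + m') = (\<lambda>\<gamma>. lookup m \<gamma> + lookup m' \<gamma>)"
      by (rule ext) simp
    thus ?thesis by (simp only: MU_add)
  qed
qed (simp_all add: MU_def)

lemmas psi_simps = laurent_hom.lev_add[OF psi_hom, folded psi_def] laurent_hom.lev_mult[OF psi_hom, folded psi_def]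
  laurent_hom.lev_diff[OF psi_hom, folded psi_def] laurent_hom.lev_1[OF psi_hom, folded psi_def]
  laurent_hom.lev_0[OF psi_hom, folded psi_def] laurent_hom.lev_const[OF psi_hom, folded psi_def]
  laurent_hom.lev_prod[OF psi_hom, folded psi_def] laurent_hom.lev_power[OF psi_hom, folded psi_def]

lemma MU_single: "\<gamma> \<in> I \<Longrightarrow> MU (lookup (frag_of \<gamma>)) = U (sl \<gamma>)"
proof -
  assume g: "\<gamma> \<in> I"
  have "MU (lookup (frag_of \<gamma>)) = (\<Prod>\<omega>\<in>I. if \<omega> = \<gamma> then U (sl \<omega>) else 1)"
    unfolding MU_def by (intro prod.cong) auto
  also have "\<dots> = U (sl \<gamma>)" using g finite_Pi by simp
  finally show ?thesis .
qed

lemma psi_lvar: "\<gamma> \<in> I \<Longrightarrow> psi (lvar \<gamma>) = U (sl \<gamma>)"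
  by (simp only: psi_def lvar_def laurent_hom.lev_single[OF psi_hom] rconst_simps MU_single mult_1)

lemma psi_J: "p \<in> J \<Longrightarrow> psi p = 0"
proof -
  interpret cring LA using calg_LA by (simp add: calg_def)
  have "ideal {p \<in> LI. psi p = 0} LA"
    by (rule ideal_calg_on[OF calg_LA])
      (auto simp: psi_simps laurent_on_const laurent_on_add laurent_on_mult)
  moreover have "psi (config_relation n B \<gamma>) = 0" if "\<gamma> \<in> I" for \<gamma>
    using U_relation[OF that] that by (simp add: config_relation_def psi_simps psi_lvar)
  ultimately have "J \<subseteq> {p \<in> LI. psi p = 0}" using relation_LI by (intro genideal_minimal) auto
  thus "p \<in> J \<Longrightarrow> psi p = 0" by auto
qed

text \<open>The monomials in the variables \<open>u\<^sub>\<gamma>\<close> correspond to the group generated by the elements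
  \<open>U (sl \<gamma>)\<close>; \<open>lift\<close> is the inverse isomorphism.\<close>

definition expvec :: "(nat \<times> nat \<Rightarrow> int) \<Rightarrow> (nat \<times> nat) \<Rightarrow>\<^sub>0 int" where
  "expvec e = (\<Sum>\<gamma>\<in>I. single \<gamma> (e \<gamma>))"

definition lift :: "ratfun \<Rightarrow> (nat \<times> nat) laurent" where
  "lift f = single (expvec (SOME e. MU e = f)) 1"

lemma lookup_expvec: "lookup (expvec e) \<gamma> = (if \<gamma> \<in> I then e \<gamma> else 0)"
proof -
  have "lookup (expvec e) \<gamma> = (\<Sum>\<omega>\<in>I. if \<omega> = \<gamma> then e \<gamma> else 0)"
    unfolding expvec_def lookup_sum by (intro sum.cong) auto
  thus ?thesis using finite_Pi by simp
qed

lemma lift_MU: "lift (MU e) = single (expvec e) 1"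
proof -
  define e' where "e' = (SOME e'. MU e' = MU e)"
  have "MU e' = MU e" unfolding e'_def by (rule someI[of "\<lambda>e'. MU e' = MU e" e]) (rule refl)
  hence "e' \<gamma> = e \<gamma>" if "\<gamma> \<in> I" for \<gamma> using MU_inj that by blast
  hence "expvec e' = expvec e" unfolding expvec_def by (intro sum.cong refl) simp
  thus ?thesis by (simp add: lift_def e'_def)
qed

lemma lift_LI: "lift f \<in> LI"
  unfolding lift_def by (rule laurent_on_single) (auto simp: in_keys_iff lookup_expvec split: if_splits)

lemma lift_mult: "f \<in> range MU \<Longrightarrow> g \<in> range MU \<Longrightarrow> lift (f * g) = lift f * lift g"
proof clarify
  fix e e'
  have "expvec (\<lambda>\<gamma>. e \<gamma> + e' \<gamma>) = expvec e + expvec e'" by (simp add: expvec_def single_add sum.distrib)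
  thus "lift (MU e * MU e') = lift (MU e) * lift (MU e')" by (simp add: lift_MU flip: MU_add)
qed

lemma lift_1: "lift 1 = 1"
  using lift_MU[of "\<lambda>_. 0"] by (simp add: MU_0 expvec_def)

lemma lift_power: "f \<in> range MU \<Longrightarrow> lift (f ^ k) = lift f ^ k"
  by (induction k) (simp_all add: lift_1 lift_mult MU_power_closed)

lemma lift_prod: "(\<And>i. i \<in> S \<Longrightarrow> f i \<in> range MU) \<Longrightarrow> lift (\<Prod>i\<in>S. f i) = (\<Prod>i\<in>S. lift (f i))"
  by (induction S rule: infinite_finite_induct) (simp_all add: lift_1 lift_mult MU_prod_closed)

lemma psi_lift: "f \<in> range MU \<Longrightarrow> psi (lift f) = f"
proof clarify
  fix e
  have "MU (lookup (expvec e)) = MU e" unfolding MU_def by (intro prod.cong) (simp_all add: lookup_expvec)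
  thus "psi (lift (MU e)) = MU e" by (simp add: lift_MU psi_def laurent_hom.lev_single[OF psi_hom])
qed

lemma lift_psi: "keys m \<subseteq> I \<Longrightarrow> lift (MU (lookup m)) = single m 1"
proof -
  assume "keys m \<subseteq> I"
  hence "expvec (lookup m) = m"
    by (intro poly_mapping_eqI) (auto simp: lookup_expvec in_keys_iff)
  thus ?thesis by (simp add: lift_MU)
qed

lemma lift_U: "\<gamma> \<in> I \<Longrightarrow> lift (U (sl \<gamma>)) = lvar \<gamma>"
  unfolding MU_single[symmetric] lvar_def by (rule lift_psi) simp

lemma lift_one_minus_U: "\<gamma> \<in> I \<Longrightarrow> lift (1 - U (sl \<gamma>)) = (\<Prod>\<omega>\<in>I. lvar \<omega> ^ compat n B \<omega> \<gamma>)"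
proof -
  assume g: "\<gamma> \<in> I"
  have "1 - U (sl \<gamma>) = (\<Prod>\<omega>\<in>I. U (sl \<omega>) ^ compat n B \<omega> \<gamma>)" using U_relation[OF g] by (simp add: algebra_simps)
  thus ?thesis by (simp add: lift_prod MU_power_closed U_closed lift_power lift_U)
qed

text \<open>It sends each \<open>y\<^sub>l\<close> to the monomial in the
  \<open>u\<^sub>\<gamma>\<close> that represents it, and the remaining variables to 1.\<close>

definition theta :: "nat laurent \<Rightarrow> (nat \<times> nat) laurent" where
  "theta = lev lconst (\<lambda>m. lift (\<Prod>l<n. rvar (n + l) powi lookup m (n + l)))"

lemma MU_powi_closed: "f \<in> range MU \<Longrightarrow> f powi e \<in> range MU"
  by (simp add: power_int_def MU_power_closed MU_inverse_closed)

lemma theta_closed: "(\<Prod>l<n. rvar (n + l) powi e l) \<in> range MU"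
  by (intro MU_prod_closed MU_powi_closed y_closed) simp

lemma theta_hom: "laurent_hom lconst (\<lambda>m. lift (\<Prod>l<n. rvar (n + l) powi lookup m (n + l)))"
  by unfold_locales (simp_all add: lconst_simps power_int_add prod.distrib
      lift_mult theta_closed lift_1)

lemmas theta_simps = laurent_hom.lev_add[OF theta_hom, folded theta_def] laurent_hom.lev_mult[OF theta_hom, folded theta_def]
  laurent_hom.lev_1[OF theta_hom, folded theta_def] laurent_hom.lev_0[OF theta_hom, folded theta_def]
  laurent_hom.lev_const[OF theta_hom, folded theta_def] laurent_hom.lev_prod[OF theta_hom, folded theta_def]
  laurent_hom.lev_power[OF theta_hom, folded theta_def]

lemma theta_LI: "theta p \<in> LI"
  unfolding theta_def lev_def by (intro laurent_on_sum laurent_on_mult laurent_on_const lift_LI)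

lemma theta_y: "l < n \<Longrightarrow> theta (lvar (n + l)) = lift (rvar (n + l))"
proof -
  assume l: "l < n"
  have "(\<Prod>k<n. rvar (n + k) powi lookup (frag_of (n + l)) (n + k)) = (\<Prod>k<n. if k = l then rvar (n + k) else 1)"
    by (intro prod.cong) auto
  thus ?thesis using l by (simp add: theta_def lvar_def laurent_hom.lev_single[OF theta_hom] lconst_simps)
qed

lemma psi_theta: "psi (theta p) = to_ratfun (set_ones (- {n..<2 * n}) p)"
proof -
  have "monomial (one_on (- {n..<2 * n})) m = (\<Prod>l<n. rvar (n + l) powi lookup m (n + l))" for m
  proof -
    have "monomial (one_on (- {n..<2 * n})) m =
        (\<Prod>i\<in>keys m \<union> {n..<2 * n}. one_on (- {n..<2 * n}) i powi lookup m i)"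
      by (rule monomial_superset) auto
    also have "\<dots> = (\<Prod>i\<in>{n..<2 * n}. rvar i powi lookup m i)"
      by (intro prod.mono_neutral_cong_right) auto
    also have "\<dots> = (\<Prod>l<n. rvar (n + l) powi lookup m (n + l))"
      by (rule prod.reindex_bij_witness[of _ "\<lambda>l. n + l" "\<lambda>i. i - n"]) auto
    finally show ?thesis .
  qed
  moreover have "psi (theta p) = (\<Sum>m\<in>keys p. rconst (lookup p m) *
      (\<Prod>l<n. rvar (n + l) powi lookup m (n + l)))"
    unfolding theta_def lev_def laurent_hom.lev_sum[OF psi_hom, folded psi_def]
    by (simp add: psi_simps psi_lift theta_closed)
  ultimately show ?thesis by (simp add: to_ratfun_set_ones ev_def lev_def)
qed

lemma theta_set_ones: "theta (set_ones (- {n..<2 * n}) p) = theta p"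
proof -
  have *: "lookup (Poly_Mapping.mapp (\<lambda>i e. if i \<in> - {n..<2 * n} then 0 else e) m) (n + l) =
      lookup m (n + l)" if "l < n" for m l
    using that by (auto simp: mapp.rep_eq in_keys_iff)
  have "(\<Prod>l<n. rvar (n + l) powi lookup (Poly_Mapping.mapp (\<lambda>i e. if i \<in> - {n..<2 * n} then 0 else e) m) (n + l)) =
      (\<Prod>l<n. rvar (n + l) powi lookup m (n + l))" for m
    by (intro prod.cong refl, subst *) auto
  thus ?thesis
    unfolding set_ones_def theta_def laurent_hom.lev_sum[OF theta_hom] laurent_hom.lev_single[OF theta_hom]
    by (simp only: lev_def)
qed

definition Fhat :: "nat \<Rightarrow> nat laurent" where "Fhat q = set_ones {..<n} (L q)"

lemma Fhat_mesh: "Fhat q * Fhat (q + n) = A q lvar + Q q lvar * nbprod q Fhat"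
  using F_mesh[of q] unfolding to_ratfun_eq_iff[symmetric] by (simp add: F_L Fhat_def)

lemma A_Q_closed: "A q rvar \<in> range MU" "Q q rvar \<in> range MU"
  unfolding A_Q by (intro MU_prod_closed MU_power_closed y_closed; simp)+

lemma theta_A_Q: "theta (A q lvar) = lift (A q rvar)" "theta (Q q lvar) = lift (Q q rvar)"
proof -
  have *: "theta (\<Prod>l<n. lvar (n + l) ^ e l) = lift (\<Prod>l<n. rvar (n + l) ^ e l)" for e
  proof -
    have "theta (\<Prod>l<n. lvar (n + l) ^ e l) = (\<Prod>l<n. lift (rvar (n + l) ^ e l))"
      unfolding theta_simps by (intro prod.cong refl) (simp add: theta_y lift_power y_closed)
    thus ?thesis by (subst lift_prod) (auto simp: MU_power_closed y_closed)
  qed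
  show "theta (A q lvar) = lift (A q rvar)" "theta (Q q lvar) = lift (Q q rvar)" unfolding A_Q by (rule *)+
qed

lemma P_closed: "nbprod q F \<in> range MU"
  by (intro MU_prod_closed MU_power_closed F_closed)

lemma lift_P: "lift (nbprod q F) =
    nbprod q (\<lambda>s. lift (F s))"
  by (simp add: lift_prod lift_power F_closed MU_power_closed)

text \<open>\<open>F\<close> lifts in two ways: as a polynomial in the lifted \<open>y\<close>, and
  as a monomial in the \<open>u\<^sub>\<gamma>\<close>. The mesh relation for the former has two
  summands, the shares \<open>lift (1 - U r)\<close> and \<open>lift (U r)\<close> of the wanted
  product, and modulo the relations these shares add up to 1.\<close>

lemma theta_Fhat: "theta (Fhat q) \<simeq>\<^sub>J lift (F q)"
proof (induction q rule: mesh_induct)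
  case (initial q)
  hence "to_ratfun (Fhat q) = 1" using F_initial[of q] by (simp only: F_L Fhat_def)
  hence "Fhat q = 1" by (metis to_ratfun_eq_iff to_ratfun_simps(3))
  thus ?case using initial by (simp add: theta_simps F_initial lift_1 congr_refl)
next
  case (step r)
  define q where "q = r + n"
  obtain \<gamma> where g: "\<gamma> \<in> I" "X r = X (sl \<gamma>)" using X_rep by blast
  note Ug = U_X[OF g(2)]
  let ?P = "nbprod r F"
  let ?lF = "lift (F r) * lift (F q)"
  have lA: "lift (A r rvar) = lift (1 - U r) * ?lF"
  proof -
    have c: "1 - U r \<in> range MU" unfolding one_minus_U
      by (intro MU_divide_closed MU_mult_closed A_Q_closed F_closed)
    have "lift (A r rvar) = lift ((1 - U r) * (F r * F q))" by (simp only: U_F(2) q_def)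
    also have "\<dots> = lift (1 - U r) * ?lF"
      by (simp only: lift_mult[OF c MU_mult_closed[OF F_closed F_closed]] lift_mult[OF F_closed F_closed])
    finally show ?thesis .
  qed
  have lQ: "lift (Q r rvar) * lift ?P = lift (U r) * ?lF"
  proof -
    have "lift (Q r rvar) * lift ?P = lift (U r * (F r * F q))"
      by (simp only: U_F(1) q_def lift_mult[OF A_Q_closed(2) P_closed])
    thus ?thesis
      by (simp only: lift_mult[OF U_closed MU_mult_closed[OF F_closed F_closed]] lift_mult[OF F_closed F_closed])
  qed
  have c1: "theta (Fhat r) * theta (Fhat q) =
      lift (A r rvar) + lift (Q r rvar) * nbprod r (\<lambda>s. theta (Fhat s))"
    using arg_cong[OF Fhat_mesh[of r], of theta] by (simp add: q_def theta_simps theta_A_Q)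
  have c2: "lift (A r rvar) + lift (Q r rvar) * nbprod r (\<lambda>s. theta (Fhat s))
      \<simeq>\<^sub>J lift (A r rvar) + lift (Q r rvar) * lift ?P"
  proof -
    have "nbprod r (\<lambda>s. theta (Fhat s)) \<simeq>\<^sub>J lift ?P"
      unfolding lift_P
    proof (rule congr_prod)
      fix j assume j: "j \<in> {..<n} - {kk r}"
      hence "theta (Fhat (slot r j)) \<simeq>\<^sub>J lift (F (slot r j))" by (intro step(2)) simp
      thus "theta (Fhat (slot r j)) ^ nat (- a j (kk r)) \<simeq>\<^sub>J lift (F (slot r j)) ^ nat (- a j (kk r))"
        by (rule congr_power[OF _ theta_LI lift_LI])
    qed (rule laurent_on_power[OF theta_LI] laurent_on_power[OF lift_LI])+
    thus ?thesis
      by (intro congr_add[OF congr_refl] congr_mult[OF congr_refl _ lift_LI] laurent_on_prod laurent_on_power theta_LI)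
  qed
  have c3: "lift (A r rvar) + lift (Q r rvar) * lift ?P = (lift (1 - U r) + lift (U r)) * ?lF"
    unfolding lA lQ by (simp add: algebra_simps)
  have 1: "theta (Fhat r) * theta (Fhat q) \<simeq>\<^sub>J (lift (1 - U r) + lift (U r)) * ?lF"
    using c2 unfolding c1 c3 .
  \<comment> \<open>This is where the defining relation of the configuration space is used.\<close>
  have "lift (1 - U r) + lift (U r) \<simeq>\<^sub>J 1"
    using J_relation[OF g(1)] by (simp add: congr_def Ug lift_U[OF g(1)] lift_one_minus_U[OF g(1)] config_relation_def algebra_simps)
  hence "(lift (1 - U r) + lift (U r)) * ?lF \<simeq>\<^sub>J 1 * ?lF"
    by (rule congr_mult[OF _ congr_refl laurent_on_const(2) laurent_on_mult[OF lift_LI lift_LI]])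
  from congr_trans[OF 1 this] have 2: "theta (Fhat r) * theta (Fhat q) \<simeq>\<^sub>J ?lF" by simp
  have "lift (F r) * theta (Fhat q) \<simeq>\<^sub>J theta (Fhat r) * theta (Fhat q)"
    by (rule congr_mult[OF congr_sym[OF step(1)] congr_refl theta_LI theta_LI])
  from congr_trans[OF this 2] have 3: "lift (inverse (F r)) * (lift (F r) * theta (Fhat q)) \<simeq>\<^sub>J lift (inverse (F r)) * ?lF"
    by (rule congr_mult[OF congr_refl _ lift_LI laurent_on_mult[OF lift_LI theta_LI]])
  have "lift (inverse (F r)) * lift (F r) = 1"
    using lift_mult[of "inverse (F r)" "F r"] by (simp add: F_closed MU_inverse_closed lift_1)
  thus ?case using 3 by (simp add: mult.assoc[symmetric] q_def)
qed

text \<open>Up to relations, every element of the configuration ring becomes an element of the image of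
  \<open>theta\<close> after multiplication by a suitable monomial; and \<open>psi\<close> is injective on that image.\<close>

definition theta_frac :: "(nat \<times> nat) laurent \<Rightarrow> bool" where
  "theta_frac p \<longleftrightarrow> p \<in> LI \<and> (\<exists>f\<in>range MU. \<exists>p1 p2. theta p1 \<simeq>\<^sub>J lift f \<and> p * lift f \<simeq>\<^sub>J theta p2)"

lemma theta_fracI: "p \<in> LI \<Longrightarrow> f \<in> range MU \<Longrightarrow> theta p1 \<simeq>\<^sub>J lift f \<Longrightarrow> p * lift f \<simeq>\<^sub>J theta p2 \<Longrightarrow> theta_frac p"
  unfolding theta_frac_def by blast

lemma theta_frac_ops:
  assumes "theta_frac p" "theta_frac q" shows "theta_frac (p + q)" "theta_frac (p * q)"
proof -
  obtain f p1 p2 where p: "p \<in> LI" "f \<in> range MU" "theta p1 \<simeq>\<^sub>J lift f" "p * lift f \<simeq>\<^sub>J theta p2"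
    using assms(1) unfolding theta_frac_def by blast
  obtain g q1 q2 where q: "q \<in> LI" "g \<in> range MU" "theta q1 \<simeq>\<^sub>J lift g" "q * lift g \<simeq>\<^sub>J theta q2"
    using assms(2) unfolding theta_frac_def by blast
  have fg: "f * g \<in> range MU" "theta (p1 * q1) \<simeq>\<^sub>J lift (f * g)"
    using p q by (auto simp: theta_simps lift_mult MU_mult_closed intro!: congr_mult lift_LI theta_LI)
  have "(p * lift f) * lift g + (q * lift g) * lift f \<simeq>\<^sub>J theta p2 * theta q1 + theta q2 * theta p1"
    using p q by (intro congr_add congr_mult congr_sym[OF p(3)] congr_sym[OF q(3)] theta_LI lift_LI)
  hence "(p + q) * lift (f * g) \<simeq>\<^sub>J theta (p2 * q1 + q2 * p1)"
    using p q by (simp add: theta_simps lift_mult algebra_simps)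
  thus "theta_frac (p + q)" using p(1) q(1) fg by (intro theta_fracI) (auto simp: laurent_on_add)
  have "(p * lift f) * (q * lift g) \<simeq>\<^sub>J theta p2 * theta q2"
    using p q by (intro congr_mult theta_LI laurent_on_mult lift_LI)
  hence "(p * q) * lift (f * g) \<simeq>\<^sub>J theta (p2 * q2)"
    using p q by (simp add: theta_simps lift_mult algebra_simps)
  thus "theta_frac (p * q)" using p(1) q(1) fg by (intro theta_fracI) (auto simp: laurent_on_mult)
qed

lemma theta_frac_const: "theta_frac (lconst c)"
  by (rule theta_fracI[of _ 1 1 "lconst c"])
    (simp_all add: laurent_on_const MU_1_closed theta_simps lift_1 congr_refl)

text \<open>\<open>U q\<close> is the quotient of \<open>Q q rvar * nbprod q F\<close> by
  \<open>F q * F (q + n)\<close>, and by \<open>theta_Fhat\<close> the lifts of both are congruent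
  to elements of the image of \<open>theta\<close>.\<close>

lemma theta_frac_U: "theta_frac (lift (U q))" "theta_frac (lift (inverse (U q)))"
proof -
  let ?P = "nbprod q F"
  let ?Ph = "nbprod q Fhat"
  have FF: "theta (Fhat q * Fhat (q + n)) \<simeq>\<^sub>J lift (F q * F (q + n))"
    by (simp add: theta_simps lift_mult F_closed congr_mult theta_Fhat lift_LI theta_LI)
  have QP: "theta (Q q lvar * ?Ph) \<simeq>\<^sub>J lift (Q q rvar * ?P)"
    by (simp add: theta_simps theta_A_Q lift_mult P_closed A_Q_closed lift_P)
      (intro congr_mult congr_prod congr_power congr_refl theta_Fhat theta_LI lift_LI laurent_on_prod laurent_on_power)
  have "lift (U q) * lift (F q * F (q + n)) = lift (Q q rvar * ?P)"
    by (simp add: U_closed F_closed MU_mult_closed flip: lift_mult U_F(1))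
  thus "theta_frac (lift (U q))"
    using congr_sym[OF QP] FF by (intro theta_fracI[of _ "F q * F (q + n)"]) (auto intro: lift_LI MU_mult_closed F_closed)
  have "inverse (U q) * (Q q rvar * ?P) = F q * F (q + n)" by (simp flip: U_F(1))
  hence "lift (inverse (U q)) * lift (Q q rvar * ?P) = lift (F q * F (q + n))"
    using lift_mult[of "inverse (U q)" "Q q rvar * ?P"] MU_inverse_closed[OF U_closed] MU_mult_closed[OF A_Q_closed(2) P_closed] by simp
  thus "theta_frac (lift (inverse (U q)))"
    using congr_sym[OF FF] QP by (intro theta_fracI[of _ "Q q rvar * ?P"]) (auto intro: lift_LI MU_mult_closed P_closed A_Q_closed)
qed

lemma theta_frac_LI:
  assumes "p \<in> LI" shows "theta_frac p"
proof -
  have 1: "theta_frac 1" using theta_frac_const[of 1] by (simp add: lconst_simps)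
  have pw: "theta_frac (x ^ k)" if "theta_frac x" for x k
    by (induction k) (simp_all add: 1 theta_frac_ops that)
  have "theta_frac (lift (U q powi e))" for q e
    using pw[OF theta_frac_U(1)[of q], of "nat e"] pw[OF theta_frac_U(2)[of q], of "nat (- e)"]
    by (simp add: power_int_def lift_power U_closed MU_inverse_closed)
  hence "theta_frac (lift (\<Prod>\<gamma>\<in>S. U (sl \<gamma>) powi e \<gamma>))" for S e
    by (induction S rule: infinite_finite_induct)
      (simp_all add: lift_1 1 lift_mult theta_frac_ops MU_prod_closed MU_powi_closed U_closed)
  hence mon: "theta_frac (lift (MU e))" for e by (simp add: MU_def)
  have "theta_frac (single m c)" if "keys m \<subseteq> I" for m c
    using theta_frac_ops(2)[OF theta_frac_const[of c] mon[of "lookup m"]] lift_psi[OF that]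
    by (simp add: lconst_def)
  hence "theta_frac (\<Sum>m\<in>S. single m (lookup p m))" if "S \<subseteq> keys p" for S
    using that assms theta_frac_const[of 0]
    by (induction S rule: infinite_finite_induct) (auto simp: theta_frac_ops lconst_simps laurent_on_def)
  from this[OF subset_refl] show ?thesis by (simp add: poly_mapping_sum_single)
qed

theorem kernel_psi: "J = {p \<in> LI. psi p = 0}"
proof
  show "J \<subseteq> {p \<in> LI. psi p = 0}" using psi_J J_LI by auto
  show "{p \<in> LI. psi p = 0} \<subseteq> J"
  proof clarify
    fix p assume p: "p \<in> LI" "psi p = 0"
    obtain f p1 p2 where f: "f \<in> range MU" "p * lift f \<simeq>\<^sub>J theta p2"
      using theta_frac_LI[OF p(1)] unfolding theta_frac_def by blast
    have "psi (theta p2) = 0" using psi_J[of "p * lift f - theta p2"] f(2) p(2) by (simp add: congr_def psi_simps)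
    hence "set_ones (- {n..<2 * n}) p2 = 0" by (simp add: psi_theta)
    hence "theta p2 = 0" using theta_set_ones[of p2] by (simp add: theta_simps)
    hence "p * lift f \<in> J" using f(2) by (simp add: congr_def)
    hence "lift (inverse f) * (p * lift f) \<in> J" by (rule J_mult[OF _ lift_LI])
    moreover have "lift (inverse f) * lift f = 1"
      using f(1) lift_mult[of "inverse f" f] by (auto simp: MU_inverse_closed lift_1)
    ultimately show "p \<in> J" by (simp add: mult.left_commute)
  qed
qed

section \<open>The image of \<open>psi\<close>\<close>

abbreviation "Fgens \<equiv> (\<Union>\<gamma>\<in>I. {F_poly n B \<gamma>, inverse (F_poly n B \<gamma>)}) \<union> (\<Union>i<n. {rvar (n + i), inverse (rvar (n + i))})"
abbreviation "FR \<equiv> subalg_gen rconst Fgens"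

lemma F_poly_eq: "\<gamma> \<in> I \<Longrightarrow> F_poly n B \<gamma> = F (sl \<gamma>)"
  using xvar_prin[OF Pi_snd] by (simp add: F_poly_def set_one_eq F_L L_def)

lemma subalg_prod: "(\<And>i. i \<in> S \<Longrightarrow> f i \<in> subalg_gen rconst G) \<Longrightarrow> (\<Prod>i\<in>S. f i) \<in> subalg_gen rconst G"
  using subalg_gen.const[of rconst 1 G]
  by (induction S rule: infinite_finite_induct) (auto intro: subalg_gen.mult)

lemma subalg_power: "f \<in> subalg_gen rconst G \<Longrightarrow> f ^ k \<in> subalg_gen rconst G"
  using subalg_prod[of "{..<k}" "\<lambda>_. f"] by simp

lemma F_FR: "F q \<in> FR" "inverse (F q) \<in> FR"
proof -
  obtain \<gamma> where "\<gamma> \<in> I" "X q = X (sl \<gamma>)" using X_rep by blast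
  hence "F q = F_poly n B \<gamma>" "\<gamma> \<in> I" using F_X F_poly_eq by metis+
  thus "F q \<in> FR" "inverse (F q) \<in> FR" by (auto intro!: subalg_gen.gen)
qed

lemma y_FR: "l < n \<Longrightarrow> rvar (n + l) \<in> FR" "l < n \<Longrightarrow> inverse (rvar (n + l)) \<in> FR"
  by (auto intro!: subalg_gen.gen)

lemma U_FR: "U q \<in> FR" "inverse (U q) \<in> FR"
proof -
  let ?P = "nbprod q F"
  have Q: "Q q rvar \<in> FR" "inverse (Q q rvar) \<in> FR"
    unfolding A_Q prod_inversef[symmetric] comp_def power_inverse[symmetric]
    by (intro subalg_prod subalg_power y_FR; simp)+
  have P: "?P \<in> FR" "inverse ?P \<in> FR"
    unfolding prod_inversef[symmetric] comp_def power_inverse[symmetric]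
    by (intro subalg_prod subalg_power F_FR)+
  have "U q = Q q rvar * ?P * (inverse (F q) * inverse (F (q + n)))"
    "inverse (U q) = inverse (Q q rvar) * inverse ?P * (F q * F (q + n))"
    unfolding U_eq by (simp_all add: divide_inverse)
  thus "U q \<in> FR" "inverse (U q) \<in> FR" using Q P F_FR by (auto intro!: subalg_gen.mult)
qed

lemma MU_FR: "f \<in> range MU \<Longrightarrow> f \<in> FR"
proof clarify
  fix e
  show "MU e \<in> FR" unfolding MU_def power_int_def
    by (intro subalg_prod) (simp add: subalg_power U_FR)
qed

lemma psi_FR: "psi p \<in> FR"
proof -
  have "(\<Sum>m\<in>S. rconst (c m) * MU (lookup m)) \<in> FR" for S c
    using subalg_gen.const[of rconst 0 Fgens]
    by (induction S rule: infinite_finite_induct)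
      (auto intro: subalg_gen.add subalg_gen.mult[OF subalg_gen.const MU_FR[OF rangeI]])
  thus ?thesis by (simp add: psi_def lev_def)
qed

lemma psi_image: "psi ` LI = FR"
proof
  show "psi ` LI \<subseteq> FR" using psi_FR by auto
  show "FR \<subseteq> psi ` LI"
  proof
    fix f assume "f \<in> FR"
    thus "f \<in> psi ` LI"
    proof induction
      case (const c)
      thus ?case using psi_simps(6)[of c] laurent_on_const(1) by (metis image_eqI)
    next
      case (gen g)
      hence "g \<in> range MU" by (auto simp: F_poly_eq intro: F_closed y_closed MU_inverse_closed)
      thus ?case using psi_lift lift_LI by (metis image_eqI)
    next
      case (add f g)
      thus ?case by (auto simp flip: psi_simps(1) intro!: laurent_on_add)
    next
      case (mult f g)
      thus ?case by (auto simp flip: psi_simps(2) intro!: laurent_on_mult)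
    qed
  qed
qed

lemma F_ring_simps: "carrier (F_ring n B) = FR" "x \<otimes>\<^bsub>F_ring n B\<^esub> y = x * y" "x \<oplus>\<^bsub>F_ring n B\<^esub> y = x + y"
  "\<one>\<^bsub>F_ring n B\<^esub> = 1" "\<zero>\<^bsub>F_ring n B\<^esub> = 0" "c \<odot>\<^bsub>F_ring n B\<^esub> x = rconst c * x"
  by (simp_all add: F_ring_def)

lemma calg_F_ring: "calg (F_ring n B)"
  unfolding F_ring_def
  by (rule calg_calg_on) (auto simp: rconst_uminus[of 1, simplified ] intro: subalg_gen.intros)

theorem config_ring_iso: "calg (config_ring n B)" "calg_isomorphic (config_ring n B) (F_ring n B)"
proof -
  have "calg (calg_quot LA J) \<and> calg_isomorphic (calg_quot LA J) (F_ring n B)"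
  proof (intro conjI; rule calg_quot_iso[of LA "F_ring n B" psi])
    show "psi ` carrier LA = carrier (F_ring n B)" "psi ` carrier LA = carrier (F_ring n B)"
      using psi_image by (simp_all add: F_ring_def)
  qed (use psi_FR calg_LA calg_F_ring in \<open>simp_all add: kernel_psi psi_simps F_ring_def\<close>)
  thus "calg (config_ring n B)" "calg_isomorphic (config_ring n B) (F_ring n B)"
    by (simp_all add: config_ring_def Let_def)
qed

end


section \<open>Functions on a basic open subset\<close>

text \<open>A subalgebra of a field together with the basic open set where \<open>f\<close> does not
  vanish. All local rings embed into the field, so sections over this set can be treated as elements
  of the field.\<close>

locale domain_alg =
  fixes S :: "ratfun set" and f :: ratfun
  assumes const: "rconst c \<in> S" and add: "a \<in> S \<Longrightarrow> b \<in> S \<Longrightarrow> a + b \<in> S"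
    and mult: "a \<in> S \<Longrightarrow> b \<in> S \<Longrightarrow> a * b \<in> S" and f: "f \<in> S" "f \<noteq> 0"
begin

abbreviation "A \<equiv> calg_on rconst S"

lemma calg_A: "calg A"
proof (rule calg_calg_on)
  show "rconst (- 1) = - 1" using rconst_simps(1)[of 1 "-1"] by (simp add: eq_neg_iff_add_eq_0 add.commute)
qed (auto simp: const add mult)

lemma one: "1 \<in> S" using const[of 1] by simp

lemma zero: "0 \<in> S" using const[of 0] by simp

lemma power: "a \<in> S \<Longrightarrow> a ^ k \<in> S" by (induction k) (simp_all add: one mult)

lemma specD:
  assumes "p \<in> spec_points A"
  shows "p \<subseteq> S" "0 \<in> p" "a \<in> p \<Longrightarrow> b \<in> p \<Longrightarrow> a + b \<in> p" "a \<in> p \<Longrightarrow> s \<in> S \<Longrightarrow> s * a \<in> p"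
    "a \<in> S \<Longrightarrow> b \<in> S \<Longrightarrow> a * b \<in> p \<Longrightarrow> a \<in> p \<or> b \<in> p" "1 \<notin> p"
proof -
  interpret primeideal p A using assms by (simp add: spec_points_def)
  show "p \<subseteq> S" using Icarr by auto
  show "0 \<in> p" using additive_subgroup.zero_closed[OF is_additive_subgroup] by simp
  show "a \<in> p \<Longrightarrow> b \<in> p \<Longrightarrow> a + b \<in> p" using additive_subgroup.a_closed[OF is_additive_subgroup] by simp
  show "a \<in> p \<Longrightarrow> s \<in> S \<Longrightarrow> s * a \<in> p" using I_l_closed by simp
  show "a \<in> S \<Longrightarrow> b \<in> S \<Longrightarrow> a * b \<in> p \<Longrightarrow> a \<in> p \<or> b \<in> p" using I_prime by simp
  show "1 \<notin> p" using one_imp_carrier I_notcarr by auto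
qed

lemma specI:
  assumes p: "p \<subseteq> S" "0 \<in> p" "\<And>a b. a \<in> p \<Longrightarrow> b \<in> p \<Longrightarrow> a + b \<in> p" "\<And>a s. a \<in> p \<Longrightarrow> s \<in> S \<Longrightarrow> s * a \<in> p"
    and prime: "\<And>a b. a \<in> S \<Longrightarrow> b \<in> S \<Longrightarrow> a * b \<in> p \<Longrightarrow> a \<in> p \<or> b \<in> p" and 1: "1 \<notin> p"
  shows "p \<in> spec_points A"
proof -
  have "ideal p A" using calg_A p by (rule ideal_calg_on)
  hence "primeideal p A"
    by (rule primeidealI) (use calg_A prime 1 one in \<open>auto simp: calg_def\<close>)
  thus ?thesis by (simp add: spec_points_def)
qed

lemma power_notin: "p \<in> spec_points A \<Longrightarrow> a \<in> S \<Longrightarrow> a \<notin> p \<Longrightarrow> a ^ k \<notin> p"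
  by (induction k) (auto simp: specD(6) dest: specD(5)[rotated 3] simp: power)

text \<open>The class of a fraction in the local ring, described by its value \<open>z\<close> in
  the field.\<close>

definition lf :: "ratfun set \<Rightarrow> ratfun \<Rightarrow> (ratfun \<times> ratfun) set" where
  "lf p z = {(c, d). c \<in> S \<and> d \<in> S - p \<and> c = z * d}"

lemma loc_frac_eq:
  assumes p: "p \<in> spec_points A" and ab: "a \<in> S" "b \<in> S" "b \<notin> p"
  shows "loc_frac A p a b = lf p (a / b)"
proof -
  have z: "0 \<in> p" by (rule specD(2)[OF p])
  have "(\<exists>t\<in>S - p. t * (a * d) = t * (c * b)) \<longleftrightarrow> c = a / b * d" for c d
  proof
    assume "\<exists>t\<in>S - p. t * (a * d) = t * (c * b)"
    then obtain t where "t \<notin> p" "t * (a * d) = t * (c * b)" by auto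
    thus "c = a / b * d" using z ab(3) by auto
  next
    assume c: "c = a / b * d"
    have "1 * (a * d) = 1 * (c * b)" using z ab(3) unfolding c by auto
    thus "\<exists>t\<in>S - p. t * (a * d) = t * (c * b)" using one specD(6)[OF p] by blast
  qed
  thus ?thesis by (auto simp: loc_frac_def lf_def)
qed

lemma lf_inj: "p \<in> spec_points A \<Longrightarrow> (c, d) \<in> lf p z \<Longrightarrow> z = c / d"
  using specD(2)[of p] by (auto simp: lf_def)

lemma zero_prime: "{0} \<in> spec_points A"
  by (rule specI) (auto simp: zero)

text \<open>The zero ideal is the generic point. There the local fractions of a section can be
  compared with each other.\<close>

lemma open_zero_prime:
  assumes "openin (zariski A) V" "V \<noteq> {}" shows "{0} \<in> V"
proof -
  have "generate_topology_on {{p \<in> spec_points A. g \<notin> p} |g. g \<in> carrier A} V"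
    using assms(1) by (simp add: zariski_def openin_topology_generated_by_iff)
  hence "V \<noteq> {} \<longrightarrow> {0} \<in> V"
  proof induction
    case (Basis V)
    then obtain g where g: "V = {p \<in> spec_points A. g \<notin> p}" by auto
    thus ?case using zero_prime specD(2) by auto
  qed auto
  thus ?thesis using assms(2) by simp
qed

definition W :: "ratfun set set" where "W = {p \<in> spec_points A. f \<notin> p}"

lemma W_open: "openin (zariski A) W"
  unfolding W_def zariski_def using f(1) by (intro topology_generated_by_Basis) auto

lemma zero_W: "{0} \<in> W"
  using zero_prime f(2) by (simp add: W_def)

definition R0 :: "ratfun set" where "R0 = {a / f ^ k |a k. a \<in> S}"

lemma R0_I: "a \<in> S \<Longrightarrow> a / f ^ k \<in> R0"
  by (auto simp: R0_def)

lemma S_R0: "a \<in> S \<Longrightarrow> a \<in> R0"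
  using R0_I[of a 0] by simp

lemma inverse_f_R0: "inverse f \<in> R0"
  using R0_I[OF one, of 1] by (simp add: divide_inverse)

lemma R0_add: "x \<in> R0 \<Longrightarrow> y \<in> R0 \<Longrightarrow> x + y \<in> R0"
proof -
  assume "x \<in> R0" "y \<in> R0"
  then obtain a k c l where "x = a / f ^ k" "a \<in> S" "y = c / f ^ l" "c \<in> S" by (auto simp: R0_def)
  thus ?thesis using R0_I[of "a * f ^ l + c * f ^ k" "k + l"] f
    by (simp add: add mult power add_divide_distrib power_add)
qed

lemma R0_mult: "x \<in> R0 \<Longrightarrow> y \<in> R0 \<Longrightarrow> x * y \<in> R0"
proof -
  assume "x \<in> R0" "y \<in> R0"
  then obtain a k c l where "x = a / f ^ k" "a \<in> S" "y = c / f ^ l" "c \<in> S" by (auto simp: R0_def)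
  thus ?thesis using R0_I[of "a * c" "k + l"] by (simp add: mult power_add)
qed

text \<open>An ideal that is maximal among those containing \<open>a\<close> and no power of
  \<open>f\<close> is prime.\<close>

lemma prime_avoiding:
  assumes a: "a \<subseteq> S" "0 \<in> a" "\<And>x y. x \<in> a \<Longrightarrow> y \<in> a \<Longrightarrow> x + y \<in> a" "\<And>x s. x \<in> a \<Longrightarrow> s \<in> S \<Longrightarrow> s * x \<in> a"
    and nf: "\<And>k. f ^ k \<notin> a"
  obtains p where "p \<in> W" "a \<subseteq> p"
proof -
  define ids where "ids = {p. a \<subseteq> p \<and> p \<subseteq> S \<and> (\<forall>x\<in>p. \<forall>y\<in>p. x + y \<in> p) \<and> (\<forall>x\<in>p. \<forall>s\<in>S. s * x \<in> p) \<and> (\<forall>k. f ^ k \<notin> p)}"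
  have "\<exists>M\<in>ids. \<forall>X\<in>ids. M \<subseteq> X \<longrightarrow> X = M"
  proof (rule subset_Zorn_nonempty)
    have "a \<in> ids" unfolding ids_def using a nf by blast
    thus "ids \<noteq> {}" by blast
    fix C assume C: "C \<noteq> {}" "subset.chain ids C"
    hence sub: "C \<subseteq> ids" and ch: "\<And>p q. p \<in> C \<Longrightarrow> q \<in> C \<Longrightarrow> p \<subseteq> q \<or> q \<subseteq> p"
      by (auto simp: subset_chain_def)
    have el: "a \<subseteq> p" "p \<subseteq> S" "\<And>x y. x \<in> p \<Longrightarrow> y \<in> p \<Longrightarrow> x + y \<in> p" "\<And>x s. x \<in> p \<Longrightarrow> s \<in> S \<Longrightarrow> s * x \<in> p"
      "\<And>k. f ^ k \<notin> p" if "p \<in> C" for p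
      using subsetD[OF sub that] unfolding ids_def by blast+
    have "x + y \<in> \<Union>C" if xy: "x \<in> \<Union>C" "y \<in> \<Union>C" for x y
    proof -
      obtain p q where pq: "p \<in> C" "x \<in> p" "q \<in> C" "y \<in> q" using xy by auto
      then obtain r where "r \<in> C" "x \<in> r" "y \<in> r" using ch[of p q] by blast
      thus ?thesis using el(3) by blast
    qed
    moreover have "s * x \<in> \<Union>C" if "x \<in> \<Union>C" "s \<in> S" for x s using that el(4) by blast
    moreover have "a \<subseteq> \<Union>C" using C(1) el(1) by blast
    moreover have "\<Union>C \<subseteq> S" "\<And>k. f ^ k \<notin> \<Union>C" using el(2,5) by blast+
    ultimately show "\<Union>C \<in> ids" unfolding ids_def by blast
  qed
  then obtain M where M: "M \<in> ids" and max: "\<And>X. X \<in> ids \<Longrightarrow> M \<subseteq> X \<Longrightarrow> X = M" by blast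
  have M': "a \<subseteq> M" "M \<subseteq> S" "\<And>x y. x \<in> M \<Longrightarrow> y \<in> M \<Longrightarrow> x + y \<in> M" "\<And>x s. x \<in> M \<Longrightarrow> s \<in> S \<Longrightarrow> s * x \<in> M"
    "\<And>k. f ^ k \<notin> M" using M by (auto simp: ids_def)
  have ext: "\<exists>k m s. m \<in> M \<and> s \<in> S \<and> f ^ k = m + s * c" if c: "c \<in> S" "c \<notin> M" for c
  proof (rule ccontr)
    assume no: "\<not> ?thesis"
    define X where "X = {m + s * c |m s. m \<in> M \<and> s \<in> S}"
    have sub: "M \<subseteq> X" using zero by (force simp: X_def)
    have "x + y \<in> X" if xy: "x \<in> X" "y \<in> X" for x y
    proof -
      obtain m s m' s' where "x = m + s * c" "m \<in> M" "s \<in> S" "y = m' + s' * c" "m' \<in> M" "s' \<in> S"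
        using xy by (auto simp: X_def)
      thus ?thesis unfolding X_def
        by (intro CollectI exI[of _ "m + m'"] exI[of _ "s + s'"]) (simp add: M'(3) add algebra_simps)
    qed
    moreover have "t * x \<in> X" if xt: "x \<in> X" "t \<in> S" for x t
    proof -
      obtain m s where ms: "x = m + s * c" "m \<in> M" "s \<in> S" using xt(1) by (auto simp: X_def)
      have "t * x = t * m + (t * s) * c" unfolding ms(1) by (simp add: algebra_simps)
      thus ?thesis unfolding X_def using M'(4)[OF ms(2) xt(2)] mult[OF xt(2) ms(3)] by blast
    qed
    moreover have "X \<subseteq> S" unfolding X_def using M'(2) c by (auto intro!: add mult)
    moreover have "f ^ k \<notin> X" for k using no by (auto simp: X_def)
    ultimately have "X \<in> ids" using sub M'(1) by (auto simp: ids_def)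
    hence "X = M" using max sub by simp
    moreover have "0 + 1 * c \<in> X" unfolding X_def using M'(1) a(2) one by blast
    ultimately show False using c(2) by simp
  qed
  have "M \<in> spec_points A"
  proof (rule specI)
    show "1 \<notin> M" using M'(5)[of 0] by simp
    fix c d assume cd: "c \<in> S" "d \<in> S" "c * d \<in> M"
    show "c \<in> M \<or> d \<in> M"
    proof (rule ccontr)
      assume "\<not> ?thesis"
      then obtain k m s l m' s' where ms: "m \<in> M" "s \<in> S" "f ^ k = m + s * c" "m' \<in> M" "s' \<in> S" "f ^ l = m' + s' * d"
        using ext[OF cd(1)] ext[OF cd(2)] by metis
      have "f ^ (k + l) = (m' + s' * d) * m + ((s * c) * m' + (s * s') * (c * d))"
        unfolding power_add ms by (simp add: algebra_simps)
      moreover have "(m' + s' * d) * m \<in> M" "(s * c) * m' \<in> M" "(s * s') * (c * d) \<in> M"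
        using ms cd M'(2) by (auto intro!: M'(4) add mult)
      ultimately show False using M'(3,5) by metis
    qed
  qed (use M' a in auto)
  thus ?thesis using that[of M] M'(1) M'(5)[of 1] by (simp add: W_def)
qed

definition sec :: "ratfun \<Rightarrow> ratfun set \<Rightarrow> (ratfun \<times> ratfun) set" where
  "sec z = (\<lambda>p\<in>W. lf p z)"

lemma fk_notin: "p \<in> W \<Longrightarrow> f ^ k \<notin> p"
  using power_notin f by (auto simp: W_def)

lemma lf_nonempty: "p \<in> W \<Longrightarrow> z \<in> R0 \<Longrightarrow> lf p z \<noteq> {}"
proof -
  assume p: "p \<in> W" and "z \<in> R0"
  then obtain a k where z: "z = a / f ^ k" "a \<in> S" by (auto simp: R0_def)
  hence "(a, f ^ k) \<in> lf p z" using fk_notin[OF p] f by (simp add: lf_def power)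
  thus ?thesis by auto
qed

lemma sec_carrier:
  assumes "z \<in> R0" shows "sec z \<in> carrier (spec_sections A W)"
proof -
  obtain a k where z: "z = a / f ^ k" "a \<in> S" using assms by (auto simp: R0_def)
  have "f ^ k \<notin> q \<and> sec z q = loc_frac A q a (f ^ k)" if "q \<in> W" for q
    using that fk_notin[OF that] z f by (simp add: sec_def loc_frac_eq power W_def)
  thus ?thesis unfolding spec_sections_def using W_open z(2) power[OF f(1)]
    by (auto simp: sec_def intro!: exI[of _ W])
qed

text \<open>The value at the generic point is an element \<open>z\<close> of the field. If its ideal
  of denominators \<open>den\<close> contained no power of \<open>f\<close>, some prime in
  \<open>W\<close> would contain \<open>den\<close>, although the local fraction of the section at
  this prime has a denominator outside it.\<close>

lemma sec_surj:
  assumes s: "s \<in> carrier (spec_sections A W)" shows "\<exists>z\<in>R0. s = sec z"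
proof -
  have loc: "\<exists>a b. a \<in> S \<and> b \<in> S \<and> b \<notin> p \<and> b \<noteq> 0 \<and> s p = lf p (a / b) \<and> s {0} = lf {0} (a / b)" if p: "p \<in> W" for p
  proof -
    obtain V a b where V: "openin (zariski A) V" "p \<in> V" "V \<subseteq> W" "a \<in> carrier A" "b \<in> carrier A"
      "\<forall>q\<in>V. b \<notin> q \<and> s q = loc_frac A q a b"
      by (rule spec_sectionsD[OF s p])
    have 0: "{0} \<in> V" using open_zero_prime[OF V(1)] V(2) by auto
    have p': "p \<in> spec_points A" using p by (simp add: W_def)
    have ab: "a \<in> S" "b \<in> S" using V(4,5) by simp_all
    have b: "b \<notin> p" "b \<noteq> 0" using bspec[OF V(6,2)] bspec[OF V(6) 0] by auto
    have "s p = lf p (a / b)" "s {0} = lf {0} (a / b)"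
      using bspec[OF V(6,2)] bspec[OF V(6) 0] loc_frac_eq[OF p' ab b(1)] loc_frac_eq[OF zero_prime ab] by auto
    thus ?thesis using ab b by blast
  qed
  obtain a0 b0 where ab0: "a0 \<in> S" "b0 \<in> S" "b0 \<noteq> 0" "s {0} = lf {0} (a0 / b0)" using loc[OF zero_W] by blast
  define z where "z = a0 / b0"
  have z0: "a / b = z" if "a \<in> S" "b \<in> S" "b \<noteq> 0" "s {0} = lf {0} (a / b)" for a b
  proof -
    have "(a, b) \<in> s {0}" using that by (simp add: lf_def)
    thus ?thesis using lf_inj[OF zero_prime, of a b z] ab0(4) by (simp add: z_def)
  qed
  have sp: "s p = lf p z" if "p \<in> W" for p using loc[OF that] z0 by metis
  define den where "den = {d \<in> S. d * z \<in> S}"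
  have "\<exists>k. f ^ k \<in> den"
  proof (rule ccontr)
    assume "\<not> ?thesis"
    then obtain p where p: "p \<in> W" "den \<subseteq> p"
      by (rule_tac prime_avoiding[of den]) (auto simp: den_def zero distrib_right mult.assoc intro: add mult)
    obtain a b where ab: "a \<in> S" "b \<in> S" "b \<notin> p" "b \<noteq> 0" "s {0} = lf {0} (a / b)" using loc[OF p(1)] by blast
    have "b * z = a" using z0[OF ab(1,2,4,5)] ab(4) by (simp add: field_simps)
    hence "b * z \<in> S" using ab(1) by simp
    hence "b \<in> den" using ab by (simp add: den_def)
    thus False using p ab by auto
  qed
  then obtain k where "f ^ k * z \<in> S" by (auto simp: den_def)
  from R0_I[OF this, of k] have "z \<in> R0" using f(2) by simp
  moreover have "s = sec z" using sp s by (auto simp: sec_def spec_sections_def extensional_def fun_eq_iff)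
  ultimately show ?thesis by blast
qed

lemma sec_inj: "z \<in> R0 \<Longrightarrow> z' \<in> R0 \<Longrightarrow> sec z = sec z' \<Longrightarrow> z = z'"
proof -
  assume z: "z \<in> R0" "z' \<in> R0" "sec z = sec z'"
  have e: "lf {0} z = lf {0} z'"
    using fun_cong[OF z(3)[unfolded sec_def], of "{0}"] zero_W by (simp only: restrict_apply if_True)
  obtain c d where "(c, d) \<in> lf {0} z" using lf_nonempty[OF zero_W z(1)] by auto
  thus "z = z'" using lf_inj[OF zero_prime] e by metis
qed

lemma lf_pairs:
  assumes p: "p \<in> W" and z: "z \<in> R0" "z' \<in> R0"
    and G: "\<And>a b c d. (a, b) \<in> lf p z \<Longrightarrow> (c, d) \<in> lf p z' \<Longrightarrow> G a b c d = T"
  shows "(\<Union>(a, b)\<in>lf p z. \<Union>(c, d)\<in>lf p z'. G a b c d) = T"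
proof -
  obtain a b c d where "(a, b) \<in> lf p z" "(c, d) \<in> lf p z'"
    using lf_nonempty[OF p z(1)] lf_nonempty[OF p z(2)] by (metis ex_in_conv surj_pair)
  thus ?thesis using G by fastforce
qed

lemma lf_ops:
  assumes p: "p \<in> W" and z: "z \<in> R0" "z' \<in> R0"
  shows "lf p z \<otimes>\<^bsub>localization A p\<^esub> lf p z' = lf p (z * z')" "lf p z \<oplus>\<^bsub>localization A p\<^esub> lf p z' = lf p (z + z')"
    "c \<odot>\<^bsub>localization A p\<^esub> lf p z = lf p (rconst c * z)" "\<one>\<^bsub>localization A p\<^esub> = lf p 1" "\<zero>\<^bsub>localization A p\<^esub> = lf p 0"
proof -
  have p': "p \<in> spec_points A" using p by (simp add: W_def)
  have bd: "b * d \<notin> p" if "b \<in> S - p" "d \<in> S - p" for b d using specD(5)[OF p'] that by blast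
  have nz: "b \<noteq> 0" if "b \<in> S - p" for b using specD(2)[OF p'] that by auto
  have "loc_frac A p (a * c) (b * d) = lf p (z * z')" if "(a, b) \<in> lf p z" "(c, d) \<in> lf p z'" for a b c d
    using that bd[of b d] nz[of b] nz[of d] loc_frac_eq[OF p', of "a * c" "b * d"]
    by (auto simp: lf_def mult)
  thus "lf p z \<otimes>\<^bsub>localization A p\<^esub> lf p z' = lf p (z * z')"
    unfolding localization_def by (simp add: lf_pairs[OF p z])
  have "loc_frac A p (a * d + c * b) (b * d) = lf p (z + z')" if "(a, b) \<in> lf p z" "(c, d) \<in> lf p z'" for a b c d
  proof -
    have *: "a \<in> S" "b \<in> S - p" "a = z * b" "c \<in> S" "d \<in> S - p" "c = z' * d" using that by (auto simp: lf_def)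
    have "(a * d + c * b) / (b * d) = z + z'" using nz[OF *(2)] nz[OF *(5)] unfolding *(3,6) by (simp add: field_simps)
    thus ?thesis using * bd[OF *(2,5)] loc_frac_eq[OF p', of "a * d + c * b" "b * d"] by (simp add: add mult)
  qed
  thus "lf p z \<oplus>\<^bsub>localization A p\<^esub> lf p z' = lf p (z + z')"
    unfolding localization_def by (simp add: lf_pairs[OF p z])
  have "loc_frac A p (rconst c * a) b = lf p (rconst c * z)" if "(a, b) \<in> lf p z" for a b
    using that nz[of b] loc_frac_eq[OF p', of "rconst c * a" b] by (auto simp: lf_def mult const)
  thus "c \<odot>\<^bsub>localization A p\<^esub> lf p z = lf p (rconst c * z)"
    using lf_nonempty[OF p z(1)] unfolding localization_def by fastforce
  show "\<one>\<^bsub>localization A p\<^esub> = lf p 1" "\<zero>\<^bsub>localization A p\<^esub> = lf p 0"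
    using loc_frac_eq[OF p', of 1 1] loc_frac_eq[OF p', of 0 1] one zero specD(6)[OF p'] by (simp_all add: localization_def)
qed

lemma sec_iso: "sec \<in> calg_iso (calg_on rconst R0) (spec_sections A W)"
proof (rule calg_isoI)
  show "bij_betw sec (carrier (calg_on rconst R0)) (carrier (spec_sections A W))"
    unfolding bij_betw_def
  proof
    show "inj_on sec (carrier (calg_on rconst R0))" using sec_inj by (auto simp: inj_on_def)
    show "sec ` carrier (calg_on rconst R0) = carrier (spec_sections A W)"
      using sec_carrier sec_surj by (simp only: calg_on_simps) blast
  qed
next
  fix z z' assume "z \<in> carrier (calg_on rconst R0)" "z' \<in> carrier (calg_on rconst R0)"
  hence z: "z \<in> R0" "z' \<in> R0" by auto
  show "sec (z \<otimes>\<^bsub>calg_on rconst R0\<^esub> z') = sec z \<otimes>\<^bsub>spec_sections A W\<^esub> sec z'"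
    "sec (z \<oplus>\<^bsub>calg_on rconst R0\<^esub> z') = sec z \<oplus>\<^bsub>spec_sections A W\<^esub> sec z'"
    unfolding spec_sections_def sec_def by (auto simp: lf_ops[OF _ z] fun_eq_iff)
next
  fix c z assume "z \<in> carrier (calg_on rconst R0)"
  hence z: "z \<in> R0" by simp
  show "sec (c \<odot>\<^bsub>calg_on rconst R0\<^esub> z) = c \<odot>\<^bsub>spec_sections A W\<^esub> sec z"
    unfolding spec_sections_def sec_def by (auto simp: lf_ops(3)[OF _ z z] fun_eq_iff)
next
  show "sec \<one>\<^bsub>calg_on rconst R0\<^esub> = \<one>\<^bsub>spec_sections A W\<^esub>"
    unfolding spec_sections_def sec_def using lf_ops(4)[OF _ S_R0[OF one] S_R0[OF one]] by (auto simp: fun_eq_iff)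
qed

lemma sec_zero: "sec 0 = \<zero>\<^bsub>spec_sections A W\<^esub>"
  unfolding spec_sections_def sec_def using lf_ops(5)[OF _ S_R0[OF one] S_R0[OF one]] by (auto simp: fun_eq_iff)

lemma to_section_eq: "a \<in> S \<Longrightarrow> to_section A W a = sec a"
  using loc_frac_eq[of _ a 1] one specD(6) by (auto simp: to_section_def sec_def W_def fun_eq_iff)

lemma calg_R0: "calg (calg_on rconst R0)"
proof (rule calg_calg_on)
  show "rconst (- 1) = - 1" using rconst_simps(1)[of 1 "-1"] by (simp add: eq_neg_iff_add_eq_0 add.commute)
qed (auto simp: const S_R0 R0_add R0_mult)

lemma calg_sections: "calg (spec_sections A W)"
  by (rule calg_image[OF calg_R0 sec_iso]) (simp add: sec_zero)

text \<open>\<open>aut_act\<close> applies \<open>g\<close> to numerators and denominators; on the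
  value \<open>z\<close> this is the extension \<open>g'\<close> to the localized ring. The
  hypothesis \<open>pre\<close> says that the open set is stable.\<close>

lemma aut_act_sec:
  assumes g: "bij_betw g S S" and g': "\<And>a. a \<in> S \<Longrightarrow> g' a = g a"
    and gm: "\<And>x y. x \<in> R0 \<Longrightarrow> y \<in> R0 \<Longrightarrow> g' (x * y) = g' x * g' y"
    and pre: "\<And>p. p \<in> W \<Longrightarrow> {a \<in> S. g a \<in> p} \<in> W"
    and z: "z \<in> R0"
  shows "aut_act A W g (sec z) = sec (g' z)"
proof -
  have "map_prod g g ` lf {a \<in> S. g a \<in> p} z = lf p (g' z)" if p: "p \<in> W" for p
  proof
    have *: "g c = g' z * g d" if "c \<in> S" "d \<in> S" "c = z * d" for c d
      using gm[OF z S_R0[OF that(2)]] g'[OF that(1)] g'[OF that(2)] that(3) by simp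
    show "map_prod g g ` lf {a \<in> S. g a \<in> p} z \<subseteq> lf p (g' z)"
      using g * by (auto simp: lf_def bij_betw_def)
    show "lf p (g' z) \<subseteq> map_prod g g ` lf {a \<in> S. g a \<in> p} z"
    proof (rule subsetI, clarify)
      fix c' d' assume cd': "(c', d') \<in> lf p (g' z)"
      have "c' \<in> g ` S" "d' \<in> g ` S" using cd' g by (auto simp: lf_def bij_betw_def)
      then obtain c d where cd: "c \<in> S" "c' = g c" "d \<in> S" "d' = g d" by auto
      obtain a k where ak: "z = a / f ^ k" "a \<in> S" using z by (auto simp: R0_def)
      have fk: "f ^ k * z = a" using ak f(2) by simp
      have "g' (f ^ k * c) = g' (f ^ k) * (g' z * g' d)"
        using cd cd' gm[OF S_R0[OF power[OF f(1)]] S_R0[OF cd(1)]] by (auto simp: lf_def g')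
      also have "\<dots> = g' ((f ^ k * z) * d)"
        using gm[OF S_R0[OF power[OF f(1)], of k] z] gm[OF S_R0[OF ak(2)] S_R0[OF cd(3)]] by (simp add: fk)
      finally have e: "g' (f ^ k * c) = g' (a * d)" unfolding fk .
      have S: "f ^ k * c \<in> S" "a * d \<in> S" using cd ak by (auto simp: mult power f(1))
      hence "g (f ^ k * c) = g (a * d)" using e by (simp add: g')
      hence "f ^ k * c = a * d" using g S by (auto simp: bij_betw_def inj_on_def)
      hence "c = z * d" unfolding ak(1) using f(2) by (simp add: field_simps)
      thus "(c', d') \<in> map_prod g g ` lf {a \<in> S. g a \<in> p} z"
        using cd cd' by (auto simp: lf_def intro!: image_eqI[of _ _ "(c, d)"])
    qed
  qed
  thus ?thesis using pre by (auto simp: aut_act_def sec_def fun_eq_iff)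
qed

end


section \<open>The torus quotient and the unit locus\<close>

text \<open>Independence of eigenvectors with distinct eigenvalues: subtracting
  \<open>rconst (c x)\<close> times the relation from its image under \<open>\<tau>\<close> removes
  the term at \<open>x\<close>.\<close>

lemma eigen_sum_zero:
  assumes h: "field_hom \<tau>" and T: "finite T" "inj_on c T"
    and ev: "\<And>e. e \<in> T \<Longrightarrow> \<tau> (v e) = rconst (c e) * v e" and sum: "(\<Sum>e\<in>T. v e) = 0"
  shows "e \<in> T \<Longrightarrow> v e = 0"
  using T ev sum
proof (induction T arbitrary: v e)
  case (insert x T)
  have "(\<Sum>e\<in>insert x T. rconst (c e) * v e) = \<tau> (\<Sum>e\<in>insert x T. v e)"
    unfolding field_hom_sum[OF h] using insert.prems(3) by (intro sum.cong) auto
  hence 0: "(\<Sum>e\<in>insert x T. rconst (c e) * v e) = 0" using insert.prems(4) field_homD(5)[OF h] by simp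
  have "(\<Sum>e\<in>T. (rconst (c e) - rconst (c x)) * v e) =
      (\<Sum>e\<in>insert x T. rconst (c e) * v e) - rconst (c x) * (\<Sum>e\<in>insert x T. v e)"
    using insert.hyps by (simp add: left_diff_distrib sum_subtractf sum_distrib_left distrib_left)
  hence 1: "(\<Sum>e\<in>T. (rconst (c e) - rconst (c x)) * v e) = 0" using 0 insert.prems(4) by simp
  have z: "v e = 0" if e: "e \<in> T" for e
  proof -
    have "(rconst (c e) - rconst (c x)) * v e = 0"
    proof (rule insert.IH[OF e _ _ 1])
      show "inj_on c T" using insert.prems(2) by simp
      show "\<tau> ((rconst (c e) - rconst (c x)) * v e) = rconst (c e) * ((rconst (c e) - rconst (c x)) * v e)"
        if "e \<in> T" for e
        using insert.prems(3)[of e] that by (simp add: field_homD[OF h] field_hom_diff[OF h])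
    qed
    moreover have "c e \<noteq> c x" using insert.prems(2) insert.hyps(2) e by (auto simp: inj_on_def)
    hence "rconst (c e) - rconst (c x) \<noteq> 0"
      using rconst_simps(1)[of "c e - c x" "c x"] by auto
    ultimately show ?thesis by simp
  qed
  hence "v x = 0" using insert.prems(4) insert.hyps by simp
  thus ?case using z insert.prems(1) by auto
qed simp

definition unit_pt :: "nat \<Rightarrow> nat \<Rightarrow> ratfun" where "unit_pt n = one_on {..<n}"

lemma unit_pt: "unit_pt n i = (if i < n then 1 else rvar i)" "unit_pt n i \<noteq> 0"
  by (simp_all add: unit_pt_def)

lemmas unit_fhom = fhom_regular[of "unit_pt n" for n, OF unit_pt(2)] fhom_unit[of "unit_pt n" for n, OF unit_pt(2)]
  fhom_to_ratfun[of "unit_pt n" for n, OF unit_pt(2)]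

lemma unit_rconst: "rconst c \<in> regular (unit_pt n)" "fhom (unit_pt n) (rconst c) = rconst c"
  by (simp_all add: fhom_rconst unit_pt(2)) (simp add: rconst_def unit_fhom)

context dynkin
begin

text \<open>The homomorphism sending \<open>y\<^sub>j\<close> to \<open>yhat\<^sub>j\<close> and fixing the initial cluster variables\<close>

definition Hvar :: "nat \<Rightarrow> ratfun" where
  "Hvar i = (if n \<le> i \<and> i < 2 * n then rvar i * (\<Prod>k<n. rvar k powi B k (i - n)) else rvar i)"

definition H :: "ratfun \<Rightarrow> ratfun" where "H = fhom Hvar"

lemma lm_indep_Hvar: "lm_indep Hvar"
proof (rule lm_indep_triangular[of _ "{n..<2 * n}"])
  show "Hvar i \<noteq> 0" for i by (simp add: Hvar_def)
  show "\<exists>w. lm (Hvar i) = frag_of i + w \<and> (\<forall>j\<in>{n..<2 * n}. lookup w j = 0)" if i: "i \<in> {n..<2 * n}" for i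
  proof (intro exI[of _ "lm (\<Prod>k<n. rvar k powi B k (i - n))"] conjI ballI)
    show "lm (Hvar i) = frag_of i + lm (\<Prod>k<n. rvar k powi B k (i - n))"
      using i by (simp add: Hvar_def lm_mult lm_rvar)
    fix j assume "j \<in> {n..<2 * n}"
    thus "lookup (lm (\<Prod>k<n. rvar k powi B k (i - n))) j = 0"
      by (subst lm_prod) (auto simp: lm_powi lm_rvar lookup_sum)
  qed
  show "lm (Hvar i) = frag_of i \<or> lm (Hvar i) = - frag_of i" if "i \<notin> {n..<2 * n}" for i
    using that by (auto simp: Hvar_def lm_rvar)
qed

lemma H: "field_hom H"
  unfolding H_def by (rule field_hom_fhom[OF lm_indep_Hvar])

definition xm :: "(nat \<Rightarrow> int) \<Rightarrow> ratfun" where "xm m = (\<Prod>i<n. rvar i powi m i)"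

lemma xm_nonzero [simp]: "xm m \<noteq> 0" by (simp add: xm_def)

lemma xm_add: "xm (\<lambda>i. m i + m' i) = xm m * xm m'"
  by (simp add: xm_def power_int_add prod.distrib)

lemma xm_uminus: "xm (\<lambda>i. - m i) = inverse (xm m)"
  by (simp add: xm_def power_int_minus prod_inversef[symmetric])

lemma xm_0: "xm (\<lambda>i. 0) = 1" by (simp add: xm_def)

lemma H_y: "l < n \<Longrightarrow> H (rvar (n + l)) = rvar (n + l) * xm (\<lambda>k. B k l)"
  by (simp add: H_def fhom_rvar[OF lm_indep_Hvar] Hvar_def xm_def)

lemma H_yhat: "l < n \<Longrightarrow> H (rvar (n + l)) = yhat (2 * n) (rvar, B_prin) l"
proof -
  assume l: "l < n"
  have "{..<2 * n} = {..<n} \<union> {n..<2 * n}" by auto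
  moreover have "(\<Prod>i\<in>{n..<2 * n}. rvar i powi B_prin i l) = (\<Prod>i\<in>{n..<2 * n}. if i = n + l then rvar (n + l) else 1)"
    using l by (intro prod.cong) (auto simp: prin_frozen)
  ultimately have "yhat (2 * n) (rvar, B_prin) l = (\<Prod>i<n. rvar i powi B_prin i l) * rvar (n + l)"
    unfolding yhat_def using l by (simp add: prod.union_disjoint ivl_disj_int)
  also have "(\<Prod>i<n. rvar i powi B_prin i l) = xm (\<lambda>k. B k l)"
    unfolding xm_def by (intro prod.cong) (auto simp: principal_ext_def)
  finally show ?thesis using H_y[OF l] by simp
qed

lemma H_U:
  "H (U q) * (X q * X (q + n)) = Q q rvar * nbprod q X"
  "(1 - H (U q)) * (X q * X (q + n)) = A q rvar"
  using U_general[of H rvar q, OF H _ _ H_yhat] by auto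

lemma X_nonzero [simp]: "X q \<noteq> 0"
  by (rule rpos_nonzero[OF rpos_X])

definition xeq :: "ratfun \<Rightarrow> ratfun \<Rightarrow> bool" where "xeq z w \<longleftrightarrow> (\<exists>m. z = xm m * H w)"

lemma xeq_mult: "xeq z w \<Longrightarrow> xeq z' w' \<Longrightarrow> xeq (z * z') (w * w')"
  unfolding xeq_def by (auto simp: field_homD[OF H]) (metis xm_add)

lemma xeq_inverse: "xeq z w \<Longrightarrow> xeq (inverse z) (inverse w)"
  unfolding xeq_def by (auto simp: field_hom_inverse[OF H]) (metis xm_uminus)

lemma xeq_divide: "xeq z w \<Longrightarrow> xeq z' w' \<Longrightarrow> xeq (z / z') (w / w')"
  by (simp add: divide_inverse xeq_mult xeq_inverse)

lemma xeq_1: "xeq 1 1"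
  unfolding xeq_def by (intro exI[of _ "\<lambda>_. 0"]) (simp add: xm_0 field_homD[OF H])

lemma xeq_power: "xeq z w \<Longrightarrow> xeq (z ^ k) (w ^ k)"
  by (induction k) (simp_all add: xeq_1 xeq_mult)

lemma xeq_prod: "(\<And>i. i \<in> S \<Longrightarrow> xeq (f i) (g i)) \<Longrightarrow> xeq (\<Prod>i\<in>S. f i) (\<Prod>i\<in>S. g i)"
  by (induction S rule: infinite_finite_induct) (simp_all add: xeq_1 xeq_mult)

lemma xeq_H: "xeq (H w) w"
  unfolding xeq_def by (intro exI[of _ "\<lambda>_. 0"]) (simp add: xm_0)

lemma xeq_y: "l < n \<Longrightarrow> xeq (rvar (n + l)) (rvar (n + l))"
  unfolding xeq_def by (intro exI[of _ "\<lambda>k. - B k l"]) (simp add: H_y xm_uminus)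

text \<open>The relations \<open>H_U(1)\<close> for \<open>X\<close> and \<open>U_F(1)\<close> for
  \<open>F\<close> are purely multiplicative and have the same shape, with \<open>H (U r)\<close> in
  place of \<open>U r\<close>. So the relation \<open>xeq\<close> passes through them, and sums
  never have to be compared.\<close>

lemma xeq_X: "xeq (X q) (F q)"
proof (induction q rule: mesh_induct)
  case (initial q)
  have "xm (\<lambda>i. if i = kk q then 1 else 0) = (\<Prod>i<n. if i = kk q then rvar (kk q) else 1)"
    unfolding xm_def by (intro prod.cong) auto
  hence "X q = xm (\<lambda>i. if i = kk q then 1 else 0) * H (F q)"
    using initial by (simp add: X_initial F_initial field_homD[OF H])
  thus ?case unfolding xeq_def by blast
next
  case (step r)
  have HU: "H (U r) \<noteq> 0" by (simp add: field_hom_eq_0_iff[OF H])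
  have div: "z = w / (u * x)" if "u * (x * z) = w" "u \<noteq> 0" "x \<noteq> 0" for u x z w :: ratfun
    using that by (simp add: field_simps)
  have "X (r + n) = Q r rvar * nbprod r X / (H (U r) * X r)" by (rule div[OF H_U(1) HU X_nonzero])
  moreover have "F (r + n) = Q r rvar * nbprod r F / (U r * F r)" by (rule div[OF U_F(1) U_nonzero F_nonzero])
  moreover have "xeq (Q r rvar) (Q r rvar)" unfolding A_Q by (intro xeq_prod xeq_power xeq_y) simp
  moreover have "xeq (nbprod r X) (nbprod r F)" by (intro xeq_prod xeq_power step) auto
  ultimately show ?case using step(1) by (simp add: xeq_divide xeq_mult xeq_H)
qed

section \<open>The ring of functions on the open locus\<close>

definition AC :: "ratfun set" where
  "AC = subalg_gen rconst (cluster_variables n (2 * n) B_prin \<union> frozen_variables n (2 * n) \<union> inverse ` frozen_variables n (2 * n))"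

text \<open>The open locus is the basic open set of this product (\<open>OL_eq\<close>).\<close>

definition fX :: ratfun where "fX = (\<Prod>\<gamma>\<in>I. X (sl \<gamma>))"

lemma AC_gens: "X q \<in> AC" "l < n \<Longrightarrow> rvar (n + l) \<in> AC" "l < n \<Longrightarrow> inverse (rvar (n + l)) \<in> AC"
  unfolding AC_def cluster_variables_X frozen_variables_def by (auto intro!: subalg_gen.gen)

lemma domain_alg: "domain_alg AC fX"
proof
  show "fX \<in> AC" unfolding fX_def using AC_gens(1) unfolding AC_def by (intro subalg_prod) auto
qed (use finite_Pi in \<open>auto simp: AC_def fX_def intro: subalg_gen.intros\<close>)

end

sublocale dynkin \<subseteq> loc: domain_alg "subalg_gen rconst (cluster_variables n (2 * n) B_prin \<union> frozen_variables n (2 * n) \<union> inverse ` frozen_variables n (2 * n))" "fX"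
  using domain_alg by (simp add: AC_def)

context dynkin
begin

abbreviation "R0 \<equiv> loc.R0"
abbreviation "AL \<equiv> cluster_algebra n (2 * n) B_prin"
abbreviation "OL \<equiv> open_locus n (2 * n) B_prin"

lemma AL_eq: "AL = calg_on rconst AC"
  by (simp add: cluster_algebra_def AC_def)

lemma X_rep_Pi: "range X = (\<lambda>\<gamma>. X (sl \<gamma>)) ` I"
proof
  show "range X \<subseteq> (\<lambda>\<gamma>. X (sl \<gamma>)) ` I"
  proof
    fix z assume "z \<in> range X"
    then obtain q where "z = X q" by blast
    moreover obtain \<gamma> where "\<gamma> \<in> I" "X q = X (sl \<gamma>)" using X_rep by blast
    ultimately show "z \<in> (\<lambda>\<gamma>. X (sl \<gamma>)) ` I" by blast
  qed
qed blast

lemma OL_eq: "OL = loc.W"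
proof -
  have "(\<forall>x\<in>range X. x \<notin> p) \<longleftrightarrow> fX \<notin> p" if p: "p \<in> spec_points AL" for p
  proof -
    have p': "p \<in> spec_points loc.A" using p by (simp add: cluster_algebra_def)
    note s = loc.specD[OF p', folded AC_def]
    have S: "(\<Prod>\<gamma>\<in>K. X (sl \<gamma>)) \<in> AC" for K
      using AC_gens(1) unfolding AC_def by (intro subalg_prod) auto
    have "(\<Prod>\<gamma>\<in>K. X (sl \<gamma>)) \<in> p \<longleftrightarrow> (\<exists>\<gamma>\<in>K. X (sl \<gamma>) \<in> p)" if "finite K" for K
      using that
    proof (induction K)
      case (insert \<gamma> K)
      have "X (sl \<gamma>) * (\<Prod>\<gamma>\<in>K. X (sl \<gamma>)) \<in> p \<longleftrightarrow> X (sl \<gamma>) \<in> p \<or> (\<Prod>\<gamma>\<in>K. X (sl \<gamma>)) \<in> p"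
        using s(5)[OF AC_gens(1) S] s(4)[OF _ S[of K]] s(4)[OF _ AC_gens(1)] by (metis mult.commute)
      thus ?case using insert by simp
    qed (use s(6) in simp)
    thus ?thesis unfolding fX_def X_rep_Pi using finite_Pi by auto
  qed
  hence "OL = {p \<in> spec_points AL. fX \<notin> p}" unfolding open_locus_def cluster_variables_X by blast
  thus ?thesis unfolding loc.W_def by (simp add: cluster_algebra_def)
qed

lemma OLR: "open_locus_ring n (2 * n) B_prin = spec_sections loc.A loc.W"
  by (simp add: open_locus_ring_def OL_eq) (simp add: cluster_algebra_def)

abbreviation "G0 \<equiv> range X \<union> inverse ` range X \<union> (\<Union>l<n. {rvar (n + l), inverse (rvar (n + l))})"

lemma R0_eq: "R0 = subalg_gen rconst G0"
proof
  have X: "X q \<in> R0" for q using loc.S_R0 AC_gens(1) by (simp add: AC_def)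
  have "R0 \<subseteq> subalg_gen rconst G0 \<and> inverse fX \<in> subalg_gen rconst G0"
  proof
    have i: "inverse fX \<in> subalg_gen rconst G0"
      unfolding fX_def prod_inversef[symmetric] by (intro subalg_prod subalg_gen.gen) auto
    thus "inverse fX \<in> subalg_gen rconst G0" .
    have "x \<in> subalg_gen rconst G0" if "x \<in> AC" for x
      using that unfolding AC_def
    proof induction
      case (gen g)
      hence "g \<in> G0"
        unfolding cluster_variables_X frozen_variables_def using le_Suc_ex by fastforce
      thus ?case by (rule subalg_gen.gen)
    qed (auto intro: subalg_gen.intros)
    thus "R0 \<subseteq> subalg_gen rconst G0"
      using i by (auto simp: loc.R0_def AC_def divide_inverse power_inverse[symmetric] intro!: subalg_gen.mult subalg_power)
  qed
  thus "R0 \<subseteq> subalg_gen rconst G0" by simp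
  show "subalg_gen rconst G0 \<subseteq> R0"
  proof
    fix z assume "z \<in> subalg_gen rconst G0"
    thus "z \<in> R0"
    proof induction
      case (const c)
      thus ?case by (rule loc.S_R0[OF loc.const])
    next
      case (gen g)
      \<comment> \<open>The inverse of one variable is the product of the others divided by
        \<open>fX\<close>.\<close>
      have "inverse (X q) \<in> R0" for q
      proof -
        obtain \<gamma> where g: "\<gamma> \<in> I" "X q = X (sl \<gamma>)" using X_rep by blast
        have "(\<Prod>\<omega>\<in>I - {\<gamma>}. X (sl \<omega>)) \<in> AC" using AC_gens(1) unfolding AC_def by (intro subalg_prod) auto
        hence "(\<Prod>\<omega>\<in>I - {\<gamma>}. X (sl \<omega>)) * inverse fX \<in> R0"
          using loc.R0_mult loc.S_R0 loc.inverse_f_R0 by (simp add: AC_def)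
        moreover have "fX = X q * (\<Prod>\<omega>\<in>I - {\<gamma>}. X (sl \<omega>))"
          unfolding fX_def g(2) by (rule prod.remove[OF finite_Pi g(1)])
        moreover have "(\<Prod>\<omega>\<in>I - {\<gamma>}. X (sl \<omega>)) \<noteq> 0" using finite_Pi by simp
        ultimately show ?thesis by (simp add: field_simps)
      qed
      thus ?case using gen X loc.S_R0 AC_gens(2,3) by (auto simp: AC_def)
    qed (auto intro: loc.R0_add loc.R0_mult)
  qed
qed

lemma R0_induct [consumes 1, case_names const X invX y invy add mult]:
  assumes "z \<in> R0" "\<And>c. P (rconst c)" "\<And>q. P (X q)" "\<And>q. P (inverse (X q))"
    "\<And>l. l < n \<Longrightarrow> P (rvar (n + l))" "\<And>l. l < n \<Longrightarrow> P (inverse (rvar (n + l)))"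
    "\<And>x y. x \<in> R0 \<Longrightarrow> y \<in> R0 \<Longrightarrow> P x \<Longrightarrow> P y \<Longrightarrow> P (x + y)" "\<And>x y. x \<in> R0 \<Longrightarrow> y \<in> R0 \<Longrightarrow> P x \<Longrightarrow> P y \<Longrightarrow> P (x * y)"
  shows "P z"
  using assms(1) unfolding R0_eq
proof induction
  case (const c) show ?case by (rule assms(2))
next
  case (gen g) thus ?case using assms(3-6) by auto
next
  case (add x y) thus ?case using assms(7) by (simp add: R0_eq)
next
  case (mult x y) thus ?case using assms(8) by (simp add: R0_eq)
qed

lemma R0_gens: "X q \<in> R0" "inverse (X q) \<in> R0" "l < n \<Longrightarrow> rvar (n + l) \<in> R0"
  "l < n \<Longrightarrow> inverse (rvar (n + l)) \<in> R0" "rconst c \<in> R0"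
  unfolding R0_eq by (auto intro!: subalg_gen.gen subalg_gen.const)

lemma R0_prod: "(\<And>i. i \<in> S \<Longrightarrow> f i \<in> R0) \<Longrightarrow> (\<Prod>i\<in>S. f i) \<in> R0"
  unfolding R0_eq by (rule subalg_prod)

lemma R0_power: "x \<in> R0 \<Longrightarrow> x ^ k \<in> R0"
  unfolding R0_eq by (rule subalg_power)

lemma rvar_X: "i < n \<Longrightarrow> rvar i = X (slot 0 i)"
  by (simp add: X_slot0)

lemma xm_R0: "xm m \<in> R0"
  unfolding xm_def by (intro R0_prod) (auto simp: rvar_X power_int_def R0_power R0_gens)

lemma R0_0: "0 \<in> R0" using R0_gens(5)[of 0] by simp

lemma R0_1: "1 \<in> R0" using R0_gens(5)[of 1] by simp

lemma R0_uminus: "x \<in> R0 \<Longrightarrow> - x \<in> R0"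
  using loc.R0_mult[OF R0_gens(5)[of "-1"], of x] by (simp add: rconst_uminus)

lemma R0_diff: "x \<in> R0 \<Longrightarrow> y \<in> R0 \<Longrightarrow> x - y \<in> R0"
  using loc.R0_add[of x "- y"] R0_uminus[of y] by simp

lemma FR_induct [consumes 1, case_names const F invF y invy add mult]:
  assumes "z \<in> FR" "\<And>c. P (rconst c)" "\<And>q. P (F q)" "\<And>q. P (inverse (F q))"
    "\<And>l. l < n \<Longrightarrow> P (rvar (n + l))" "\<And>l. l < n \<Longrightarrow> P (inverse (rvar (n + l)))"
    "\<And>x y. x \<in> FR \<Longrightarrow> y \<in> FR \<Longrightarrow> P x \<Longrightarrow> P y \<Longrightarrow> P (x + y)" "\<And>x y. x \<in> FR \<Longrightarrow> y \<in> FR \<Longrightarrow> P x \<Longrightarrow> P y \<Longrightarrow> P (x * y)"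
  shows "P z"
  using assms(1)
proof induction
  case (const c) show ?case by (rule assms(2))
next
  case (gen g) thus ?case using assms(3-6) by (auto simp: F_poly_eq)
next
  case (add x y) thus ?case using assms(7) by simp
next
  case (mult x y) thus ?case using assms(8) by simp
qed

lemma H_F: "\<exists>m. H (F q) = xm m * X q" "\<exists>m. H (inverse (F q)) = xm m * inverse (X q)"
proof -
  obtain m where m: "X q = xm m * H (F q)" using xeq_X[of q] by (auto simp: xeq_def)
  show "\<exists>m. H (F q) = xm m * X q" by (rule exI[of _ "\<lambda>i. - m i"]) (simp add: m xm_uminus)
  show "\<exists>m. H (inverse (F q)) = xm m * inverse (X q)"
    by (rule exI[of _ m]) (simp add: m field_hom_inverse[OF H])
qed

lemma H_R0: "w \<in> FR \<Longrightarrow> H w \<in> R0"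
proof (induction w rule: FR_induct)
  case (const c) thus ?case by (simp add: field_homD[OF H] R0_gens)
next
  case (F q) thus ?case using H_F(1)[of q] loc.R0_mult[OF xm_R0 R0_gens(1)] by auto
next
  case (invF q) thus ?case using H_F(2)[of q] loc.R0_mult[OF xm_R0 R0_gens(2)] by auto
next
  case (y l) thus ?case by (simp add: H_y loc.R0_mult xm_R0 R0_gens)
next
  case (invy l)
  thus ?case using loc.R0_mult[OF R0_gens(4)[OF invy] xm_R0[of "\<lambda>k. - B k l"]]
    by (simp add: H_y field_hom_inverse[OF H] xm_uminus)
qed (simp_all add: field_homD[OF H] loc.R0_add loc.R0_mult)

subsection \<open>The unit locus\<close>

text \<open>Evaluation at \<open>x\<^sub>0 = \<dots> = x\<^sub>n\<^sub>-\<^sub>1 = 1\<close>, where it is defined\<close>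

abbreviation "eps \<equiv> fhom (unit_pt n)"

lemma ev_unit_L: "ev (unit_pt n) (L q) = F q"
  unfolding unit_pt_def by (simp only: F_L to_ratfun_set_ones)

lemma R0_regular: "z \<in> R0 \<Longrightarrow> z \<in> regular (unit_pt n)"
proof (induction z rule: R0_induct)
  case (invX q) show ?case unfolding X_L by (rule unit_fhom) (simp only: ev_unit_L F_nonzero not_False_eq_True)
next
  case (invy l) show ?case unfolding rvar_def by (rule unit_fhom) (simp add: unit_pt)
qed (simp_all add: unit_rconst unit_fhom, simp_all add: X_L rvar_def unit_fhom)

lemma eps_ops: "x \<in> R0 \<Longrightarrow> y \<in> R0 \<Longrightarrow> eps (x + y) = eps x + eps y" "x \<in> R0 \<Longrightarrow> y \<in> R0 \<Longrightarrow> eps (x * y) = eps x * eps y"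
  by (simp_all add: unit_fhom R0_regular)

lemma eps_gens: "eps (X q) = F q" "eps (inverse (X q)) = inverse (F q)"
  "eps (rvar (n + l)) = rvar (n + l)" "eps (inverse (rvar (n + l))) = inverse (rvar (n + l))"
  "i < n \<Longrightarrow> eps (rvar i) = 1" "i < n \<Longrightarrow> eps (inverse (rvar i)) = 1"
proof -
  show "eps (X q) = F q" unfolding X_L unit_fhom ev_unit_L ..
  show "eps (inverse (X q)) = inverse (F q)" unfolding X_L
    by (subst unit_fhom(6)) (simp_all only: ev_unit_L F_nonzero not_False_eq_True)
  show "eps (rvar (n + l)) = rvar (n + l)" "eps (inverse (rvar (n + l))) = inverse (rvar (n + l))"
    "i < n \<Longrightarrow> eps (rvar i) = 1" "i < n \<Longrightarrow> eps (inverse (rvar i)) = 1"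
    unfolding rvar_def[of "n + l"] rvar_def[of i]
    by (simp_all add: unit_fhom unit_pt) (simp_all add: rvar_def)
qed

lemma eps_xm: "eps (xm m) = 1"
proof -
  have 1: "eps 1 = 1" using unit_rconst(2)[of n 1] by simp
  have pw: "eps (x ^ k) = 1" if "x \<in> R0" "eps x = 1" for x k
    by (induction k) (simp_all add: 1 eps_ops R0_power that)
  have "rvar i \<in> R0" "inverse (rvar i) \<in> R0" if "i < n" for i using R0_gens(1,2)[of "slot 0 i"] X_slot0[OF that] by simp_all
  hence p: "rvar i powi e \<in> R0" "eps (rvar i powi e) = 1" if "i < n" for i e
    using that by (auto simp: power_int_def R0_power pw eps_gens)
  have "eps (\<Prod>i\<in>S. rvar i powi m i) = 1" if "S \<subseteq> {..<n}" for S
    using that by (induction S rule: infinite_finite_induct) (auto simp: 1 eps_ops p R0_prod subset_iff)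
  thus ?thesis by (simp add: xm_def)
qed

text \<open>Setting the initial variables to 1 turns \<open>yhat\<close> back into
  \<open>y\<close>.\<close>

lemma eps_H: "w \<in> FR \<Longrightarrow> eps (H w) = w"
proof (induction w rule: FR_induct)
  case (const c) thus ?case by (simp add: field_homD[OF H] unit_rconst)
next
  case (F q) thus ?case using H_F(1)[of q] by (auto simp: eps_ops xm_R0 R0_gens eps_xm eps_gens)
next
  case (invF q) thus ?case using H_F(2)[of q] by (auto simp: eps_ops xm_R0 R0_gens eps_xm eps_gens)
next
  case (y l) thus ?case by (simp add: H_y eps_ops xm_R0 R0_gens eps_xm eps_gens)
next
  case (invy l)
  hence "H (inverse (rvar (n + l))) = inverse (rvar (n + l)) * xm (\<lambda>k. - B k l)"
    by (simp add: H_y field_hom_inverse[OF H] xm_uminus)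
  thus ?case using invy by (simp add: eps_ops xm_R0 R0_gens eps_xm eps_gens)
next
  case (add x y) thus ?case by (simp add: field_homD[OF H] eps_ops H_R0)
next
  case (mult x y) thus ?case by (simp add: field_homD[OF H] eps_ops H_R0)
qed

lemma eps_FR: "z \<in> R0 \<Longrightarrow> eps z \<in> FR"
  by (induction z rule: R0_induct)
    (auto simp: unit_rconst eps_gens eps_ops F_FR intro: subalg_gen.const subalg_gen.add subalg_gen.mult y_FR)

text \<open>Modulo the \<open>rvar i - 1\<close> all monomials in the initial variables become 1, so
  by the separation formula each generator is congruent to \<open>H\<close> of its specialization.
  Hence these elements generate the kernel of \<open>eps\<close>.\<close>

lemma eps_kernel:
  assumes N: "\<And>x y. x \<in> N \<Longrightarrow> y \<in> N \<Longrightarrow> x + y \<in> N" "\<And>x s. x \<in> N \<Longrightarrow> s \<in> R0 \<Longrightarrow> s * x \<in> N"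
    and init: "\<And>i. i < n \<Longrightarrow> rvar i - 1 \<in> N" and z: "z \<in> R0"
  shows "z - H (eps z) \<in> N"
proof -
  have N0: "0 \<in> N" using N(2)[OF init[OF n_pos] R0_0] by simp
  have u: "x * y - 1 \<in> N" if "x - 1 \<in> N" "y - 1 \<in> N" "x \<in> R0" for x y
    using N(1)[OF that(1) N(2)[OF that(2,3)]] by (simp add: algebra_simps)
  have pw: "x ^ k - 1 \<in> N" if "x - 1 \<in> N" "x \<in> R0" for x k
    by (induction k) (simp_all add: N0 u that)
  have inv: "inverse (rvar i) - 1 \<in> N" if i: "i < n" for i
  proof -
    have "inverse (rvar i) \<in> R0" using R0_gens(2)[of "slot 0 i"] X_slot0[OF i] by simp
    from N(2)[OF init[OF i] R0_uminus[OF this]] show ?thesis by (simp add: algebra_simps)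
  qed
  have r: "rvar i \<in> R0" "inverse (rvar i) \<in> R0" if "i < n" for i using R0_gens(1,2)[of "slot 0 i"] X_slot0[OF that] by simp_all
  have p: "rvar i powi e - 1 \<in> N" "rvar i powi e \<in> R0" if "i < n" for i e
    using that by (auto simp: power_int_def R0_power pw init inv r)
  have "(\<Prod>i\<in>S. rvar i powi m i) - 1 \<in> N" if "S \<subseteq> {..<n}" for S m
    using that by (induction S rule: infinite_finite_induct) (auto simp: N0 intro!: u p)
  hence xm: "xm m - 1 \<in> N" for m by (simp add: xm_def)
  have gen: "z - H w \<in> N" if e: "xeq z w" and w: "w \<in> FR" for z w
  proof -
    obtain m where "z = xm m * H w" using e by (auto simp: xeq_def)
    thus ?thesis using N(2)[OF xm[of m] H_R0[OF w]] by (simp add: algebra_simps)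
  qed
  show ?thesis using z
  proof (induction z rule: R0_induct)
    case (const c) thus ?case by (simp add: unit_rconst field_homD[OF H] N0)
  next
    case (X q) thus ?case unfolding eps_gens by (intro gen xeq_X F_FR)
  next
    case (invX q) thus ?case unfolding eps_gens by (intro gen xeq_inverse xeq_X F_FR)
  next
    case (y l) thus ?case unfolding eps_gens by (intro gen xeq_y y_FR)
  next
    case (invy l) thus ?case unfolding eps_gens by (intro gen xeq_inverse xeq_y y_FR)
  next
    case (add x y)
    have "x + y - H (eps (x + y)) = (x - H (eps x)) + (y - H (eps y))"
      using add(1,2) by (simp add: eps_ops field_homD[OF H])
    thus ?case using N(1)[OF add(3,4)] by metis
  next
    case (mult x y)
    have "x * y - H (eps (x * y)) = y * (x - H (eps x)) + H (eps x) * (y - H (eps y))"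
      using mult(1,2) by (simp add: eps_ops field_homD[OF H] algebra_simps)
    thus ?case using N(1)[OF N(2)[OF mult(3,2)] N(2)[OF mult(4) H_R0[OF eps_FR[OF mult(1)]]]] by simp
  qed
qed

abbreviation "OR \<equiv> open_locus_ring n (2 * n) B_prin"

lemma OR_calg: "calg OR"
  using loc.calg_sections by (simp add: OLR)

lemma sec_iso: "loc.sec \<in> calg_iso (calg_on rconst R0) OR"
  using loc.sec_iso by (simp add: OLR)

lemmas secD = calg_isoD[OF sec_iso, simplified]

lemma sec_zero: "loc.sec 0 = \<zero>\<^bsub>OR\<^esub>"
  using loc.sec_zero by (simp add: OLR)

definition unsec where "unsec = inv_into R0 loc.sec"

lemma unsec: "z \<in> R0 \<Longrightarrow> unsec (loc.sec z) = z" "s \<in> carrier OR \<Longrightarrow> unsec s \<in> R0" "s \<in> carrier OR \<Longrightarrow> loc.sec (unsec s) = s"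
  using secD(1) unfolding unsec_def by (auto simp: bij_betw_def inv_into_into f_inv_into_f)

theorem unit_locus_ring_iso:
  "calg (unit_locus_ring n (2 * n) B_prin)" "calg_isomorphic (unit_locus_ring n (2 * n) B_prin) (F_ring n B)"
proof -
  interpret OR: cring OR using OR_calg by (simp add: calg_def)
  let ?G = "{to_section AL OL (rvar i) \<ominus>\<^bsub>OR\<^esub> \<one>\<^bsub>OR\<^esub> |i. i < n}"
  let ?g = "\<lambda>s. eps (unsec s)"
  have r: "rvar i \<in> R0" if "i < n" for i using R0_gens(1)[of "slot 0 i"] X_slot0[OF that] by simp
  have G: "to_section AL OL (rvar i) \<ominus>\<^bsub>OR\<^esub> \<one>\<^bsub>OR\<^esub> = loc.sec (rvar i - 1)" if i: "i < n" for i
  proof -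
    have "to_section AL OL (rvar i) = loc.sec (rvar i)"
      using loc.to_section_eq[of "rvar i"] AC_gens(1)[of "slot 0 i"] X_slot0[OF i]
      by (simp add: OL_eq cluster_algebra_def AC_def)
    moreover have "\<ominus>\<^bsub>OR\<^esub> \<one>\<^bsub>OR\<^esub> = loc.sec (- 1)"
    proof (rule OR.minus_equality)
      show "loc.sec (- 1) \<oplus>\<^bsub>OR\<^esub> \<one>\<^bsub>OR\<^esub> = \<zero>\<^bsub>OR\<^esub>"
        using secD(4)[of "- 1" 1] secD(5) R0_1 R0_uminus[OF R0_1] by (simp add: sec_zero)
    qed (use secD(2) R0_uminus[OF R0_1] in auto)
    ultimately show ?thesis using secD(4)[OF r[OF i] R0_uminus[OF R0_1]] by (simp add: a_minus_def)
  qed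
  have Gc: "?G \<subseteq> carrier OR" using G secD(2) R0_diff r R0_1 by auto
  have g: "?g s \<in> FR" if "s \<in> carrier OR" for s using that eps_FR unsec(2) by blast
  have hom: "?g (s \<otimes>\<^bsub>OR\<^esub> t) = ?g s * ?g t" "?g (s \<oplus>\<^bsub>OR\<^esub> t) = ?g s + ?g t" if "s \<in> carrier OR" "t \<in> carrier OR" for s t
  proof -
    note u = unsec(2,3)[OF that(1)] unsec(2,3)[OF that(2)]
    have "s \<otimes>\<^bsub>OR\<^esub> t = loc.sec (unsec s * unsec t)" "s \<oplus>\<^bsub>OR\<^esub> t = loc.sec (unsec s + unsec t)"
      unfolding secD(3,4)[OF u(1,3)] u(2,4) by (rule refl)+
    thus "?g (s \<otimes>\<^bsub>OR\<^esub> t) = ?g s * ?g t" "?g (s \<oplus>\<^bsub>OR\<^esub> t) = ?g s + ?g t"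
      by (simp_all only: unsec(1)[OF loc.R0_mult[OF u(1,3)]] unsec(1)[OF loc.R0_add[OF u(1,3)]] eps_ops[OF u(1,3)])
  qed
  have one: "?g \<one>\<^bsub>OR\<^esub> = 1" using unit_rconst(2)[of n 1] R0_1 by (simp add: unsec flip: secD(5))
  have smult: "?g (c \<odot>\<^bsub>OR\<^esub> s) = rconst c * ?g s" if "s \<in> carrier OR" for c s
  proof -
    note u = unsec(2,3)[OF that]
    have "c \<odot>\<^bsub>OR\<^esub> s = loc.sec (rconst c * unsec s)" unfolding secD(6)[OF u(1)] u(2) by (rule refl)
    thus ?thesis by (simp only: unsec(1)[OF loc.R0_mult[OF R0_gens(5) u(1)]] eps_ops[OF R0_gens(5) u(1)] unit_rconst)
  qed
  have surj: "?g ` carrier OR = FR"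
  proof
    show "FR \<subseteq> ?g ` carrier OR"
    proof
      fix w assume w: "w \<in> FR"
      have "?g (loc.sec (H w)) = w" using w by (simp add: unsec H_R0 eps_H)
      thus "w \<in> ?g ` carrier OR" using secD(2)[OF H_R0[OF w]] by (metis image_eqI)
    qed
  qed (use g in auto)
  have hom': "?g \<in> ring_hom OR (F_ring n B)"
    by (rule ring_hom_memI) (use g hom one in \<open>auto simp: F_ring_def\<close>)
  interpret FRc: cring "F_ring n B" using calg_F_ring by (simp add: calg_def)
  interpret gh: ring_hom_ring OR "F_ring n B" ?g by (rule ring_hom_ringI2[OF OR.ring_axioms FRc.ring_axioms hom'])
  have ker: "a_kernel OR (F_ring n B) ?g = {s \<in> carrier OR. ?g s = 0}"
    unfolding a_kernel_def' by (simp add: F_ring_def)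
  have J: "Idl\<^bsub>OR\<^esub> ?G = {s \<in> carrier OR. ?g s = \<zero>\<^bsub>F_ring n B\<^esub>}"
  proof
    have "?G \<subseteq> {s \<in> carrier OR. ?g s = 0}"
    proof
      fix s assume "s \<in> ?G"
      then obtain i where i: "i < n" "s = loc.sec (rvar i - 1)" using G by auto
      have "eps (rvar i) = eps (rvar i - 1) + eps 1" using eps_ops(1)[OF R0_diff[OF r[OF i(1)] R0_1] R0_1] by simp
      hence "eps (rvar i - 1) = 0" using eps_gens(5)[OF i(1)] one R0_1 by (simp add: unsec flip: secD(5))
      thus "s \<in> {s \<in> carrier OR. ?g s = 0}" using i secD(2) R0_diff[OF r[OF i(1)] R0_1] by (simp add: unsec)
    qed
    thus "Idl\<^bsub>OR\<^esub> ?G \<subseteq> {s \<in> carrier OR. ?g s = \<zero>\<^bsub>F_ring n B\<^esub>}"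
      using OR.genideal_minimal[OF gh.kernel_is_ideal] unfolding ker by (simp add: F_ring_def)
  next
    interpret Idl: ideal "Idl\<^bsub>OR\<^esub> ?G" OR by (rule OR.genideal_ideal[OF Gc])
    define N where "N = {z \<in> R0. loc.sec z \<in> Idl\<^bsub>OR\<^esub> ?G}"
    have N1: "x + y \<in> N" if "x \<in> N" "y \<in> N" for x y
      using that by (auto simp: N_def loc.R0_add secD(4))
    have N2: "s * x \<in> N" if "x \<in> N" "s \<in> R0" for x s
      using that Idl.I_l_closed secD(2) by (auto simp: N_def loc.R0_mult secD(3))
    have N3: "rvar i - 1 \<in> N" if "i < n" for i
      using that OR.genideal_self[OF Gc] G r R0_diff R0_1 by (auto simp: N_def)
    show "{s \<in> carrier OR. ?g s = \<zero>\<^bsub>F_ring n B\<^esub>} \<subseteq> Idl\<^bsub>OR\<^esub> ?G"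
    proof clarify
      fix s assume s: "s \<in> carrier OR" "?g s = \<zero>\<^bsub>F_ring n B\<^esub>"
      have "unsec s - H (eps (unsec s)) \<in> N" by (rule eps_kernel[OF N1 N2 N3 unsec(2)[OF s(1)]])
      thus "s \<in> Idl\<^bsub>OR\<^esub> ?G" using s by (simp add: F_ring_def field_homD[OF H] N_def unsec(3))
    qed
  qed
  note q = calg_quot_iso[OF OR_calg calg_F_ring, of ?g "Idl\<^bsub>OR\<^esub> ?G", unfolded F_ring_simps, OF g hom one smult surj J[unfolded F_ring_simps]]
  from q show "calg (unit_locus_ring n (2 * n) B_prin)" "calg_isomorphic (unit_locus_ring n (2 * n) B_prin) (F_ring n B)"
    by (simp_all only: unit_locus_ring_def Let_def)
qed

end


subsection \<open>Torus invariants\<close>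

lemma rconst_inverse: "rconst (inverse c) = inverse (rconst c)"
proof (cases "c = 0")
  case False
  have "rconst c * rconst (inverse c) = 1" unfolding rconst_simps(2)[symmetric] using False by simp
  thus ?thesis by (rule inverse_unique[symmetric])
qed simp

lemma rconst_power: "rconst (c ^ k) = rconst c ^ k"
  by (induction k) simp_all

lemma rconst_powi: "rconst (c powi e) = rconst c powi e"
  by (simp add: power_int_def rconst_inverse rconst_power)

lemma rconst_prod: "rconst (\<Prod>i\<in>S. f i) = (\<Prod>i\<in>S. rconst (f i))"
  by (induction S rule: infinite_finite_induct) simp_all

definition scale :: "(nat \<Rightarrow> complex) \<Rightarrow> ratfun \<Rightarrow> ratfun" where
  "scale t = fhom (\<lambda>k. rconst (t k) * rvar k)"

lemma scale:
  assumes "\<And>k. t k \<noteq> 0"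
  shows "field_hom (scale t)" "scale t (rvar k) = rconst (t k) * rvar k"
proof -
  have "lm_indep (\<lambda>k. rconst (t k) * rvar k)"
    by (rule lm_indep_triangular[of _ "{}"]) (simp_all add: assms lm_mult lm_rconst lm_rvar)
  thus "field_hom (scale t)" "scale t (rvar k) = rconst (t k) * rvar k"
    unfolding scale_def by (auto intro: field_hom_fhom simp: fhom_rvar)
qed

lemma scale_inverse:
  assumes t: "\<And>k. t k \<noteq> 0"
  shows "scale t (scale (\<lambda>k. inverse (t k)) z) = z"
proof -
  have t': "inverse (t k) \<noteq> 0" for k using t by simp
  have "scale t \<circ> scale (\<lambda>k. inverse (t k)) = (\<lambda>z. z)"
  proof (rule field_hom_eqI)
    show "field_hom (scale t \<circ> scale (\<lambda>k. inverse (t k)))"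
      using scale(1)[of t] scale(1)[of "\<lambda>k. inverse (t k)"] t' by (simp add: field_hom_def)
    have "rconst (inverse (t i)) * rconst (t i) = 1" for i
      using t rconst_simps(2)[of "inverse (t i)" "t i"] by simp
    thus "(scale t \<circ> scale (\<lambda>k. inverse (t k))) (rvar i) = rvar i" for i
      using t' by (simp add: scale(2)[of "\<lambda>k. inverse (t k)"] scale(2)[of t] field_homD[OF scale(1)[of t]])
  qed (simp add: field_hom_def)
  thus ?thesis by (simp add: fun_eq_iff)
qed

lemma rconst_neq_rvar: "rconst c \<noteq> rvar i"
proof
  assume "rconst c = rvar i"
  moreover have "c \<noteq> 0" using calculation by auto
  ultimately have "frag_of i = (0 :: nat \<Rightarrow>\<^sub>0 int)" using lm_rvar[of i] lm_rconst[of c] by simp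
  thus False by simp
qed

context dynkin
begin

text \<open>Scalings of the initial variables that fix every \<open>yhat\<close>. By
  \<open>tor_torus\<close> and \<open>torus_tor\<close> they make up the whole torus.\<close>

definition tor :: "(nat \<Rightarrow> complex) \<Rightarrow> bool" where
  "tor t \<longleftrightarrow> (\<forall>k. t k \<noteq> 0) \<and> (\<forall>l<n. scale t (H (rvar (n + l))) = H (rvar (n + l)))"

lemma tor_scale: "tor t \<Longrightarrow> field_hom (scale t)" "tor t \<Longrightarrow> scale t (rvar k) = rconst (t k) * rvar k" "tor t \<Longrightarrow> t k \<noteq> 0"
  by (auto simp: tor_def intro: scale)

lemma tor_inverse: "tor t \<Longrightarrow> tor (\<lambda>k. inverse (t k))"
proof -
  assume t: "tor t"
  have nz: "inverse (t k) \<noteq> 0" for k using t by (simp add: tor_def)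
  have "scale (\<lambda>k. inverse (t k)) (H (rvar (n + l))) = H (rvar (n + l))" if "l < n" for l
  proof -
    have "scale (\<lambda>k. inverse (t k)) (scale t (H (rvar (n + l)))) = H (rvar (n + l))"
      using scale_inverse[of "\<lambda>k. inverse (t k)"] nz by simp
    thus ?thesis using t that by (simp add: tor_def)
  qed
  thus ?thesis using nz by (simp add: tor_def)
qed

text \<open>The \<open>F\<close> are built from the \<open>y\<close> by mesh relations, and each
  relation can be solved for its new factor; so it suffices that the \<open>yhat\<close> are
  fixed.\<close>

lemma tor_fixes:
  assumes t: "tor t" and w: "w \<in> FR"
  shows "scale t (H w) = H w"
proof -
  note s = tor_scale(1)[OF t] and D = field_homD[OF tor_scale(1)[OF t]] field_homD[OF H]
  have y: "scale t (H (rvar (n + l))) = H (rvar (n + l))" if "l < n" for l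
    using t that by (simp add: tor_def)
  have AQ: "scale t (H (A q rvar)) = H (A q rvar)" "scale t (H (Q q rvar)) = H (Q q rvar)" for q
    unfolding A_Q field_hom_prod[OF H] field_hom_prod[OF s] field_hom_power[OF H] field_hom_power[OF s]
    by (auto simp: y)
  have F: "scale t (H (F q)) = H (F q)" for q
  proof (induction q rule: mesh_induct)
    case (initial q) thus ?case by (simp add: F_initial D)
  next
    case (step r)
    have P: "scale t (H (nbprod r F)) = H (nbprod r F)"
      unfolding field_hom_prod[OF H] field_hom_prod[OF s] field_hom_power[OF H] field_hom_power[OF s]
      by (intro prod.cong refl arg_cong2[of _ _ _ _ "(^)"] step) auto
    have m: "H (F r) * H (F (r + n)) = H (A r rvar + Q r rvar * nbprod r F)"
      unfolding F_mesh[symmetric] by (simp add: field_homD[OF H])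
    have "scale t (H (F r)) * scale t (H (F (r + n))) = scale t (H (A r rvar + Q r rvar * nbprod r F))"
      using m by (metis D(2))
    also have "\<dots> = H (F r) * H (F (r + n))" unfolding m field_homD(1,2)[OF H] D(1,2) AQ P ..
    finally show ?case using step(1) by (simp add: field_hom_eq_0_iff[OF H])
  qed
  show ?thesis using w
    by (induction w rule: FR_induct) (simp_all add: D F y field_hom_inverse[OF s] field_hom_inverse[OF H])
qed

lemma scale_xm: "tor t \<Longrightarrow> scale t (xm m) = rconst (\<Prod>k<n. t k powi m k) * xm m"
  by (simp add: xm_def field_hom_prod[OF tor_scale(1)] field_hom_powi[OF tor_scale(1)] tor_scale(2)
      power_int_mult_distrib rconst_prod rconst_powi prod.distrib)

lemma tor_X: "tor t \<Longrightarrow> \<exists>c. c \<noteq> 0 \<and> scale t (X q) = rconst c * X q"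
proof -
  assume t: "tor t"
  obtain m where m: "X q = xm m * H (F q)" using xeq_X[of q] by (auto simp: xeq_def)
  have "scale t (X q) = rconst (\<Prod>k<n. t k powi m k) * X q"
    unfolding m field_homD(2)[OF tor_scale(1)[OF t]] scale_xm[OF t] tor_fixes[OF t F_FR(1)] by simp
  moreover have "(\<Prod>k<n. t k powi m k) \<noteq> 0" using tor_scale(3)[OF t] by simp
  ultimately show ?thesis by blast
qed

lemma AC_ops: "rconst c \<in> AC" "x \<in> AC \<Longrightarrow> y \<in> AC \<Longrightarrow> x + y \<in> AC" "x \<in> AC \<Longrightarrow> y \<in> AC \<Longrightarrow> x * y \<in> AC"
  unfolding AC_def by (auto intro: subalg_gen.intros)

lemma AC_induct [consumes 1, case_names const X y invy add mult]:
  assumes "z \<in> AC" "\<And>c. P (rconst c)" "\<And>q. P (X q)"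
    "\<And>l. l < n \<Longrightarrow> P (rvar (n + l))" "\<And>l. l < n \<Longrightarrow> P (inverse (rvar (n + l)))"
    "\<And>x y. x \<in> AC \<Longrightarrow> y \<in> AC \<Longrightarrow> P x \<Longrightarrow> P y \<Longrightarrow> P (x + y)" "\<And>x y. x \<in> AC \<Longrightarrow> y \<in> AC \<Longrightarrow> P x \<Longrightarrow> P y \<Longrightarrow> P (x * y)"
  shows "P z"
  using assms(1) unfolding AC_def
proof induction
  case (const c) show ?case by (rule assms(2))
next
  case (gen g)
  have "\<exists>l<n. i = n + l" if "i \<in> {n..<2 * n}" for i using that by (intro exI[of _ "i - n"]) auto
  thus ?case using gen assms(3-5) unfolding cluster_variables_X frozen_variables_def by blast
next
  case (add x y) thus ?case using assms(6) by (simp add: AC_def)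
next
  case (mult x y) thus ?case using assms(7) by (simp add: AC_def)
qed

lemma tor_AC: assumes t: "tor t" shows "z \<in> AC \<Longrightarrow> scale t z \<in> AC"
proof (induction z rule: AC_induct)
  case (X q) thus ?case using tor_X[OF t, of q] AC_ops AC_gens by auto
qed (simp_all add: field_homD[OF tor_scale(1)[OF t]] field_hom_inverse[OF tor_scale(1)[OF t]] tor_scale(2)[OF t]
    rconst_inverse[symmetric] AC_ops AC_gens)

lemma tor_bij: assumes t: "tor t" shows "bij_betw (scale t) AC AC"
proof (rule bij_betw_byWitness[where f' = "scale (\<lambda>k. inverse (t k))"])
  have i: "inverse (t k) \<noteq> 0" for k using t by (simp add: tor_def)
  show "\<forall>z\<in>AC. scale (\<lambda>k. inverse (t k)) (scale t z) = z" using scale_inverse[of "\<lambda>k. inverse (t k)"] i by simp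
  show "\<forall>z\<in>AC. scale t (scale (\<lambda>k. inverse (t k)) z) = z" using scale_inverse[of t] t by (simp add: tor_def)
qed (use tor_AC[OF t] tor_AC[OF tor_inverse[OF t]] in auto)

abbreviation "TR \<equiv> torus n (2 * n) B_prin"

lemma tor_torus: assumes t: "tor t" shows "restrict (scale t) AC \<in> TR"
proof -
  note s = field_homD[OF tor_scale(1)[OF t]]
  have 1: "1 \<in> AC" using AC_ops(1)[of 1] by simp
  have b: "bij_betw (restrict (scale t) AC) AC AC" using tor_bij[OF t] by (rule bij_betw_restrict_eq[THEN iffD2])
  have "restrict (scale t) AC \<in> calg_iso AL AL"
    unfolding AL_eq by (rule calg_isoI) (use b in \<open>simp_all add: s AC_ops 1\<close>)
  moreover have "\<exists>c. c \<noteq> 0 \<and> restrict (scale t) AC z = rconst c * z"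
    if "z \<in> cluster_variables n (2 * n) B_prin \<union> frozen_variables n (2 * n)" for z
    using that
  proof
    assume "z \<in> cluster_variables n (2 * n) B_prin"
    then obtain q where "z = X q" unfolding cluster_variables_X by blast
    thus ?thesis using tor_X[OF t, of q] AC_gens(1)[of q] by simp
  next
    assume "z \<in> frozen_variables n (2 * n)"
    then obtain i where i: "z = rvar i" "n \<le> i" "i < 2 * n" by (auto simp: frozen_variables_def)
    hence "z \<in> AC" using AC_gens(2)[of "i - n"] by simp
    thus ?thesis using tor_scale(2,3)[OF t] i(1) by auto
  qed
  ultimately show ?thesis by (simp add: torus_def Let_def AL_eq)
qed

lemma tor_act:
  assumes t: "tor t" and z: "z \<in> R0"
  shows "aut_act AL OL (restrict (scale t) AC) (loc.sec z) = loc.sec (scale t z)"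
proof -
  note s = field_homD[OF tor_scale(1)[OF t]]
  obtain c where c: "\<And>q. c q \<noteq> 0 \<and> scale t (X q) = rconst (c q) * X q" using tor_X[OF t] by metis
  define k where "k = (\<Prod>\<gamma>\<in>I. c (sl \<gamma>))"
  have k: "k \<noteq> 0" "scale t fX = rconst k * fX"
    using c finite_Pi by (auto simp: k_def fX_def field_hom_prod[OF tor_scale(1)[OF t]] prod.distrib rconst_prod)
  have pre: "{a \<in> AC. restrict (scale t) AC a \<in> p} \<in> loc.W" if p: "p \<in> loc.W" for p
  proof -
    have e: "{a \<in> AC. restrict (scale t) AC a \<in> p} = {a \<in> AC. scale t a \<in> p}" by auto
    have ps: "p \<in> spec_points loc.A" and f: "fX \<notin> p" using p by (auto simp: loc.W_def)
    note D = loc.specD[OF ps, folded AC_def]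
    note tAC = tor_AC[OF t]
    have "{a \<in> AC. scale t a \<in> p} \<in> spec_points (calg_on rconst AC)"
    proof (rule loc.specI[folded AC_def])
      show "0 \<in> {a \<in> AC. scale t a \<in> p}" using D(2) AC_ops(1)[of 0] by (simp add: s)
      show "1 \<notin> {a \<in> AC. scale t a \<in> p}" using D(6) by (simp add: s)
      show "a \<in> {a \<in> AC. scale t a \<in> p} \<or> b \<in> {a \<in> AC. scale t a \<in> p}"
        if "a \<in> AC" "b \<in> AC" "a * b \<in> {a \<in> AC. scale t a \<in> p}" for a b
        using that D(5)[OF tAC tAC, of a b] by (simp add: s)
    qed (use D(3,4) tAC AC_ops in \<open>auto simp: s\<close>)
    moreover have "scale t fX \<notin> p"
    proof
      assume "scale t fX \<in> p"
      hence "rconst (inverse k) * (rconst k * fX) \<in> p" using D(4) AC_ops(1) k(2) by simp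
      thus False using f k(1) by (simp add: rconst_inverse mult.assoc[symmetric])
    qed
    ultimately show ?thesis unfolding e by (simp add: loc.W_def AC_def)
  qed
  have b: "bij_betw (restrict (scale t) AC) AC AC" using tor_bij[OF t] by (rule bij_betw_restrict_eq[THEN iffD2])
  show ?thesis unfolding OL_eq AL_eq AC_def
    by (rule loc.aut_act_sec[OF b[unfolded AC_def] _ _ pre[unfolded AC_def] z]) (simp_all add: s)
qed

text \<open>The mutated variable \<open>(P + R) / rvar l\<close> must be scaled too. As
  \<open>P / R = H (rvar (n + l))\<close> is not a constant, this forces the same factor on
  \<open>P\<close> and \<open>R\<close>, so that \<open>yhat\<close>, their quotient, is
  fixed.\<close>

lemma torus_tor:
  assumes g: "g \<in> TR"
  obtains t where "tor t" "g = restrict (scale t) AC"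
proof -
  have g1: "g \<in> calg_iso AL AL" and ext: "g \<in> extensional AC"
    and sc: "\<And>z. z \<in> cluster_variables n (2 * n) B_prin \<union> frozen_variables n (2 * n) \<Longrightarrow> \<exists>c. c \<noteq> 0 \<and> g z = rconst c * z"
    using g by (auto simp: torus_def Let_def AL_eq)
  note gD = calg_isoD[OF g1[unfolded AL_eq], simplified]
  have rAC: "rvar i \<in> AC" "\<exists>c. c \<noteq> 0 \<and> g (rvar i) = rconst c * rvar i" if i: "i < 2 * n" for i
  proof -
    have "rvar i \<in> cluster_variables n (2 * n) B_prin \<union> frozen_variables n (2 * n)"
    proof (cases "i < n")
      case True thus ?thesis unfolding cluster_variables_X using X_slot0[OF True] by (metis UnI1 rangeI)
    next
      case False thus ?thesis using i by (simp add: frozen_variables_def)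
    qed
    thus "rvar i \<in> AC" "\<exists>c. c \<noteq> 0 \<and> g (rvar i) = rconst c * rvar i"
      using sc unfolding AC_def by (auto intro: subalg_gen.gen)
  qed
  hence "\<forall>i. \<exists>c. c \<noteq> 0 \<and> (i < 2 * n \<longrightarrow> g (rvar i) = rconst c * rvar i)" by (metis one_neq_zero)
  then obtain t where t: "\<And>i. t i \<noteq> 0" "\<And>i. i < 2 * n \<Longrightarrow> g (rvar i) = rconst (t i) * rvar i" by metis
  note s = scale(1)[of t, OF t(1)]
  note sD = field_homD[OF s]
  define E where "E = {z \<in> AC. g z = scale t z}"
  have E: "rconst c \<in> E" "x \<in> E \<Longrightarrow> y \<in> E \<Longrightarrow> x + y \<in> E" "x \<in> E \<Longrightarrow> y \<in> E \<Longrightarrow> x * y \<in> E" for c x y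
    using gD(6)[of 1 c] gD(3-5) AC_ops AC_ops(1)[of 1] by (auto simp: E_def sD)
  have E1: "1 \<in> E" using E(1)[of 1] by simp
  have Ep: "x ^ k \<in> E" if "x \<in> E" for x k by (induction k) (simp_all add: E1 E(3) that)
  have Epr: "(\<Prod>i\<in>S. f i) \<in> E" if "\<And>i. i \<in> S \<Longrightarrow> f i \<in> E" for f and S :: "nat set"
    using that by (induction S rule: infinite_finite_induct) (simp_all add: E1 E(3))
  have Ed: "z \<in> E" if "x \<in> E" "x * z \<in> E" "z \<in> AC" "x \<noteq> 0" for x z
  proof -
    have "scale t x * g z = scale t x * scale t z" using that gD(3)[of x z] by (simp add: E_def sD)
    thus ?thesis using that by (simp add: E_def field_hom_eq_0_iff[OF s])
  qed
  have Er: "rvar i \<in> E" if "i < 2 * n" for i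
    using that rAC(1) t scale(2)[of t, OF t(1)] by (simp add: E_def)
  have EX: "X q \<in> E" for q
  proof (induction q rule: mesh_induct)
    case (initial q)
    moreover have "kk q < 2 * n" using kk_less[of q] by linarith
    ultimately show ?case using Er by (simp add: X_initial)
  next
    case (step r)
    have "X r * X (r + n) = Q r rvar * nbprod r X + A r rvar"
      unfolding H_U[symmetric] by (simp add: left_diff_distrib)
    moreover have "Q r rvar * nbprod r X + A r rvar \<in> E" unfolding A_Q
      by (intro E Epr Ep Er step) auto
    ultimately show ?case using Ed[of "X r" "X (r + n)"] AC_gens(1) step(1) by simp
  qed
  have gs: "g z = scale t z" if "z \<in> AC" for z
  proof -
    have "z \<in> E" using that
    proof (induction z rule: AC_induct)
      case (invy l)
      thus ?case using Ed[of "rvar (n + l)" "inverse (rvar (n + l))"] Er[of "n + l"] E1 AC_gens(3)[of l]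
        by simp
    qed (simp_all add: E EX Er)
    thus ?thesis by (simp add: E_def)
  qed
  have "scale t (H (rvar (n + l))) = H (rvar (n + l))" if l: "l < n" for l
  proof -
    define P where "P = mon_pos (2 * n) rvar B_prin l"
    define R where "R = mon_neg (2 * n) rvar B_prin l"
    define x where "x = (P + R) / rvar l"
    have nz: "P \<noteq> 0" "R \<noteq> 0" by (simp_all add: P_def R_def mon_pos_def mon_neg_def)
    have PR: "P / R = H (rvar (n + l))" unfolding H_yhat[OF l] P_def R_def by (rule yhat_quotient[symmetric]) (rule rvar_nonzero)
    have mon: "\<exists>c. scale t (\<Prod>i\<in>S. rvar i ^ e i) = rconst c * (\<Prod>i\<in>S. rvar i ^ e i)" for e S
      by (intro exI[of _ "\<Prod>i\<in>S. t i powi int (e i)"])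
        (simp add: field_hom_prod[OF s] field_hom_power[OF s] scale(2)[of t, OF t(1)] power_mult_distrib prod.distrib rconst_prod rconst_power)
    obtain p where p: "scale t P = rconst p * P"
      using mon[of "\<lambda>i. nat (B_prin i l)" "{..<2 * n}"] unfolding P_def mon_pos_def by blast
    obtain r where r: "scale t R = rconst r * R"
      using mon[of "\<lambda>i. nat (- B_prin i l)" "{..<2 * n}"] unfolding R_def mon_neg_def by blast
    have "x = fst (mutate (2 * n) l (rvar, B_prin)) l" by (simp add: mutate_eq x_def P_def R_def)
    hence xc: "x \<in> cluster_variables n (2 * n) B_prin"
      unfolding cluster_variables_def using seeds.mutation[OF seeds.initial l] l by blast
    hence xA: "x \<in> AC" unfolding AC_def by (auto intro: subalg_gen.gen)
    obtain c where "g x = rconst c * x" using sc[of x] xc by blast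
    hence "scale t x = rconst c * x" using gs[OF xA] by simp
    hence "scale t (rvar l * x) = rconst (t l * c) * (rvar l * x)"
      by (simp add: sD scale(2)[of t, OF t(1)])
    moreover have "rvar l * x = P + R" by (simp add: x_def)
    ultimately have "rconst p * P + rconst r * R = rconst (t l * c) * (P + R)" by (simp add: sD p r)
    hence e: "rconst (p - t l * c) * P = rconst (t l * c - r) * R"
      using rconst_simps(1)[of "p - t l * c" "t l * c"] rconst_simps(1)[of "t l * c - r" r] by (simp add: algebra_simps)
    have div: "P / R = v * inverse u" if "u * P = v * R" "u \<noteq> 0" "R \<noteq> 0" for u v
      using that by (simp add: divide_inverse[symmetric] frac_eq_eq mult.commute)
    have p0: "p = t l * c"
    proof (rule ccontr)
      assume "p \<noteq> t l * c"
      hence ne: "p - t l * c \<noteq> 0" by simp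
      have "H (rvar (n + l)) = rconst ((t l * c - r) * inverse (p - t l * c))"
        unfolding PR[symmetric] using div[OF e] nz ne by (simp add: rconst_inverse)
      hence "H (rvar (n + l)) = H (rconst ((t l * c - r) * inverse (p - t l * c)))" by (simp add: field_homD[OF H])
      thus False using rconst_neq_rvar unfolding field_hom_inj[OF H] by metis
    qed
    hence "r = p" using e nz by simp
    moreover have "p \<noteq> 0" using p nz field_hom_eq_0_iff[OF s, of P] by auto
    ultimately show ?thesis unfolding PR[symmetric] field_hom_divide[OF s] p r by simp
  qed
  hence "tor t" using t(1) by (simp add: tor_def)
  moreover have "g = restrict (scale t) AC" using gs ext by (auto simp: extensional_def)
  ultimately show ?thesis by (rule that)
qed

text \<open>The grading by monomials in the initial variables is treated one coordinate at a time:
  \<open>R0\<close> lies in \<open>span 0\<close>, and in \<open>span n\<close> only degree 0 is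
  left.\<close>

inductive_set span :: "nat \<Rightarrow> ratfun set" for i where
  zero: "0 \<in> span i"
| add: "x \<in> span i \<Longrightarrow> w \<in> FR \<Longrightarrow> (\<And>k. k < i \<Longrightarrow> m k = 0) \<Longrightarrow> xm m * H w + x \<in> span i"

lemma span_add: "x \<in> span i \<Longrightarrow> y \<in> span i \<Longrightarrow> x + y \<in> span i"
  by (induction x rule: span.induct) (simp_all add: span.intros add.assoc)

lemma span_term: "w \<in> FR \<Longrightarrow> (\<And>k. k < i \<Longrightarrow> m k = 0) \<Longrightarrow> xm m * H w \<in> span i"
  using span.add[OF span.zero] by simp

lemma span_mult: "x \<in> span 0 \<Longrightarrow> y \<in> span 0 \<Longrightarrow> x * y \<in> span 0"
proof (induction x rule: span.induct)
  case (add x w m)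
  have "xm m * H w * y \<in> span 0" using add.prems
  proof (induction y rule: span.induct)
    case (add y w' m')
    have "xm m * H w * (xm m' * H w' + y) = xm (\<lambda>k. m k + m' k) * H (w * w') + xm m * H w * y"
      by (simp add: xm_add field_homD[OF H] algebra_simps)
    moreover have "w * w' \<in> FR" using \<open>w \<in> FR\<close> add.hyps by (auto intro: subalg_gen.mult)
    ultimately show ?case using span.add[OF add.IH] by simp
  qed (simp add: span.zero)
  thus ?case using add by (simp add: distrib_right span_add)
qed (simp add: span.zero)

lemma R0_span: "z \<in> R0 \<Longrightarrow> z \<in> span 0"
proof -
  have xeq: "z \<in> span 0" if "xeq z w" "w \<in> FR" for z w
    using that span_term by (auto simp: xeq_def)
  show "z \<in> R0 \<Longrightarrow> z \<in> span 0"
  proof (induction z rule: R0_induct)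
    case (const c)
    show ?case using xeq[OF xeq_H[of "rconst c"]] by (simp add: field_homD[OF H] subalg_gen.const)
  qed (auto intro: span_add span_mult xeq xeq_inverse xeq_X xeq_y F_FR y_FR)
qed

text \<open>A single element of the torus separates the exponents of \<open>x\<^sub>i\<close>: it
  acts on the part with exponent \<open>e\<close> by \<open>2 powi e\<close>, so a fixed element has
  only the part with \<open>e = 0\<close>.\<close>

lemma span_fixed:
  assumes i: "i < n" and z: "z \<in> span i" and fixed: "\<And>t. tor t \<Longrightarrow> scale t z = z"
  shows "z \<in> span (Suc i)"
proof -
  define t :: "nat \<Rightarrow> complex" where
    "t k = (if k = i then 2 else if n \<le> k \<and> k < 2 * n then 2 powi (- B i (k - n)) else 1)" for k
  have t0: "t k \<noteq> 0" for k by (simp add: t_def)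
  have e0: "(\<Prod>k<n. t k powi m k) = 2 powi m i" for m
  proof -
    have "(\<Prod>k<n. t k powi m k) = (\<Prod>k<n. if k = i then 2 powi m i else 1)"
      by (intro prod.cong) (auto simp: t_def)
    thus ?thesis using i by simp
  qed
  note s = scale(1)[of t, OF t0]
  have xm0: "scale t (xm m) = rconst (2 powi m i) * xm m" for m
    unfolding e0[symmetric] by (simp add: xm_def field_hom_prod[OF s] field_hom_powi[OF s] scale(2)[of t, OF t0]
      power_int_mult_distrib rconst_prod rconst_powi prod.distrib)
  have tor: "tor t"
  proof -
    have "scale t (H (rvar (n + l))) = H (rvar (n + l))" if l: "l < n" for l
    proof -
      have "t (n + l) * 2 powi B i l = 1" using i l by (simp add: t_def flip: power_int_add)
      hence "rconst (t (n + l)) * rconst (2 powi B i l) = 1" by (simp only: rconst_simps(2)[symmetric] rconst_simps(3))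
      hence "rconst (t (n + l)) * u * (rconst (2 powi B i l) * w) = u * w" for u w
      proof -
        assume 1: "rconst (t (n + l)) * rconst (2 powi B i l) = 1"
        have "rconst (t (n + l)) * u * (rconst (2 powi B i l) * w) =
            (rconst (t (n + l)) * rconst (2 powi B i l)) * (u * w)" by (simp only: mult_ac)
        thus ?thesis by (simp only: 1 mult_1)
      qed
      thus ?thesis unfolding H_y[OF l] field_homD(2)[OF s] xm0 scale(2)[of t, OF t0] .
    qed
    thus ?thesis using t0 by (simp add: tor_def)
  qed
  have "\<exists>T v. finite T \<and> (\<forall>e. e \<notin> T \<longrightarrow> v e = 0) \<and> (\<forall>e. scale t (v e) = rconst (2 powi e) * v e) \<and> v 0 \<in> span (Suc i) \<and>
      z = (\<Sum>e\<in>T. v e)"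
    using z
  proof (induction z rule: span.induct)
    case zero
    show ?case by (intro exI[of _ "{}"] exI[of _ "\<lambda>_. 0"]) (simp add: field_homD[OF s] span.zero)
  next
    case (add x w m)
    then obtain T v where v: "finite T" "\<And>e. e \<notin> T \<Longrightarrow> v e = 0" "\<And>e. scale t (v e) = rconst (2 powi e) * v e"
      "v 0 \<in> span (Suc i)" "x = (\<Sum>e\<in>T. v e)" by blast
    define v' where "v' = (\<lambda>e. (if e = m i then xm m * H w else 0) + v e)"
    have "scale t (v' e) = rconst (2 powi e) * v' e" for e
      by (simp add: v'_def field_homD[OF s] v(3) xm0 tor_fixes[OF tor add.hyps(2)] distrib_left mult.assoc)
    moreover have "v' 0 \<in> span (Suc i)"
    proof (cases "m i = 0")
      case True
      have "m k = 0" if "k < Suc i" for k using that True add.hyps(3) by (cases "k = i") auto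
      thus ?thesis using span.add[OF v(4) add.hyps(2)] by (simp add: v'_def)
    qed (use v(4) in \<open>simp add: v'_def\<close>)
    moreover have "xm m * H w + x = (\<Sum>e\<in>insert (m i) T. v' e)"
    proof -
      have "(\<Sum>e\<in>insert (m i) T. v e) = x" unfolding v(5) using v(1,2) by (intro sum.mono_neutral_right) auto
      thus ?thesis using v(1) by (simp add: v'_def sum.distrib)
    qed
    ultimately show ?case using v(1,2) by (intro exI[of _ "insert (m i) T"] exI[of _ v']) (auto simp: v'_def)
  qed
  then obtain T v where v: "finite T" "\<And>e. e \<notin> T \<Longrightarrow> v e = 0" "\<And>e. scale t (v e) = rconst (2 powi e) * v e"
    "v 0 \<in> span (Suc i)" "z = (\<Sum>e\<in>T. v e)" by blast
  \<comment> \<open>\<open>z\<close> is itself an eigenvector with eigenvalue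
    \<open>2 powi 0\<close>; subtracting it from the component at 0 leaves a vanishing sum of
    eigenvectors with distinct eigenvalues.\<close>
  have "v 0 - z = 0"
  proof -
    let ?v = "\<lambda>e. v e - (if e = 0 then z else 0)"
    have sz: "(\<Sum>e\<in>insert 0 T. v e) = z" unfolding v(5) using v(1,2) by (intro sum.mono_neutral_right) auto
    have "?v 0 = 0"
    proof (rule eigen_sum_zero[OF s, of "insert 0 T" "\<lambda>e. 2 powi e" ?v])
      show "inj_on (\<lambda>e. (2 :: complex) powi e) (insert 0 T)"
      proof (rule inj_onI)
        fix x y :: int assume "(2 :: complex) powi x = 2 powi y"
        hence "of_real ((2 :: real) powi x) = (of_real (2 powi y) :: complex)" by simp
        hence "(2 :: real) powi x = 2 powi y" by (simp only: of_real_eq_iff)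
        thus "x = y" using power_int_strict_increasing[of x y "2 :: real"] power_int_strict_increasing[of y x "2 :: real"]
          by (cases x y rule: linorder_cases) auto
      qed
      show "scale t (?v e) = rconst (2 powi e) * ?v e" for e
        using fixed[OF tor] by (simp add: field_hom_diff[OF s] v(3) field_homD[OF s] right_diff_distrib)
      show "(\<Sum>e\<in>insert 0 T. ?v e) = 0" using sz v(1) by (simp add: sum_subtractf)
    qed (use v(1) in simp_all)
    thus ?thesis by simp
  qed
  thus ?thesis using v(4) by simp
qed

lemma fixed_R0:
  assumes z: "z \<in> R0" and fixed: "\<And>t. tor t \<Longrightarrow> scale t z = z"
  shows "z \<in> H ` FR"
proof -
  have "z \<in> span i" if "i \<le> n" for i
    using that by (induction i) (auto intro: R0_span[OF z] span_fixed fixed)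
  hence "z \<in> span n" by simp
  thus ?thesis
  proof (induction z rule: span.induct)
    case zero
    show ?case by (rule image_eqI[of _ _ "rconst 0"]) (simp add: field_homD[OF H] , rule subalg_gen.const)
  next
    case (add x w m)
    then obtain w' where w': "x = H w'" "w' \<in> FR" by blast
    have "xm m = 1" using add.hyps by (simp add: xm_def)
    hence "xm m * H w + x = H (w + w')" by (simp add: w' field_homD[OF H])
    moreover have "w + w' \<in> FR" using add.hyps(2) w'(2) by (rule subalg_gen.add)
    ultimately show ?case by blast
  qed
qed

abbreviation "IR \<equiv> invariant_ring n (2 * n) B_prin"

theorem invariant_ring_iso: "calg IR" "calg_isomorphic (F_ring n B) IR"
proof -
  have inv: "(\<forall>g\<in>TR. aut_act AL OL g (loc.sec z) = loc.sec z) \<longleftrightarrow> z \<in> H ` FR" if z: "z \<in> R0" for z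
  proof
    assume L: "\<forall>g\<in>TR. aut_act AL OL g (loc.sec z) = loc.sec z"
    show "z \<in> H ` FR"
    proof (rule fixed_R0[OF z])
      fix t assume t: "tor t"
      have zc: "scale t z \<in> R0"
        using z
      proof (induction z rule: R0_induct)
        case (X q) thus ?case using tor_X[OF t, of q] loc.R0_mult R0_gens by metis
      next
        case (invX q)
        obtain c where "scale t (X q) = rconst c * X q" using tor_X[OF t] by blast
        thus ?case by (simp add: field_hom_inverse[OF tor_scale(1)[OF t]] loc.R0_mult R0_gens flip: rconst_inverse)
      qed (simp_all add: field_homD[OF tor_scale(1)[OF t]] field_hom_inverse[OF tor_scale(1)[OF t]] tor_scale(2)[OF t]
          loc.R0_mult loc.R0_add R0_gens flip: rconst_inverse)
      have "loc.sec (scale t z) = loc.sec z" using L tor_torus[OF t] tor_act[OF t z] by simp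
      thus "scale t z = z" using loc.sec_inj zc z by blast
    qed
  next
    assume "z \<in> H ` FR"
    then obtain w where w: "z = H w" "w \<in> FR" by blast
    show "\<forall>g\<in>TR. aut_act AL OL g (loc.sec z) = loc.sec z"
    proof
      fix g assume "g \<in> TR"
      then obtain t where "tor t" "g = restrict (scale t) AC" by (rule torus_tor)
      thus "aut_act AL OL g (loc.sec z) = loc.sec z" using tor_act[OF _ z] tor_fixes[OF _ w(2)] w(1) by simp
    qed
  qed
  have car: "carrier IR = (\<lambda>w. loc.sec (H w)) ` FR"
  proof -
    have "carrier OR = loc.sec ` R0" using secD(1) by (simp add: bij_betw_def)
    hence "carrier IR = {f \<in> loc.sec ` R0. \<forall>g\<in>TR. aut_act AL OL g f = f}" by (simp add: invariant_ring_def)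
    also have "\<dots> = (\<lambda>w. loc.sec (H w)) ` FR"
      using inv H_R0 by auto
    finally show ?thesis .
  qed
  have ops: "x \<otimes>\<^bsub>IR\<^esub> y = x \<otimes>\<^bsub>OR\<^esub> y" "x \<oplus>\<^bsub>IR\<^esub> y = x \<oplus>\<^bsub>OR\<^esub> y" "\<one>\<^bsub>IR\<^esub> = \<one>\<^bsub>OR\<^esub>" "\<zero>\<^bsub>IR\<^esub> = \<zero>\<^bsub>OR\<^esub>"
    "c \<odot>\<^bsub>IR\<^esub> x = c \<odot>\<^bsub>OR\<^esub> x" for x y c
    by (simp_all add: invariant_ring_def)
  have iso: "(\<lambda>w. loc.sec (H w)) \<in> calg_iso (F_ring n B) IR"
  proof (rule calg_isoI)
    have "inj_on (\<lambda>w. loc.sec (H w)) FR"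
      by (rule inj_onI) (use loc.sec_inj H_R0 field_hom_inj[OF H] in blast)
    thus "bij_betw (\<lambda>w. loc.sec (H w)) (carrier (F_ring n B)) (carrier IR)"
      by (simp only: bij_betw_def F_ring_simps car)
  qed (use secD(3,4)[OF H_R0 H_R0] secD(5) secD(6)[OF H_R0] in \<open>simp_all only: F_ring_simps ops field_homD[OF H]\<close>)
  show "calg IR"
    by (rule calg_image[OF calg_F_ring iso]) (simp only: F_ring_simps ops field_homD[OF H] sec_zero)
  show "calg_isomorphic (F_ring n B) IR" using iso by (auto simp: calg_isomorphic_def)
qed

end

theorem theorem4p3:
  fixes n :: nat and a :: "nat \<Rightarrow> nat \<Rightarrow> int" and E :: "(nat \<times> nat) set"
    and B B_prin :: "nat \<Rightarrow> nat \<Rightarrow> int"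
  assumes "finite_type_cartan n a"
    and "orientation n a E"
    and "B = exchange_matrix a E"
    and "B_prin = principal_ext n B"
  shows "cspace_isomorphic (config_space n B) (torus_quotient n (2 * n) B_prin) \<and>
    cspace_isomorphic (torus_quotient n (2 * n) B_prin) (unit_locus n (2 * n) B_prin) \<and>
    calg_isomorphic (config_ring n B) (F_ring n B)"
proof -
  have "\<exists>d :: nat \<Rightarrow> real. (\<forall>i<n. 0 < d i) \<and>
      (\<forall>i<n. \<forall>j<n. d i * of_int (a i j) = d j * of_int (a j i)) \<and>
      (\<forall>v :: nat \<Rightarrow> real. (\<exists>i<n. v i \<noteq> 0) \<longrightarrow> 0 < (\<Sum>i<n. \<Sum>j<n. d i * of_int (a i j) * v i * v j))"
    using assms(1) unfolding finite_type_cartan_def by (elim conjE)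
  then obtain d :: "nat \<Rightarrow> real" where pos: "\<forall>i<n. 0 < d i"
    and sym: "\<forall>i<n. \<forall>j<n. d i * of_int (a i j) = d j * of_int (a j i)"
    and def: "\<forall>v :: nat \<Rightarrow> real. (\<exists>i<n. v i \<noteq> 0) \<longrightarrow> 0 < (\<Sum>i<n. \<Sum>j<n. d i * of_int (a i j) * v i * v j)"
    by (elim exE conjE)
  have c: "0 < n" "\<forall>i<n. a i i = 2" "\<forall>i<n. \<forall>j<n. i \<noteq> j \<longrightarrow> a i j \<le> 0 \<and> (a i j = 0 \<longleftrightarrow> a j i = 0)"
    using assms(1) unfolding finite_type_cartan_def by blast+
  have d: "cartan_datum n a d"
  proof
    show "a i j = 0 \<longleftrightarrow> a j i = 0" if "i < n" "j < n" for i j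
      using c(3) that by (cases "i = j") auto
    show "0 < (\<Sum>i<n. \<Sum>j<n. d i * of_int (a i j) * v i * v j)" if "i < n" "v i \<noteq> 0" for i v
      by (rule def[rule_format]) (use that in blast)
  qed (simp_all add: c pos sym[rule_format])
  obtain h :: "nat \<Rightarrow> int" where h: "\<forall>(i, j)\<in>E. h j = h i + 1"
    using exists_height[OF d assms(2)] by blast
  interpret dynkin n a d E h
    using d h assms(2) by (auto simp: dynkin_def dynkin_axioms_def)
  \<comment> \<open>All comparisons pass through the ring of F-polynomials.\<close>
  have 1: "calg_isomorphic (config_ring n B) (invariant_ring n (2 * n) B_prin)"
    unfolding assms(3,4) by (rule calg_isomorphic_trans[OF config_ring_iso(2) invariant_ring_iso(2)])
  have 2: "calg_isomorphic (invariant_ring n (2 * n) B_prin) (unit_locus_ring n (2 * n) B_prin)"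
    unfolding assms(3,4) by (rule calg_isomorphic_trans[OF calg_isomorphic_sym[OF calg_F_ring invariant_ring_iso(2)]
      calg_isomorphic_sym[OF unit_locus_ring_iso]])
  note R = config_ring_iso invariant_ring_iso(1) unit_locus_ring_iso(1)
  show ?thesis
    unfolding config_space_def torus_quotient_def unit_locus_def
    using Spec_isomorphic[OF _ _ 1] Spec_isomorphic[OF _ _ 2] R unfolding assms(3,4) by blast
qed

end
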